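(* Let $n\ge 1$ and let $f:\mathbf{C}\to\mathbf{P}^n(\mathbf{C})$ be a holomorphic map. Let $a_1,\dots,a_q$ be moving hyperplanes of $\mathbf{P}^n(\mathbf{C})$ (holomorphic maps of $\mathbf{C}$ into the dual space $\mathbf{P}^n(\mathbf{C})^*$) in general position such that $(f,a_j)\not\equiv 0$ for $1\le j\le q$. If $q\ge 2n+1$, then $$\Big|\Big|\ \ \frac{q}{n(n+2)}\,T_f(r)\le\sum_{i=1}^q N^{[1]}_{(f,a_i)}(r)+o(T_f(r))+O\Big(\max_{1\le i\le q}T_{a_i}(r)\Big).$$
   Context: A reduced representation of a holomorphic map $f:\mathbf{C}\to\mathbf{P}^n(\mathbf{C})$ is $f=(f_0:\cdots:f_n)$ with $f_i$ entire functions without common zeros. With $\|f\|=(\sum_i|f_i|^2)^{1/2}$, the characteristic function is $T_f(r)=\frac1{2\pi}\int_0^{2\pi}\log\|f(re^{i\theta})\|\,d\theta-\frac1{2\pi}\int_0^{2\pi}\log\|f(e^{i\theta})\|\,d\theta$ for $r>1$. The function $T_a(r)$ is defined in the same way for a holomorphic map $a$ into $\mathbf{P}^n(\mathbf{C})^*$. For an entire function $\varphi\not\equiv 0$ with zero divisor $\nu_\varphi$ and an integer $k\ge 0$, the counting function truncated to level $k$ is $N^{[k]}_\varphi(r)=\int_1^r\frac{n^{[k]}(t)}{t}\,dt$ for $r>1$, where $n^{[k]}(t)=\sum_{|z|\le t}\min\{\nu_\varphi(z),k\}$. With reduced representations $f=(f_0:\cdots:f_n)$ and $a_i=(a_{i0}:\cdots:a_{in})$,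 put $(f,a_i)=\sum_{l=0}^n f_l a_{il}$. The maps $a_1,\dots,a_q$ ($q\ge n+1$) are in general position if $\det(a_{i_j l})_{0\le j,l\le n}\not\equiv 0$ for all $1\le i_0<\cdots<i_n\le q$. "$||\ P$" means that the assertion $P$ holds for all $r\in[0,\infty)$ (where the functions are defined) outside a Borel set $E\subset[0,\infty)$ with $\int_E dr<\infty$. The terms $o(\cdot)$ and $O(\cdot)$ are for $r\to\infty$. *)

theory Defs
  imports
    "HOL-Complex_Analysis.Complex_Analysis"
    "HOL-Library.Landau_Symbols"
    "Jordan_Normal_Form.Determinant"
begin

text \<open>
  A point of the \<open>n\<close>-dimensional complex projective space is a line through the origin of
  the space of complex vectors of dimension \<open>n + 1\<close>. The same type of points serves for the
  dual space, a linear form being given by its coefficient vector.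
\<close>

definition proj_point :: "complex Matrix.vec \<Rightarrow> complex Matrix.vec set" where
  "proj_point v = range (\<lambda>c. c \<cdot>\<^sub>v v)"

definition represents_on ::
  "nat \<Rightarrow> complex set \<Rightarrow> (nat \<Rightarrow> complex \<Rightarrow> complex) \<Rightarrow> (complex \<Rightarrow> complex Matrix.vec set) \<Rightarrow> bool" where
  "represents_on n U F f \<longleftrightarrow>
     (\<forall>l\<le>n. F l holomorphic_on U) \<and>
     (\<forall>z\<in>U. (\<exists>l\<le>n. F l z \<noteq> 0) \<and> f z = proj_point (Matrix.vec (n + 1) (\<lambda>l. F l z)))"

definition holomorphic_map :: "nat \<Rightarrow> (complex \<Rightarrow> complex Matrix.vec set) \<Rightarrow> bool" where
  "holomorphic_map n f \<longleftrightarrow> (\<forall>z. \<exists>U F. open U \<and> z \<in> U \<and> represents_on n U F f)"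

definition reduced_representation ::
  "nat \<Rightarrow> (nat \<Rightarrow> complex \<Rightarrow> complex) \<Rightarrow> (complex \<Rightarrow> complex Matrix.vec set) \<Rightarrow> bool" where
  "reduced_representation n F f \<longleftrightarrow> represents_on n UNIV F f"

definition rep_norm :: "nat \<Rightarrow> (nat \<Rightarrow> complex \<Rightarrow> complex) \<Rightarrow> complex \<Rightarrow> real" where
  "rep_norm n F z = sqrt (\<Sum>l=0..n. (cmod (F l z))\<^sup>2)"

text \<open>
  The characteristic function is computed from a reduced representation. Two reduced
  representations of the same map differ by an entire function \<open>h\<close> without zeros, and
  \<open>ln \<bar>h\<bar>\<close> is harmonic, so the value only depends on the map.
\<close>

definition characteristic :: "nat \<Rightarrow> (nat \<Rightarrow> complex \<Rightarrow> complex) \<Rightarrow> real \<Rightarrow> real" where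
  "characteristic n F r =
     1 / (2 * pi) * integral {0..2 * pi} (\<lambda>\<theta>. ln (rep_norm n F (of_real r * exp (\<i> * of_real \<theta>))))
   - 1 / (2 * pi) * integral {0..2 * pi} (\<lambda>\<theta>. ln (rep_norm n F (exp (\<i> * of_real \<theta>))))"

text \<open>
  Both definitions below are meant for entire \<open>\<phi>\<close> that do not vanish identically: then there are
  finitely many zeros in each disc, and \<open>zorder \<phi> z\<close> is the multiplicity of the zero \<open>z\<close>.
\<close>

definition trunc_count :: "nat \<Rightarrow> (complex \<Rightarrow> complex) \<Rightarrow> real \<Rightarrow> nat" where
  "trunc_count k \<phi> t = (\<Sum>z | cmod z \<le> t \<and> \<phi> z = 0. min (nat (zorder \<phi> z)) k)"

definition trunc_counting :: "nat \<Rightarrow> (complex \<Rightarrow> complex) \<Rightarrow> real \<Rightarrow> real" where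
  "trunc_counting k \<phi> r = integral {1..r} (\<lambda>t. real (trunc_count k \<phi> t) / t)"

definition pairing ::
  "nat \<Rightarrow> (nat \<Rightarrow> complex \<Rightarrow> complex) \<Rightarrow> (nat \<Rightarrow> complex \<Rightarrow> complex) \<Rightarrow> complex \<Rightarrow> complex" where
  "pairing n F A z = (\<Sum>l=0..n. F l z * A l z)"

definition general_position :: "nat \<Rightarrow> nat \<Rightarrow> (nat \<Rightarrow> nat \<Rightarrow> complex \<Rightarrow> complex) \<Rightarrow> bool" where
  "general_position n q A \<longleftrightarrow>
     (\<forall>i. strict_mono_on {0..n} i \<and> i ` {0..n} \<subseteq> {1..q} \<longrightarrow>
        (\<exists>z. Determinant.det (Matrix.mat (n + 1) (n + 1) (\<lambda>(j, l). A (i j) l z)) \<noteq> 0))"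

text \<open>
  The double bar notation of value distribution theory, for assertions about functions that are
  defined for \<open>r > 1\<close>.
\<close>

definition outside_finite_measure :: "(real \<Rightarrow> bool) \<Rightarrow> bool" where
  "outside_finite_measure P \<longleftrightarrow>
     (\<exists>E\<in>sets borel. E \<subseteq> {0..} \<and> emeasure lborel E < \<infinity> \<and> (\<forall>r>1. r \<notin> E \<longrightarrow> P r))"

end

theory Submission
  imports Defs
begin

text \<open>
  Let \<open>P\<close> be the product of the norms of the \<open>a\<^sub>i\<close> and \<open>K\<close> the field of quotients of entire
  functions that are bounded by constants times powers of \<open>P\<close>. Suitable representatives of the
  pairings \<open>(f, a\<^sub>i)\<close> and of the \<open>f\<^sub>l\<close> span the same space over \<open>K\<close>, of dimension \<open>k + 1 \<le> n + 1\<close>.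
  Among any \<open>2 n + 2 - k\<close> of the pairings there is an increasing chain of families which starts with
  one pairing and ends with a spanning family, such that a nonzero vector in the span of each family
  is a combination of at most \<open>k + 1\<close> linearly independent members that are added in the next step.
  Such a relation and the lemma on the logarithmic derivative, in the form of Cartan's estimate with
  Wronskians, bound the mean of the logarithm of the maximum of the larger family by that of the
  smaller one and counting functions truncated to level \<open>k\<close>. The last family controls the norm of
  \<open>f\<close>, which gives \<open>T\<^sub>f \<le> k (N\<^sub>1 + \<dots> + N\<^sub>p)\<close> up to small terms for any \<open>p = 2 n + 2 - k\<close> of the
  counting functions truncated to level 1. Applied to the \<open>p\<close> smallest ones this is the theorem,
  since \<open>k p \<le> n (n + 2)\<close>.
\<close>

section \<open>Circle means and positive real part\<close>

definition circle_mean :: "(complex \<Rightarrow> 'a::banach) \<Rightarrow> real \<Rightarrow> 'a" where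
  "circle_mean u r = integral {0..2 * pi} (\<lambda>\<theta>. u (of_real r * exp (\<i> * of_real \<theta>))) /\<^sub>R (2 * pi)"

lemma circle_integrable:
  fixes u :: "complex \<Rightarrow> 'a::banach"
  assumes "continuous_on (sphere 0 r) u" "r \<ge> 0"
  shows "(\<lambda>\<theta>. u (of_real r * exp (\<i> * of_real \<theta>))) integrable_on {0..2 * pi}"
proof (rule integrable_continuous_real)
  have "continuous_on {0..2*pi} (u \<circ> (\<lambda>\<theta>. of_real r * exp (\<i> * of_real \<theta>)))"
    by (rule continuous_on_compose)
       (use assms in \<open>auto intro!: continuous_intros continuous_on_subset[OF assms(1)] simp: norm_mult\<close>)
  then show "continuous_on {0..2 * pi} (\<lambda>\<theta>. u (of_real r * exp (\<i> * of_real \<theta>)))"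
    by (simp add: o_def)
qed

lemma circle_mean_add:
  fixes u v :: "complex \<Rightarrow> 'a::banach"
  assumes "continuous_on (sphere 0 r) u" "continuous_on (sphere 0 r) v" "r \<ge> 0"
  shows "circle_mean (\<lambda>z. u z + v z) r = circle_mean u r + circle_mean v r"
  unfolding circle_mean_def
  by (subst integral_add) (use assms circle_integrable in \<open>auto simp: scaleR_add_right\<close>)

lemma circle_mean_diff:
  fixes u v :: "complex \<Rightarrow> 'a::banach"
  assumes "continuous_on (sphere 0 r) u" "continuous_on (sphere 0 r) v" "r \<ge> 0"
  shows "circle_mean (\<lambda>z. u z - v z) r = circle_mean u r - circle_mean v r"
  unfolding circle_mean_def
  by (subst integral_diff) (use assms circle_integrable in \<open>auto simp: scaleR_diff_right\<close>)

lemma circle_mean_sum: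
  fixes u :: "'b \<Rightarrow> complex \<Rightarrow> 'a::banach"
  assumes "finite I" "\<And>i. i \<in> I \<Longrightarrow> continuous_on (sphere 0 r) (u i)" "r \<ge> 0"
  shows "circle_mean (\<lambda>z. \<Sum>i\<in>I. u i z) r = (\<Sum>i\<in>I. circle_mean (u i) r)"
  unfolding circle_mean_def
  by (subst integral_sum) (use assms circle_integrable in \<open>auto simp: scaleR_sum_right\<close>)

lemma circle_mean_cmul: "circle_mean (\<lambda>z. c * u z) r = (c::real) * circle_mean u r"
  unfolding circle_mean_def by simp

lemma circle_mean_const [simp]: "circle_mean (\<lambda>z. c::real) r = c"
  unfolding circle_mean_def by simp

lemma circle_mean_mono:
  fixes u v :: "complex \<Rightarrow> real"
  assumes "continuous_on (sphere 0 r) u" "continuous_on (sphere 0 r) v" "r \<ge> 0"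
    and "\<And>z. cmod z = r \<Longrightarrow> u z \<le> v z"
  shows "circle_mean u r \<le> circle_mean v r"
  unfolding circle_mean_def
  by (simp add: divide_right_mono, intro divide_right_mono integral_le circle_integrable assms) (auto simp: norm_mult assms)

lemma circle_mean_cong:
  assumes "\<And>z. cmod z = \<bar>r\<bar> \<Longrightarrow> u z = v z"
  shows "circle_mean u r = circle_mean v r"
  unfolding circle_mean_def
  by (intro arg_cong2[of _ _ _ _ scaleR] refl integral_cong assms) (auto simp: norm_mult)

lemma circle_mean_Re:
  fixes u :: "complex \<Rightarrow> complex"
  assumes "continuous_on (sphere 0 r) u" "r \<ge> 0"
  shows "circle_mean (\<lambda>z. Re (u z)) r = Re (circle_mean u r)"
  unfolding circle_mean_def using integral_linear[OF circle_integrable[OF assms] bounded_linear_Re]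
  by (simp add: o_def)

lemma circle_mean_cnj:
  fixes u :: "complex \<Rightarrow> complex"
  assumes "continuous_on (sphere 0 r) u" "r \<ge> 0"
  shows "circle_mean (\<lambda>z. cnj (u z)) r = cnj (circle_mean u r)"
  unfolding circle_mean_def using integral_linear[OF circle_integrable[OF assms] bounded_linear_cnj]
  by (simp add: o_def)

lemma circle_mean_norm_le:
  fixes u :: "complex \<Rightarrow> complex"
  assumes "continuous_on (sphere 0 r) u" "r \<ge> 0"
  shows "cmod (circle_mean u r) \<le> circle_mean (\<lambda>z. cmod (u z)) r"
proof -
  have "norm (integral {0..2*pi} (\<lambda>\<theta>. u (of_real r * exp (\<i> * of_real \<theta>))))
        \<le> integral {0..2*pi} (\<lambda>\<theta>. cmod (u (of_real r * exp (\<i> * of_real \<theta>))))"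
    by (rule integral_norm_bound_integral)
       (use assms in \<open>auto intro!: circle_integrable continuous_intros\<close>)
  then show ?thesis unfolding circle_mean_def by (simp add: divide_right_mono)
qed

lemma circle_mean_contour:
  assumes "(u has_contour_integral I) (circlepath 0 r)"
  shows "circle_mean (\<lambda>\<zeta>. u \<zeta> * \<zeta>) r = I / (2 * of_real pi * \<i>)"
proof -
  have "((\<lambda>t. u (0 + of_real r * cis t) * of_real r * \<i> * cis t) has_integral I) {0..2*pi}"
    using assms unfolding circlepath_def by (subst (asm) has_contour_integral_part_circlepath_iff) auto
  from has_integral_mult_right[OF this, of "-\<i>"]
  have "((\<lambda>t. u (of_real r * cis t) * (of_real r * cis t)) has_integral - \<i> * I) {0..2*pi}"
    by (simp add: algebra_simps)
  then have "integral {0..2*pi} (\<lambda>t. u (of_real r * exp (\<i> * of_real t)) * (of_real r * exp (\<i> * of_real t))) = - \<i> * I"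
    by (simp add: cis_conv_exp integral_unique)
  moreover have "- (\<i> * (I * \<i>)) = I" by (simp add: mult.commute[of I] mult.assoc[symmetric])
  ultimately show ?thesis unfolding circle_mean_def by (simp add: scaleR_conv_of_real divide_simps)
qed

lemma circle_mean_holomorphic:
  assumes "g holomorphic_on cball 0 r" "r > 0"
  shows "circle_mean g r = g 0"
proof -
  have "((\<lambda>u. g u / (u - 0)) has_contour_integral (2 * of_real pi * \<i> * g 0)) (circlepath 0 r)"
    by (rule Cauchy_integral_circlepath_simple) (use assms in auto)
  from circle_mean_contour[OF this] have "circle_mean (\<lambda>\<zeta>. g \<zeta> / (\<zeta> - 0) * \<zeta>) r = g 0"
    by simp
  moreover have "circle_mean (\<lambda>\<zeta>. g \<zeta> / (\<zeta> - 0) * \<zeta>) r = circle_mean g r"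
    by (rule circle_mean_cong) (use assms in auto)
  ultimately show ?thesis by simp
qed

lemma circle_mean_deriv:
  assumes "h holomorphic_on cball 0 r" "cmod z < r"
  shows "circle_mean (\<lambda>\<zeta>. h \<zeta> * \<zeta> / (\<zeta> - z)^2) r = deriv h z"
proof -
  have "((\<lambda>u. h u / (u - z) ^ Suc 1) has_contour_integral (2 * pi * \<i>) / fact 1 * (deriv ^^ 1) h z) (circlepath 0 r)"
    by (rule Cauchy_has_contour_integral_higher_derivative_circlepath)
       (use assms in \<open>auto intro: holomorphic_on_imp_continuous_on holomorphic_on_subset\<close>)
  from circle_mean_contour[OF this] show ?thesis by (simp add: power2_eq_square)
qed

lemma circle_mean_deriv_Re:
  assumes h: "h holomorphic_on cball 0 r" and z: "cmod z < r"
  shows "circle_mean (\<lambda>\<zeta>. of_real (2 * Re (h \<zeta>)) * (\<zeta> / (\<zeta> - z)^2)) r = deriv h z"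
proof -
  have r: "r > 0" using z by (meson norm_ge_zero order_le_less_trans)
  have ch: "continuous_on (sphere 0 r) h"
    using h by (meson holomorphic_on_imp_continuous_on holomorphic_on_subset sphere_cball)
  have nz: "\<zeta> - z \<noteq> 0" if "cmod \<zeta> = r" for \<zeta> using that z by auto
  have nz': "of_real (r^2) - cnj z * \<zeta> \<noteq> 0" if "cmod \<zeta> \<le> r" for \<zeta>
  proof
    assume "of_real (r^2) - cnj z * \<zeta> = 0"
    then have "cmod (of_real (r^2)) = cmod (cnj z * \<zeta>)" by simp
    then have "r^2 = cmod z * cmod \<zeta>" by (simp add: norm_mult norm_power)
    moreover have "cmod z * cmod \<zeta> \<le> cmod z * r" using that by (intro mult_left_mono) auto
    moreover have "cmod z * r < r * r" using z r by simp
    ultimately show False by (simp add: power2_eq_square)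
  qed
  define g where "g = (\<lambda>\<zeta>. h \<zeta> * of_real (r^2) * \<zeta> / (of_real (r^2) - cnj z * \<zeta>)^2)"
  have "g holomorphic_on cball 0 r" unfolding g_def
    by (intro holomorphic_intros h) (use nz' in auto)
  from circle_mean_holomorphic[OF this r] have "circle_mean g r = 0" by (simp add: g_def)
  moreover have "circle_mean (\<lambda>\<zeta>. cnj (g \<zeta>)) r = cnj (circle_mean g r)"
    by (rule circle_mean_cnj[OF holomorphic_on_imp_continuous_on[OF holomorphic_on_subset[OF \<open>g holomorphic_on _\<close>]]])
       (use r in auto)
  moreover have "circle_mean (\<lambda>\<zeta>. cnj (g \<zeta>)) r = circle_mean (\<lambda>\<zeta>. cnj (h \<zeta>) * \<zeta> / (\<zeta> - z)^2) r"
  proof (rule circle_mean_cong)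
    fix \<zeta> assume "cmod \<zeta> = \<bar>r\<bar>"
    then have *: "cmod \<zeta> = r" using r by simp
    have eq: "of_real (r^2) = \<zeta> * cnj \<zeta>" using * by (metis complex_norm_square of_real_power)
    have "cnj (g \<zeta>) = cnj (h \<zeta>) * of_real (r^2) * cnj \<zeta> / (of_real (r^2) - z * cnj \<zeta>)^2"
      unfolding g_def by simp
    also have "\<dots> = cnj (h \<zeta>) * (\<zeta> * cnj \<zeta>) * cnj \<zeta> / ((\<zeta> - z) * cnj \<zeta>)^2"
      unfolding eq by (simp add: algebra_simps)
    also have "\<dots> = (cnj (h \<zeta>) * \<zeta>) * (cnj \<zeta>)^2 / ((\<zeta> - z)^2 * (cnj \<zeta>)^2)"
      by (simp add: power2_eq_square mult_ac)
    also have "\<dots> = cnj (h \<zeta>) * \<zeta> / (\<zeta> - z)^2"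
      by (rule nonzero_mult_divide_mult_cancel_right) (use * r in auto)
    finally show "cnj (g \<zeta>) = cnj (h \<zeta>) * \<zeta> / (\<zeta> - z)^2" .
  qed
  ultimately have 0: "circle_mean (\<lambda>\<zeta>. cnj (h \<zeta>) * \<zeta> / (\<zeta> - z)^2) r = 0" by simp
  have "circle_mean (\<lambda>\<zeta>. h \<zeta> * \<zeta> / (\<zeta> - z)^2 + cnj (h \<zeta>) * \<zeta> / (\<zeta> - z)^2) r =
     circle_mean (\<lambda>\<zeta>. h \<zeta> * \<zeta> / (\<zeta> - z)^2) r + circle_mean (\<lambda>\<zeta>. cnj (h \<zeta>) * \<zeta> / (\<zeta> - z)^2) r"
    by (rule circle_mean_add) (use r nz in \<open>auto intro!: continuous_intros ch\<close>)
  moreover have "h \<zeta> * \<zeta> / (\<zeta> - z)^2 + cnj (h \<zeta>) * \<zeta> / (\<zeta> - z)^2 = of_real (2 * Re (h \<zeta>)) * (\<zeta> / (\<zeta> - z)^2)" for \<zeta>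
    unfolding complex_add_cnj[symmetric] by (simp add: ring_distribs add_divide_distrib)
  ultimately show ?thesis using 0 circle_mean_deriv[OF h z] by simp
qed

lemma poisson_kernel_mean:
  assumes "cmod \<zeta> = R" "0 < r" "r < R"
  shows "circle_mean (\<lambda>z. 1 / (cmod (\<zeta> - z))^2) r = 1 / (R^2 - r^2)"
proof -
  have nz: "\<zeta> - z \<noteq> 0" if "cmod z \<le> r" for z using that assms by auto
  define p where "p = (\<lambda>z. (\<zeta> + z) / (\<zeta> - z))"
  have hp: "p holomorphic_on cball 0 r" unfolding p_def
    by (intro holomorphic_intros) (use nz in auto)
  have cp: "continuous_on (sphere 0 r) p"
    using hp by (meson holomorphic_on_imp_continuous_on holomorphic_on_subset sphere_cball)
  have z0: "\<zeta> \<noteq> 0" using assms by auto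
  have "circle_mean (\<lambda>z. Re (p z)) r = Re (circle_mean p r)"
    by (rule circle_mean_Re[OF cp]) (use assms in auto)
  also have "circle_mean p r = 1" using circle_mean_holomorphic[OF hp assms(2)] z0 by (simp add: p_def)
  finally have 1: "circle_mean (\<lambda>z. Re (p z)) r = 1" by simp
  have "circle_mean (\<lambda>z. Re (p z)) r = circle_mean (\<lambda>z. (R^2 - r^2) * (1 / (cmod (\<zeta> - z))^2)) r"
  proof (rule circle_mean_cong)
    fix z assume z: "cmod z = \<bar>r\<bar>"
    have "p z = (\<zeta> + z) * cnj (\<zeta> - z) / of_real ((cmod (\<zeta> - z))^2)"
      unfolding p_def by (metis complex_div_cnj of_real_power)
    then have "Re (p z) = Re ((\<zeta> + z) * cnj (\<zeta> - z)) / (cmod (\<zeta> - z))^2"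
      by (simp only: Re_divide_of_real)
    also have "Re ((\<zeta> + z) * cnj (\<zeta> - z)) = (cmod \<zeta>)^2 - (cmod z)^2"
      unfolding cmod_power2 by (simp add: algebra_simps power2_eq_square)
    finally show "Re (p z) = (R^2 - r^2) * (1 / (cmod (\<zeta> - z))^2)" using z assms by simp
  qed
  then show ?thesis using 1 assms unfolding circle_mean_cmul
    by (smt (verit) nonzero_eq_divide_eq power_strict_mono pos2 mult.commute)
qed

lemma circle_mean_swap:
  fixes K :: "complex \<Rightarrow> complex \<Rightarrow> real"
  assumes "continuous_on (sphere 0 r \<times> sphere 0 R) (\<lambda>(z, w). K z w)" "r \<ge> 0" "R \<ge> 0"
  shows "circle_mean (\<lambda>z. circle_mean (K z) R) r = circle_mean (\<lambda>w. circle_mean (\<lambda>z. K z w) r) R"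
proof -
  define e where "e = (\<lambda>r t. complex_of_real r * exp (\<i> * of_real t))"
  have "continuous_on (cbox (0, 0) (2*pi, 2*pi)) ((\<lambda>(z, w). K z w) \<circ> (\<lambda>(s,t). (e r s, e R t)))"
    by (intro continuous_on_compose continuous_on_subset[OF assms(1)])
      (use assms in \<open>auto simp: e_def case_prod_unfold norm_mult intro!: continuous_intros\<close>)
  then have "continuous_on (cbox (0, 0) (2*pi, 2*pi)) (\<lambda>(s,t). K (e r s) (e R t))"
    by (simp add: o_def case_prod_unfold)
  from integral_swap_continuous[OF this] show ?thesis
    unfolding circle_mean_def e_def by (simp add: cbox_interval)
qed

lemma circle_mean_deriv_le:
  assumes h: "h holomorphic_on cball 0 R" and r: "0 < r" "r < R"
  shows "circle_mean (\<lambda>z. cmod (deriv h z)) r \<le> 2 / (R - r) * circle_mean (\<lambda>z. \<bar>Re (h z)\<bar>) R"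
proof -
  define K where "K = (\<lambda>z \<zeta>. 2 * R * \<bar>Re (h \<zeta>)\<bar> * (1 / (cmod (\<zeta> - z))^2))"
  have ch: "continuous_on (sphere 0 R) h"
    using h by (meson holomorphic_on_imp_continuous_on holomorphic_on_subset sphere_cball)
  have nz: "\<zeta> \<noteq> z" if "cmod \<zeta> = R" "cmod z = r" for \<zeta> z using that r by auto
  have ch2: "continuous_on (sphere 0 r \<times> sphere 0 R) (\<lambda>x. h (snd x))"
    by (rule continuous_on_compose2[OF ch]) (auto intro!: continuous_intros)
  have cK: "continuous_on (sphere 0 r \<times> sphere 0 R) (\<lambda>(z, w). K z w)"
    unfolding K_def case_prod_unfold by (intro continuous_intros ch2) (use nz in auto)
  have hd: "deriv h holomorphic_on ball 0 R"
    by (rule holomorphic_deriv) (use h in \<open>auto intro: holomorphic_on_subset\<close>)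
  have cd: "continuous_on (sphere 0 r) (deriv h)"
    by (rule holomorphic_on_imp_continuous_on, rule holomorphic_on_subset[OF hd]) (use r in auto)
  have cK1: "continuous_on (sphere 0 R) (K z)" if "cmod z = r" for z
    unfolding K_def by (intro continuous_intros ch) (use nz that in auto)
  have pt: "cmod (deriv h z) \<le> circle_mean (K z) R" if z: "cmod z = r" for z
  proof -
    let ?u = "\<lambda>\<zeta>. of_real (2 * Re (h \<zeta>)) * (\<zeta> / (\<zeta> - z)^2)"
    have cu: "continuous_on (sphere 0 R) ?u" by (intro continuous_intros ch) (use nz z in auto)
    have "cmod (deriv h z) = cmod (circle_mean ?u R)"
      by (subst circle_mean_deriv_Re[OF h]) (use z r in auto)
    also have "\<dots> \<le> circle_mean (\<lambda>\<zeta>. cmod (?u \<zeta>)) R"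
      by (rule circle_mean_norm_le[OF cu]) (use r in auto)
    also have "\<dots> = circle_mean (K z) R"
      by (rule circle_mean_cong) (use r in \<open>auto simp: K_def norm_mult norm_divide norm_power\<close>)
    finally show ?thesis .
  qed
  have cKm: "continuous_on (sphere 0 r) (\<lambda>z. circle_mean (K z) R)"
  proof -
    have "continuous_on (sphere 0 r \<times> cbox 0 (2*pi)) ((\<lambda>(z, w). K z w) \<circ> (\<lambda>(z,t). (z, of_real R * exp (\<i> * of_real t))))"
      by (intro continuous_on_compose continuous_on_subset[OF cK])
        (use r in \<open>auto simp: case_prod_unfold norm_mult intro!: continuous_intros\<close>)
    then have "continuous_on (sphere 0 r \<times> cbox 0 (2*pi)) (\<lambda>(z,t). K z (of_real R * exp (\<i> * of_real t)))"
      by (simp add: o_def case_prod_unfold)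
    from integral_continuous_on_param[OF this] show ?thesis
      unfolding circle_mean_def by (intro continuous_intros) (simp add: cbox_interval)
  qed
  have "circle_mean (\<lambda>z. cmod (deriv h z)) r \<le> circle_mean (\<lambda>z. circle_mean (K z) R) r"
    by (rule circle_mean_mono) (use r pt cKm cd in \<open>auto intro!: continuous_intros\<close>)
  also have "\<dots> = circle_mean (\<lambda>w. circle_mean (\<lambda>z. K z w) r) R"
    by (rule circle_mean_swap[OF cK]) (use r in auto)
  also have "\<dots> = circle_mean (\<lambda>w. 2 * R * \<bar>Re (h w)\<bar> * (1 / (R^2 - r^2))) R"
  proof (rule circle_mean_cong)
    fix w assume "cmod w = \<bar>R\<bar>"
    then have "cmod w = R" using r by simp
    from poisson_kernel_mean[OF this r]
    show "circle_mean (\<lambda>z. K z w) r = 2 * R * \<bar>Re (h w)\<bar> * (1 / (R^2 - r^2))"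
      unfolding K_def circle_mean_cmul by simp
  qed
  also have "\<dots> = circle_mean (\<lambda>w. (2 * R / (R^2 - r^2)) * \<bar>Re (h w)\<bar>) R" by (simp add: field_simps)
  also have "\<dots> = 2 * R / (R^2 - r^2) * circle_mean (\<lambda>w. \<bar>Re (h w)\<bar>) R" by (rule circle_mean_cmul)
  also have "\<dots> \<le> 2 / (R - r) * circle_mean (\<lambda>w. \<bar>Re (h w)\<bar>) R"
  proof (rule mult_right_mono)
    have "R^2 - r^2 = (R - r) * (R + r)" by (simp add: power2_eq_square algebra_simps)
    then have "2 * R / (R^2 - r^2) = 2 / (R - r) * (R / (R + r))" by simp
    also have "\<dots> \<le> 2 / (R - r) * 1" by (rule mult_left_mono) (use r in auto)
    finally show "2 * R / (R^2 - r^2) \<le> 2 / (R - r)" by simp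
    have "circle_mean (\<lambda>w. 0) R \<le> circle_mean (\<lambda>w. \<bar>Re (h w)\<bar>) R"
      by (rule circle_mean_mono) (use r in \<open>auto intro!: continuous_intros ch\<close>)
    then show "0 \<le> circle_mean (\<lambda>w. \<bar>Re (h w)\<bar>) R" by simp
  qed
  finally show ?thesis .
qed

section \<open>Zeros of entire functions and Jensen's formula\<close>

definition nz_entire :: "(complex \<Rightarrow> complex) \<Rightarrow> bool" where
  "nz_entire g \<longleftrightarrow> g holomorphic_on UNIV \<and> (\<exists>z. g z \<noteq> 0)"

definition vanish_order :: "(complex \<Rightarrow> complex) \<Rightarrow> complex \<Rightarrow> nat" where
  "vanish_order g z = (if g z = 0 then nat (zorder g z) else 0)"

definition critical_radii :: "(complex \<Rightarrow> complex) \<Rightarrow> real set" where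
  "critical_radii g = cmod ` {z. g z = 0}"

lemma nz_entireI: "g holomorphic_on UNIV \<Longrightarrow> g z \<noteq> 0 \<Longrightarrow> nz_entire g"
  unfolding nz_entire_def by blast

lemma nz_entire_holo: "nz_entire g \<Longrightarrow> g holomorphic_on A"
  unfolding nz_entire_def using holomorphic_on_subset by blast

lemma nz_entire_cont: "nz_entire g \<Longrightarrow> continuous_on A g"
  using nz_entire_holo holomorphic_on_imp_continuous_on by blast

lemma nz_entire_const: "c \<noteq> 0 \<Longrightarrow> nz_entire (\<lambda>_. c)"
  by (rule nz_entireI) auto

lemma nz_entire_decomp:
  assumes "nz_entire g"
  obtains h where "nz_entire h" "h a \<noteq> 0" "\<And>w. g w = (w - a) ^ vanish_order g a * h w"
proof -
  define n where "n = vanish_order g a"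
  have n: "n = nat (zorder g a)" and zo: "(if g a = 0 then zorder g a > 0 else zorder g a = 0)"
    and ex: "\<exists>r>0. zor_poly g a holomorphic_on cball a r \<and>
      (\<forall>w\<in>cball a r. g w = zor_poly g a w * (w - a) ^ nat (zorder g a) \<and> zor_poly g a w \<noteq> 0)"
    using zorder_exist_zero[of g UNIV a] assms unfolding nz_entire_def n_def vanish_order_def by (auto simp: connected_UNIV)
  from ex n obtain r where r: "r > 0" "zor_poly g a holomorphic_on cball a r"
     "\<And>w. w \<in> cball a r \<Longrightarrow> g w = zor_poly g a w * (w - a) ^ n \<and> zor_poly g a w \<noteq> 0" by blast
  define h where "h = (\<lambda>w. if w = a then zor_poly g a a else g w / (w - a) ^ n)"
  have heq: "h w = zor_poly g a w" if "w \<in> cball a r" for w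
    using r(3)[OF that] by (auto simp: h_def)
  have "h field_differentiable (at w)" for w
  proof (cases "w = a")
    case True
    have "h holomorphic_on ball a r"
      by (subst holomorphic_cong[OF refl heq]) (use r(2) in \<open>auto intro: holomorphic_on_subset\<close>)
    then show ?thesis using True r(1) by (meson centre_in_ball holomorphic_on_imp_differentiable_at open_ball)
  next
    case False
    have "(\<lambda>w. g w / (w - a) ^ n) holomorphic_on - {a}"
      using assms by (intro holomorphic_intros nz_entire_holo) auto
    then have "h holomorphic_on - {a}"
      by (rule holomorphic_transform) (auto simp: h_def)
    then show ?thesis using False by (auto intro: holomorphic_on_imp_differentiable_at)
  qed
  then have hol: "h holomorphic_on UNIV" by (simp add: holomorphic_on_def)
  have ha: "h a \<noteq> 0" using heq[of a] r by auto
  have eq: "g w = (w - a) ^ n * h w" for w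
  proof (cases "w = a")
    case True then show ?thesis using r(3)[of a] r(1) by (auto simp: h_def)
  qed (auto simp: h_def)
  show ?thesis by (rule that[of h]) (use hol ha eq in \<open>auto intro: nz_entireI simp: n_def\<close>)
qed

lemma vanish_order_unique:
  assumes "\<And>w. g w = (w - a) ^ n * h w" "h holomorphic_on UNIV" "h a \<noteq> 0"
  shows "vanish_order g a = n"
proof -
  have "zorder g a = int n"
    by (rule zorder_eqI[of UNIV a h]) (use assms in \<open>auto simp: power_int_def mult.commute\<close>)
  then show ?thesis using assms(1)[of a] assms(3) by (auto simp: vanish_order_def power_0_left)
qed

lemma vanish_order_mult:
  assumes "nz_entire f" "nz_entire g"
  shows "nz_entire (\<lambda>z. f z * g z)" "vanish_order (\<lambda>z. f z * g z) a = vanish_order f a + vanish_order g a"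
proof -
  obtain f1 where f1: "nz_entire f1" "f1 a \<noteq> 0" "\<And>w. f w = (w - a) ^ vanish_order f a * f1 w"
    using nz_entire_decomp[OF assms(1)] by blast
  obtain g1 where g1: "nz_entire g1" "g1 a \<noteq> 0" "\<And>w. g w = (w - a) ^ vanish_order g a * g1 w"
    using nz_entire_decomp[OF assms(2)] by blast
  have eq: "f w * g w = (w - a) ^ (vanish_order f a + vanish_order g a) * (f1 w * g1 w)" for w
    by (subst f1(3), subst g1(3)) (simp add: power_add)
  show "vanish_order (\<lambda>z. f z * g z) a = vanish_order f a + vanish_order g a"
    by (rule vanish_order_unique[OF eq]) (use f1 g1 in \<open>auto intro: holomorphic_on_mult nz_entire_holo\<close>)
  have "\<exists>z. f z * g z \<noteq> 0"
  proof (rule ccontr)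
    assume "\<not> ?thesis"
    then have 0: "f w = 0 \<or> g w = 0" for w by auto
    have c: "continuous (at a) (\<lambda>w. f1 w * g1 w)"
      by (intro continuous_intros) (use nz_entire_cont[OF f1(1), of UNIV] nz_entire_cont[OF g1(1), of UNIV] in \<open>auto simp: continuous_on_eq_continuous_at\<close>)
    then have "eventually (\<lambda>w. f1 w * g1 w \<noteq> 0) (at a)"
      using f1(2) g1(2) by (intro tendsto_imp_eventually_ne[of _ "f1 a * g1 a"]) (auto simp: isCont_def)
    moreover have "eventually (\<lambda>w. w \<noteq> a) (at a)" by (simp add: eventually_at_filter)
    ultimately have "eventually (\<lambda>w. False) (at a)"
    proof eventually_elim
      case (elim w) then show ?case using eq[of w] 0[of w] by auto
    qed
    then show False by simp
  qed
  then show "nz_entire (\<lambda>z. f z * g z)" using assms unfolding nz_entire_def by (auto intro!: holomorphic_intros)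
qed

lemma vanish_order_prod:
  assumes "finite I" "\<And>i. i \<in> I \<Longrightarrow> nz_entire (f i)"
  shows "nz_entire (\<lambda>z. \<Prod>i\<in>I. f i z)" "vanish_order (\<lambda>z. \<Prod>i\<in>I. f i z) a = (\<Sum>i\<in>I. vanish_order (f i) a)"
  using assms
proof (induction I rule: finite_induct)
  case empty
  { case 1 show ?case by (simp add: nz_entire_const) next case 2 show ?case by (simp add: vanish_order_def) }
next
  case (insert i I)
  { case 1 then show ?case using insert vanish_order_mult(1)[of "f i" "\<lambda>z. \<Prod>i\<in>I. f i z"] by simp
  next case 2 then show ?case using insert vanish_order_mult(2)[of "f i" "\<lambda>z. \<Prod>i\<in>I. f i z"] by simp }
qed

lemma vanish_order_0_iff:
  assumes "nz_entire g" shows "vanish_order g a = 0 \<longleftrightarrow> g a \<noteq> 0"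
proof -
  obtain h where h: "h a \<noteq> 0" "\<And>w. g w = (w - a) ^ vanish_order g a * h w"
    using nz_entire_decomp[OF assms] by blast
  show ?thesis using h(2)[of a] h(1) by (cases "vanish_order g a = 0") (auto simp: power_0_left)
qed

lemma vanish_order_ge:
  assumes "nz_entire g" "\<And>w. g w = (w - a) ^ n * h w" "h holomorphic_on UNIV"
  shows "vanish_order g a \<ge> n"
proof -
  have h: "nz_entire h" using assms unfolding nz_entire_def by auto
  then obtain h1 where h1: "nz_entire h1" "h1 a \<noteq> 0" "\<And>w. h w = (w - a) ^ vanish_order h a * h1 w"
    using nz_entire_decomp by blast
  have "vanish_order g a = n + vanish_order h a"
    by (rule vanish_order_unique[of _ _ _ h1])
       (use assms(2) h1 nz_entire_holo in \<open>auto simp: power_add mult_ac\<close>)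
  then show ?thesis by simp
qed

lemma vanish_order_dvdE:
  assumes "g holomorphic_on UNIV" "n \<le> vanish_order g a \<or> (\<forall>z. g z = 0)"
  obtains h where "h holomorphic_on UNIV" "\<And>w. g w = (w - a) ^ n * h w"
proof (cases "\<forall>z. g z = 0")
  case True
  then show ?thesis by (intro that[of "\<lambda>_. 0"]) auto
next
  case False
  then have "nz_entire g" using assms by (auto simp: nz_entire_def)
  then obtain h where h: "nz_entire h" "\<And>w. g w = (w - a) ^ vanish_order g a * h w"
    using nz_entire_decomp by metis
  show ?thesis
  proof (rule that[of "\<lambda>w. (w - a) ^ (vanish_order g a - n) * h w"])
    show "(\<lambda>w. (w - a) ^ (vanish_order g a - n) * h w) holomorphic_on UNIV"
      by (intro holomorphic_intros nz_entire_holo h)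
    show "g w = (w - a) ^ n * ((w - a) ^ (vanish_order g a - n) * h w)" for w
      using h(2)[of w] assms(2) False by (simp add: mult.assoc[symmetric] power_add[symmetric])
  qed
qed

lemma finite_zeros_cball:
  assumes "nz_entire g" shows "finite {z. cmod z \<le> r \<and> g z = 0}"
proof (cases "g constant_on UNIV")
  case True
  then have "g z \<noteq> 0" for z using assms by (auto simp: nz_entire_def constant_on_def)
  then show ?thesis by simp
next
  case False
  have "finite {z\<in>cball 0 r. g z = 0}"
    by (rule holomorphic_compact_finite_zeros[of g UNIV]) (use assms False nz_entire_holo in auto)
  then show ?thesis by simp
qed

lemma countable_critical_radii: "nz_entire g \<Longrightarrow> countable (critical_radii g)"
proof -
  assume g: "nz_entire g"
  have "{z. g z = 0} = (\<Union>n::nat. {z. cmod z \<le> real n \<and> g z = 0})"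
    using real_arch_simple by auto
  moreover have "countable \<dots>"
    by (rule countable_UN) (auto intro: countable_finite finite_zeros_cball[OF g])
  ultimately have "countable {z. g z = 0}" by simp
  then show ?thesis by (simp add: critical_radii_def)
qed

lemma ex_noncritical:
  assumes "nz_entire g" "x < y" obtains r where "x < r" "r < y" "r \<notin> critical_radii g"
proof -
  have "uncountable ({x<..<y} - critical_radii g)"
    using uncountable_open_interval assms countable_critical_radii uncountable_minus_countable by blast
  then have "{x<..<y} - critical_radii g \<noteq> {}" by (metis countable_empty)
  then obtain r where "r \<in> {x<..<y} - critical_radii g" by blast
  then show ?thesis using that by auto
qed

lemma noncritical_nz: "r \<notin> critical_radii g \<Longrightarrow> cmod z = r \<Longrightarrow> g z \<noteq> 0"
  by (auto simp: critical_radii_def)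

lemma critical_radii_prod:
  "finite I \<Longrightarrow> critical_radii (\<lambda>z. \<Prod>i\<in>I. f i z) = (\<Union>i\<in>I. critical_radii (f i))"
  by (auto simp: critical_radii_def)

lemma factor_out_zeros:
  assumes "finite Z" "nz_entire g"
  obtains H where "nz_entire H" "\<And>a. a \<in> Z \<Longrightarrow> H a \<noteq> 0" "\<And>z. g z = (\<Prod>a\<in>Z. (z - a) ^ vanish_order g a) * H z"
  using assms
proof (induction Z arbitrary: thesis rule: finite_induct)
  case empty
  then show ?case by (intro empty.prems(1)[of g]) auto
next
  case (insert a Z)
  obtain H where H: "nz_entire H" "\<And>a. a \<in> Z \<Longrightarrow> H a \<noteq> 0" "\<And>z. g z = (\<Prod>a\<in>Z. (z - a) ^ vanish_order g a) * H z"
    using insert.IH insert.prems by blast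
  obtain H1 where H1: "nz_entire H1" "H1 a \<noteq> 0" "\<And>w. H w = (w - a) ^ vanish_order H a * H1 w"
    using nz_entire_decomp[OF H(1)] by blast
  have "vanish_order g a = vanish_order H a"
  proof (rule vanish_order_unique)
    show "g w = (w - a) ^ vanish_order H a * ((\<Prod>a\<in>Z. (w - a) ^ vanish_order g a) * H1 w)" for w
      by (subst H(3), subst H1(3)) simp
    show "(\<lambda>w. (\<Prod>a\<in>Z. (w - a) ^ vanish_order g a) * H1 w) holomorphic_on UNIV"
      by (intro holomorphic_intros nz_entire_holo H1)
    show "(\<Prod>b\<in>Z. (a - b) ^ vanish_order g b) * H1 a \<noteq> 0"
      using H1 insert.hyps by (auto)
  qed
  then have *: "g z = (\<Prod>a\<in>insert a Z. (z - a) ^ vanish_order g a) * H1 z" for z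
    using insert.hyps H(3)[of z] H1(3)[of z] by (simp add: mult_ac)
  have **: "H1 b \<noteq> 0" if "b \<in> Z" for b using H(2)[OF that] H1(3)[of b] by auto
  show ?case
    by (rule insert.prems(1)[OF H1(1) _ *]) (use ** H1(2) in auto)
qed

lemma circle_mean_ln_zero_free:
  assumes "H holomorphic_on ball 0 R" "\<And>z. cmod z < R \<Longrightarrow> H z \<noteq> 0" "0 < r" "r < R"
  shows "circle_mean (\<lambda>z. ln (cmod (H z))) r = ln (cmod (H 0))"
proof -
  obtain L where L: "L holomorphic_on ball 0 R" "\<And>x. x \<in> ball 0 R \<Longrightarrow> exp (L x) = H x"
    using holomorphic_logarithm_exists[of "ball 0 R" H 0] assms by auto
  have eq: "ln (cmod (H z)) = Re (L z)" if "cmod z < R" for z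
    using L(2)[of z] that by (metis dist_0_norm ln_exp mem_ball norm_exp_eq_Re)
  have L': "L holomorphic_on cball 0 r" using L(1) assms by (auto intro: holomorphic_on_subset)
  have "circle_mean (\<lambda>z. ln (cmod (H z))) r = circle_mean (\<lambda>z. Re (L z)) r"
    by (rule circle_mean_cong) (use eq assms in auto)
  also have "\<dots> = Re (circle_mean L r)"
    by (rule circle_mean_Re) (use L' assms in \<open>auto intro!: holomorphic_on_imp_continuous_on holomorphic_on_subset[OF L']\<close>)
  also have "\<dots> = ln (cmod (H 0))" using circle_mean_holomorphic[OF L'] assms eq by simp
  finally show ?thesis .
qed

lemma circle_mean_ln_linear:
  assumes "0 < r" "r \<noteq> cmod a"
  shows "circle_mean (\<lambda>z. ln (cmod (z - a))) r = ln (max r (cmod a))"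
proof (cases "r < cmod a")
  case True
  then show ?thesis
    by (subst circle_mean_ln_zero_free[of "\<lambda>z. z - a" "cmod a" r]) (use assms in \<open>auto intro!: holomorphic_intros\<close>)
next
  case False
  then have ar: "cmod a < r" using assms by simp
  show ?thesis
  proof (cases "a = 0")
    case True
    then have "circle_mean (\<lambda>z. ln (cmod (z - a))) r = circle_mean (\<lambda>z. ln r) r"
      by (intro circle_mean_cong) (use assms in auto)
    then show ?thesis using True assms by simp
  next
    case a0: False
    define R where "R = r^2 / cmod a"
    have R: "r < R" using ar a0 assms by (simp add: R_def field_simps power2_eq_square)
    define H where "H = (\<lambda>z. of_real r - cnj a * z / of_real r)"
    have "circle_mean (\<lambda>z. ln (cmod (z - a))) r = circle_mean (\<lambda>z. ln (cmod (H z))) r"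
    proof (rule circle_mean_cong)
      fix z assume "cmod z = \<bar>r\<bar>"
      then have z: "cmod z = r" using assms by simp
      have rr: "of_real r * of_real r = z * cnj z" using complex_norm_square[of z] z by (simp add: power2_eq_square)
      have "H z = (of_real r * of_real r - cnj a * z) / of_real r"
        using assms by (simp add: H_def field_simps)
      also have "\<dots> = z * cnj (z - a) / of_real r" unfolding rr by (simp add: algebra_simps)
      finally have "cmod (H z) = cmod z * cmod (cnj (z - a)) / r"
        using assms by (simp add: norm_mult norm_divide del: complex_cnj_diff)
      then show "ln (cmod (z - a)) = ln (cmod (H z))" using z assms by (simp del: complex_cnj_diff)
    qed
    also have "\<dots> = ln (cmod (H 0))"
    proof (rule circle_mean_ln_zero_free[of _ R])
      show "H holomorphic_on ball 0 R" unfolding H_def by (intro holomorphic_intros) (use assms in auto)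
      fix z assume "cmod z < R"
      then have "cmod (cnj a * z) < r^2" using a0 by (simp add: R_def norm_mult field_simps)
      moreover have "cmod (cnj a * z) = r^2" if "H z = 0"
      proof -
        have "cnj a * z = of_real r * of_real r" using that assms by (simp add: H_def field_simps)
        then show ?thesis using assms by (simp add: norm_mult power2_eq_square)
      qed
      ultimately show "H z \<noteq> 0" by auto
    qed (use assms R in auto)
    also have "\<dots> = ln (max r (cmod a))" using ar assms by (simp add: H_def)
    finally show ?thesis .
  qed
qed

definition divisor_sum :: "(complex \<Rightarrow> real) \<Rightarrow> real \<Rightarrow> real" where
  "divisor_sum D r = (\<Sum>a | cmod a \<le> r \<and> D a \<noteq> 0. D a * ln (r / max 1 (cmod a)))"

definition count_fun :: "(complex \<Rightarrow> complex) \<Rightarrow> real \<Rightarrow> real" where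
  "count_fun g = divisor_sum (\<lambda>a. real (vanish_order g a))"

lemma divisor_sum_superset:
  assumes "finite Z" "\<And>a. a \<in> Z \<Longrightarrow> cmod a \<le> r" "\<And>a. cmod a \<le> r \<Longrightarrow> D a \<noteq> 0 \<Longrightarrow> a \<in> Z"
  shows "divisor_sum D r = (\<Sum>a\<in>Z. D a * ln (r / max 1 (cmod a)))"
  unfolding divisor_sum_def by (rule sum.mono_neutral_left) (use assms in auto)

lemma ln_ratio_nonneg: "r \<ge> 1 \<Longrightarrow> cmod a \<le> r \<Longrightarrow> ln (r / max 1 (cmod a)) \<ge> 0"
  by (rule ln_ge_zero) (auto simp: le_divide_eq max_def)

lemma circle_mean_ln_factored:
  assumes r: "0 < r" "r < R" and Z: "finite Z" and H: "H holomorphic_on ball 0 R" "\<And>z. cmod z < R \<Longrightarrow> H z \<noteq> 0"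
    and ne: "\<And>a. a \<in> Z \<Longrightarrow> r \<noteq> cmod a"
    and g: "\<And>z. g z = (\<Prod>a\<in>Z. (z - a) ^ m a) * H z"
  shows "circle_mean (\<lambda>z. ln (cmod (g z))) r = (\<Sum>a\<in>Z. real (m a) * ln (max r (cmod a))) + ln (cmod (H 0))"
proof -
  have cH: "continuous_on (sphere 0 r) H"
    by (rule holomorphic_on_imp_continuous_on[OF holomorphic_on_subset[OF H(1)]]) (use r in auto)
  have ne': "z \<noteq> a" if "a \<in> Z" "cmod z = r" for a z using ne[OF that(1)] that(2) by auto
  have "circle_mean (\<lambda>z. ln (cmod (g z))) r
      = circle_mean (\<lambda>z. (\<Sum>a\<in>Z. real (m a) * ln (cmod (z - a))) + ln (cmod (H z))) r"
  proof (rule circle_mean_cong)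
    fix z assume "cmod z = \<bar>r\<bar>"
    then have z: "cmod z = r" using r by simp
    have p: "cmod (z - a) > 0" if "a \<in> Z" for a using ne[OF that] z by auto
    have "ln (cmod (g z)) = ln (\<Prod>a\<in>Z. cmod (z - a) ^ m a) + ln (cmod (H z))"
      unfolding g norm_mult prod_norm[symmetric] norm_power
      by (rule ln_mult_pos) (use p H(2)[of z] z r in \<open>auto intro!: prod_pos\<close>)
    also have "ln (\<Prod>a\<in>Z. cmod (z - a) ^ m a) = (\<Sum>a\<in>Z. ln (cmod (z - a) ^ m a))"
      by (rule ln_prod) (use p Z in auto)
    also have "\<dots> = (\<Sum>a\<in>Z. real (m a) * ln (cmod (z - a)))"
      by (intro sum.cong refl ln_realpow)
    finally show "ln (cmod (g z)) = (\<Sum>a\<in>Z. real (m a) * ln (cmod (z - a))) + ln (cmod (H z))" .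
  qed
  also have "\<dots> = circle_mean (\<lambda>z. \<Sum>a\<in>Z. real (m a) * ln (cmod (z - a))) r + circle_mean (\<lambda>z. ln (cmod (H z))) r"
    by (rule circle_mean_add) (use ne' r cH H(2) in \<open>auto intro!: continuous_intros\<close>)
  also have "circle_mean (\<lambda>z. \<Sum>a\<in>Z. real (m a) * ln (cmod (z - a))) r = (\<Sum>a\<in>Z. circle_mean (\<lambda>z. real (m a) * ln (cmod (z - a))) r)"
    by (rule circle_mean_sum) (use Z ne' r in \<open>auto intro!: continuous_intros\<close>)
  also have "\<dots> = (\<Sum>a\<in>Z. real (m a) * ln (max r (cmod a)))"
    by (intro sum.cong refl) (use circle_mean_ln_linear ne r in \<open>auto simp: circle_mean_cmul\<close>)
  finally show ?thesis using circle_mean_ln_zero_free[OF H r] by simp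
qed

lemma jensen:
  assumes "nz_entire g"
  obtains c where "\<And>r. r \<ge> 1 \<Longrightarrow> r \<notin> critical_radii g \<Longrightarrow> circle_mean (\<lambda>z. ln (cmod (g z))) r = count_fun g r + c"
proof -
  define d where "d = (\<lambda>r. circle_mean (\<lambda>z. ln (cmod (g z))) r - count_fun g r)"
  have ex: "\<exists>c. \<forall>r. 1 \<le> r \<and> r < R \<and> r \<notin> critical_radii g \<longrightarrow> d r = c" for R
  proof -
    define Z where "Z = {z. cmod z \<le> R \<and> g z = 0}"
    have fZ: "finite Z" unfolding Z_def by (rule finite_zeros_cball[OF assms])
    obtain H where H: "nz_entire H" "\<And>a. a \<in> Z \<Longrightarrow> H a \<noteq> 0" "\<And>z. g z = (\<Prod>a\<in>Z. (z - a) ^ vanish_order g a) * H z"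
      using factor_out_zeros[OF fZ assms] by blast
    have nz: "H z \<noteq> 0" if "cmod z < R" for z
      using H(2)[of z] H(3)[of z] that by (auto simp: Z_def)
    have "d r = (\<Sum>a\<in>Z. real (vanish_order g a) * ln (max 1 (cmod a))) + ln (cmod (H 0))"
      if r: "1 \<le> r" "r < R" "r \<notin> critical_radii g" for r
    proof -
      have ne: "r \<noteq> cmod a" if "a \<in> Z" for a
        using that r(3) by (auto simp: Z_def critical_radii_def)
      have m: "circle_mean (\<lambda>z. ln (cmod (g z))) r = (\<Sum>a\<in>Z. real (vanish_order g a) * ln (max r (cmod a))) + ln (cmod (H 0))"
        by (rule circle_mean_ln_factored[of r R Z H]) (use r fZ H nz ne nz_entire_holo in auto)
      have fZr: "finite {a\<in>Z. cmod a \<le> r}" using fZ by simp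
      have "count_fun g r = (\<Sum>a\<in>{a\<in>Z. cmod a \<le> r}. real (vanish_order g a) * ln (r / max 1 (cmod a)))"
        unfolding count_fun_def
        by (rule divisor_sum_superset[OF fZr]) (use r in \<open>auto simp: Z_def vanish_order_def split: if_splits\<close>)
      also have "\<dots> = (\<Sum>a\<in>{a\<in>Z. cmod a \<le> r}. real (vanish_order g a) * (ln (max r (cmod a)) - ln (max 1 (cmod a))))"
        by (intro sum.cong refl) (use r in \<open>auto simp: ln_div max_def\<close>)
      also have "\<dots> = (\<Sum>a\<in>Z. real (vanish_order g a) * (ln (max r (cmod a)) - ln (max 1 (cmod a))))"
        by (rule sum.mono_neutral_left) (use fZ r in \<open>auto simp: max_def\<close>)
      finally show ?thesis unfolding d_def m by (simp add: right_diff_distrib sum_subtractf)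
    qed
    then show ?thesis by blast
  qed
  obtain r0 where r0: "1 < r0" "r0 < 2" "r0 \<notin> critical_radii g" using ex_noncritical[OF assms, of 1 2] by auto
  have "d r = d r0" if "1 \<le> r" "r \<notin> critical_radii g" for r
    using ex[of "max r r0 + 1"] that r0 by fastforce
  note * = this
  show ?thesis
  proof (rule that[of "d r0"])
    fix r assume "1 \<le> r" "r \<notin> critical_radii g"
    from *[OF this] show "circle_mean (\<lambda>z. ln (cmod (g z))) r = count_fun g r + d r0"
      unfolding d_def by linarith
  qed
qed

lemma count_fun_mono:
  assumes "nz_entire g" "1 \<le> r" "r \<le> s" shows "0 \<le> count_fun g r" "count_fun g r \<le> count_fun g s"
proof -
  define Z where "Z = {z. cmod z \<le> s \<and> g z = 0}"
  have fZ: "finite Z" unfolding Z_def by (rule finite_zeros_cball[OF assms(1)])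
  have 1: "count_fun g s = (\<Sum>a\<in>Z. real (vanish_order g a) * ln (s / max 1 (cmod a)))"
    unfolding count_fun_def by (rule divisor_sum_superset[OF fZ]) (use fZ in \<open>auto simp: Z_def vanish_order_def split: if_splits\<close>)
  have fZr: "finite {a\<in>Z. cmod a \<le> r}" using fZ by simp
  have 2: "count_fun g r = (\<Sum>a\<in>{a\<in>Z. cmod a \<le> r}. real (vanish_order g a) * ln (r / max 1 (cmod a)))"
    unfolding count_fun_def by (rule divisor_sum_superset[OF fZr]) (use assms in \<open>auto simp: Z_def vanish_order_def split: if_splits\<close>)
  show "0 \<le> count_fun g r" unfolding 2 using assms by (auto intro!: sum_nonneg mult_nonneg_nonneg ln_ratio_nonneg)
  have "count_fun g r \<le> (\<Sum>a\<in>{a\<in>Z. cmod a \<le> r}. real (vanish_order g a) * ln (s / max 1 (cmod a)))"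
    unfolding 2 using assms by (intro sum_mono mult_left_mono ln_mono divide_right_mono) auto
  also have "\<dots> \<le> count_fun g s" unfolding 1 using fZ assms
    by (intro sum_mono2) (auto simp: Z_def intro!: mult_nonneg_nonneg ln_ratio_nonneg)
  finally show "count_fun g r \<le> count_fun g s" .
qed

lemma zero_number_le_count_fun:
  assumes "nz_entire g" "1 \<le> r" "r < R"
  shows "(\<Sum>a | cmod a \<le> r \<and> g a = 0. real (vanish_order g a)) \<le> count_fun g R * (R / (R - r))"
proof -
  define Z where "Z = {z. cmod z \<le> R \<and> g z = 0}"
  have fZ: "finite Z" unfolding Z_def by (rule finite_zeros_cball[OF assms(1)])
  have 1: "count_fun g R = (\<Sum>a\<in>Z. real (vanish_order g a) * ln (R / max 1 (cmod a)))"
    unfolding count_fun_def by (rule divisor_sum_superset[OF fZ]) (use fZ in \<open>auto simp: Z_def vanish_order_def split: if_splits\<close>)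
  have "ln (r / R) \<le> r / R - 1" using assms by (intro ln_le_minus_one) auto
  then have l: "(R - r) / R \<le> ln (R / r)" using assms by (simp add: ln_div field_simps)
  have "(\<Sum>a | cmod a \<le> r \<and> g a = 0. real (vanish_order g a)) * ((R - r) / R)
      \<le> (\<Sum>a | cmod a \<le> r \<and> g a = 0. real (vanish_order g a) * ln (R / max 1 (cmod a)))"
    unfolding sum_distrib_right
  proof (intro sum_mono mult_left_mono)
    fix a assume "a \<in> {a. cmod a \<le> r \<and> g a = 0}"
    then have "ln (R / r) \<le> ln (R / max 1 (cmod a))" using assms by (intro ln_mono divide_left_mono) auto
    then show "(R - r) / R \<le> ln (R / max 1 (cmod a))" using l by simp
  qed auto
  also have "\<dots> \<le> count_fun g R" unfolding 1
    by (rule sum_mono2) (use fZ assms in \<open>auto simp: Z_def intro!: mult_nonneg_nonneg ln_ratio_nonneg\<close>)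
  finally show ?thesis using assms by (simp add: field_simps)
qed

section \<open>The lemma on the logarithmic derivative\<close>

definition log_plus :: "real \<Rightarrow> real" where "log_plus x = ln (max 1 x)"

lemma log_plus_nonneg: "log_plus x \<ge> 0" by (simp add: log_plus_def)

lemma log_plus_ge_ln: "x > 0 \<Longrightarrow> log_plus x \<ge> ln x"
  unfolding log_plus_def by (auto simp: max_def)

lemma log_plus_mult: "x \<ge> 0 \<Longrightarrow> y \<ge> 0 \<Longrightarrow> log_plus (x * y) \<le> log_plus x + log_plus y"
proof -
  assume xy: "x \<ge> 0" "y \<ge> 0"
  have "1 * 1 \<le> max 1 x * max 1 y" by (intro mult_mono) auto
  moreover have "x * y \<le> max 1 x * max 1 y" using xy by (intro mult_mono) auto
  ultimately have "ln (max 1 (x * y)) \<le> ln (max 1 x * max 1 y)" by (intro ln_mono) auto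
  then show ?thesis unfolding log_plus_def by (simp add: ln_mult_pos)
qed

lemma abs_ln_eq_log_plus: "x > 0 \<Longrightarrow> \<bar>ln x\<bar> = 2 * log_plus x - ln x"
  by (auto simp: log_plus_def max_def)

lemma log_plus_continuous [continuous_intros]:
  "continuous_on S f \<Longrightarrow> continuous_on S (\<lambda>x. log_plus (f x))"
  unfolding log_plus_def by (intro continuous_intros) auto

lemma sqrt_cmod_le_Re_csqrt:
  assumes "Re w \<ge> 0" shows "sqrt (cmod w) \<le> sqrt 2 * Re (csqrt w)"
proof -
  obtain u where u: "u = csqrt w" by blast
  have sq: "u^2 = w" using u by (simp del: csqrt.simps)
  have Re0: "Re u \<ge> 0" using csqrt_principal[of w] unfolding u by auto
  have "Re w = (Re u)^2 - (Im u)^2" using sq by (metis Re_power2)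
  then have im: "(Im u)^2 \<le> (Re u)^2" using assms by simp
  have "cmod w = (cmod u)^2" using sq by (metis norm_power)
  also have "\<dots> \<le> (sqrt 2 * Re u)^2" using im by (simp add: cmod_power2 power_mult_distrib)
  finally show ?thesis using Re0 unfolding u[symmetric] by (intro real_le_lsqrt) auto
qed

lemma Re_inverse_one_minus_pos:
  assumes "cmod w < 1" shows "Re (1 / (1 - w)) > 0"
proof -
  have "Re w < 1" using assms complex_Re_le_cmod[of w] by linarith
  moreover have "w \<noteq> 1" using assms by auto
  ultimately show ?thesis unfolding Re_divide
    by (intro divide_pos_pos) (auto simp: complex_neq_0 add_pos_nonneg)
qed

text \<open>
  Kolmogorov's argument: the sum has positive real part, so the mean of its square root is
  controlled by the value at the origin.
\<close>

lemma circle_mean_sqrt_cauchy_sum: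
  fixes m :: "'i \<Rightarrow> nat"
  assumes I: "finite I" "\<And>i. i \<in> I \<Longrightarrow> cmod (b i) * r < 1" and r: "r > 0"
  shows "circle_mean (\<lambda>z. sqrt (cmod (\<Sum>i\<in>I. of_nat (m i) * (1 / (1 - b i * z))))) r \<le> sqrt 2 * sqrt (\<Sum>i\<in>I. real (m i))"
proof (cases "\<forall>i\<in>I. m i = 0")
  case True
  then show ?thesis by simp
next
  case False
  define G where "G = (\<lambda>z. \<Sum>i\<in>I. of_nat (m i) * (1 / (1 - b i * z)))"
  have lt: "cmod (b i * z) < 1" if "i \<in> I" "cmod z \<le> r" for i z
    using I(2)[OF that(1)] mult_left_mono[OF that(2), of "cmod (b i)"] by (simp add: norm_mult)
  have nz: "1 - b i * z \<noteq> 0" if "i \<in> I" "cmod z \<le> r" for i z using lt[OF that] by auto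
  have ReG: "Re (G z) > 0" if "cmod z \<le> r" for z
  proof -
    obtain i where i: "i \<in> I" "m i \<noteq> 0" using False by blast
    have "Re (G z) = (\<Sum>i\<in>I. real (m i) * Re (1 / (1 - b i * z)))" unfolding G_def Re_sum
      by (intro sum.cong refl) (simp del: times_divide_eq_right)
    also have "\<dots> > 0"
      by (rule sum_pos2[OF I(1) i(1)])
         (use i lt[OF _ that] Re_inverse_one_minus_pos in \<open>auto intro!: mult_nonneg_nonneg mult_pos_pos simp: less_imp_le\<close>)
    finally show ?thesis .
  qed
  have hG: "G holomorphic_on cball 0 r" unfolding G_def
    by (intro holomorphic_intros) (use nz in auto)
  have nn: "G z \<notin> \<real>\<^sub>\<le>\<^sub>0" if "cmod z \<le> r" for z
    using ReG[OF that] by (auto simp: complex_nonpos_Reals_iff)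
  have hs: "(\<lambda>z. csqrt (G z)) holomorphic_on cball 0 r"
    by (rule holomorphic_on_csqrt'[OF hG]) (use nn in auto)
  have cG: "continuous_on (sphere 0 r) G"
    using hG by (meson holomorphic_on_imp_continuous_on holomorphic_on_subset sphere_cball)
  have cs: "continuous_on (sphere 0 r) (\<lambda>z. csqrt (G z))"
    using hs by (meson holomorphic_on_imp_continuous_on holomorphic_on_subset sphere_cball)
  have "circle_mean (\<lambda>z. sqrt (cmod (G z))) r \<le> circle_mean (\<lambda>z. sqrt 2 * Re (csqrt (G z))) r"
  proof (rule circle_mean_mono)
    fix z assume "cmod z = r"
    then show "sqrt (cmod (G z)) \<le> sqrt 2 * Re (csqrt (G z))"
      by (intro sqrt_cmod_le_Re_csqrt) (use ReG[of z] in simp)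
  qed (use r cs cG in \<open>auto intro!: continuous_intros simp del: csqrt.simps\<close>)
  also have "\<dots> = sqrt 2 * Re (circle_mean (\<lambda>z. csqrt (G z)) r)"
    using circle_mean_Re[OF cs] r by (simp add: circle_mean_cmul)
  also have "circle_mean (\<lambda>z. csqrt (G z)) r = csqrt (G 0)"
    by (rule circle_mean_holomorphic[OF hs r])
  also have "G 0 = of_real (\<Sum>i\<in>I. real (m i))" by (simp add: G_def)
  also have "Re (csqrt \<dots>) = sqrt (\<Sum>i\<in>I. real (m i))"
    by (subst csqrt_of_real_nonneg) (auto intro!: sum_nonneg simp: sum_nonneg)
  finally show ?thesis by (simp add: G_def)
qed

lemma sqrt_cmod_add: "sqrt (cmod (x + y)) \<le> sqrt (cmod x) + sqrt (cmod y)"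
  by (rule order_trans[OF real_sqrt_le_mono[OF norm_triangle_ineq] sqrt_add_le_add_sqrt]) auto

lemma sqrt_cmod_diff: "sqrt (cmod (x - y)) \<le> sqrt (cmod x) + sqrt (cmod y)"
  using sqrt_cmod_add[of x "-y"] by simp

lemma circle_mean_sqrt_blaschke:
  fixes m :: "complex \<Rightarrow> nat"
  assumes Z: "finite Z" "\<And>a. a \<in> Z \<Longrightarrow> cmod a < \<rho>" and r: "0 < r" "r < \<rho>"
    and ne: "\<And>a. a \<in> Z \<Longrightarrow> cmod a \<noteq> r"
  defines "S \<equiv> (\<lambda>z. \<Sum>a\<in>Z. of_nat (m a) * (1 / (z - a) + cnj a / (of_real (\<rho>^2) - cnj a * z)))"
  shows "continuous_on (sphere 0 r) S"
    and "circle_mean (\<lambda>z. sqrt (cmod (S z))) r \<le> 10 * sqrt ((\<Sum>a\<in>Z. real (m a)) / r)"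
proof -
  define n where "n = (\<Sum>a\<in>Z. real (m a))"
  have n0: "n \<ge> 0" unfolding n_def by (auto intro: sum_nonneg)
  define Z1 where "Z1 = {a\<in>Z. cmod a < r}"
  define Z2 where "Z2 = {a\<in>Z. cmod a > r}"
  have ZZ: "Z = Z1 \<union> Z2" "Z1 \<inter> Z2 = {}" "finite Z1" "finite Z2"
    using ne Z(1) by (auto simp: Z1_def Z2_def) (metis linorder_neqE_linordered_idom)
  define G1 where "G1 = (\<lambda>z. \<Sum>a\<in>Z1. of_nat (m a) * (1 / (1 - (cnj a / of_real (r^2)) * z)))"
  define G2 where "G2 = (\<lambda>z. \<Sum>a\<in>Z2. of_nat (m a) * (1 / (1 - (1 / a) * z)))"
  define G3 where "G3 = (\<lambda>z. \<Sum>a\<in>Z. of_nat (m a) * (1 / (1 - (cnj a / of_real (\<rho>^2)) * z)))"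
  have b1: "cmod (cnj a / of_real (r^2)) * r < 1" if "a \<in> Z1" for a
    using that r by (simp add: Z1_def norm_divide norm_power norm_mult power2_eq_square field_simps)
  have b2: "cmod (1 / a) * r < 1" if "a \<in> Z2" for a
    using that r by (auto simp: Z2_def norm_divide divide_less_eq)
  have b3: "cmod (cnj a / of_real (\<rho>^2)) * r < 1" if "a \<in> Z" for a
  proof -
    have "cmod a * r < \<rho> * \<rho>" using Z(2)[OF that] r by (intro mult_strict_mono) auto
    then show ?thesis using r by (simp add: norm_divide norm_power norm_mult power2_eq_square field_simps)
  qed
  have nz: "1 - b * z \<noteq> 0" if "cmod b * r < 1" "cmod z = r" for b z :: complex
    using that by (metis eq_iff_diff_eq_0 norm_mult norm_one less_irrefl)
  have c1: "continuous_on (sphere 0 r) G1" unfolding G1_def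
    by (intro continuous_intros ballI) (use nz[OF b1] in auto)
  have c2: "continuous_on (sphere 0 r) G2" unfolding G2_def
    by (intro continuous_intros ballI) (use nz[OF b2] in auto)
  have c3: "continuous_on (sphere 0 r) G3" unfolding G3_def
    by (intro continuous_intros ballI) (use nz[OF b3] in auto)
  have le: "sum (\<lambda>a. real (m a)) Z' \<le> n" if "Z' \<subseteq> Z" for Z'
    unfolding n_def by (rule sum_mono2) (use Z that in auto)
  have m1: "circle_mean (\<lambda>z. sqrt (cmod (G1 z))) r \<le> sqrt 2 * sqrt n"
    unfolding G1_def by (rule order_trans[OF circle_mean_sqrt_cauchy_sum]) (use ZZ b1 r le[of Z1] in auto)
  have m2: "circle_mean (\<lambda>z. sqrt (cmod (G2 z))) r \<le> sqrt 2 * sqrt n"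
    unfolding G2_def by (rule order_trans[OF circle_mean_sqrt_cauchy_sum]) (use ZZ b2 r le[of Z2] in auto)
  have m3: "circle_mean (\<lambda>z. sqrt (cmod (G3 z))) r \<le> sqrt 2 * sqrt n"
    unfolding G3_def by (rule order_trans[OF circle_mean_sqrt_cauchy_sum]) (use Z b3 r le[of Z] in auto)
  have S_eq: "z * S z = cnj (G1 z) + (of_nat (\<Sum>a\<in>Z2. m a) - G2 z) + (G3 z - of_nat (\<Sum>a\<in>Z. m a))"
    if z: "cmod z = r" for z
  proof -
    have z0: "z \<noteq> 0" using z r by auto
    have zz: "of_real (r^2) = z * cnj z" using complex_norm_square[of z] z by simp
    have e1: "z * (1 / (z - a)) = cnj (1 / (1 - (cnj a / of_real (r^2)) * z))" if "a \<in> Z1" for a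
    proof -
      have "z \<noteq> a" using that z by (auto simp: Z1_def)
      have "1 - a / of_real (r^2) * cnj z = (z - a) / z"
        unfolding zz using z0 by (simp add: field_simps)
      then show ?thesis using z0 by simp
    qed
    have e2: "z * (1 / (z - a)) = 1 - 1 / (1 - (1 / a) * z)" if "a \<in> Z2" for a
    proof -
      have "z \<noteq> a" "a \<noteq> 0" using that z r by (auto simp: Z2_def)
      then show ?thesis by (simp add: field_simps)
    qed
    have e3: "z * (cnj a / (of_real (\<rho>^2) - cnj a * z)) = 1 / (1 - (cnj a / of_real (\<rho>^2)) * z) - 1" if "a \<in> Z" for a
    proof -
      have "1 - (cnj a / of_real (\<rho>^2)) * z \<noteq> 0" using nz[OF b3[OF that] z] .
      moreover have "complex_of_real (\<rho>^2) \<noteq> 0" using r by simp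
      moreover have "of_real (\<rho>^2) - cnj a * z = of_real (\<rho>^2) * (1 - (cnj a / of_real (\<rho>^2)) * z)"
        using calculation(2) by (simp add: field_simps)
      ultimately show ?thesis by (simp add: divide_simps)
    qed
    have "z * S z = (\<Sum>a\<in>Z. of_nat (m a) * (z * (1 / (z - a)))) + (\<Sum>a\<in>Z. of_nat (m a) * (z * (cnj a / (of_real (\<rho>^2) - cnj a * z))))"
      unfolding S_def sum_distrib_left sum.distrib[symmetric] by (intro sum.cong refl) (simp add: algebra_simps)
    also have "(\<Sum>a\<in>Z. of_nat (m a) * (z * (cnj a / (of_real (\<rho>^2) - cnj a * z)))) = G3 z - of_nat (\<Sum>a\<in>Z. m a)"
      unfolding G3_def of_nat_sum sum_subtractf[symmetric]
      by (intro sum.cong refl, subst e3) (simp_all add: algebra_simps)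
    also have "(\<Sum>a\<in>Z. of_nat (m a) * (z * (1 / (z - a)))) = (\<Sum>a\<in>Z1. of_nat (m a) * (z * (1 / (z - a)))) + (\<Sum>a\<in>Z2. of_nat (m a) * (z * (1 / (z - a))))"
      unfolding ZZ(1) by (rule sum.union_disjoint) (use ZZ in auto)
    also have "(\<Sum>a\<in>Z1. of_nat (m a) * (z * (1 / (z - a)))) = cnj (G1 z)"
      unfolding G1_def cnj_sum by (intro sum.cong refl, subst e1) simp_all
    also have "(\<Sum>a\<in>Z2. of_nat (m a) * (z * (1 / (z - a)))) = of_nat (\<Sum>a\<in>Z2. m a) - G2 z"
      unfolding G2_def of_nat_sum sum_subtractf[symmetric]
      by (intro sum.cong refl, subst e2) (simp_all add: algebra_simps)
    finally show ?thesis by simp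
  qed
  show cS: "continuous_on (sphere 0 r) S"
  proof -
    have d1: "z - a \<noteq> 0" if "cmod z = r" "a \<in> Z" for z a using ne[OF that(2)] that(1) by auto
    have d2: "of_real (\<rho>^2) - cnj a * z \<noteq> 0" if "cmod z = r" "a \<in> Z" for z a
    proof
      assume "of_real (\<rho>^2) - cnj a * z = 0"
      then have "cnj a * z = of_real (\<rho>^2)" by simp
      then have "(cnj a / of_real (\<rho>^2)) * z = 1" using r by (simp only: times_divide_eq_left) simp
      then show False using nz[OF b3[OF that(2)] that(1)] by simp
    qed
    show ?thesis unfolding S_def by (intro continuous_intros ballI) (use d1 d2 in auto)
  qed
  have "circle_mean (\<lambda>z. sqrt r * sqrt (cmod (S z))) r
     \<le> circle_mean (\<lambda>z. sqrt (cmod (G1 z)) + sqrt (cmod (G2 z)) + sqrt (cmod (G3 z)) + 2 * sqrt n) r"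
  proof (rule circle_mean_mono)
    fix z assume z: "cmod z = r"
    have cn: "cmod (of_nat (sum m X)) = (\<Sum>a\<in>X. real (m a))" for X
      by (subst norm_of_nat) (rule of_nat_sum)
    have l2: "sqrt (cmod (of_nat (\<Sum>a\<in>Z2. m a) - G2 z)) \<le> sqrt n + sqrt (cmod (G2 z))"
      by (rule order_trans[OF sqrt_cmod_diff]) (use le[of Z2] ZZ in \<open>auto simp del: of_nat_sum norm_of_nat simp: cn\<close>)
    have l3: "sqrt (cmod (G3 z - of_nat (\<Sum>a\<in>Z. m a))) \<le> sqrt (cmod (G3 z)) + sqrt n"
      by (rule order_trans[OF sqrt_cmod_diff]) (use le[of Z] ZZ in \<open>auto simp del: of_nat_sum norm_of_nat simp: cn\<close>)
    have "sqrt r * sqrt (cmod (S z)) = sqrt (cmod (z * S z))"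
      using z by (simp add: norm_mult real_sqrt_mult)
    also have "\<dots> \<le> sqrt (cmod (cnj (G1 z))) + sqrt (cmod (of_nat (\<Sum>a\<in>Z2. m a) - G2 z)) + sqrt (cmod (G3 z - of_nat (\<Sum>a\<in>Z. m a)))"
      unfolding S_eq[OF z] by (meson sqrt_cmod_add order_trans add_right_mono)
    finally show "sqrt r * sqrt (cmod (S z)) \<le> sqrt (cmod (G1 z)) + sqrt (cmod (G2 z)) + sqrt (cmod (G3 z)) + 2 * sqrt n"
      using l2 l3 by simp
  qed (use c1 c2 c3 cS r in \<open>auto intro!: continuous_intros\<close>)
  also have "\<dots> = circle_mean (\<lambda>z. sqrt (cmod (G1 z))) r + circle_mean (\<lambda>z. sqrt (cmod (G2 z))) r + circle_mean (\<lambda>z. sqrt (cmod (G3 z))) r + 2 * sqrt n"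
    using c1 c2 c3 r by (simp add: circle_mean_add continuous_intros)
  also have "\<dots> \<le> 3 * (sqrt 2 * sqrt n) + 2 * sqrt n" using m1 m2 m3 by simp
  also have "\<dots> \<le> 10 * sqrt n"
  proof -
    have "sqrt 2 \<le> 2" by (rule real_le_lsqrt) auto
    then have "sqrt 2 * sqrt n \<le> 2 * sqrt n" using n0 by (intro mult_right_mono) auto
    then show ?thesis using real_sqrt_ge_zero[OF n0] by linarith
  qed
  finally have "sqrt r * circle_mean (\<lambda>z. sqrt (cmod (S z))) r \<le> 10 * sqrt n"
    by (simp add: circle_mean_cmul)
  then show "circle_mean (\<lambda>z. sqrt (cmod (S z))) r \<le> 10 * sqrt ((\<Sum>a\<in>Z. real (m a)) / r)"
    using r unfolding n_def[symmetric] by (simp add: real_sqrt_divide field_simps)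
qed

lemma circle_mean_log_plus_le:
  assumes "continuous_on (sphere 0 r) A" "r \<ge> 0"
  shows "circle_mean (\<lambda>z. log_plus (cmod (A z))) r \<le> 2 * ln (1 + circle_mean (\<lambda>z. sqrt (cmod (A z))) r)"
proof -
  define m where "m = circle_mean (\<lambda>z. sqrt (cmod (A z))) r"
  have "circle_mean (\<lambda>z. 0::real) r \<le> m" unfolding m_def
    by (rule circle_mean_mono) (use assms in \<open>auto intro!: continuous_intros\<close>)
  then have m: "m \<ge> 0" by simp
  define k where "k = 1 / (1 + m)"
  have "circle_mean (\<lambda>z. log_plus (cmod (A z))) r \<le> circle_mean (\<lambda>z. 2 * (ln (1 + m) + k * (sqrt (cmod (A z)) - m))) r"
  proof (rule circle_mean_mono)
    fix z
    define x where "x = sqrt (cmod (A z))"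
    have x: "x \<ge> 0" "cmod (A z) = x^2" by (auto simp: x_def)
    have "max 1 (x^2) \<le> (1 + x)^2" using x(1) by (auto simp: power2_eq_square algebra_simps)
    then have "log_plus (cmod (A z)) \<le> ln ((1 + x)^2)" unfolding log_plus_def x(2) by (intro ln_mono) auto
    also have "\<dots> = 2 * ln (1 + x)" using x(1) by (simp add: ln_realpow)
    also have "ln (1 + x) \<le> ln (1 + m) + k * (x - m)"
    proof -
      have "ln ((1 + x) / (1 + m)) \<le> (1 + x) / (1 + m) - 1" using x m by (intro ln_le_minus_one) auto
      also have "\<dots> = (x - m) / (1 + m)" using m by (simp add: field_simps)
      finally show ?thesis using x m by (simp add: ln_div k_def)
    qed
    finally show "log_plus (cmod (A z)) \<le> 2 * (ln (1 + m) + k * (sqrt (cmod (A z)) - m))"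
      by (simp add: x_def)
  qed (use assms m in \<open>auto intro!: continuous_intros\<close>)
  also have "\<dots> = 2 * (ln (1 + m) + circle_mean (\<lambda>z. k * (sqrt (cmod (A z)) - m)) r)"
    unfolding circle_mean_cmul using assms m
    by (subst circle_mean_add) (auto intro!: continuous_intros simp: circle_mean_cmul)
  also have "circle_mean (\<lambda>z. k * (sqrt (cmod (A z)) - m)) r = k * (m - m)"
    unfolding circle_mean_cmul using assms
    by (subst circle_mean_diff) (auto intro!: continuous_intros simp: m_def)
  finally show ?thesis by (simp add: m_def)
qed

definition logderiv :: "(complex \<Rightarrow> complex) \<Rightarrow> complex \<Rightarrow> complex" where
  "logderiv f z = deriv f z / f z"

lemma logderiv_mult:
  assumes "f field_differentiable (at z)" "g field_differentiable (at z)" "f z \<noteq> 0" "g z \<noteq> 0"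
  shows "logderiv (\<lambda>z. f z * g z) z = logderiv f z + logderiv g z"
  unfolding logderiv_def using assms by (subst deriv_mult) (auto simp: field_simps)

lemma logderiv_divide:
  assumes "f field_differentiable (at z)" "g field_differentiable (at z)" "f z \<noteq> 0" "g z \<noteq> 0"
  shows "logderiv (\<lambda>z. f z / g z) z = logderiv f z - logderiv g z"
  unfolding logderiv_def using assms by (subst deriv_divide) (auto simp: field_simps power2_eq_square)

lemma logderiv_linear_power:
  assumes "c * z + d \<noteq> 0"
  shows "logderiv (\<lambda>z. (c * z + d) ^ m) z = of_nat m * (c / (c * z + d))"
proof -
  have "((\<lambda>z. (c * z + d) ^ m) has_field_derivative (of_nat m * (c * z + d) ^ (m - 1) * c)) (at z)"
    by (auto intro!: derivative_eq_intros)
  then have "deriv (\<lambda>z. (c * z + d) ^ m) z = of_nat m * (c * z + d) ^ (m - 1) * c" by (rule DERIV_imp_deriv)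
  moreover have "of_nat m * x ^ (m - 1) * c / x ^ m = of_nat m * (c / x)" if "x \<noteq> 0" for x :: complex
    using that by (cases m) (simp_all add: divide_simps)
  ultimately show ?thesis unfolding logderiv_def using assms by simp
qed

lemma logderiv_prod:
  assumes "finite I" "\<And>i. i \<in> I \<Longrightarrow> f i field_differentiable (at z)" "\<And>i. i \<in> I \<Longrightarrow> f i z \<noteq> 0"
  shows "logderiv (\<lambda>z. \<Prod>i\<in>I. f i z) z = (\<Sum>i\<in>I. logderiv (f i) z)
     \<and> (\<lambda>z. \<Prod>i\<in>I. f i z) field_differentiable (at z)"
  using assms
proof (induction I rule: finite_induct)
  case empty
  then show ?case by (simp add: logderiv_def)
next
  case (insert i I)
  then have *: "logderiv (\<lambda>z. f i z * (\<Prod>i\<in>I. f i z)) z = logderiv (f i) z + logderiv (\<lambda>z. \<Prod>i\<in>I. f i z) z"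
    by (intro logderiv_mult) auto
  show ?case using insert * by (auto intro!: field_differentiable_mult)
qed

lemma ball_superset_of_cball:
  assumes "open U" "cball (0::complex) \<rho> \<subseteq> U" "\<rho> > 0"
  obtains R where "R > \<rho>" "ball 0 R \<subseteq> U"
proof -
  obtain e where e: "e > 0" "(\<Union>x\<in>cball 0 \<rho>. ball x e) \<subseteq> U"
    using compact_subset_open_imp_ball_epsilon_subset[OF compact_cball assms(1,2)] by blast
  have "ball 0 (\<rho> + e) \<subseteq> U"
  proof
    fix z :: complex assume z: "z \<in> ball 0 (\<rho> + e)"
    define x where "x = (if cmod z \<le> \<rho> then z else of_real (\<rho> / cmod z) * z)"
    have "dist x z < e"
    proof (cases "cmod z \<le> \<rho>")
      case True then show ?thesis using e by (simp add: x_def)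
    next
      case False
      then have "x - z = of_real (\<rho> / cmod z - 1) * z" by (simp add: x_def algebra_simps)
      then have "dist x z = \<bar>\<rho> / cmod z - 1\<bar> * cmod z" by (simp only: dist_norm norm_mult norm_of_real)
      also have "\<dots> = cmod z - \<rho>" using False assms(3) by (auto simp: abs_if field_simps)
      finally show ?thesis using z by simp
    qed
    moreover have "x \<in> cball 0 \<rho>" using assms(3) by (auto simp: x_def norm_mult norm_divide)
    ultimately show "z \<in> U" using e(2) by (meson UN_I mem_ball subsetD)
  qed
  then show ?thesis using e by (intro that[of "\<rho> + e"]) auto
qed

definition zeros_in :: "(complex \<Rightarrow> complex) \<Rightarrow> real \<Rightarrow> complex set" where
  "zeros_in g \<rho> = {a. cmod a \<le> \<rho> \<and> g a = 0}"

lemma finite_zeros_in: "nz_entire g \<Longrightarrow> finite (zeros_in g \<rho>)"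
  unfolding zeros_in_def by (rule finite_zeros_cball)

lemma blaschke_decomposition:
  assumes g: "nz_entire g" and \<rho>: "\<rho> > 0" "\<rho> \<notin> critical_radii g"
  obtains E where "nz_entire E" "\<And>z. cmod z \<le> \<rho> \<Longrightarrow> E z \<noteq> 0" "\<And>z. cmod z = \<rho> \<Longrightarrow> cmod (E z) = cmod (g z)"
    "\<And>z. cmod z < \<rho> \<Longrightarrow> g z \<noteq> 0 \<Longrightarrow> logderiv g z = logderiv E z +
       (\<Sum>a\<in>zeros_in g \<rho>. of_nat (vanish_order g a) * (1 / (z - a) + cnj a / (of_real (\<rho>^2) - cnj a * z)))"
proof -
  define Z where "Z = zeros_in g \<rho>"
  have fZ: "finite Z" unfolding Z_def by (rule finite_zeros_in[OF g])
  have aZ: "cmod a < \<rho>" if "a \<in> Z" for a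
    using that \<rho>(2) by (auto simp: Z_def zeros_in_def critical_radii_def less_le)
  define m where "m = vanish_order g"
  obtain H where H: "nz_entire H" "\<And>a. a \<in> Z \<Longrightarrow> H a \<noteq> 0" "\<And>z. g z = (\<Prod>a\<in>Z. (z - a) ^ m a) * H z"
    using factor_out_zeros[OF fZ g] unfolding m_def by blast
  define q where "q = (\<lambda>a z. (- (cnj a / of_real \<rho>) * z + of_real \<rho>) ^ m a)"
  have q0: "- (cnj a / of_real \<rho>) * z + of_real \<rho> \<noteq> 0" if "a \<in> Z" "cmod z \<le> \<rho>" for a z
  proof
    assume "- (cnj a / of_real \<rho>) * z + of_real \<rho> = 0"
    then have "cnj a * z = of_real \<rho> * of_real \<rho>" using \<rho> by (simp add: field_simps)
    then have "cmod (cnj a * z) = \<rho> * \<rho>" using \<rho> by (simp only: norm_mult) simp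
    moreover have "cmod a * cmod z \<le> cmod a * \<rho>" using that by (intro mult_left_mono) auto
    moreover have "cmod a * \<rho> < \<rho> * \<rho>" using aZ[OF that(1)] \<rho> by simp
    ultimately show False by (simp add: norm_mult)
  qed
  have qabs: "cmod (- (cnj a / of_real \<rho>) * z + of_real \<rho>) = cmod (z - a)" if "cmod z = \<rho>" for a z
  proof -
    have "of_real \<rho> * of_real \<rho> = z * cnj z" using complex_norm_square[of z] that by (simp add: power2_eq_square)
    then have "of_real \<rho> * (- (cnj a / of_real \<rho>) * z + of_real \<rho>) = z * cnj (z - a)"
      using \<rho> by (simp add: algebra_simps)
    then have "cmod (of_real \<rho> * (- (cnj a / of_real \<rho>) * z + of_real \<rho>)) = cmod z * cmod (z - a)"
      by (simp only: norm_mult complex_mod_cnj)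
    then show ?thesis using that \<rho> by (simp only: norm_mult) simp
  qed
  define E where "E = (\<lambda>z. (\<Prod>a\<in>Z. q a z) * H z)"
  have Hnz: "H z \<noteq> 0" if "cmod z \<le> \<rho>" for z
    using H(2)[of z] H(3)[of z] that by (auto simp: Z_def zeros_in_def)
  have qhol: "q a holomorphic_on UNIV" for a unfolding q_def by (intro holomorphic_intros) (use \<rho> in auto)
  have Ehol: "E holomorphic_on UNIV" unfolding E_def
    by (intro holomorphic_on_mult holomorphic_on_prod qhol nz_entire_holo H)
  have Enz: "E z \<noteq> 0" if "cmod z \<le> \<rho>" for z
    unfolding E_def using Hnz[OF that] q0[OF _ that] fZ by (auto simp: q_def)
  have E: "nz_entire E" using nz_entireI[OF Ehol Enz[of 0]] \<rho> by simp
  have Eabs: "cmod (E z) = cmod (g z)" if "cmod z = \<rho>" for z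
    unfolding E_def H(3) norm_mult prod_norm[symmetric] q_def norm_power using qabs[OF that] by simp
  have fd: "f field_differentiable (at z)" if "f holomorphic_on UNIV" for f and z :: complex
    using that holomorphic_on_imp_differentiable_at by blast
  have ld: "logderiv g z = logderiv E z +
       (\<Sum>a\<in>Z. of_nat (m a) * (1 / (z - a) + cnj a / (of_real (\<rho>^2) - cnj a * z)))"
    if z: "cmod z < \<rho>" "g z \<noteq> 0" for z
  proof -
    have zne: "z \<noteq> a" if "a \<in> Z" for a using that z by (auto simp: Z_def zeros_in_def)
    have p: "logderiv (\<lambda>z. \<Prod>a\<in>Z. (z - a) ^ m a) z = (\<Sum>a\<in>Z. logderiv (\<lambda>z. (z - a) ^ m a) z)
      \<and> (\<lambda>z. \<Prod>a\<in>Z. (z - a) ^ m a) field_differentiable (at z)"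
      by (rule logderiv_prod[OF fZ]) (use zne in \<open>auto intro!: fd holomorphic_intros\<close>)
    have "g = (\<lambda>z. (\<Prod>a\<in>Z. (z - a) ^ m a) * H z)" using H(3) by (rule ext)
    then have "logderiv g z = logderiv (\<lambda>z. (\<Prod>a\<in>Z. (z - a) ^ m a) * H z) z" by (rule arg_cong)
    also have "\<dots> = (\<Sum>a\<in>Z. logderiv (\<lambda>z. (z - a) ^ m a) z) + logderiv H z"
      by (subst logderiv_mult) (use p zne fZ Hnz z in \<open>auto intro!: fd nz_entire_holo H\<close>)
    also have "(\<Sum>a\<in>Z. logderiv (\<lambda>z. (z - a) ^ m a) z) = (\<Sum>a\<in>Z. of_nat (m a) * (1 / (z - a)))"
    proof (intro sum.cong refl)
      fix a assume "a \<in> Z"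
      then show "logderiv (\<lambda>z. (z - a) ^ m a) z = of_nat (m a) * (1 / (z - a))"
        using logderiv_linear_power[of 1 z "-a" "m a"] zne by simp
    qed
    finally have 1: "logderiv g z = (\<Sum>a\<in>Z. of_nat (m a) * (1 / (z - a))) + logderiv H z" .
    have p2: "logderiv (\<lambda>z. \<Prod>a\<in>Z. q a z) z = (\<Sum>a\<in>Z. logderiv (q a) z) \<and> (\<lambda>z. \<Prod>a\<in>Z. q a z) field_differentiable (at z)"
      by (rule logderiv_prod[OF fZ]) (use q0 z qhol in \<open>auto intro!: fd simp: q_def\<close>)
    have "logderiv E z = (\<Sum>a\<in>Z. logderiv (q a) z) + logderiv H z"
      unfolding E_def by (subst logderiv_mult) (use p2 q0 fZ Hnz z in \<open>auto intro!: fd nz_entire_holo H simp: q_def\<close>)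
    also have "(\<Sum>a\<in>Z. logderiv (q a) z) = (\<Sum>a\<in>Z. - (of_nat (m a) * (cnj a / (of_real (\<rho>^2) - cnj a * z))))"
    proof (intro sum.cong refl)
      fix a assume a: "a \<in> Z"
      have n: "- (cnj a / of_real \<rho>) * z + of_real \<rho> \<noteq> 0" using q0[OF a] z by simp
      have e: "of_real (\<rho>^2) - cnj a * z = of_real \<rho> * (- (cnj a / of_real \<rho>) * z + of_real \<rho>)"
        using \<rho> by (simp add: algebra_simps power2_eq_square)
      have "logderiv (q a) z = of_nat (m a) * (- (cnj a / of_real \<rho>) / (- (cnj a / of_real \<rho>) * z + of_real \<rho>))"
        unfolding q_def using logderiv_linear_power[OF n] by simp
      also have "\<dots> = - (of_nat (m a) * (cnj a / (of_real (\<rho>^2) - cnj a * z)))"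
        unfolding e by simp
      finally show "logderiv (q a) z = - (of_nat (m a) * (cnj a / (of_real (\<rho>^2) - cnj a * z)))" .
    qed
    finally show ?thesis using 1 by (simp add: distrib_left sum.distrib sum_negf)
  qed
  show ?thesis by (rule that[of E]) (use E Enz Eabs ld in \<open>auto simp: Z_def m_def\<close>)
qed

lemma circle_mean_sqrt_logderiv:
  assumes g: "nz_entire g0" "nz_entire g1"
    and r: "0 < r" "r < \<rho>" "r \<notin> critical_radii g0" "r \<notin> critical_radii g1"
    and \<rho>: "\<rho> \<notin> critical_radii g0" "\<rho> \<notin> critical_radii g1"
  shows "continuous_on (sphere 0 r) (\<lambda>z. logderiv g1 z - logderiv g0 z)"
    and "circle_mean (\<lambda>z. sqrt (cmod (logderiv g1 z - logderiv g0 z))) r \<le>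
     1 + 2 / (\<rho> - r) * circle_mean (\<lambda>z. \<bar>ln (cmod (g1 z / g0 z))\<bar>) \<rho>
     + 10 * sqrt ((\<Sum>a\<in>zeros_in g0 \<rho>. real (vanish_order g0 a)) / r)
     + 10 * sqrt ((\<Sum>a\<in>zeros_in g1 \<rho>. real (vanish_order g1 a)) / r)"
proof -
  have \<rho>0: "\<rho> > 0" using r by simp
  define S where "S g z = (\<Sum>a\<in>zeros_in g \<rho>. of_nat (vanish_order g a) * (1 / (z - a) + cnj a / (of_real (\<rho>^2) - cnj a * z)))" for g z
  obtain E0 where E0: "nz_entire E0" "\<And>z. cmod z \<le> \<rho> \<Longrightarrow> E0 z \<noteq> 0" "\<And>z. cmod z = \<rho> \<Longrightarrow> cmod (E0 z) = cmod (g0 z)"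
    "\<And>z. cmod z < \<rho> \<Longrightarrow> g0 z \<noteq> 0 \<Longrightarrow> logderiv g0 z = logderiv E0 z + S g0 z"
    by (rule blaschke_decomposition[OF g(1) \<rho>0 \<rho>(1), folded S_def]) (rule that)
  obtain E1 where E1: "nz_entire E1" "\<And>z. cmod z \<le> \<rho> \<Longrightarrow> E1 z \<noteq> 0" "\<And>z. cmod z = \<rho> \<Longrightarrow> cmod (E1 z) = cmod (g1 z)"
    "\<And>z. cmod z < \<rho> \<Longrightarrow> g1 z \<noteq> 0 \<Longrightarrow> logderiv g1 z = logderiv E1 z + S g1 z"
    by (rule blaschke_decomposition[OF g(2) \<rho>0 \<rho>(2), folded S_def]) (rule that)
  define U where "U = {z. E0 z * E1 z \<noteq> 0}"
  have "open U" unfolding U_def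
    by (intro open_Collect_neq continuous_intros nz_entire_cont E0 E1)
  moreover have "cball 0 \<rho> \<subseteq> U" using E0(2) E1(2) by (auto simp: U_def)
  ultimately obtain R where R: "R > \<rho>" "ball 0 R \<subseteq> U" using ball_superset_of_cball \<rho>0 by blast
  define Q where "Q = (\<lambda>z. E1 z / E0 z)"
  have nz: "E0 z \<noteq> 0" "E1 z \<noteq> 0" if "cmod z < R" for z using R(2) that by (auto simp: U_def)
  have hQ: "Q holomorphic_on ball 0 R" unfolding Q_def
    by (intro holomorphic_intros nz_entire_holo E0 E1) (use nz in auto)
  obtain h where h: "h holomorphic_on ball 0 R" "\<And>x. x \<in> ball 0 R \<Longrightarrow> exp (h x) = Q x"
    using holomorphic_logarithm_exists[of "ball 0 R" Q 0] hQ nz R \<rho>0 by (auto simp: Q_def)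
  have hc: "h holomorphic_on cball 0 \<rho>" using h(1) R by (auto intro: holomorphic_on_subset)
  have fd: "f field_differentiable (at z)" if "f holomorphic_on ball 0 R" "cmod z < R" for f z
    using that holomorphic_on_imp_differentiable_at[OF that(1) open_ball] by simp
  have dh: "deriv h z = logderiv E1 z - logderiv E0 z" if z: "cmod z < R" for z
  proof -
    have "logderiv Q z = logderiv E1 z - logderiv E0 z" unfolding Q_def
      by (rule logderiv_divide) (use nz z fd nz_entire_holo E0 E1 in auto)
    moreover have "deriv Q z = deriv (\<lambda>z. exp (h z)) z"
      by (rule deriv_cong_ev) (use z h(2) in \<open>auto intro!: eventually_nhds_in_open[of "ball 0 R", THEN eventually_mono]\<close>)
    moreover have "deriv (\<lambda>z. exp (h z)) z = exp (h z) * deriv h z"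
      by (rule DERIV_imp_deriv) (use fd[OF h(1) z] in \<open>auto intro!: derivative_eq_intros simp: DERIV_deriv_iff_field_differentiable\<close>)
    ultimately show ?thesis using h(2)[of z] z nz[OF z] by (simp add: logderiv_def Q_def)
  qed
  have Reh: "Re (h z) = ln (cmod (g1 z / g0 z))" if z: "cmod z = \<rho>" for z
  proof -
    have "exp (Re (h z)) = cmod (Q z)" using h(2)[of z] z R by (metis dist_0_norm mem_ball norm_exp_eq_Re)
    also have "\<dots> = cmod (g1 z / g0 z)" using E0(3) E1(3) z by (simp add: Q_def norm_divide)
    finally show ?thesis by (metis ln_exp)
  qed
  have zlt: "cmod a < \<rho>" if "a \<in> zeros_in g0 \<rho> \<or> a \<in> zeros_in g1 \<rho>" for a
    using that \<rho> by (auto simp: zeros_in_def critical_radii_def less_le)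
  have zne: "cmod a \<noteq> r" if "a \<in> zeros_in g0 \<rho> \<or> a \<in> zeros_in g1 \<rho>" for a
    using that r by (auto simp: zeros_in_def critical_radii_def)
  have S0: "continuous_on (sphere 0 r) (S g0)"
    "circle_mean (\<lambda>z. sqrt (cmod (S g0 z))) r \<le> 10 * sqrt ((\<Sum>a\<in>zeros_in g0 \<rho>. real (vanish_order g0 a)) / r)"
    unfolding S_def by (rule circle_mean_sqrt_blaschke[OF finite_zeros_in[OF g(1)]]; use zlt zne r in auto)+
  have S1: "continuous_on (sphere 0 r) (S g1)"
    "circle_mean (\<lambda>z. sqrt (cmod (S g1 z))) r \<le> 10 * sqrt ((\<Sum>a\<in>zeros_in g1 \<rho>. real (vanish_order g1 a)) / r)"
    unfolding S_def by (rule circle_mean_sqrt_blaschke[OF finite_zeros_in[OF g(2)]]; use zlt zne r in auto)+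
  have eq: "logderiv g1 z - logderiv g0 z = deriv h z + S g1 z - S g0 z" if z: "cmod z = r" for z
    using E0(4)[of z] E1(4)[of z] noncritical_nz[OF r(3) z] noncritical_nz[OF r(4) z] dh[of z] z r R by simp
  have cdh: "continuous_on (sphere 0 r) (deriv h)"
    by (rule holomorphic_on_imp_continuous_on, rule holomorphic_on_subset[OF holomorphic_deriv[OF h(1) open_ball]]) (use r R in auto)
  show "continuous_on (sphere 0 r) (\<lambda>z. logderiv g1 z - logderiv g0 z)"
    by (subst continuous_on_cong[OF refl eq]) (auto intro!: continuous_intros cdh S0 S1)
  have "circle_mean (\<lambda>z. sqrt (cmod (logderiv g1 z - logderiv g0 z))) r = circle_mean (\<lambda>z. sqrt (cmod (deriv h z + S g1 z - S g0 z))) r"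
    by (rule circle_mean_cong) (use eq r in auto)
  also have "\<dots> \<le> circle_mean (\<lambda>z. 1 + cmod (deriv h z) + sqrt (cmod (S g1 z)) + sqrt (cmod (S g0 z))) r"
  proof (rule circle_mean_mono)
    fix z
    have "x \<ge> 0 \<Longrightarrow> sqrt x \<le> 1 + x" for x
      by (rule real_le_lsqrt) (auto simp: power2_eq_square algebra_simps)
    then have "sqrt (cmod (deriv h z)) \<le> 1 + cmod (deriv h z)" by simp
    moreover have "sqrt (cmod (deriv h z + S g1 z - S g0 z)) \<le> sqrt (cmod (deriv h z)) + sqrt (cmod (S g1 z)) + sqrt (cmod (S g0 z))"
      by (meson add_right_mono order_trans sqrt_cmod_add sqrt_cmod_diff)
    ultimately show "sqrt (cmod (deriv h z + S g1 z - S g0 z)) \<le> 1 + cmod (deriv h z) + sqrt (cmod (S g1 z)) + sqrt (cmod (S g0 z))" by linarith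
  qed (use r in \<open>auto intro!: continuous_intros cdh S0 S1\<close>)
  also have "\<dots> = 1 + circle_mean (\<lambda>z. cmod (deriv h z)) r + circle_mean (\<lambda>z. sqrt (cmod (S g1 z))) r + circle_mean (\<lambda>z. sqrt (cmod (S g0 z))) r"
    using r cdh S0(1) S1(1) by (simp add: circle_mean_add continuous_intros)
  also have "circle_mean (\<lambda>z. cmod (deriv h z)) r \<le> 2 / (\<rho> - r) * circle_mean (\<lambda>z. \<bar>Re (h z)\<bar>) \<rho>"
    by (rule circle_mean_deriv_le[OF hc r(1,2)])
  also have "circle_mean (\<lambda>z. \<bar>Re (h z)\<bar>) \<rho> = circle_mean (\<lambda>z. \<bar>ln (cmod (g1 z / g0 z))\<bar>) \<rho>"
    by (rule circle_mean_cong) (use Reh \<rho>0 in auto)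
  finally show "circle_mean (\<lambda>z. sqrt (cmod (logderiv g1 z - logderiv g0 z))) r \<le>
     1 + 2 / (\<rho> - r) * circle_mean (\<lambda>z. \<bar>ln (cmod (g1 z / g0 z))\<bar>) \<rho>
     + 10 * sqrt ((\<Sum>a\<in>zeros_in g0 \<rho>. real (vanish_order g0 a)) / r)
     + 10 * sqrt ((\<Sum>a\<in>zeros_in g1 \<rho>. real (vanish_order g1 a)) / r)"
    using S0(2) S1(2) by linarith
qed

text \<open>
  The lemma on the logarithmic derivative in the sharp form of Goldberg and Grinshtein: the bound
  does not contain the logarithm of the radius, which would not be negligible for rational maps.
\<close>

lemma log_derivative_lemma:
  assumes g: "nz_entire g0" "nz_entire g1" and Q: "nz_entire Q"
  obtains C where "C \<ge> 0" "\<And>r R B t. \<lbrakk>1 \<le> r; r < R; R \<le> 2 * r; 1 \<le> B;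
     \<And>s. \<lbrakk>r \<le> s; s \<le> R; s \<notin> critical_radii g0; s \<notin> critical_radii g1; s \<notin> critical_radii Q\<rbrakk> \<Longrightarrow>
        circle_mean (\<lambda>z. log_plus (cmod (g1 z / g0 z))) s + count_fun g0 s \<le> B;
     r \<le> t; 2 * t \<le> r + R; t \<notin> critical_radii g0; t \<notin> critical_radii g1\<rbrakk> \<Longrightarrow>
     circle_mean (\<lambda>z. log_plus (cmod (logderiv g1 z - logderiv g0 z))) t \<le> C + 2 * ln B + 2 * log_plus (1 / (R - r))"
proof -
  obtain c0 where c0: "\<And>r. r \<ge> 1 \<Longrightarrow> r \<notin> critical_radii g0 \<Longrightarrow> circle_mean (\<lambda>z. ln (cmod (g0 z))) r = count_fun g0 r + c0"
    using jensen[OF g(1)] by blast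
  obtain c1 where c1: "\<And>r. r \<ge> 1 \<Longrightarrow> r \<notin> critical_radii g1 \<Longrightarrow> circle_mean (\<lambda>z. ln (cmod (g1 z))) r = count_fun g1 r + c1"
    using jensen[OF g(2)] by blast
  define K where "K = \<bar>c0\<bar> + \<bar>c1\<bar>"
  have K: "K \<ge> 0" by (simp add: K_def)
  define C where "C = 2 * ln (1000 * (1 + K))"
  have C: "C \<ge> 0" using K by (simp add: C_def)
  show ?thesis
  proof (rule that[OF C])
    fix r R B t
    assume r: "1 \<le> r" "r < R" "R \<le> 2 * r" and B: "(1::real) \<le> B"
      and bd: "\<And>s. \<lbrakk>r \<le> s; s \<le> R; s \<notin> critical_radii g0; s \<notin> critical_radii g1; s \<notin> critical_radii Q\<rbrakk> \<Longrightarrow>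
        circle_mean (\<lambda>z. log_plus (cmod (g1 z / g0 z))) s + count_fun g0 s \<le> B"
      and t: "r \<le> t" "2 * t \<le> r + R" and tc: "t \<notin> critical_radii g0" "t \<notin> critical_radii g1"
    define d where "d = R - t"
    have d: "d > 0" "R - r \<le> 2 * d" "t + d = R" using r t by (auto simp: d_def)
    have g01: "nz_entire (\<lambda>z. g0 z * g1 z * Q z)" by (rule vanish_order_mult(1)[OF vanish_order_mult(1)[OF g] Q])
    have cr: "s \<notin> critical_radii g0" "s \<notin> critical_radii g1" "s \<notin> critical_radii Q" if "s \<notin> critical_radii (\<lambda>z. g0 z * g1 z * Q z)" for s
      using that by (auto simp: critical_radii_def)
    obtain \<rho> where \<rho>: "t + d / 4 < \<rho>" "\<rho> < t + d / 2" "\<rho> \<notin> critical_radii (\<lambda>z. g0 z * g1 z * Q z)"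
      using ex_noncritical[OF g01, of "t + d/4" "t + d/2"] d by auto
    obtain R2 where R2: "t + 3 * d / 4 < R2" "R2 < t + d" "R2 \<notin> critical_radii (\<lambda>z. g0 z * g1 z * Q z)"
      using ex_noncritical[OF g01, of "t + 3*d/4" "t + d"] d by auto
    have ctn: "continuous_on (sphere 0 s) g0" "continuous_on (sphere 0 s) g1" for s
      using g nz_entire_cont by blast+
    have mln: "circle_mean (\<lambda>z. ln (cmod (g1 z / g0 z))) s = count_fun g1 s + c1 - (count_fun g0 s + c0)"
      and M: "circle_mean (\<lambda>z. ln (cmod (g1 z / g0 z))) s \<le> circle_mean (\<lambda>z. log_plus (cmod (g1 z / g0 z))) s"
      and M2: "circle_mean (\<lambda>z. \<bar>ln (cmod (g1 z / g0 z))\<bar>) s = 2 * circle_mean (\<lambda>z. log_plus (cmod (g1 z / g0 z))) s - circle_mean (\<lambda>z. ln (cmod (g1 z / g0 z))) s"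
      and M3: "0 \<le> circle_mean (\<lambda>z. log_plus (cmod (g1 z / g0 z))) s"
      if s: "s \<ge> 1" "s \<notin> critical_radii g0" "s \<notin> critical_radii g1" for s
    proof -
      have nz: "g0 z \<noteq> 0" "g1 z \<noteq> 0" if "cmod z = s" for z
        using s that noncritical_nz by blast+
      have cl: "continuous_on (sphere 0 s) (\<lambda>z. ln (cmod (g1 z / g0 z)))" "continuous_on (sphere 0 s) (\<lambda>z. ln (cmod (g1 z)))"
         "continuous_on (sphere 0 s) (\<lambda>z. ln (cmod (g0 z)))" "continuous_on (sphere 0 s) (\<lambda>z. log_plus (cmod (g1 z / g0 z)))"
        using nz by (auto intro!: continuous_intros ctn)
      have "circle_mean (\<lambda>z. ln (cmod (g1 z / g0 z))) s = circle_mean (\<lambda>z. ln (cmod (g1 z)) - ln (cmod (g0 z))) s"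
        by (rule circle_mean_cong) (use s nz in \<open>auto simp: norm_divide ln_div\<close>)
      also have "\<dots> = circle_mean (\<lambda>z. ln (cmod (g1 z))) s - circle_mean (\<lambda>z. ln (cmod (g0 z))) s"
        by (rule circle_mean_diff) (use s cl in auto)
      finally show "circle_mean (\<lambda>z. ln (cmod (g1 z / g0 z))) s = count_fun g1 s + c1 - (count_fun g0 s + c0)"
        using c0 c1 s by simp
      show "circle_mean (\<lambda>z. ln (cmod (g1 z / g0 z))) s \<le> circle_mean (\<lambda>z. log_plus (cmod (g1 z / g0 z))) s"
        by (rule circle_mean_mono) (use cl s nz in \<open>auto intro!: log_plus_ge_ln\<close>)
      have "circle_mean (\<lambda>z. \<bar>ln (cmod (g1 z / g0 z))\<bar>) s = circle_mean (\<lambda>z. 2 * log_plus (cmod (g1 z / g0 z)) - ln (cmod (g1 z / g0 z))) s"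
        by (rule circle_mean_cong, rule abs_ln_eq_log_plus) (use s nz in auto)
      also have "\<dots> = 2 * circle_mean (\<lambda>z. log_plus (cmod (g1 z / g0 z))) s - circle_mean (\<lambda>z. ln (cmod (g1 z / g0 z))) s"
        by (subst circle_mean_diff) (use cl s in \<open>auto simp: circle_mean_cmul intro!: continuous_intros\<close>)
      finally show "circle_mean (\<lambda>z. \<bar>ln (cmod (g1 z / g0 z))\<bar>) s = 2 * circle_mean (\<lambda>z. log_plus (cmod (g1 z / g0 z))) s - circle_mean (\<lambda>z. ln (cmod (g1 z / g0 z))) s" .
      have "circle_mean (\<lambda>z. 0::real) s \<le> circle_mean (\<lambda>z. log_plus (cmod (g1 z / g0 z))) s"
        by (rule circle_mean_mono) (use cl s log_plus_nonneg in auto)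
      then show "0 \<le> circle_mean (\<lambda>z. log_plus (cmod (g1 z / g0 z))) s" by simp
    qed
    have \<rho>1: "\<rho> \<ge> 1" "r \<le> \<rho>" "\<rho> \<le> R" "t < \<rho>" "d / 4 \<le> \<rho> - t" "\<rho> \<notin> critical_radii g0" "\<rho> \<notin> critical_radii g1" "\<rho> \<notin> critical_radii Q"
      using \<rho> t r d cr by auto
    have R21: "R2 \<ge> 1" "r \<le> R2" "R2 \<le> R" "\<rho> < R2" "d / 4 \<le> R2 - \<rho>" "R2 \<notin> critical_radii g0" "R2 \<notin> critical_radii g1" "R2 \<notin> critical_radii Q"
      using R2 \<rho> t r d cr by auto
    have N0: "count_fun g0 s \<ge> 0" "count_fun g1 s \<ge> 0" if "s \<ge> 1" for s
      using count_fun_mono[OF g(1), of s s] count_fun_mono[OF g(2), of s s] that by auto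
    have M\<rho>: "circle_mean (\<lambda>z. \<bar>ln (cmod (g1 z / g0 z))\<bar>) \<rho> \<le> 3 * B + K"
      using M2[OF \<rho>1(1,6,7)] mln[OF \<rho>1(1,6,7)] M3[OF \<rho>1(1,6,7)] bd[OF \<rho>1(2,3,6,7,8)] N0[OF \<rho>1(1)] unfolding K_def by linarith
    have n0: "count_fun g0 R2 \<le> B + K"
      using M3[OF R21(1,6,7)] bd[OF R21(2,3,6,7,8)] N0[OF R21(1)] K by linarith
    have n1: "count_fun g1 R2 \<le> B + K"
      using mln[OF R21(1,6,7)] M[OF R21(1,6,7)] bd[OF R21(2,3,6,7,8)] N0[OF R21(1)] unfolding K_def by linarith
    have nn: "(\<Sum>a\<in>zeros_in g \<rho>. real (vanish_order g a)) / t \<le> 8 * (B + K) / d"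
      if "nz_entire g" "count_fun g R2 \<le> B + K" for g
    proof -
      have "(\<Sum>a\<in>zeros_in g \<rho>. real (vanish_order g a)) \<le> count_fun g R2 * (R2 / (R2 - \<rho>))"
        unfolding zeros_in_def by (rule zero_number_le_count_fun) (use that \<rho>1 R21 in auto)
      also have "\<dots> \<le> (B + K) * ((2 * t) / (d / 4))"
        by (intro mult_mono frac_le) (use that R21 \<rho>1 t r d B K in auto)
      finally show ?thesis using t r d by (simp add: field_simps)
    qed
    have sq: "sqrt x \<le> 1 + y" if "x \<le> y" "0 \<le> y" for x y :: real
    proof (rule real_le_lsqrt)
      have "y \<le> (1 + y)^2" using that by (auto simp: power2_eq_square algebra_simps intro: order_trans)
      then show "x \<le> (1 + y)^2" using that by simp
    qed (use that in auto)
    have d8: "8 * (B + K) / d \<ge> 0" using B K d by simp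
    let ?L = "\<lambda>z. logderiv g1 z - logderiv g0 z"
    have t0: "0 < t" using t r by simp
    note mt = circle_mean_sqrt_logderiv[OF g t0 \<rho>1(4) tc \<rho>1(6,7)]
    have "circle_mean (\<lambda>z. sqrt (cmod (?L z))) t \<le> 1 + 2 / (\<rho> - t) * (3 * B + K) + 10 * (1 + 8 * (B + K) / d) + 10 * (1 + 8 * (B + K) / d)"
    proof -
      have pos: "0 \<le> 2 / (\<rho> - t)" using \<rho>1 by simp
      have aux: "X \<le> 1 + P + 10 * s0 + 10 * s1 \<Longrightarrow> s0 \<le> v \<Longrightarrow> s1 \<le> v \<Longrightarrow> P \<le> Q \<Longrightarrow> X \<le> 1 + Q + 10 * v + 10 * v"
        for X P Q s0 s1 v :: real by linarith
      show ?thesis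
        by (rule aux[OF mt(2) sq[OF nn[OF g(1) n0] d8] sq[OF nn[OF g(2) n1] d8] mult_left_mono[OF M\<rho> pos]])
    qed
    also have "2 / (\<rho> - t) * (3 * B + K) \<le> 8 / d * (3 * B + K)"
    proof (rule mult_right_mono)
      have "2 / (\<rho> - t) \<le> 2 / (d / 4)" by (rule divide_left_mono) (use \<rho>1 d in auto)
      then show "2 / (\<rho> - t) \<le> 8 / d" by simp
    qed (use B K in auto)
    also have "1 + 8 / d * (3 * B + K) + 10 * (1 + 8 * (B + K) / d) + 10 * (1 + 8 * (B + K) / d) = 21 + (184 * B + 168 * K) / d"
      using d by (simp add: field_simps)
    finally have X: "circle_mean (\<lambda>z. sqrt (cmod (?L z))) t \<le> 21 + (184 * B + 168 * K) / d" by simp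
    have X0: "circle_mean (\<lambda>z. sqrt (cmod (?L z))) t \<ge> 0"
    proof -
      have "circle_mean (\<lambda>z. 0::real) t \<le> circle_mean (\<lambda>z. sqrt (cmod (?L z))) t"
        by (rule circle_mean_mono) (use mt(1) t0 in \<open>auto intro!: continuous_intros\<close>)
      then show ?thesis by simp
    qed
    define w where "w = max 1 (1 / (R - r))"
    have w: "w \<ge> 1" "1 / d \<le> 2 * w"
    proof -
      have "1 / d \<le> 1 / ((R - r) / 2)" by (rule divide_left_mono) (use d r in auto)
      then show "1 / d \<le> 2 * w" by (simp add: w_def max_def)
    qed (simp add: w_def)
    have "1 + circle_mean (\<lambda>z. sqrt (cmod (?L z))) t \<le> 22 + (184 * B + 168 * K) * (1 / d)" using X by simp
    also have "\<dots> \<le> 22 + (184 * B + 168 * K) * (2 * w)" using w B K by (intro add_left_mono mult_left_mono) auto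
    also have "\<dots> \<le> (1000 * (1 + K)) * B * w"
    proof -
      have KB: "K \<le> K * B" using mult_left_mono[OF B K] by simp
      have "22 * 1 \<le> 22 * (B * w)" using mult_mono[of 1 B 1 w] B w by simp
      moreover have "(184 * B + 168 * K) * (2 * w) \<le> (184 * B + 168 * (K * B)) * (2 * w)"
        using KB w by (intro mult_right_mono) auto
      moreover have "(184 * B + 168 * (K * B)) * (2 * w) = 368 * (B * w) + 336 * (K * (B * w))" by (simp add: algebra_simps)
      moreover have "K * (B * w) \<ge> 0" "B * w \<ge> 0" using K B w by auto
      moreover have "(1000 * (1 + K)) * B * w = 1000 * (B * w) + 1000 * (K * (B * w))" by (simp add: algebra_simps)
      ultimately show ?thesis by linarith
    qed
    finally have Y: "1 + circle_mean (\<lambda>z. sqrt (cmod (?L z))) t \<le> (1000 * (1 + K)) * B * w" .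
    have "circle_mean (\<lambda>z. log_plus (cmod (?L z))) t \<le> 2 * ln (1 + circle_mean (\<lambda>z. sqrt (cmod (?L z))) t)"
      by (rule circle_mean_log_plus_le) (use mt(1) t0 in auto)
    also have "ln (1 + circle_mean (\<lambda>z. sqrt (cmod (?L z))) t) \<le> ln ((1000 * (1 + K)) * B * w)"
      using Y X0 by (intro ln_mono) auto
    also have "\<dots> = ln (1000 * (1 + K)) + ln B + ln w" using K B w by (simp add: ln_mult_pos)
    finally show "circle_mean (\<lambda>z. log_plus (cmod (?L z))) t \<le> C + 2 * ln B + 2 * log_plus (1 / (R - r))"
      unfolding C_def log_plus_def w_def by (simp add: distrib_left)
  qed
qed

lemma noncritical_subset_nz:
  "critical_radii g \<subseteq> critical_radii Q \<Longrightarrow> t \<notin> critical_radii Q \<Longrightarrow> cmod z = t \<Longrightarrow> g z \<noteq> 0"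
  using noncritical_nz by blast

lemma divisor_sum_cmult: "c \<noteq> 0 \<Longrightarrow> divisor_sum (\<lambda>a. c * D a) r = c * divisor_sum D r"
  by (simp add: divisor_sum_def sum_distrib_left mult_ac)

lemma higher_deriv_quotient:
  assumes "g0 holomorphic_on UNIV" "g1 holomorphic_on UNIV"
  obtains G where "G holomorphic_on UNIV"
    "\<And>z. g0 z \<noteq> 0 \<Longrightarrow> (deriv ^^ k) (\<lambda>z. g1 z / g0 z) z = G z / g0 z ^ Suc k"
proof (induction k arbitrary: thesis)
  case 0
  show ?case by (rule 0[of g1]) (use assms in auto)
next
  case (Suc k)
  obtain G where G: "G holomorphic_on UNIV"
    "\<And>z. g0 z \<noteq> 0 \<Longrightarrow> (deriv ^^ k) (\<lambda>z. g1 z / g0 z) z = G z / g0 z ^ Suc k" using Suc.IH by blast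
  define G' where "G' = (\<lambda>z. deriv G z * g0 z - of_nat (Suc k) * G z * deriv g0 z)"
  have op: "open {z. g0 z \<noteq> 0}"
    by (intro open_Collect_neq holomorphic_on_imp_continuous_on assms continuous_on_const)
  show ?case
  proof (rule Suc.prems[of G'])
    show "G' holomorphic_on UNIV" unfolding G'_def
      by (intro holomorphic_intros assms G holomorphic_deriv) auto
    fix z assume z: "g0 z \<noteq> 0"
    have d: "(f has_field_derivative deriv f z) (at z)" if "f holomorphic_on UNIV" for f
      using that by (simp add: holomorphic_derivI)
    have "(deriv ^^ Suc k) (\<lambda>z. g1 z / g0 z) z = deriv (\<lambda>z. G z / g0 z ^ Suc k) z"
      unfolding funpow.simps o_def
      by (rule deriv_cong_ev) (use z G(2) op in \<open>auto intro!: eventually_nhds_in_open[of "{z. g0 z \<noteq> 0}", THEN eventually_mono]\<close>)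
    also have "((\<lambda>z. G z / g0 z ^ Suc k) has_field_derivative
       (deriv G z * g0 z ^ Suc k - G z * (of_nat (Suc k) * g0 z ^ k * deriv g0 z)) / (g0 z ^ Suc k * g0 z ^ Suc k)) (at z)"
      by (rule DERIV_divide[OF d[OF G(1)]]) (use z DERIV_power[OF d[OF assms(1)], of "Suc k"] in \<open>simp_all add: mult_ac\<close>)
    then have "deriv (\<lambda>z. G z / g0 z ^ Suc k) z = (deriv G z * g0 z ^ Suc k - G z * (of_nat (Suc k) * g0 z ^ k * deriv g0 z)) / (g0 z ^ Suc k * g0 z ^ Suc k)"
      by (rule DERIV_imp_deriv)
    also have "\<dots> = (g0 z ^ k * G' z) / (g0 z ^ k * g0 z ^ Suc (Suc k))"
      by (rule arg_cong2[of _ _ _ _ "(/)"]) (simp_all add: G'_def algebra_simps)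
    also have "\<dots> = G' z / g0 z ^ Suc (Suc k)" using z by (intro nonzero_mult_divide_mult_cancel_left) simp
    finally show "(deriv ^^ Suc k) (\<lambda>z. g1 z / g0 z) z = G' z / g0 z ^ Suc (Suc k)" .
  qed
qed

lemma iterated_log_derivative:
  fixes k :: nat
  assumes g: "nz_entire g0" "nz_entire g1" and W: "nz_entire W"
  defines "\<phi> \<equiv> \<lambda>z. g1 z / g0 z"
  shows "\<exists>Q C. nz_entire Q \<and> critical_radii g0 \<subseteq> critical_radii Q \<and> critical_radii g1 \<subseteq> critical_radii Q \<and> critical_radii W \<subseteq> critical_radii Q \<and> C \<ge> 0 \<and>
    (\<forall>r R B t. 1 \<le> r \<and> r < R \<and> R \<le> 2 * r \<and> 1 \<le> B \<and> 1 / (R - r) \<le> B \<and>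
      (\<forall>s. r \<le> s \<and> s \<le> R \<and> s \<notin> critical_radii Q \<longrightarrow> circle_mean (\<lambda>z. log_plus (cmod (\<phi> z))) s + count_fun g0 s \<le> B) \<and>
      r \<le> t \<and> t \<le> r + (R - r) / 2 ^ k \<and> t \<notin> critical_radii Q \<longrightarrow>
        circle_mean (\<lambda>z. log_plus (cmod ((deriv ^^ k) \<phi> z))) t \<le> C * B \<and>
        circle_mean (\<lambda>z. log_plus (cmod ((deriv ^^ k) \<phi> z / \<phi> z))) t \<le> C + C * ln B)"
  using W
proof (induction k arbitrary: W)
  case 0
  define Q where "Q = (\<lambda>z. g0 z * g1 z * W z)"
  have Q: "nz_entire Q" unfolding Q_def by (rule vanish_order_mult(1)[OF vanish_order_mult(1)[OF g] 0])
  have sub: "critical_radii g0 \<subseteq> critical_radii Q" "critical_radii g1 \<subseteq> critical_radii Q" "critical_radii W \<subseteq> critical_radii Q"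
    by (auto simp: Q_def critical_radii_def)
  have "circle_mean (\<lambda>z. log_plus (cmod (\<phi> z))) t \<le> 1 * B \<and>
        circle_mean (\<lambda>z. log_plus (cmod (\<phi> z / \<phi> z))) t \<le> 1 + 1 * ln B"
    if "1 \<le> r" "1 \<le> B" "circle_mean (\<lambda>z. log_plus (cmod (\<phi> z))) t + count_fun g0 t \<le> B" "r \<le> t" for r B t
  proof -
    have "log_plus (cmod (\<phi> z / \<phi> z)) = 0" for z by (cases "\<phi> z = 0") (auto simp: log_plus_def)
    then have "circle_mean (\<lambda>z. log_plus (cmod (\<phi> z / \<phi> z))) t = 0" by simp
    moreover have "count_fun g0 t \<ge> 0" using count_fun_mono[OF g(1), of t t] that by simp
    moreover have "ln B \<ge> 0" using that by simp
    ultimately show ?thesis using that by simp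
  qed
  then show ?case
    by (intro exI[of _ Q] exI[of _ 1]) (use Q sub in auto)
next
  case (Suc k)
  obtain G where G: "G holomorphic_on UNIV"
    "\<And>z. g0 z \<noteq> 0 \<Longrightarrow> (deriv ^^ k) \<phi> z = G z / g0 z ^ Suc k"
    unfolding \<phi>_def by (rule higher_deriv_quotient[OF nz_entire_holo[OF g(1)] nz_entire_holo[OF g(2)], where k=k]) blast
  define W' where "W' = (if \<forall>z. G z = 0 then W else (\<lambda>z. W z * G z))"
  have W': "nz_entire W'" "critical_radii W \<subseteq> critical_radii W'"
    using Suc.prems vanish_order_mult(1)[OF Suc.prems, of G] G(1) by (auto simp: W'_def nz_entire_def critical_radii_def)
  obtain Q C where Q: "nz_entire Q" "critical_radii g0 \<subseteq> critical_radii Q" "critical_radii g1 \<subseteq> critical_radii Q" "critical_radii W' \<subseteq> critical_radii Q" and C: "C \<ge> 0"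
    and IH0: "\<forall>r R B t. 1 \<le> r \<and> r < R \<and> R \<le> 2 * r \<and> 1 \<le> B \<and> 1 / (R - r) \<le> B \<and>
      (\<forall>s. r \<le> s \<and> s \<le> R \<and> s \<notin> critical_radii Q \<longrightarrow> circle_mean (\<lambda>z. log_plus (cmod (\<phi> z))) s + count_fun g0 s \<le> B) \<and>
      r \<le> t \<and> t \<le> r + (R - r) / 2 ^ k \<and> t \<notin> critical_radii Q \<longrightarrow>
        circle_mean (\<lambda>z. log_plus (cmod ((deriv ^^ k) \<phi> z))) t \<le> C * B \<and>
        circle_mean (\<lambda>z. log_plus (cmod ((deriv ^^ k) \<phi> z / \<phi> z))) t \<le> C + C * ln B"
    using Suc.IH[OF W'(1)] by (elim exE conjE) (rule that)
  have IH: "circle_mean (\<lambda>z. log_plus (cmod ((deriv ^^ k) \<phi> z))) t \<le> C * B \<and>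
        circle_mean (\<lambda>z. log_plus (cmod ((deriv ^^ k) \<phi> z / \<phi> z))) t \<le> C + C * ln B"
    if "1 \<le> r" "r < R" "R \<le> 2 * r" "1 \<le> B" "1 / (R - r) \<le> B"
      "\<And>s. r \<le> s \<Longrightarrow> s \<le> R \<Longrightarrow> s \<notin> critical_radii Q \<Longrightarrow> circle_mean (\<lambda>z. log_plus (cmod (\<phi> z))) s + count_fun g0 s \<le> B"
      "r \<le> t" "t \<le> r + (R - r) / 2 ^ k" "t \<notin> critical_radii Q" for r R B t
    by (rule IH0[rule_format], intro conjI allI impI) (use that in auto)
  have op: "open {z. g0 z \<noteq> 0}"
    by (intro open_Collect_neq nz_entire_cont g continuous_on_const)
  have hol: "(deriv ^^ j) \<phi> holomorphic_on {z. g0 z \<noteq> 0}" for j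
    unfolding \<phi>_def
    by (rule holomorphic_higher_deriv[OF holomorphic_on_divide[OF nz_entire_holo[OF g(2)] nz_entire_holo[OF g(1)]] op]) auto
  have dS: "(deriv ^^ Suc k) \<phi> z = deriv (\<lambda>z. G z / g0 z ^ Suc k) z" if "g0 z \<noteq> 0" for z
    unfolding funpow.simps o_def
    by (rule deriv_cong_ev) (use that G(2) op in \<open>auto intro!: eventually_nhds_in_open[of "{z. g0 z \<noteq> 0}", THEN eventually_mono]\<close>)
  have cont: "continuous_on (sphere 0 t) ((deriv ^^ j) \<phi>)" if "t \<notin> critical_radii Q" for t j
    by (rule holomorphic_on_imp_continuous_on, rule holomorphic_on_subset[OF hol])
       (use noncritical_subset_nz[OF Q(2) that] in auto)
  have nz: "\<phi> z \<noteq> 0" "g0 z \<noteq> 0" if "t \<notin> critical_radii Q" "cmod z = t" for z t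
    using noncritical_subset_nz[OF Q(2) that] noncritical_subset_nz[OF Q(3) that] by (auto simp: \<phi>_def)
  show ?case
  proof (cases "\<forall>z. G z = 0")
    case True
    have z0: "(deriv ^^ Suc k) \<phi> z = 0" if "g0 z \<noteq> 0" for z
      using dS[OF that] True by simp
    have m0: "circle_mean (\<lambda>z. log_plus (cmod ((deriv ^^ Suc k) \<phi> z))) t = 0 \<and>
         circle_mean (\<lambda>z. log_plus (cmod ((deriv ^^ Suc k) \<phi> z / \<phi> z))) t = 0"
      if "t \<notin> critical_radii Q" "t \<ge> 1" for t
    proof -
      have z0': "(deriv ^^ Suc k) \<phi> z = 0" if "cmod z = \<bar>t\<bar>" for z
        using z0 nz \<open>t \<notin> critical_radii Q\<close> \<open>t \<ge> 1\<close> that by auto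
      have 1: "circle_mean (\<lambda>z. log_plus (cmod ((deriv ^^ Suc k) \<phi> z))) t = circle_mean (\<lambda>z. 0) t"
        by (rule circle_mean_cong) (simp only: z0', simp add: log_plus_def)
      have 2: "circle_mean (\<lambda>z. log_plus (cmod ((deriv ^^ Suc k) \<phi> z / \<phi> z))) t = circle_mean (\<lambda>z. 0) t"
        by (rule circle_mean_cong) (simp only: z0', simp add: log_plus_def)
      show ?thesis using 1 2 by simp
    qed
    have "circle_mean (\<lambda>z. log_plus (cmod ((deriv ^^ Suc k) \<phi> z))) t \<le> C * B \<and>
         circle_mean (\<lambda>z. log_plus (cmod ((deriv ^^ Suc k) \<phi> z / \<phi> z))) t \<le> C + C * ln B"
      if "t \<notin> critical_radii Q" "t \<ge> r" "r \<ge> 1" "1 \<le> B" for t r B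
    proof -
      have "0 \<le> C * B" "0 \<le> C + C * ln B" using C that by auto
      then show ?thesis using m0[of t] that by linarith
    qed
    then show ?thesis
      by (intro exI[of _ Q] exI[of _ C]) (use Q C W' in \<open>auto simp del: funpow.simps\<close>)
  next
    case False
    then have Gnz: "nz_entire G" using G(1) by (auto simp: nz_entire_def)
    have QG: "critical_radii G \<subseteq> critical_radii Q" using Q(4) False by (auto simp: W'_def critical_radii_def)
    define P where "P = (\<lambda>z. g0 z ^ Suc k)"
    have P_prod: "P = (\<lambda>z. \<Prod>i\<in>{..k}. g0 z)" by (simp add: P_def)
    have P: "nz_entire P" "vanish_order P a = Suc k * vanish_order g0 a" for a
      unfolding P_prod using vanish_order_prod[of "{..k}" "\<lambda>_. g0"] g(1) by auto
    have cP: "critical_radii P = critical_radii g0" by (auto simp: critical_radii_def P_def)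
    have NP: "count_fun P s = real (Suc k) * count_fun g0 s" for s
      unfolding count_fun_def P(2) of_nat_mult by (rule divisor_sum_cmult) simp
    obtain C0 where C0: "C0 \<ge> 0" and LD: "\<And>r R B t. \<lbrakk>1 \<le> r; r < R; R \<le> 2 * r; 1 \<le> B;
     \<And>s. \<lbrakk>r \<le> s; s \<le> R; s \<notin> critical_radii P; s \<notin> critical_radii G; s \<notin> critical_radii Q\<rbrakk> \<Longrightarrow>
        circle_mean (\<lambda>z. log_plus (cmod (G z / P z))) s + count_fun P s \<le> B;
     r \<le> t; 2 * t \<le> r + R; t \<notin> critical_radii P; t \<notin> critical_radii G\<rbrakk> \<Longrightarrow>
     circle_mean (\<lambda>z. log_plus (cmod (logderiv G z - logderiv P z))) t \<le> C0 + 2 * ln B + 2 * log_plus (1 / (R - r))"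
      by (rule log_derivative_lemma[OF P(1) Gnz Q(1)]) blast
    define C1 where "C1 = C0 + 2 * ln (C + Suc k) + 2 * (k * ln 2)"
    define C' where "C' = C + C1 + 4"
    have C1: "C1 \<ge> 0" using C0 C unfolding C1_def by (intro add_nonneg_nonneg) auto
    have main: "circle_mean (\<lambda>z. log_plus (cmod ((deriv ^^ Suc k) \<phi> z))) t \<le> C' * B \<and>
        circle_mean (\<lambda>z. log_plus (cmod ((deriv ^^ Suc k) \<phi> z / \<phi> z))) t \<le> C' + C' * ln B"
      if r: "1 \<le> r" "r < R" "R \<le> 2 * r" and B: "1 \<le> B" "1 / (R - r) \<le> B"
       and bd: "\<And>s. r \<le> s \<Longrightarrow> s \<le> R \<Longrightarrow> s \<notin> critical_radii Q \<Longrightarrow> circle_mean (\<lambda>z. log_plus (cmod (\<phi> z))) s + count_fun g0 s \<le> B"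
       and t: "r \<le> t" "t \<le> r + (R - r) / 2 ^ Suc k" "t \<notin> critical_radii Q" for r R B t
    proof -
      define R' where "R' = r + (R - r) / 2 ^ k"
      define B' where "B' = (C + Suc k) * B"
      have R'R: "(R - r) / 2 ^ k \<le> R - r" using r by (simp add: divide_le_eq mult_le_cancel_left1)
      have R': "r < R'" "R' \<le> R" "R' \<le> 2 * r" using R'R r by (auto simp: R'_def)
      have t2: "2 * t \<le> r + R'" using t(2) by (simp add: R'_def)
      then have tR': "t \<le> R'" using R' t by linarith
      have B'1: "B' \<ge> 1"
        unfolding B'_def using mult_mono[of 1 "C + Suc k" 1 B] C B by simp
      have IHt: "circle_mean (\<lambda>z. log_plus (cmod ((deriv ^^ k) \<phi> z))) s \<le> C * B"
        "circle_mean (\<lambda>z. log_plus (cmod ((deriv ^^ k) \<phi> z / \<phi> z))) s \<le> C + C * ln B"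
        if "r \<le> s" "s \<le> R'" "s \<notin> critical_radii Q" for s
        using IH[OF r B bd that(1) that(2)[unfolded R'_def] that(3)] by auto
      have eqGP: "(deriv ^^ k) \<phi> z = G z / P z" if "cmod z = \<bar>s\<bar>" "s \<ge> 1" "s \<notin> critical_radii Q" for z s
        unfolding P_def using G(2) nz(2)[of s z] that by auto
      have L: "circle_mean (\<lambda>z. log_plus (cmod (logderiv G z - logderiv P z))) t \<le> C0 + 2 * ln B' + 2 * log_plus (1 / (R' - r))"
      proof (rule LD[OF r(1) R'(1) R'(3) B'1 _ t(1) t2])
        fix s assume s: "r \<le> s" "s \<le> R'" "s \<notin> critical_radii Q"
        have s1: "s \<ge> 1" using s r by simp
        have cs: "continuous_on (sphere 0 s) (\<lambda>z. log_plus (cmod (\<phi> z)))"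
          using cont[OF s(3), of 0] by (auto intro!: continuous_intros)
        have "circle_mean (\<lambda>z. 0::real) s \<le> circle_mean (\<lambda>z. log_plus (cmod (\<phi> z))) s"
          by (rule circle_mean_mono) (use cs s1 log_plus_nonneg in auto)
        then have N: "count_fun g0 s \<le> B" using bd[OF s(1) _ s(3)] s(2) R'(2) by simp
        have "circle_mean (\<lambda>z. log_plus (cmod (G z / P z))) s = circle_mean (\<lambda>z. log_plus (cmod ((deriv ^^ k) \<phi> z))) s"
          by (rule circle_mean_cong) (use eqGP s1 s(3) in simp)
        also have "\<dots> \<le> C * B" using IHt(1) s by simp
        finally show "circle_mean (\<lambda>z. log_plus (cmod (G z / P z))) s + count_fun P s \<le> B'"
          using N mult_left_mono[OF N, of "real (Suc k)"] unfolding NP B'_def by (simp add: algebra_simps)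
      qed (use t Q QG cP in auto)
      have "log_plus (1 / (R' - r)) \<le> ln (2 ^ k * B)"
        unfolding log_plus_def
      proof (intro ln_mono max.boundedI)
        show "1 \<le> 2 ^ k * B" using mult_mono[of 1 "2^k" 1 B] B by simp
        have "1 / (R' - r) = 2 ^ k * (1 / (R - r))" by (simp add: R'_def)
        also have "\<dots> \<le> 2 ^ k * B" using B by (intro mult_left_mono) auto
        finally show "1 / (R' - r) \<le> 2 ^ k * B" .
      qed auto
      also have "\<dots> = k * ln 2 + ln B" using B by (simp add: ln_mult_pos ln_realpow)
      finally have lR: "log_plus (1 / (R' - r)) \<le> k * ln 2 + ln B" .
      have lB: "ln B' = ln (C + Suc k) + ln B" unfolding B'_def by (rule ln_mult_pos) (use B C in auto)
      have L': "circle_mean (\<lambda>z. log_plus (cmod (logderiv G z - logderiv P z))) t \<le> C1 + 4 * ln B"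
      proof -
        have "X \<le> c + 2 * (u + v) + 2 * w \<Longrightarrow> w \<le> x + v \<Longrightarrow> X \<le> c + 2 * u + 2 * x + 4 * v" for X c u v w x :: real
          by argo
        from this[OF L[unfolded lB] lR] show ?thesis unfolding C1_def .
      qed
      have t1: "t \<ge> 1" using t r by simp
      have deq: "(deriv ^^ Suc k) \<phi> z = (deriv ^^ k) \<phi> z * (logderiv G z - logderiv P z)" if z: "cmod z = t" for z
      proof -
        have n: "G z \<noteq> 0" "P z \<noteq> 0" using noncritical_subset_nz[OF QG t(3) z] nz(2)[OF t(3) z] by (auto simp: P_def)
        have fd: "f field_differentiable (at z)" if "nz_entire f" for f
          using nz_entire_holo[OF that, of UNIV] holomorphic_on_imp_differentiable_at by blast
        have "(deriv ^^ Suc k) \<phi> z = deriv (\<lambda>z. G z / P z) z"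
          using dS nz(2)[OF t(3) z] unfolding P_def by simp
        also have "\<dots> = (G z / P z) * logderiv (\<lambda>z. G z / P z) z" using n by (simp add: logderiv_def)
        also have "logderiv (\<lambda>z. G z / P z) z = logderiv G z - logderiv P z"
          by (rule logderiv_divide) (use fd Gnz P n in auto)
        finally show ?thesis using eqGP[of z t] z t t1 by simp
      qed
      have cL: "continuous_on (sphere 0 t) (\<lambda>z. logderiv G z - logderiv P z)"
      proof -
        have dc: "continuous_on (sphere 0 t) (deriv f)" if "nz_entire f" for f
          by (rule holomorphic_on_imp_continuous_on, rule holomorphic_on_subset[OF holomorphic_deriv[OF nz_entire_holo[OF that] open_UNIV]]) auto
        show ?thesis unfolding logderiv_def
          by (intro continuous_intros dc[OF Gnz] dc[OF P(1)] nz_entire_cont[OF Gnz] nz_entire_cont[OF P(1)] ballI)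
             (use noncritical_subset_nz[OF QG t(3)] noncritical_subset_nz[OF Q(2) t(3)] in \<open>auto simp: P_def\<close>)
      qed
      note ck = cont[OF t(3), of k] and c0 = cont[OF t(3), of 0, simplified] and cS = cont[OF t(3), of "Suc k"]
      have p1: "circle_mean (\<lambda>z. log_plus (cmod ((deriv ^^ Suc k) \<phi> z))) t \<le> C * B + (C1 + 4 * ln B)"
      proof -
        have "circle_mean (\<lambda>z. log_plus (cmod ((deriv ^^ Suc k) \<phi> z))) t \<le>
          circle_mean (\<lambda>z. log_plus (cmod ((deriv ^^ k) \<phi> z)) + log_plus (cmod (logderiv G z - logderiv P z))) t"
        proof (rule circle_mean_mono)
          fix z assume "cmod z = t"
          then show "log_plus (cmod ((deriv ^^ Suc k) \<phi> z)) \<le> log_plus (cmod ((deriv ^^ k) \<phi> z)) + log_plus (cmod (logderiv G z - logderiv P z))"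
            by (subst deq) (auto simp: norm_mult intro!: log_plus_mult)
        qed (use ck cL cS t1 in \<open>auto intro!: continuous_intros simp del: funpow.simps\<close>)
        also have "\<dots> = circle_mean (\<lambda>z. log_plus (cmod ((deriv ^^ k) \<phi> z))) t + circle_mean (\<lambda>z. log_plus (cmod (logderiv G z - logderiv P z))) t"
          by (rule circle_mean_add) (use ck cL t1 in \<open>auto intro!: continuous_intros\<close>)
        finally show ?thesis using L' IHt(1)[OF t(1) tR' t(3)] by linarith
      qed
      have p2: "circle_mean (\<lambda>z. log_plus (cmod ((deriv ^^ Suc k) \<phi> z / \<phi> z))) t \<le> C + C * ln B + (C1 + 4 * ln B)"
      proof -
        have "circle_mean (\<lambda>z. log_plus (cmod ((deriv ^^ Suc k) \<phi> z / \<phi> z))) t \<le>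
          circle_mean (\<lambda>z. log_plus (cmod ((deriv ^^ k) \<phi> z / \<phi> z)) + log_plus (cmod (logderiv G z - logderiv P z))) t"
        proof (rule circle_mean_mono)
          fix z assume "cmod z = t"
          then have "(deriv ^^ Suc k) \<phi> z / \<phi> z = ((deriv ^^ k) \<phi> z / \<phi> z) * (logderiv G z - logderiv P z)"
            by (subst deq) auto
          then show "log_plus (cmod ((deriv ^^ Suc k) \<phi> z / \<phi> z)) \<le> log_plus (cmod ((deriv ^^ k) \<phi> z / \<phi> z)) + log_plus (cmod (logderiv G z - logderiv P z))"
            by (auto simp only: norm_mult intro!: log_plus_mult norm_ge_zero)
        qed (use ck cL cS c0 nz(1)[OF t(3)] t1 in \<open>auto intro!: continuous_intros simp del: funpow.simps\<close>)
        also have "\<dots> = circle_mean (\<lambda>z. log_plus (cmod ((deriv ^^ k) \<phi> z / \<phi> z))) t + circle_mean (\<lambda>z. log_plus (cmod (logderiv G z - logderiv P z))) t"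
          by (rule circle_mean_add) (use ck cL c0 nz(1)[OF t(3)] t1 in \<open>auto intro!: continuous_intros\<close>)
        finally show ?thesis using L' IHt(2)[OF t(1) tR' t(3)] by linarith
      qed
      have lnB: "0 \<le> ln B" "ln B \<le> B" using B ln_le_minus_one[of B] by auto
      have "C * B + (C1 + 4 * ln B) \<le> C' * B"
        using mult_left_mono[OF B(1) C1] lnB unfolding C'_def by (simp add: algebra_simps)
      moreover have "C + C * ln B + (C1 + 4 * ln B) \<le> C' + C' * ln B"
        using mult_nonneg_nonneg[OF C1 lnB(1)] unfolding C'_def by (simp add: algebra_simps)
      ultimately show ?thesis using p1 p2 by linarith
    qed
    have C': "C' \<ge> 0" using C C1 by (simp add: C'_def)
    show ?thesis
    proof (intro exI[of _ Q] exI[of _ C'] conjI allI impI)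
      fix r R B t
      assume "1 \<le> r \<and> r < R \<and> R \<le> 2 * r \<and> 1 \<le> B \<and> 1 / (R - r) \<le> B \<and>
        (\<forall>s. r \<le> s \<and> s \<le> R \<and> s \<notin> critical_radii Q \<longrightarrow> circle_mean (\<lambda>z. log_plus (cmod (\<phi> z))) s + count_fun g0 s \<le> B) \<and>
        r \<le> t \<and> t \<le> r + (R - r) / 2 ^ Suc k \<and> t \<notin> critical_radii Q"
      then show "circle_mean (\<lambda>z. log_plus (cmod ((deriv ^^ Suc k) \<phi> z))) t \<le> C' * B"
        "circle_mean (\<lambda>z. log_plus (cmod ((deriv ^^ Suc k) \<phi> z / \<phi> z))) t \<le> C' + C' * ln B"
        using main[of r R B t] by blast+
    qed (use Q C' W' in auto)
  qed
qed

section \<open>Growth and the characteristic function\<close>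

lemma borel_growth_lemma:
  fixes \<tau> :: "real \<Rightarrow> real"
  assumes mono: "\<And>r s. 1 \<le> r \<Longrightarrow> r \<le> s \<Longrightarrow> \<tau> r \<le> \<tau> s" and ge1: "\<And>r. r \<ge> 1 \<Longrightarrow> \<tau> r \<ge> 1"
  obtains E where "E \<in> sets borel" "E \<subseteq> {0..}" "emeasure lborel E < \<infinity>"
    "\<And>r. r \<ge> 1 \<Longrightarrow> r \<notin> E \<Longrightarrow> \<tau> (r + 1 / \<tau> r) \<le> 2 * \<tau> r"
proof -
  define A where "A = (\<lambda>k::nat. {r. 1 \<le> r \<and> 2 ^ k \<le> \<tau> r \<and> \<tau> r < 2 ^ Suc k \<and> 2 * \<tau> r < \<tau> (r + 1 / \<tau> r)})"
  define I where "I = (\<lambda>k. if A k = {} then {} else {Inf (A k) .. Inf (A k) + (1/2) ^ k})"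
  have AI: "A k \<subseteq> I k" for k
  proof
    fix r assume r: "r \<in> A k"
    have bdd: "bdd_below (A k)" by (rule bdd_belowI[of _ 1]) (auto simp: A_def)
    have "r - (1/2) ^ k \<le> s" if s: "s \<in> A k" for s
    proof (rule ccontr)
      assume "\<not> ?thesis"
      then have sr: "s + (1/2) ^ k < r" by simp
      have "1 / \<tau> s \<le> 1 / 2 ^ k" using s ge1[of s] by (intro divide_left_mono) (auto simp: A_def)
      then have "\<tau> (s + 1 / \<tau> s) \<le> \<tau> r"
        using s sr ge1[of s] by (intro mono) (auto simp: A_def power_one_over intro: add_increasing2)
      moreover have "2 ^ Suc k \<le> 2 * \<tau> s" using s by (simp add: A_def)
      ultimately show False using s r by (auto simp: A_def)
    qed
    then have "r - (1/2) ^ k \<le> Inf (A k)" using r by (intro cInf_greatest) auto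
    then show "r \<in> I k" using r cInf_lower[OF r bdd] by (auto simp: I_def)
  qed
  define E where "E = (\<Union>k. I k)"
  have Im: "I k \<in> sets lborel" for k by (auto simp: I_def)
  have "emeasure lborel E \<le> (\<Sum>k. emeasure lborel (I k))"
    unfolding E_def by (rule emeasure_subadditive_countably) (use Im in auto)
  also have "\<dots> \<le> (\<Sum>k. ennreal ((1/2) ^ k))"
    by (rule suminf_le) (auto simp: I_def)
  also have "\<dots> = ennreal (\<Sum>k. (1/2) ^ k)"
    by (rule suminf_ennreal2) (auto intro: summable_geometric)
  also have "\<dots> < \<infinity>" by simp
  finally have fin: "emeasure lborel E < \<infinity>" .
  show ?thesis
  proof (rule that[of E])
    show "E \<in> sets borel" using Im unfolding E_def by (auto intro!: sets.countable_UN)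
    have "I k \<subseteq> {0..}" for k
    proof (cases "A k = {}")
      case False
      then have "1 \<le> Inf (A k)" by (intro cInf_greatest) (auto simp: A_def)
      then show ?thesis by (auto simp: I_def)
    qed (simp add: I_def)
    then show "E \<subseteq> {0..}" by (auto simp: E_def)
    fix r :: real assume r: "r \<ge> 1" "r \<notin> E"
    show "\<tau> (r + 1 / \<tau> r) \<le> 2 * \<tau> r"
    proof (rule ccontr)
      assume n: "\<not> ?thesis"
      have t1: "\<tau> r \<ge> 1" using ge1 r by auto
      define k where "k = nat \<lfloor>log 2 (\<tau> r)\<rfloor>"
      have l0: "log 2 (\<tau> r) \<ge> 0" using t1 by simp
      have "real k \<le> log 2 (\<tau> r)" "log 2 (\<tau> r) < real k + 1" using l0 unfolding k_def by linarith+
      then have "2 powr real k \<le> \<tau> r" "\<tau> r < 2 powr (real k + 1)"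
        using t1 by (simp_all add: le_log_iff log_less_iff)
      then have "2 ^ k \<le> \<tau> r" "\<tau> r < 2 ^ Suc k" by (auto simp: powr_realpow powr_add)
      then have "r \<in> A k" using r n by (simp add: A_def)
      then show False using AI[of k] r by (auto simp: E_def)
    qed
  qed (rule fin)
qed

lemma circle_mean_rotate:
  fixes u :: "complex \<Rightarrow> real"
  assumes "continuous_on (sphere 0 r) u" "r \<ge> 0" "cmod c = 1"
  shows "circle_mean (\<lambda>z. u (c * z)) r = circle_mean u r"
proof -
  define v where "v = (\<lambda>\<theta>. u (of_real r * exp (\<i> * of_real \<theta>)))"
  define \<alpha> where "\<alpha> = Arg2pi c"
  have \<alpha>: "0 \<le> \<alpha>" "\<alpha> < 2 * pi" "c = exp (\<i> * of_real \<alpha>)"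
    using Arg2pi[of c] assms(3) by (simp_all add: \<alpha>_def is_Arg_def)
  have cv: "continuous_on S v" for S
  proof -
    have "continuous_on S (u \<circ> (\<lambda>\<theta>. of_real r * exp (\<i> * of_real \<theta>)))"
      by (rule continuous_on_compose)
         (use assms in \<open>auto intro!: continuous_intros continuous_on_subset[OF assms(1)] simp: norm_mult\<close>)
    then show ?thesis by (simp add: o_def v_def)
  qed
  have per: "v (\<theta> + 2 * pi) = v \<theta>" for \<theta>
  proof -
    have "exp (\<i> * (2 * of_real pi)) = (1::complex)" by (simp add: exp_eq_1)
    then show ?thesis unfolding v_def by (simp add: distrib_left exp_add)
  qed
  have int: "v integrable_on {a..b}" for a b by (rule integrable_continuous_real[OF cv])
  have sh: "integral {a..b} (\<lambda>x. v (x + d)) = integral {a + d..b + d} v" for a b d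
    using integral_shift_Icc_real[of a b v d] cv by (simp add: o_def add.commute[of _ d])
  have "integral {0..2*pi} (\<lambda>\<theta>. v (\<theta> + \<alpha>)) = integral {\<alpha>..2 * pi + \<alpha>} v" using sh[of 0 "2*pi" \<alpha>] by simp
  also have "\<dots> = integral {\<alpha>..2 * pi} v + integral {2 * pi..2 * pi + \<alpha>} v"
    by (rule Henstock_Kurzweil_Integration.integral_combine[symmetric]) (use \<alpha> int in auto)
  also have "integral {2 * pi..2 * pi + \<alpha>} v = integral {0..\<alpha>} v"
    using sh[of 0 \<alpha> "2*pi"] per by (simp add: add.commute)
  also have "integral {\<alpha>..2 * pi} v + integral {0..\<alpha>} v = integral {0..2 * pi} v"
    using Henstock_Kurzweil_Integration.integral_combine[of 0 \<alpha> "2*pi" v] \<alpha> int by simp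
  finally have "integral {0..2*pi} (\<lambda>\<theta>. v (\<theta> + \<alpha>)) = integral {0..2 * pi} v" .
  moreover have "v (\<theta> + \<alpha>) = u (c * (of_real r * exp (\<i> * of_real \<theta>)))" for \<theta>
    unfolding v_def \<alpha>(3) by (simp add: distrib_left exp_add mult_ac)
  ultimately show ?thesis unfolding circle_mean_def v_def by simp
qed

definition curve_rep :: "nat \<Rightarrow> (nat \<Rightarrow> complex \<Rightarrow> complex) \<Rightarrow> bool" where
  "curve_rep n F \<longleftrightarrow> (\<forall>l\<le>n. F l holomorphic_on UNIV) \<and> (\<forall>z. \<exists>l\<le>n. F l z \<noteq> 0)"

lemma rep_norm_pos:
  assumes "curve_rep n F" shows "rep_norm n F z > 0"
proof -
  obtain l where "l \<le> n" "F l z \<noteq> 0" using assms by (auto simp: curve_rep_def)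
  then have "0 < (\<Sum>l=0..n. (cmod (F l z))\<^sup>2)" by (intro sum_pos2[of _ l]) auto
  then show ?thesis by (simp add: rep_norm_def)
qed

lemma rep_norm_cont: "curve_rep n F \<Longrightarrow> continuous_on S (rep_norm n F)"
  unfolding rep_norm_def curve_rep_def
  by (intro continuous_intros) (auto intro: holomorphic_on_imp_continuous_on holomorphic_on_subset)

lemma ln_rep_norm_cont: "curve_rep n F \<Longrightarrow> continuous_on S (\<lambda>z. ln (rep_norm n F z))"
  by (intro continuous_on_ln rep_norm_cont) (use rep_norm_pos in \<open>auto simp: less_le\<close>)

lemma cmod_le_rep_norm: "l \<le> n \<Longrightarrow> cmod (F l z) \<le> rep_norm n F z"
  unfolding rep_norm_def by (rule real_le_rsqrt, rule member_le_sum[of l _ "\<lambda>l. (cmod (F l z))\<^sup>2"]) auto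

lemma rep_norm_nonneg: "rep_norm n F z \<ge> 0"
  unfolding rep_norm_def by (auto intro: sum_nonneg)

lemma pairing_cauchy_schwarz: "cmod (pairing n F A z) \<le> rep_norm n F z * rep_norm n A z"
proof -
  have "cmod (pairing n F A z) \<le> (\<Sum>l=0..n. cmod (F l z) * cmod (A l z))"
    unfolding pairing_def by (rule order_trans[OF norm_sum]) (simp add: norm_mult)
  also have "\<dots> \<le> rep_norm n F z * rep_norm n A z"
    unfolding rep_norm_def using L2_set_mult_ineq[of "\<lambda>l. cmod (F l z)" "\<lambda>l. cmod (A l z)" "{0..n}"]
    by (simp add: L2_set_def)
  finally show ?thesis .
qed

text \<open>
  Averages over rotations by roots of unity turn the logarithm of the norm into the logarithm of the
  norm of a tensor product, to which the maximum modulus principle applies.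
\<close>

lemma circle_mean_rep_norm_mono:
  assumes F: "curve_rep n F" and r: "0 < r" "r \<le> R"
  shows "circle_mean (\<lambda>z. ln (rep_norm n F z)) r \<le> circle_mean (\<lambda>z. ln (rep_norm n F z)) R"
proof -
  define u where "u = (\<lambda>z. ln (rep_norm n F z))"
  have cu: "continuous_on S u" for S unfolding u_def by (rule ln_rep_norm_cont[OF F])
  have R0: "R > 0" using r by simp
  have "circle_mean u r \<le> circle_mean u R + \<epsilon>" if \<epsilon>: "\<epsilon> > 0" for \<epsilon>
  proof -
    have "uniformly_continuous_on (sphere 0 R) u" by (rule compact_uniformly_continuous[OF cu]) auto
    then obtain \<delta> where \<delta>: "\<delta> > 0" "\<And>z w. cmod z = R \<Longrightarrow> cmod w = R \<Longrightarrow> dist w z < \<delta> \<Longrightarrow> \<bar>u w - u z\<bar> < \<epsilon>"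
      using \<epsilon> unfolding uniformly_continuous_on_def by (auto simp: dist_real_def)
    obtain m0 :: nat where m0: "2 * pi * R / \<delta> < real m0" using reals_Archimedean2 by blast
    define m where "m = Suc m0"
    have m: "m > 0" "2 * pi * R / real m < \<delta>"
    proof -
      show "m > 0" by (simp add: m_def)
      have "2 * pi * R / \<delta> < real m" using m0 by (simp add: m_def)
      then show "2 * pi * R / real m < \<delta>" using \<delta> \<open>m > 0\<close> by (simp add: field_simps)
    qed
    define \<omega> where "\<omega> = exp (\<i> * of_real (2 * pi / real m))"
    have \<omega>1: "cmod \<omega> = 1" by (simp add: \<omega>_def)
    have \<omega>m: "\<omega> ^ m = 1"
    proof -
      have "\<omega> ^ m = exp (of_nat m * (\<i> * of_real (2 * pi / real m)))" unfolding \<omega>_def by (rule exp_of_nat_mult[symmetric])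
      also have "of_nat m * (\<i> * of_real (2 * pi / real m)) = 2 * of_real pi * \<i>" using m by simp
      finally show ?thesis by simp
    qed
    define S where "S = (\<lambda>z. (\<Sum>j<m. u (\<omega> ^ j * z)) / real m)"
    have S_rot: "S (\<omega> * z) = S z" for z
    proof -
      have "(\<Sum>j<m. u (\<omega> ^ j * (\<omega> * z))) = (\<Sum>j<m. u (\<omega> ^ Suc j * z))" by (simp add: mult_ac)
      also have "\<dots> = (\<Sum>j<Suc m. u (\<omega> ^ j * z)) - u z" by (subst sum.lessThan_Suc_shift) simp
      also have "\<dots> = (\<Sum>j<m. u (\<omega> ^ j * z))" using \<omega>m by simp
      finally show ?thesis by (simp add: S_def)
    qed
    have S_rot': "S (\<omega> ^ j * z) = S z" for j z
      by (induction j) (simp_all add: S_rot mult.assoc)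
    have S_mean: "circle_mean S s = circle_mean u s" if "s \<ge> 0" for s
    proof -
      have "circle_mean S s = circle_mean (\<lambda>z. (1 / real m) * (\<Sum>j<m. u (\<omega> ^ j * z))) s" by (simp add: S_def)
      also have "\<dots> = (1 / real m) * (\<Sum>j<m. circle_mean (\<lambda>z. u (\<omega> ^ j * z)) s)"
        unfolding circle_mean_cmul
        by (subst circle_mean_sum) (auto intro!: continuous_on_compose2[OF cu[of UNIV]] continuous_intros that)
      also have "\<dots> = circle_mean u s"
        using m by (simp add: circle_mean_rotate[OF cu that] \<omega>1 norm_power)
      finally show ?thesis .
    qed
    have cS: "continuous_on T S" for T unfolding S_def
      by (intro continuous_intros continuous_on_compose2[OF cu[of UNIV]]) (use m in auto)
    have osc: "S z \<le> S w + \<epsilon>" if zw: "cmod z = R" "cmod w = R" for z w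
    proof -
      define \<beta> where "\<beta> = Arg2pi (w / z)"
      have z0: "z \<noteq> 0" "w / z \<noteq> 0" using zw R0 by auto
      have nwz: "cmod (w / z) = 1" using zw R0 by (simp add: norm_divide)
      have \<beta>: "0 \<le> \<beta>" "\<beta> < 2 * pi" "w / z = exp (\<i> * of_real \<beta>)"
        using Arg2pi[of "w / z"] unfolding is_Arg_def nwz by (simp_all add: \<beta>_def)
      have w_eq: "w = exp (\<i> * of_real \<beta>) * z" using \<beta>(3) z0 by (simp add: field_simps)
      define j where "j = nat \<lfloor>\<beta> * real m / (2 * pi)\<rfloor>"
      define \<gamma> where "\<gamma> = \<beta> - real j * (2 * pi / real m)"
      have j: "real j \<le> \<beta> * real m / (2 * pi)" "\<beta> * real m / (2 * pi) < real j + 1"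
        using \<beta> m unfolding j_def by (auto intro!: of_nat_floor)
      have \<gamma>: "0 \<le> \<gamma>" "\<gamma> \<le> 2 * pi / real m"
      proof -
        have mp: "2 * pi / real m > 0" using m by simp
        have e: "\<beta> * real m / (2 * pi) * (2 * pi / real m) = \<beta>" using m by simp
        show "0 \<le> \<gamma>" using mult_right_mono[OF j(1), of "2 * pi / real m"] mp unfolding e \<gamma>_def by simp
        show "\<gamma> \<le> 2 * pi / real m"
          using mult_strict_right_mono[OF j(2) mp] unfolding e \<gamma>_def by (simp add: distrib_right add_divide_distrib)
      qed
      define w' where "w' = exp (\<i> * of_real \<gamma>) * z"
      have "w = \<omega> ^ j * w'"
      proof -
        have "\<omega> ^ j = exp (of_nat j * (\<i> * of_real (2 * pi / real m)))" unfolding \<omega>_def by (rule exp_of_nat_mult[symmetric])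
        then have "\<omega> ^ j * exp (\<i> * of_real \<gamma>) = exp (of_nat j * (\<i> * of_real (2 * pi / real m)) + \<i> * of_real \<gamma>)" by (simp add: exp_add)
        also have "of_nat j * (\<i> * of_real (2 * pi / real m)) + \<i> * of_real \<gamma> = \<i> * of_real \<beta>" by (simp add: \<gamma>_def algebra_simps)
        finally show ?thesis by (simp add: w_eq w'_def mult.assoc[symmetric])
      qed
      then have Sw: "S w = S w'" using S_rot' by simp
      have "dist w' z = cmod (exp (\<i> * of_real \<gamma>) - 1) * R"
      proof -
        have "w' - z = (exp (\<i> * of_real \<gamma>) - 1) * z" by (simp add: w'_def algebra_simps)
        then show ?thesis using zw by (simp only: dist_norm norm_mult)
      qed
      also have "\<dots> \<le> \<gamma> * R"
      proof (rule mult_right_mono)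
        have "cmod (exp (\<i> * of_real \<gamma>) - 1) = 2 * \<bar>sin (\<gamma> / 2)\<bar>"
          using dist_exp_i_1[of \<gamma>] by (simp add: dist_norm)
        also have "\<dots> \<le> \<gamma>" using abs_sin_x_le_abs_x[of "\<gamma> / 2"] \<gamma> by simp
        finally show "cmod (exp (\<i> * of_real \<gamma>) - 1) \<le> \<gamma>" .
      qed (use R0 in auto)
      also have "\<dots> \<le> 2 * pi / real m * R" using \<gamma> R0 by (intro mult_right_mono) auto
      also have "\<dots> < \<delta>" using m by simp
      finally have d: "dist w' z < \<delta>" .
      have "S z - S w' = (\<Sum>j<m. u (\<omega> ^ j * z) - u (\<omega> ^ j * w')) / real m"
        by (simp add: S_def sum_subtractf diff_divide_distrib)
      also have "\<dots> \<le> (\<Sum>j<m. \<epsilon>) / real m"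
      proof (intro divide_right_mono sum_mono)
        fix j
        have "dist (\<omega> ^ j * z) (\<omega> ^ j * w') = dist w' z"
          unfolding dist_norm right_diff_distrib[symmetric] norm_mult norm_power \<omega>1 by (simp add: norm_minus_commute)
        then have "\<bar>u (\<omega> ^ j * z) - u (\<omega> ^ j * w')\<bar> < \<epsilon>"
          using zw d \<delta>(2)[of "\<omega> ^ j * w'" "\<omega> ^ j * z"] by (simp add: norm_mult norm_power \<omega>1 w'_def)
        then show "u (\<omega> ^ j * z) - u (\<omega> ^ j * w') \<le> \<epsilon>" by simp
      qed auto
      also have "\<dots> = \<epsilon>" using m by simp
      finally show ?thesis using Sw by simp
    qed
    have le: "S z0 \<le> circle_mean u R + \<epsilon>" if z0: "cmod z0 = r" for z0
    proof -
      define f where "f = (\<lambda>j z. \<Sum>l=0..n. F l (\<omega> ^ j * z) * cnj (F l (\<omega> ^ j * z0)))"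
      define H where "H = (\<lambda>z. \<Prod>j<m. f j z)"
      have Fh: "F l holomorphic_on UNIV" if "l \<le> n" for l using F that by (auto simp: curve_rep_def)
      have fh: "f j holomorphic_on UNIV" for j unfolding f_def
        by (intro holomorphic_intros holomorphic_on_compose_gen[of "\<lambda>z. \<omega> ^ j * z" UNIV _ UNIV, unfolded o_def])
           (use Fh in \<open>auto intro: holomorphic_intros\<close>)
      have Hh: "H holomorphic_on UNIV" unfolding H_def by (intro holomorphic_on_prod fh)
      have f0: "f j z0 = of_real ((rep_norm n F (\<omega> ^ j * z0))^2)" for j
      proof -
        have "(rep_norm n F (\<omega> ^ j * z0))^2 = (\<Sum>l=0..n. (cmod (F l (\<omega> ^ j * z0)))\<^sup>2)"
          unfolding rep_norm_def by (rule real_sqrt_pow2) (auto intro: sum_nonneg)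
        then show ?thesis unfolding f_def
          by (simp only: of_real_sum) (intro sum.cong refl, rule complex_norm_square[symmetric])
      qed
      have fle: "cmod (f j z) \<le> rep_norm n F (\<omega> ^ j * z) * rep_norm n F (\<omega> ^ j * z0)" for j z
        using pairing_cauchy_schwarz[of n "\<lambda>l _. F l (\<omega> ^ j * z)" "\<lambda>l _. cnj (F l (\<omega> ^ j * z0))" 0]
        by (simp add: f_def pairing_def rep_norm_def)
      have pos: "rep_norm n F z > 0" for z by (rule rep_norm_pos[OF F])
      have lnp: "ln (\<Prod>j<m. rep_norm n F (\<omega> ^ j * z)) = real m * S z" for z
        using m by (subst ln_prod) (auto simp: S_def u_def pos less_imp_neq[OF pos, symmetric])
      have "\<exists>w. cmod w = R \<and> cmod (H z0) \<le> cmod (H w)"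
      proof (rule ccontr)
        assume "\<not> ?thesis"
        then have c: "\<And>w. cmod w = R \<Longrightarrow> cmod (H w) < cmod (H z0)" by force
        have "continuous_on (sphere 0 R) (\<lambda>w. cmod (H w))"
          by (intro continuous_intros holomorphic_on_imp_continuous_on holomorphic_on_subset[OF Hh]) auto
        then obtain w where w: "w \<in> sphere 0 R" "\<And>y. y \<in> sphere 0 R \<Longrightarrow> cmod (H y) \<le> cmod (H w)"
          using continuous_attains_sup[of "sphere (0::complex) R" "\<lambda>w. cmod (H w)"] R0 by auto
        have "cmod (H z0) \<le> cmod (H w)"
        proof (rule maximum_modulus_frontier[of H "cball 0 R"])
          show "H holomorphic_on interior (cball 0 R)" using Hh by (auto intro: holomorphic_on_subset)
          show "continuous_on (closure (cball 0 R)) H"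
            by (intro holomorphic_on_imp_continuous_on holomorphic_on_subset[OF Hh]) auto
        qed (use w z0 r R0 in auto)
        then show False using c[of w] w by auto
      qed
      then obtain w where w: "cmod w = R" "cmod (H z0) \<le> cmod (H w)" by blast
      have "(\<Prod>j<m. (rep_norm n F (\<omega> ^ j * z0))^2) = cmod (H z0)"
        unfolding H_def by (simp add: f0 prod_norm[symmetric] norm_power pos less_imp_le)
      also have "\<dots> \<le> cmod (H w)" by (rule w)
      also have "\<dots> \<le> (\<Prod>j<m. rep_norm n F (\<omega> ^ j * w) * rep_norm n F (\<omega> ^ j * z0))"
        unfolding H_def prod_norm[symmetric] by (intro prod_mono) (use fle in auto)
      finally have "(\<Prod>j<m. rep_norm n F (\<omega> ^ j * z0)) * (\<Prod>j<m. rep_norm n F (\<omega> ^ j * z0))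
         \<le> (\<Prod>j<m. rep_norm n F (\<omega> ^ j * w)) * (\<Prod>j<m. rep_norm n F (\<omega> ^ j * z0))"
        by (simp add: prod.distrib power2_eq_square)
      then have "(\<Prod>j<m. rep_norm n F (\<omega> ^ j * z0)) \<le> (\<Prod>j<m. rep_norm n F (\<omega> ^ j * w))"
        by (rule mult_right_le_imp_le) (auto intro: prod_pos pos)
      then have "ln (\<Prod>j<m. rep_norm n F (\<omega> ^ j * z0)) \<le> ln (\<Prod>j<m. rep_norm n F (\<omega> ^ j * w))"
        by (intro ln_mono) (auto intro: prod_pos pos)
      then have "S z0 \<le> S w" unfolding lnp using m by simp
      moreover have "circle_mean (\<lambda>_. S w) R \<le> circle_mean (\<lambda>z. S z + \<epsilon>) R"
        by (rule circle_mean_mono) (use osc w R0 cS in \<open>auto intro!: continuous_intros\<close>)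
      moreover have "circle_mean (\<lambda>z. S z + \<epsilon>) R = circle_mean S R + \<epsilon>"
        by (subst circle_mean_add) (use cS R0 in \<open>auto intro!: continuous_intros\<close>)
      ultimately show ?thesis using S_mean[of R] R0 by simp
    qed
    have "circle_mean S r \<le> circle_mean (\<lambda>_. circle_mean u R + \<epsilon>) r"
      by (rule circle_mean_mono) (use le r cS in \<open>auto intro!: continuous_intros\<close>)
    then show ?thesis using S_mean[of r] r by simp
  qed
  then show ?thesis unfolding u_def[symmetric] by (rule field_le_epsilon)
qed

definition locally_finite :: "(complex \<Rightarrow> real) \<Rightarrow> bool" where
  "locally_finite D \<longleftrightarrow> (\<forall>r. finite {a. cmod a \<le> r \<and> D a \<noteq> 0})"

lemma locally_finite_vanish_order: "nz_entire g \<Longrightarrow> locally_finite (\<lambda>a. real (vanish_order g a))"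
  unfolding locally_finite_def using finite_zeros_cball[of g] vanish_order_0_iff[of g] by auto

lemma locally_finite_subset:
  "locally_finite D' \<Longrightarrow> (\<And>a. D a \<noteq> 0 \<Longrightarrow> D' a \<noteq> 0) \<Longrightarrow> locally_finite D"
  unfolding locally_finite_def by (metis (mono_tags, lifting) Collect_mono rev_finite_subset)

lemma locally_finite_add: "locally_finite D \<Longrightarrow> locally_finite D' \<Longrightarrow> locally_finite (\<lambda>a. D a + D' a)"
  unfolding locally_finite_def
proof
  fix r assume "\<forall>r. finite {a. cmod a \<le> r \<and> D a \<noteq> 0}" "\<forall>r. finite {a. cmod a \<le> r \<and> D' a \<noteq> 0}"
  then have "finite ({a. cmod a \<le> r \<and> D a \<noteq> 0} \<union> {a. cmod a \<le> r \<and> D' a \<noteq> 0})" by simp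
  then show "finite {a. cmod a \<le> r \<and> D a + D' a \<noteq> 0}" by (rule rev_finite_subset) auto
qed

lemma locally_finite_sum:
  "finite I \<Longrightarrow> (\<And>i. i \<in> I \<Longrightarrow> locally_finite (D i)) \<Longrightarrow> locally_finite (\<lambda>a. \<Sum>i\<in>I. D i a)"
proof (induction I rule: finite_induct)
  case empty then show ?case by (simp add: locally_finite_def)
next
  case (insert i I) then show ?case by (simp add: locally_finite_add)
qed

lemma divisor_sum_add:
  assumes "locally_finite D" "locally_finite D'"
  shows "divisor_sum (\<lambda>a. D a + D' a) r = divisor_sum D r + divisor_sum D' r"
proof -
  define Z where "Z = {a. cmod a \<le> r \<and> D a \<noteq> 0} \<union> {a. cmod a \<le> r \<and> D' a \<noteq> 0}"
  have Z: "finite Z" using assms unfolding Z_def locally_finite_def by simp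
  have "divisor_sum D'' r = (\<Sum>a\<in>Z. D'' a * ln (r / max 1 (cmod a)))" if "\<And>a. D'' a \<noteq> 0 \<Longrightarrow> D a \<noteq> 0 \<or> D' a \<noteq> 0" for D''
    by (rule divisor_sum_superset[OF Z]) (use that in \<open>auto simp: Z_def\<close>)
  from this[of D] this[of D'] this[of "\<lambda>a. D a + D' a"] show ?thesis
    by (auto simp: sum.distrib distrib_right)
qed

lemma divisor_sum_sum:
  assumes "finite I" "\<And>i. i \<in> I \<Longrightarrow> locally_finite (D i)"
  shows "divisor_sum (\<lambda>a. \<Sum>i\<in>I. D i a) r = (\<Sum>i\<in>I. divisor_sum (D i) r)"
  using assms
proof (induction I rule: finite_induct)
  case empty then show ?case by (simp add: divisor_sum_def)
next
  case (insert i I) then show ?case by (simp add: divisor_sum_add locally_finite_sum)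
qed

lemma divisor_sum_mono:
  assumes "locally_finite D" "locally_finite D'" "r \<ge> 1" "\<And>a. D a \<le> D' a"
  shows "divisor_sum D r \<le> divisor_sum D' r"
proof -
  define Z where "Z = {a. cmod a \<le> r \<and> D a \<noteq> 0} \<union> {a. cmod a \<le> r \<and> D' a \<noteq> 0}"
  have Z: "finite Z" using assms unfolding Z_def locally_finite_def by simp
  have "divisor_sum D'' r = (\<Sum>a\<in>Z. D'' a * ln (r / max 1 (cmod a)))" if "D'' = D \<or> D'' = D'" for D''
    by (rule divisor_sum_superset[OF Z]) (use that in \<open>auto simp: Z_def\<close>)
  from this[of D] this[of D'] show ?thesis
    using assms ln_ratio_nonneg by (auto intro!: sum_mono mult_right_mono simp: Z_def)
qed

lemma trunc_counting_eq_divisor_sum: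
  assumes g: "nz_entire g" and r: "r \<ge> 1"
  shows "trunc_counting k g r = divisor_sum (\<lambda>a. real (min (vanish_order g a) k)) r"
proof -
  define Z where "Z = {a. cmod a \<le> r \<and> g a = 0}"
  have fZ: "finite Z" unfolding Z_def by (rule finite_zeros_cball[OF g])
  define c where "c = (\<lambda>a. real (min (vanish_order g a) k))"
  have tc: "real (trunc_count k g t) / t = (\<Sum>a\<in>Z. c a * (if t \<in> {max 1 (cmod a)..r} then 1 / t else 0))"
    if t: "t \<in> {1..r}" for t
  proof -
    have "real (trunc_count k g t) = (\<Sum>z | cmod z \<le> t \<and> g z = 0. c z)"
      unfolding trunc_count_def of_nat_sum by (intro sum.cong refl) (auto simp: c_def vanish_order_def)
    also have "\<dots> = (\<Sum>z\<in>Z. if cmod z \<le> t then c z else 0)"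
      by (subst sum.inter_filter[symmetric, OF fZ]) (use t in \<open>auto simp: Z_def intro!: sum.cong\<close>)
    finally show ?thesis using t unfolding sum_divide_distrib by (auto simp: sum_divide_distrib intro!: sum.cong)
  qed
  have hi: "((\<lambda>t. if t \<in> {max 1 (cmod a)..r} then 1 / t else 0) has_integral ln (r / max 1 (cmod a))) {1..r}" if "a \<in> Z" for a
  proof (subst has_integral_restrict)
    show "{max 1 (cmod a)..r} \<subseteq> {1..r}" by auto
    have m: "max 1 (cmod a) \<le> r" using that r by (auto simp: Z_def)
    have "((\<lambda>t. 1 / t) has_integral (ln r - ln (max 1 (cmod a)))) {max 1 (cmod a)..r}"
      by (rule fundamental_theorem_of_calculus[OF m])
         (auto intro!: derivative_eq_intros simp: has_real_derivative_iff_has_vector_derivative[symmetric])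
    then show "((\<lambda>t. 1 / t) has_integral ln (r / max 1 (cmod a))) {max 1 (cmod a)..r}"
      using r by (subst ln_div) auto
  qed
  have "((\<lambda>t. \<Sum>a\<in>Z. c a * (if t \<in> {max 1 (cmod a)..r} then 1 / t else 0)) has_integral (\<Sum>a\<in>Z. c a * ln (r / max 1 (cmod a)))) {1..r}"
    by (intro has_integral_sum fZ has_integral_mult_right hi)
  then have "((\<lambda>t. real (trunc_count k g t) / t) has_integral (\<Sum>a\<in>Z. c a * ln (r / max 1 (cmod a)))) {1..r}"
    by (rule has_integral_eq[rotated]) (use tc in auto)
  then have "trunc_counting k g r = (\<Sum>a\<in>Z. c a * ln (r / max 1 (cmod a)))"
    unfolding trunc_counting_def by (rule integral_unique)
  also have "\<dots> = divisor_sum c r"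
    by (rule divisor_sum_superset[symmetric, OF fZ])
       (auto simp: Z_def c_def vanish_order_def split: if_splits)
  finally show ?thesis by (simp add: c_def)
qed

lemma characteristic_eq:
  "characteristic n F r = circle_mean (\<lambda>z. ln (rep_norm n F z)) r - circle_mean (\<lambda>z. ln (rep_norm n F z)) 1"
  unfolding characteristic_def circle_mean_def by (simp add: field_simps)

lemma characteristic_mono:
  assumes "curve_rep n F" "1 \<le> r" "r \<le> s"
  shows "0 \<le> characteristic n F r" "characteristic n F r \<le> characteristic n F s"
  unfolding characteristic_eq using circle_mean_rep_norm_mono[OF assms(1), of 1 r] circle_mean_rep_norm_mono[OF assms(1), of r s] assms by auto

lemma characteristic_const:
  assumes F: "curve_rep n F" and c: "\<And>l m z. l \<le> n \<Longrightarrow> m \<le> n \<Longrightarrow> F l 0 * F m z = F m 0 * F l z" and r: "r \<ge> 1"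
  shows "characteristic n F r = 0"
proof -
  obtain l where l: "l \<le> n" "F l 0 \<noteq> 0" using F by (auto simp: curve_rep_def)
  have Fm: "F m z = (F m 0 / F l 0) * F l z" if "m \<le> n" for m z
    using c[OF l(1) that] l(2) by (simp add: field_simps)
  have nz: "F l z \<noteq> 0" for z
  proof
    assume "F l z = 0"
    then have "F m z = 0" if "m \<le> n" for m using Fm[OF that, of z] by simp
    then show False using F by (auto simp: curve_rep_def)
  qed
  define K where "K = rep_norm n (\<lambda>m _. F m 0 / F l 0) 0"
  have eq: "rep_norm n F z = K * cmod (F l z)" for z
  proof -
    have "(\<Sum>m=0..n. (cmod (F m z))\<^sup>2) = (\<Sum>m=0..n. (cmod (F m 0 / F l 0))\<^sup>2) * (cmod (F l z))\<^sup>2"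
      unfolding sum_distrib_right by (intro sum.cong refl) (subst Fm, auto simp: norm_mult norm_divide power_mult_distrib power_divide)
    then show ?thesis by (simp add: rep_norm_def K_def real_sqrt_mult)
  qed
  have K: "K > 0" using rep_norm_pos[OF F, of 0] eq[of 0] nz[of 0] rep_norm_nonneg[of n "\<lambda>m _. F m 0 / F l 0" 0]
    unfolding K_def by (metis less_eq_real_def less_irrefl mult_zero_left)
  have hol: "F l holomorphic_on A" for A using F l by (auto simp: curve_rep_def intro: holomorphic_on_subset)
  have cl: "continuous_on A (\<lambda>z. ln (cmod (F l z)))" for A
    using nz by (intro continuous_intros holomorphic_on_imp_continuous_on hol) auto
  have m: "circle_mean (\<lambda>z. ln (rep_norm n F z)) s = ln K + ln (cmod (F l 0))" if "s > 0" for s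
  proof -
    have "circle_mean (\<lambda>z. ln (rep_norm n F z)) s = circle_mean (\<lambda>z. ln K + ln (cmod (F l z))) s"
      by (rule circle_mean_cong) (use eq K nz in \<open>auto simp: ln_mult_pos\<close>)
    also have "\<dots> = ln K + circle_mean (\<lambda>z. ln (cmod (F l z))) s"
      by (subst circle_mean_add) (use that cl in auto)
    also have "circle_mean (\<lambda>z. ln (cmod (F l z))) s = ln (cmod (F l 0))"
      by (rule circle_mean_ln_zero_free[of _ "s + 1"]) (use hol nz that in auto)
    finally show ?thesis .
  qed
  show ?thesis unfolding characteristic_eq using m[of r] m[of 1] r by simp
qed

lemma circle_mean_ge_of_entire:
  assumes F: "curve_rep n F" and L: "nz_entire L" and K: "K > 0" "\<And>z. cmod (L z) \<le> K * rep_norm n F z"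
  obtains c where "\<And>r. r \<ge> 1 \<Longrightarrow> r \<notin> critical_radii L \<Longrightarrow> count_fun L r \<le> characteristic n F r + c"
proof -
  obtain c where c: "\<And>r. r \<ge> 1 \<Longrightarrow> r \<notin> critical_radii L \<Longrightarrow> circle_mean (\<lambda>z. ln (cmod (L z))) r = count_fun L r + c"
    using jensen[OF L] by blast
  show ?thesis
  proof (rule that[of "circle_mean (\<lambda>z. ln (rep_norm n F z)) 1 + ln K - c"])
    fix r assume r: "r \<ge> 1" "r \<notin> critical_radii L"
    have nz: "L z \<noteq> 0" if "cmod z = r" for z using noncritical_nz[OF r(2) that] .
    have "circle_mean (\<lambda>z. ln (cmod (L z))) r \<le> circle_mean (\<lambda>z. ln K + ln (rep_norm n F z)) r"
    proof (rule circle_mean_mono)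
      show "continuous_on (sphere 0 r) (\<lambda>z. ln (cmod (L z)))"
        using nz by (auto intro!: continuous_intros nz_entire_cont L)
      fix z assume "cmod z = r"
      then have "ln (cmod (L z)) \<le> ln (K * rep_norm n F z)" using nz K by (intro ln_mono) auto
      then show "ln (cmod (L z)) \<le> ln K + ln (rep_norm n F z)"
        using K rep_norm_pos[OF F, of z] by (simp add: ln_mult_pos)
    qed (use r in \<open>auto intro!: continuous_intros ln_rep_norm_cont F\<close>)
    also have "\<dots> = ln K + circle_mean (\<lambda>z. ln (rep_norm n F z)) r"
      by (subst circle_mean_add) (use r ln_rep_norm_cont[OF F] in auto)
    finally show "count_fun L r \<le> characteristic n F r + (circle_mean (\<lambda>z. ln (rep_norm n F z)) 1 + ln K - c)"
      using c[OF r] unfolding characteristic_eq by simp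
  qed
qed

lemma characteristic_ge_ln:
  assumes F: "curve_rep n F" and ne: "l \<le> n" "m \<le> n" "F l 0 * F m z0 \<noteq> F m 0 * F l z0"
  obtains c where "\<And>r. r \<ge> 2 \<Longrightarrow> ln r \<le> characteristic n F r + c"
proof -
  define L where "L = (\<lambda>z. F l 0 * F m z - F m 0 * F l z)"
  have L: "nz_entire L"
    by (rule nz_entireI[of _ z0]) (use F ne in \<open>auto simp: L_def curve_rep_def intro!: holomorphic_intros\<close>)
  define K where "K = cmod (F l 0) + cmod (F m 0) + 1"
  have K: "K > 0" unfolding K_def by (smt (verit) norm_ge_zero)
  have LK: "cmod (L z) \<le> K * rep_norm n F z" for z
  proof -
    have "cmod (L z) \<le> cmod (F l 0) * cmod (F m z) + cmod (F m 0) * cmod (F l z)"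
      unfolding L_def by (rule order_trans[OF norm_triangle_ineq4]) (simp add: norm_mult)
    also have "\<dots> \<le> cmod (F l 0) * rep_norm n F z + cmod (F m 0) * rep_norm n F z"
      by (intro add_mono mult_left_mono cmod_le_rep_norm ne) auto
    also have "\<dots> \<le> K * rep_norm n F z" using rep_norm_nonneg[of n F z] by (simp add: K_def distrib_right)
    finally show ?thesis .
  qed
  obtain c where c: "\<And>r. r \<ge> 1 \<Longrightarrow> r \<notin> critical_radii L \<Longrightarrow> count_fun L r \<le> characteristic n F r + c"
    using circle_mean_ge_of_entire[OF F L K LK] by blast
  have ge: "ln r \<le> count_fun L r" if "r \<ge> 1" for r
  proof -
    have L0: "L 0 = 0" by (simp add: L_def mult.commute)
    then have v: "vanish_order L 0 \<ge> 1" using vanish_order_0_iff[OF L, of 0] by (cases "vanish_order L 0") auto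
    have "ln r \<le> real (vanish_order L 0) * ln (r / max 1 (cmod 0))"
      using v that mult_right_mono[of 1 "real (vanish_order L 0)" "ln r"] by simp
    also have "\<dots> \<le> count_fun L r"
      unfolding count_fun_def divisor_sum_def
      by (rule member_le_sum[of 0 _ "\<lambda>a. real (vanish_order L a) * ln (r / max 1 (cmod a))"])
         (use that v locally_finite_vanish_order[OF L] in \<open>auto simp: locally_finite_def intro!: mult_nonneg_nonneg ln_ratio_nonneg\<close>)
    finally show ?thesis .
  qed
  show ?thesis
  proof (rule that[of "c + ln 2"])
    fix r :: real assume r: "r \<ge> 2"
    obtain r' where r': "r / 2 < r'" "r' < r" "r' \<notin> critical_radii L"
      using ex_noncritical[OF L, of "r/2" r] r by auto
    have "ln r - ln 2 = ln (r / 2)" using r by (simp add: ln_div)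
    also have "\<dots> \<le> ln r'" using r' r by (intro ln_mono) auto
    also have "\<dots> \<le> characteristic n F r' + c" using ge[of r'] c[of r'] r' r by linarith
    also have "characteristic n F r' \<le> characteristic n F r" by (rule characteristic_mono[OF F]) (use r' r in auto)
    finally show "ln r \<le> characteristic n F r + (c + ln 2)" by simp
  qed
qed

section \<open>Wronskians\<close>

definition entire_fls :: "(complex \<Rightarrow> complex) \<Rightarrow> complex fls" where
  "entire_fls g = fps_to_fls (fps_expansion g 0)"

lemma entire_has_fps: "g holomorphic_on UNIV \<Longrightarrow> g has_fps_expansion fps_expansion g 0"
  by (rule has_fps_expansion_fps_expansion[of UNIV]) auto

lemma entire_fls_eqI: "g holomorphic_on UNIV \<Longrightarrow> g has_fps_expansion G \<Longrightarrow> entire_fls g = fps_to_fls G"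
  unfolding entire_fls_def using fps_expansion_unique_complex[OF entire_has_fps] by simp

lemma entire_fls_add:
  "f holomorphic_on UNIV \<Longrightarrow> g holomorphic_on UNIV \<Longrightarrow> entire_fls (\<lambda>z. f z + g z) = entire_fls f + entire_fls g"
  by (subst entire_fls_eqI[of _ "fps_expansion f 0 + fps_expansion g 0"])
     (auto intro!: holomorphic_intros fps_expansion_intros entire_has_fps simp: entire_fls_def)

lemma entire_fls_mult:
  "f holomorphic_on UNIV \<Longrightarrow> g holomorphic_on UNIV \<Longrightarrow> entire_fls (\<lambda>z. f z * g z) = entire_fls f * entire_fls g"
  by (subst entire_fls_eqI[of _ "fps_expansion f 0 * fps_expansion g 0"])
     (auto intro!: holomorphic_intros fps_expansion_intros entire_has_fps simp: entire_fls_def fls_times_fps_to_fls)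

lemma entire_fls_const: "entire_fls (\<lambda>_. c) = fls_const c"
  by (subst entire_fls_eqI[of _ "fps_const c"]) (auto intro!: fps_expansion_intros)

lemma entire_fls_deriv: "f holomorphic_on UNIV \<Longrightarrow> entire_fls (deriv f) = fls_deriv (entire_fls f)"
  by (subst entire_fls_eqI[of _ "fps_deriv (fps_expansion f 0)"])
     (auto intro!: holomorphic_deriv has_fps_expansion_deriv entire_has_fps simp: entire_fls_def fls_deriv_fps_to_fls)

lemma holomorphic_higher_deriv_UNIV: "f holomorphic_on UNIV \<Longrightarrow> (deriv ^^ k) f holomorphic_on UNIV"
  by (rule holomorphic_higher_deriv) auto

lemma entire_fls_higher_deriv: "f holomorphic_on UNIV \<Longrightarrow> entire_fls ((deriv ^^ k) f) = (fls_deriv ^^ k) (entire_fls f)"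
  by (induction k) (auto simp: entire_fls_deriv holomorphic_higher_deriv_UNIV)

lemma entire_fls_sum:
  "finite I \<Longrightarrow> (\<And>i. i \<in> I \<Longrightarrow> f i holomorphic_on UNIV) \<Longrightarrow> entire_fls (\<lambda>z. \<Sum>i\<in>I. f i z) = (\<Sum>i\<in>I. entire_fls (f i))"
proof (induction I rule: finite_induct)
  case empty then show ?case using entire_fls_const[of 0] by simp
next
  case (insert i I) then show ?case by (simp add: entire_fls_add holomorphic_on_sum)
qed

lemma entire_fls_prod:
  "finite I \<Longrightarrow> (\<And>i. i \<in> I \<Longrightarrow> f i holomorphic_on UNIV) \<Longrightarrow> entire_fls (\<lambda>z. \<Prod>i\<in>I. f i z) = (\<Prod>i\<in>I. entire_fls (f i))"
proof (induction I rule: finite_induct)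
  case empty then show ?case using entire_fls_const[of 1] by simp
next
  case (insert i I) then show ?case by (simp add: entire_fls_mult holomorphic_on_prod)
qed

lemma entire_fls_eq_0D: "f holomorphic_on UNIV \<Longrightarrow> entire_fls f = 0 \<Longrightarrow> f z = 0"
  using has_fps_expansion_0_analytic_continuation[of f UNIV z] entire_has_fps[of f]
  by (auto simp: entire_fls_def)

lemma entire_fls_nz: "nz_entire f \<Longrightarrow> entire_fls f \<noteq> 0"
  using entire_fls_eq_0D unfolding nz_entire_def by blast

lemma entire_det_holo:
  assumes "\<And>i j. i < s \<Longrightarrow> j < s \<Longrightarrow> m i j holomorphic_on UNIV"
  shows "(\<lambda>z. Determinant.det (Matrix.mat s s (\<lambda>(i, j). m i j z))) holomorphic_on UNIV"
    and "entire_fls (\<lambda>z. Determinant.det (Matrix.mat s s (\<lambda>(i, j). m i j z))) = Determinant.det (Matrix.mat s s (\<lambda>(i, j). entire_fls (m i j)))"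
proof -
  have pl: "p i < s" if "p permutes {0..<s}" "i < s" for p i using permutes_in_image[OF that(1), of i] that(2) by simp
  have eq: "Determinant.det (Matrix.mat s s (\<lambda>(i, j). m i j z)) = (\<Sum>p\<in>{p. p permutes {0..<s}}. signof p * (\<Prod>i=0..<s. m i (p i) z))" for z
    by (subst det_def'[of _ s]) (auto intro!: sum.cong prod.cong simp: pl)
  have eq2: "Determinant.det (Matrix.mat s s (\<lambda>(i, j). entire_fls (m i j))) = (\<Sum>p\<in>{p. p permutes {0..<s}}. signof p * (\<Prod>i=0..<s. entire_fls (m i (p i))))"
    by (subst det_def'[of _ s]) (auto intro!: sum.cong prod.cong simp: pl)
  have hp: "(\<lambda>z. \<Prod>i=0..<s. m i (p i) z) holomorphic_on UNIV" if "p permutes {0..<s}" for p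
    by (intro holomorphic_on_prod assms) (use that pl in auto)
  show "(\<lambda>z. Determinant.det (Matrix.mat s s (\<lambda>(i, j). m i j z))) holomorphic_on UNIV"
    unfolding eq by (intro holomorphic_intros hp) auto
  show "entire_fls (\<lambda>z. Determinant.det (Matrix.mat s s (\<lambda>(i, j). m i j z))) = Determinant.det (Matrix.mat s s (\<lambda>(i, j). entire_fls (m i j)))"
    unfolding eq eq2
  proof (subst entire_fls_sum)
    show "(\<Sum>p\<in>{p. p permutes {0..<s}}. entire_fls (\<lambda>z. signof p * (\<Prod>i=0..<s. m i (p i) z))) =
      (\<Sum>p\<in>{p. p permutes {0..<s}}. signof p * (\<Prod>i=0..<s. entire_fls (m i (p i))))"
    proof (intro sum.cong refl)
      fix p assume "p \<in> {p. p permutes {0..<s}}"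
      then have p: "p permutes {0..<s}" by simp
      have "entire_fls (\<lambda>z. signof p * (\<Prod>i=0..<s. m i (p i) z)) = entire_fls (\<lambda>z. signof p) * entire_fls (\<lambda>z. \<Prod>i=0..<s. m i (p i) z)"
        by (rule entire_fls_mult) (use hp[OF p] in auto)
      also have "entire_fls (\<lambda>z. signof p) = signof p" by (simp add: entire_fls_const fls_of_int)
      also have "entire_fls (\<lambda>z. \<Prod>i=0..<s. m i (p i) z) = (\<Prod>i=0..<s. entire_fls (m i (p i)))"
        by (rule entire_fls_prod) (use p pl assms in auto)
      finally show "entire_fls (\<lambda>z. signof p * (\<Prod>i=0..<s. m i (p i) z)) = signof p * (\<Prod>i=0..<s. entire_fls (m i (p i)))" .
    qed
  qed (auto intro!: holomorphic_intros hp finite_permutations)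
qed

definition wronskian :: "nat \<Rightarrow> (nat \<Rightarrow> complex \<Rightarrow> complex) \<Rightarrow> complex \<Rightarrow> complex" where
  "wronskian s g z = Determinant.det (Matrix.mat s s (\<lambda>(i, j). (deriv ^^ i) (g j) z))"

lemma wronskian_expand:
  "wronskian s g z = (\<Sum>p\<in>{p. p permutes {0..<s}}. signof p * (\<Prod>i=0..<s. (deriv ^^ i) (g (p i)) z))"
  unfolding wronskian_def
  by (subst det_def'[of _ s]) (auto intro!: sum.cong prod.cong simp: permutes_in_image)

lemma wronskian_holo: "(\<And>j. j < s \<Longrightarrow> g j holomorphic_on UNIV) \<Longrightarrow> wronskian s g holomorphic_on UNIV"
  unfolding wronskian_def by (rule entire_det_holo) (auto intro: holomorphic_higher_deriv_UNIV)

lemma fls_wronskian_dependent: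
  fixes x :: "nat \<Rightarrow> complex fls"
  assumes "finite J" "j1 \<in> J" "c j1 \<noteq> 0" "\<And>i. i < card J \<Longrightarrow> (\<Sum>j\<in>J. c j * (fls_deriv ^^ i) (x j)) = 0"
  shows "\<exists>b. (\<exists>j\<in>J. b j \<noteq> 0) \<and> (\<Sum>j\<in>J. fls_const (b j) * x j) = 0"
  using assms
proof (induction "card J" arbitrary: J c j1)
  case 0
  then show ?case by auto
next
  case (Suc n)
  define d where "d = (\<lambda>j. c j / c j1)"
  have d1: "d j1 = 1" using Suc.prems by (simp add: d_def)
  have dr: "(\<Sum>j\<in>J. d j * (fls_deriv ^^ i) (x j)) = 0" if "i < Suc n" for i
  proof -
    have "(\<Sum>j\<in>J. d j * (fls_deriv ^^ i) (x j)) = (\<Sum>j\<in>J. c j * (fls_deriv ^^ i) (x j)) / c j1"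
      by (simp add: d_def sum_divide_distrib)
    then show ?thesis using Suc.prems(4)[of i] that Suc.hyps(2) by simp
  qed
  have dd: "(\<Sum>j\<in>J - {j1}. fls_deriv (d j) * (fls_deriv ^^ i) (x j)) = 0" if "i < n" for i
  proof -
    have "0 = fls_deriv (\<Sum>j\<in>J. d j * (fls_deriv ^^ i) (x j))" using dr[of i] that by simp
    also have "\<dots> = (\<Sum>j\<in>J. d j * (fls_deriv ^^ Suc i) (x j)) + (\<Sum>j\<in>J. fls_deriv (d j) * (fls_deriv ^^ i) (x j))"
      by (simp add: fls_deriv_sum sum.distrib)
    also have "(\<Sum>j\<in>J. d j * (fls_deriv ^^ Suc i) (x j)) = 0" using dr[of "Suc i"] that by (simp del: funpow.simps)
    also have "(\<Sum>j\<in>J. fls_deriv (d j) * (fls_deriv ^^ i) (x j)) = (\<Sum>j\<in>J - {j1}. fls_deriv (d j) * (fls_deriv ^^ i) (x j))"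
      using Suc.prems d1 by (subst sum.remove[of J j1]) auto
    finally show ?thesis by simp
  qed
  show ?case
  proof (cases "\<exists>j2\<in>J - {j1}. fls_deriv (d j2) \<noteq> 0")
    case True
    then obtain j2 where j2: "j2 \<in> J - {j1}" "fls_deriv (d j2) \<noteq> 0" by blast
    have cd: "n = card (J - {j1})" using Suc.prems Suc.hyps(2) by simp
    have "\<exists>b. (\<exists>j\<in>J - {j1}. b j \<noteq> 0) \<and> (\<Sum>j\<in>J - {j1}. fls_const (b j) * x j) = 0"
      by (rule Suc.hyps(1)[OF cd _ j2(1), of "\<lambda>j. fls_deriv (d j)"]) (use Suc.prems j2 dd cd in auto)
    then obtain b where b: "\<exists>j\<in>J - {j1}. b j \<noteq> 0" "(\<Sum>j\<in>J - {j1}. fls_const (b j) * x j) = 0" by blast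
    show ?thesis
      by (rule exI[of _ "b(j1 := 0)"]) (use b Suc.prems in \<open>auto simp: sum.remove[of J j1] intro!: sum.cong\<close>)
  next
    case False
    then have "fls_deriv (d j) = 0" if "j \<in> J" for j using that d1 by (cases "j = j1") auto
    then have "d j = fls_const (fls_nth (d j) 0)" if "j \<in> J" for j using that by (metis fls_deriv_eq_0_iff)
    then have "(\<Sum>j\<in>J. fls_const (fls_nth (d j) 0) * x j) = (\<Sum>j\<in>J. d j * x j)"
      by (intro sum.cong refl) metis
    also have "\<dots> = 0" using dr[of 0] by simp
    finally show ?thesis using Suc.prems(2) d1
      by (intro exI[of _ "\<lambda>j. fls_nth (d j) 0"] conjI bexI[of _ j1]) auto
  qed
qed

lemma wronskian_nonzero:
  assumes g: "\<And>j. j < s \<Longrightarrow> g j holomorphic_on UNIV"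
    and ind: "\<And>b. (\<And>z. (\<Sum>j<s. b j * g j z) = 0) \<Longrightarrow> (\<And>j. j < s \<Longrightarrow> b j = 0)"
  shows "nz_entire (wronskian s g)"
proof (rule ccontr)
  assume "\<not> ?thesis"
  then have W0: "wronskian s g = (\<lambda>_. 0)" using wronskian_holo[of s g, OF g] by (auto simp: nz_entire_def)
  define M where "M = Matrix.mat s s (\<lambda>(i, j). (fls_deriv ^^ i) (entire_fls (g j)))"
  have "Determinant.det (Matrix.mat s s (\<lambda>(i, j). entire_fls ((deriv ^^ i) (g j)))) = entire_fls (wronskian s g)"
    unfolding wronskian_def by (rule entire_det_holo(2)[symmetric]) (use g in \<open>auto intro: holomorphic_higher_deriv_UNIV\<close>)
  also have "\<dots> = 0" unfolding W0 using entire_fls_const[of 0] by simp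
  also have "Matrix.mat s s (\<lambda>(i, j). entire_fls ((deriv ^^ i) (g j))) = M"
    unfolding M_def by (rule eq_matI) (auto simp: entire_fls_higher_deriv g)
  finally have d0: "Determinant.det M = 0" .
  have M: "M \<in> carrier_mat s s" by (simp add: M_def)
  from d0 det_0_iff_vec_prod_zero_field[OF M] obtain v where v: "v \<in> carrier_vec s" "v \<noteq> 0\<^sub>v s" "M *\<^sub>v v = 0\<^sub>v s" by blast
  obtain j1 where j1: "j1 < s" "v $ j1 \<noteq> 0"
    using v(1,2) by (metis carrier_vecD eq_vecI index_zero_vec)
  have "(\<Sum>j\<in>{..<s}. v $ j * (fls_deriv ^^ i) (entire_fls (g j))) = 0" if "i < s" for i
  proof -
    have "(M *\<^sub>v v) $ i = (\<Sum>j\<in>{0..<s}. (fls_deriv ^^ i) (entire_fls (g j)) * v $ j)"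
      using that v(1) by (auto simp: M_def scalar_prod_def intro!: sum.cong)
    then show ?thesis using that unfolding v(3) by (simp add: mult.commute lessThan_atLeast0)
  qed
  then obtain b where b: "\<exists>j\<in>{..<s}. b j \<noteq> 0" "(\<Sum>j<s. fls_const (b j) * entire_fls (g j)) = 0"
    using fls_wronskian_dependent[of "{..<s}" j1 "\<lambda>j. v $ j" "\<lambda>j. entire_fls (g j)"] j1 by auto
  have h: "(\<lambda>z. b j * g j z) holomorphic_on UNIV" if "j < s" for j using g[OF that] by (intro holomorphic_intros)
  have "entire_fls (\<lambda>z. \<Sum>j<s. b j * g j z) = (\<Sum>j<s. entire_fls (\<lambda>z. b j * g j z))"
    by (rule entire_fls_sum) (use h in auto)
  also have "\<dots> = (\<Sum>j<s. fls_const (b j) * entire_fls (g j))"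
    by (intro sum.cong refl, subst entire_fls_mult) (use g in \<open>auto simp: entire_fls_const\<close>)
  finally have "entire_fls (\<lambda>z. \<Sum>j<s. b j * g j z) = 0" using b(2) by simp
  then have "(\<Sum>j<s. b j * g j z) = 0" for z
    by (rule entire_fls_eq_0D[rotated]) (use h in \<open>auto intro!: holomorphic_on_sum\<close>)
  then show False using ind[of b] b(1) by auto
qed

lemma wronskian_scale:
  assumes "open S" "h holomorphic_on S" "\<And>j. j < s \<Longrightarrow> g j holomorphic_on S" "z \<in> S"
  shows "wronskian s (\<lambda>j z. h z * g j z) z = h z ^ s * wronskian s g z"
proof -
  define L where "L = Matrix.mat s s (\<lambda>(i, k). if k \<le> i then of_nat (i choose k) * (deriv ^^ (i - k)) h z else 0)"
  define G where "G = Matrix.mat s s (\<lambda>(i, j). (deriv ^^ i) (g j) z)"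
  have L: "L \<in> carrier_mat s s" and G: "G \<in> carrier_mat s s" by (auto simp: L_def G_def)
  have "Matrix.mat s s (\<lambda>(i, j). (deriv ^^ i) (\<lambda>z. h z * g j z) z) = L * G"
  proof (rule eq_matI)
    fix i j assume "i < dim_row (L * G)" "j < dim_col (L * G)"
    then have ij: "i < s" "j < s" by (auto simp: L_def G_def)
    have "(L * G) $$ (i, j) = (\<Sum>k\<in>{0..<s}. L $$ (i, k) * G $$ (k, j))"
      using ij L G by (auto simp: scalar_prod_def intro!: sum.cong)
    also have "\<dots> = (\<Sum>k\<in>{0..i}. of_nat (i choose k) * (deriv ^^ (i - k)) h z * (deriv ^^ k) (g j) z)"
      by (rule sum.mono_neutral_cong_right) (use ij in \<open>auto simp: L_def G_def\<close>)
    also have "\<dots> = (deriv ^^ i) (\<lambda>z. g j z * h z) z"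
      unfolding higher_deriv_mult[OF assms(3)[OF ij(2)] assms(2,1,4)] by (intro sum.cong refl) (simp add: mult_ac)
    finally show "Matrix.mat s s (\<lambda>(i, j). (deriv ^^ i) (\<lambda>z. h z * g j z) z) $$ (i, j) = (L * G) $$ (i, j)"
      using ij by (simp add: mult.commute)
  qed (auto simp: L_def G_def)
  then have "wronskian s (\<lambda>j z. h z * g j z) z = Determinant.det L * wronskian s g z"
    unfolding wronskian_def G_def[symmetric] using det_mult[OF L G] by simp
  also have "Determinant.det L = prod_list (diag_mat L)"
    by (rule det_lower_triangular[OF _ L]) (auto simp: L_def)
  also have "\<dots> = (\<Prod>i\<in>{0..<s}. L $$ (i, i))" unfolding prod_list_diag_prod using L by simp
  also have "\<dots> = h z ^ s" by (simp add: L_def)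
  finally show ?thesis .
qed

lemma wronskian_exchange:
  assumes g: "\<And>j. j \<le> s \<Longrightarrow> g j holomorphic_on UNIV" and sum0: "\<And>z. (\<Sum>j\<le>s. g j z) = 0" and k: "k < s"
  shows "wronskian s (\<lambda>j. if j = k then g s else g j) z = - wronskian s g z"
proof -
  define G where "G = Matrix.mat s s (\<lambda>(i, j). (deriv ^^ i) (g j) z)"
  define x where "x = Matrix.vec s (\<lambda>_. - (1::complex))"
  have G: "G \<in> carrier_mat s s" and x: "x \<in> carrier_vec s" by (auto simp: G_def x_def)
  have der: "(\<Sum>j\<le>s. (deriv ^^ i) (g j) z) = 0" for i
  proof -
    have "(\<Sum>j\<le>s. (deriv ^^ i) (g j) z) = (deriv ^^ i) (\<lambda>z. \<Sum>j\<le>s. g j z) z"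
    proof (induction i arbitrary: z)
      case (Suc i)
      have "(deriv ^^ Suc i) (\<lambda>z. \<Sum>j\<le>s. g j z) z = deriv (\<lambda>z. \<Sum>j\<le>s. (deriv ^^ i) (g j) z) z"
        using Suc by (simp add: ext)
      also have "\<dots> = (\<Sum>j\<le>s. deriv ((deriv ^^ i) (g j)) z)"
        by (rule DERIV_imp_deriv, rule DERIV_sum)
           (use g in \<open>auto intro!: holomorphic_derivI[OF holomorphic_higher_deriv_UNIV open_UNIV]\<close>)
      finally show ?case by simp
    qed simp
    also have "\<dots> = 0" using sum0 by (simp add: higher_deriv_const[of i 0, simplified])
    finally show ?thesis .
  qed
  have "Matrix.mat s s (\<lambda>(i, j). (deriv ^^ i) (if j = k then g s else g j) z) = replace_col G (G *\<^sub>v x) k"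
  proof (rule eq_matI)
    fix i j assume "i < dim_row (replace_col G (G *\<^sub>v x) k)" "j < dim_col (replace_col G (G *\<^sub>v x) k)"
    then have ij: "i < s" "j < s" by (auto simp: replace_col_def G_def)
    have "(G *\<^sub>v x) $ i = - (\<Sum>j<s. (deriv ^^ i) (g j) z)"
      using ij by (auto simp: G_def x_def scalar_prod_def sum_negf lessThan_atLeast0 intro!: sum.cong)
    also have "\<dots> = (deriv ^^ i) (g s) z" using der[of i] by (simp add: lessThan_Suc_atMost[symmetric] add_eq_0_iff2)
    finally show "Matrix.mat s s (\<lambda>(i, j). (deriv ^^ i) (if j = k then g s else g j) z) $$ (i, j) = replace_col G (G *\<^sub>v x) k $$ (i, j)"
      using ij by (auto simp: replace_col_def G_def)
  qed (auto simp: replace_col_def G_def)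
  then have "wronskian s (\<lambda>j. if j = k then g s else g j) z = x $ k * Determinant.det G"
    unfolding wronskian_def using cramer_lemma_mat[OF G x k] by (simp only:)
  then show ?thesis using k by (simp add: x_def G_def wronskian_def)
qed

lemma higher_deriv_power_factor:
  assumes "h holomorphic_on UNIV"
  shows "\<exists>q. q holomorphic_on UNIV \<and> (\<forall>z. (deriv ^^ i) (\<lambda>w. (w - a) ^ m * h w) z = (z - a) ^ (m - i) * q z)"
proof (induction i)
  case 0
  then show ?case using assms by auto
next
  case (Suc i)
  then obtain q where q: "q holomorphic_on UNIV" "\<And>z. (deriv ^^ i) (\<lambda>w. (w - a) ^ m * h w) z = (z - a) ^ (m - i) * q z" by blast
  have dq: "(q has_field_derivative deriv q z) (at z)" for z by (rule holomorphic_derivI[OF q(1)]) auto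
  have "(deriv ^^ i) (\<lambda>w. (w - a) ^ m * h w) = (\<lambda>z. (z - a) ^ (m - i) * q z)"
    using q(2) by (rule ext)
  then have eq: "(deriv ^^ Suc i) (\<lambda>w. (w - a) ^ m * h w) = deriv (\<lambda>z. (z - a) ^ (m - i) * q z)"
    by simp
  show ?case
  proof (cases "m - i")
    case 0
    then show ?thesis unfolding eq using q(1) by (intro exI[of _ "deriv q"]) (auto intro: holomorphic_deriv)
  next
    case (Suc t)
    define q' where "q' = (\<lambda>z. of_nat (Suc t) * q z + (z - a) * deriv q z)"
    have "deriv (\<lambda>z. (z - a) ^ (m - i) * q z) z = (z - a) ^ t * q' z" for z
    proof (rule DERIV_imp_deriv)
      show "((\<lambda>z. (z - a) ^ (m - i) * q z) has_field_derivative (z - a) ^ t * q' z) (at z)"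
      proof -
        have "((\<lambda>z. (z - a) ^ n) has_field_derivative of_nat n * (z - a) ^ (n - 1)) (at z)" for n
          by (auto intro!: derivative_eq_intros)
        from DERIV_mult[OF this[of "Suc t"] dq[of z]] show ?thesis
          unfolding Suc q'_def by (simp add: algebra_simps)
      qed
    qed
    moreover have "q' holomorphic_on UNIV" unfolding q'_def
      by (intro holomorphic_intros q holomorphic_deriv) auto
    moreover have "m - Suc i = t" using Suc by simp
    ultimately show ?thesis unfolding eq by (intro exI[of _ q']) simp
  qed
qed

lemma vanish_order_wronskian_ge:
  assumes g: "\<And>j. j < s \<Longrightarrow> g j holomorphic_on UNIV" and W: "nz_entire (wronskian s g)"
    and dv: "\<And>j. j < s \<Longrightarrow> w j \<le> vanish_order (g j) a \<or> (\<forall>z. g j z = 0)" and \<mu>: "\<And>j. j < s \<Longrightarrow> \<mu> \<le> w j"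
  shows "s * \<mu> + (\<Sum>j<s. w j - \<mu> - (s - 1)) \<le> vanish_order (wronskian s g) a"
proof -
  have "\<exists>h. \<forall>j<s. h j holomorphic_on UNIV \<and> (\<forall>z. g j z = (z - a) ^ w j * h j z)"
    using vanish_order_dvdE[OF g dv] by (intro choice_iff'[THEN iffD1] allI impI) metis
  then obtain h where h: "\<And>j. j < s \<Longrightarrow> h j holomorphic_on UNIV" "\<And>j z. j < s \<Longrightarrow> g j z = (z - a) ^ w j * h j z" by blast
  define p where "p = (\<lambda>j z. (z - a) ^ (w j - \<mu>) * h j z)"
  have p: "p j holomorphic_on UNIV" if "j < s" for j unfolding p_def using h(1)[OF that] by (intro holomorphic_intros)
  have gp: "g j z = (z - a) ^ \<mu> * p j z" if "j < s" for j z
    using h(2)[OF that] \<mu>[OF that] by (simp add: p_def mult.assoc[symmetric] power_add[symmetric])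
  have Wg: "wronskian s g z = ((z - a) ^ \<mu>) ^ s * wronskian s p z" for z
  proof -
    have "g j = (\<lambda>z. (z - a) ^ \<mu> * p j z)" if "j < s" for j using gp[OF that] by (rule ext)
    then have "wronskian s g z = wronskian s (\<lambda>j z. (z - a) ^ \<mu> * p j z) z"
      unfolding wronskian_def by (intro arg_cong[of _ _ Determinant.det] eq_matI) auto
    also have "\<dots> = ((z - a) ^ \<mu>) ^ s * wronskian s p z"
      by (rule wronskian_scale[of UNIV]) (use p in \<open>auto intro!: holomorphic_intros\<close>)
    finally show ?thesis .
  qed
  define e where "e = (\<lambda>j. w j - \<mu> - (s - 1))"
  define q where "q = (\<lambda>j i. SOME q. q holomorphic_on UNIV \<and> (\<forall>z. (deriv ^^ i) (p j) z = (z - a) ^ e j * q z))"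
  have q: "q j i holomorphic_on UNIV" "(deriv ^^ i) (p j) z = (z - a) ^ e j * q j i z" if "i < s" "j < s" for i j z
  proof -
    have "\<exists>q. q holomorphic_on UNIV \<and> (\<forall>z. (deriv ^^ i) (p j) z = (z - a) ^ e j * q z)" if ij: "i < s" "j < s" for i j
    proof -
      obtain q where q: "q holomorphic_on UNIV" "\<And>z. (deriv ^^ i) (p j) z = (z - a) ^ (w j - \<mu> - i) * q z"
        using higher_deriv_power_factor[OF h(1)[OF ij(2)], of i a "w j - \<mu>"] unfolding p_def by blast
      have "w j - \<mu> - i = e j + (w j - \<mu> - i - e j)" using ij by (simp add: e_def)
      then have "(deriv ^^ i) (p j) z = (z - a) ^ e j * ((z - a) ^ (w j - \<mu> - i - e j) * q z)" for z
        unfolding q(2) by (metis mult.assoc power_add)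
      then show ?thesis using q(1) by (intro exI[of _ "\<lambda>z. (z - a) ^ (w j - \<mu> - i - e j) * q z"]) (auto intro!: holomorphic_intros)
    qed
    from someI_ex[OF this[OF that]] show "q j i holomorphic_on UNIV" "(deriv ^^ i) (p j) z = (z - a) ^ e j * q j i z"
      unfolding q_def by blast+
  qed
  define V where "V = (\<lambda>z. \<Sum>\<sigma>\<in>{\<sigma>. \<sigma> permutes {0..<s}}. signof \<sigma> * (\<Prod>i=0..<s. q (\<sigma> i) i z))"
  have pl: "\<sigma> i < s" if "\<sigma> permutes {0..<s}" "i < s" for \<sigma> i using permutes_in_image[OF that(1), of i] that(2) by simp
  have Vh: "V holomorphic_on UNIV" unfolding V_def
    by (intro holomorphic_on_sum holomorphic_on_mult holomorphic_on_const holomorphic_on_prod q) (use pl in auto)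
  have Wp: "wronskian s p z = (z - a) ^ (\<Sum>j<s. e j) * V z" for z
    unfolding wronskian_expand V_def sum_distrib_left
  proof (intro sum.cong refl)
    fix \<sigma> assume "\<sigma> \<in> {\<sigma>. \<sigma> permutes {0..<s}}"
    then have \<sigma>: "\<sigma> permutes {0..<s}" by simp
    have "(\<Prod>i=0..<s. (deriv ^^ i) (p (\<sigma> i)) z) = (\<Prod>i=0..<s. (z - a) ^ e (\<sigma> i) * q (\<sigma> i) i z)"
      by (intro prod.cong refl q) (use pl[OF \<sigma>] in auto)
    also have "\<dots> = (z - a) ^ (\<Sum>i=0..<s. e (\<sigma> i)) * (\<Prod>i=0..<s. q (\<sigma> i) i z)"
      by (simp add: prod.distrib power_sum)
    also have "(\<Sum>i=0..<s. e (\<sigma> i)) = (\<Sum>j<s. e j)"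
      using sum.permute[OF \<sigma>, of e] by (simp add: o_def lessThan_atLeast0)
    finally show "signof \<sigma> * (\<Prod>i=0..<s. (deriv ^^ i) (p (\<sigma> i)) z) = (z - a) ^ (\<Sum>j<s. e j) * (signof \<sigma> * (\<Prod>i=0..<s. q (\<sigma> i) i z))"
      by (simp add: mult_ac)
  qed
  have "s * \<mu> + (\<Sum>j<s. e j) \<le> vanish_order (wronskian s g) a"
    by (rule vanish_order_ge[OF W _ Vh]) (simp add: Wg Wp power_add power_mult[symmetric] mult_ac)
  then show ?thesis by (simp add: e_def)
qed

lemma wronskian_quotient_bound:
  assumes nz: "\<And>j. j < s \<Longrightarrow> \<phi> j z \<noteq> 0"
  shows "cmod (wronskian s \<phi> z) \<le> (\<Prod>j<s. cmod (\<phi> j z)) * (fact s * (\<Prod>i<s. \<Prod>j<s. max 1 (cmod ((deriv ^^ i) (\<phi> j) z / \<phi> j z))))"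
proof -
  define M where "M = (\<lambda>i j. max 1 (cmod ((deriv ^^ i) (\<phi> j) z / \<phi> j z)))"
  have M1: "1 \<le> M i j" for i j by (simp add: M_def)
  have pl: "\<sigma> i < s" if "\<sigma> permutes {0..<s}" "i < s" for \<sigma> i using permutes_in_image[OF that(1), of i] that(2) by simp
  have "cmod (wronskian s \<phi> z) \<le> (\<Sum>\<sigma>\<in>{\<sigma>. \<sigma> permutes {0..<s}}. cmod (signof \<sigma> * (\<Prod>i=0..<s. (deriv ^^ i) (\<phi> (\<sigma> i)) z)))"
    unfolding wronskian_expand by (rule norm_sum)
  also have "\<dots> \<le> (\<Sum>\<sigma>\<in>{\<sigma>. \<sigma> permutes {0..<s}}. (\<Prod>j<s. cmod (\<phi> j z)) * (\<Prod>i<s. \<Prod>j<s. M i j))"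
  proof (rule sum_mono)
    fix \<sigma> assume "\<sigma> \<in> {\<sigma>. \<sigma> permutes {0..<s}}"
    then have \<sigma>: "\<sigma> permutes {0..<s}" by simp
    have "cmod (signof \<sigma> * (\<Prod>i=0..<s. (deriv ^^ i) (\<phi> (\<sigma> i)) z)) = (\<Prod>i=0..<s. cmod ((deriv ^^ i) (\<phi> (\<sigma> i)) z))"
      using signof_pm_one[of \<sigma>, where 'a=complex] by (auto simp: norm_mult prod_norm sign_def)
    also have "\<dots> \<le> (\<Prod>i=0..<s. cmod (\<phi> (\<sigma> i) z) * (\<Prod>j<s. M i j))"
    proof (intro prod_mono conjI)
      fix i assume i: "i \<in> {0..<s}"
      have n: "\<phi> (\<sigma> i) z \<noteq> 0" using nz pl[OF \<sigma>] i by simp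
      have "cmod ((deriv ^^ i) (\<phi> (\<sigma> i)) z) = cmod (\<phi> (\<sigma> i) z) * cmod ((deriv ^^ i) (\<phi> (\<sigma> i)) z / \<phi> (\<sigma> i) z)"
        using n by (simp add: norm_divide)
      also have "\<dots> \<le> cmod (\<phi> (\<sigma> i) z) * M i (\<sigma> i)" by (intro mult_left_mono) (auto simp: M_def)
      also have "M i (\<sigma> i) \<le> (\<Prod>j<s. M i j)"
      proof -
        have "(\<Prod>j\<in>{..<s}. M i j) = M i (\<sigma> i) * (\<Prod>j\<in>{..<s} - {\<sigma> i}. M i j)"
          by (rule prod.remove) (use pl[OF \<sigma>] i in auto)
        moreover have "1 \<le> (\<Prod>j\<in>{..<s} - {\<sigma> i}. M i j)" by (rule prod_ge_1) (rule M1)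
        ultimately show ?thesis using M1[of i "\<sigma> i"] by (metis le_numeral_extra(4) mult_left_mono mult.right_neutral order_trans zero_le_one)
      qed
      finally show "cmod ((deriv ^^ i) (\<phi> (\<sigma> i)) z) \<le> cmod (\<phi> (\<sigma> i) z) * (\<Prod>j<s. M i j)" by (simp add: mult_left_mono)
    qed auto
    also have "\<dots> = (\<Prod>i=0..<s. cmod (\<phi> (\<sigma> i) z)) * (\<Prod>i<s. \<Prod>j<s. M i j)"
      by (simp add: prod.distrib lessThan_atLeast0)
    also have "(\<Prod>i=0..<s. cmod (\<phi> (\<sigma> i) z)) = (\<Prod>j<s. cmod (\<phi> j z))"
      using prod.permute[OF \<sigma>, of "\<lambda>j. cmod (\<phi> j z)"] by (simp add: o_def lessThan_atLeast0)
    finally show "cmod (signof \<sigma> * (\<Prod>i=0..<s. (deriv ^^ i) (\<phi> (\<sigma> i)) z)) \<le> (\<Prod>j<s. cmod (\<phi> j z)) * (\<Prod>i<s. \<Prod>j<s. M i j)" .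
  qed
  also have "\<dots> = (\<Prod>j<s. cmod (\<phi> j z)) * (fact s * (\<Prod>i<s. \<Prod>j<s. M i j))"
    using card_permutations[of "{0..<s}" s] by simp
  finally show ?thesis by (simp add: M_def)
qed

lemma outside_finite_measure_mono:
  "outside_finite_measure P \<Longrightarrow> (\<And>r. r > 1 \<Longrightarrow> P r \<Longrightarrow> P' r) \<Longrightarrow> outside_finite_measure P'"
  unfolding outside_finite_measure_def by blast

lemma outside_finite_measure_conj:
  assumes "outside_finite_measure P" "outside_finite_measure P'"
  shows "outside_finite_measure (\<lambda>r. P r \<and> P' r)"
proof -
  obtain E E' where E: "E \<in> sets borel" "E \<subseteq> {0..}" "emeasure lborel E < \<infinity>" "\<And>r. r > 1 \<Longrightarrow> r \<notin> E \<Longrightarrow> P r"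
     "E' \<in> sets borel" "E' \<subseteq> {0..}" "emeasure lborel E' < \<infinity>" "\<And>r. r > 1 \<Longrightarrow> r \<notin> E' \<Longrightarrow> P' r"
    using assms unfolding outside_finite_measure_def by blast
  have "emeasure lborel (E \<union> E') \<le> emeasure lborel E + emeasure lborel E'"
    by (rule emeasure_subadditive) (use E in auto)
  also have "\<dots> < \<infinity>" using E by simp
  finally show ?thesis unfolding outside_finite_measure_def
    by (intro bexI[of _ "E \<union> E'"]) (use E in auto)
qed

lemma outside_finite_measure_True: "(\<And>r. r > 1 \<Longrightarrow> P r) \<Longrightarrow> outside_finite_measure P"
  unfolding outside_finite_measure_def by (intro bexI[of _ "{}"]) auto

lemma outside_finite_measure_ball:
  assumes "finite I" "\<And>i. i \<in> I \<Longrightarrow> outside_finite_measure (P i)"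
  shows "outside_finite_measure (\<lambda>r. \<forall>i\<in>I. P i r)"
  using assms
proof (induction I rule: finite_induct)
  case empty then show ?case by (intro outside_finite_measure_True) auto
next
  case (insert i I)
  then have "outside_finite_measure (\<lambda>r. P i r \<and> (\<forall>i\<in>I. P i r))" by (intro outside_finite_measure_conj) auto
  then show ?case by simp
qed

lemma outside_finite_measure_noncritical:
  assumes "nz_entire g" shows "outside_finite_measure (\<lambda>r. r \<notin> critical_radii g)"
proof -
  have c: "countable (critical_radii g)" by (rule countable_critical_radii[OF assms])
  have "critical_radii g \<subseteq> {0..}" by (auto simp: critical_radii_def)
  moreover have "critical_radii g \<in> sets borel" using c by (rule sets.countable[rotated]) auto
  moreover have "emeasure lborel (critical_radii g) = 0" by (rule emeasure_lborel_countable[OF c])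
  ultimately show ?thesis unfolding outside_finite_measure_def
    by (intro bexI[of _ "critical_radii g"]) auto
qed

lemma outside_finite_measure_borel_growth:
  fixes \<tau> :: "real \<Rightarrow> real"
  assumes "\<And>r s. 1 \<le> r \<Longrightarrow> r \<le> s \<Longrightarrow> \<tau> r \<le> \<tau> s" "\<And>r. r \<ge> 1 \<Longrightarrow> \<tau> r \<ge> 1"
  shows "outside_finite_measure (\<lambda>r. \<tau> (r + 1 / \<tau> r) \<le> 2 * \<tau> r)"
proof -
  obtain E where "E \<in> sets borel" "E \<subseteq> {0..}" "emeasure lborel E < \<infinity>"
    "\<And>r. r \<ge> 1 \<Longrightarrow> r \<notin> E \<Longrightarrow> \<tau> (r + 1 / \<tau> r) \<le> 2 * \<tau> r"
    using borel_growth_lemma[of \<tau>] assms by blast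
  then show ?thesis unfolding outside_finite_measure_def by (intro bexI[of _ E]) auto
qed

lemma higher_log_derivative_bound:
  fixes \<tau> :: "real \<Rightarrow> real"
  assumes \<tau>: "\<And>r s. 1 \<le> r \<Longrightarrow> r \<le> s \<Longrightarrow> \<tau> r \<le> \<tau> s" "\<And>r. r \<ge> 1 \<Longrightarrow> \<tau> r \<ge> 1"
    and g: "nz_entire g0" "nz_entire g1" "nz_entire Q0" and K: "K \<ge> 0"
    and bd: "\<And>t. t \<ge> 1 \<Longrightarrow> t \<notin> critical_radii Q0 \<Longrightarrow> circle_mean (\<lambda>z. log_plus (cmod (g1 z / g0 z))) t + count_fun g0 t \<le> K * \<tau> t"
  shows "\<exists>C\<ge>0. outside_finite_measure (\<lambda>r. circle_mean (\<lambda>z. log_plus (cmod ((deriv ^^ k) (\<lambda>z. g1 z / g0 z) z / (g1 z / g0 z)))) r \<le> C * (1 + ln (\<tau> r)))"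
proof -
  obtain Q C where Q: "nz_entire Q" "critical_radii Q0 \<subseteq> critical_radii Q" and C: "C \<ge> 0"
    and H0: "\<forall>r R B t. 1 \<le> r \<and> r < R \<and> R \<le> 2 * r \<and> 1 \<le> B \<and> 1 / (R - r) \<le> B \<and>
      (\<forall>s. r \<le> s \<and> s \<le> R \<and> s \<notin> critical_radii Q \<longrightarrow> circle_mean (\<lambda>z. log_plus (cmod (g1 z / g0 z))) s + count_fun g0 s \<le> B) \<and>
      r \<le> t \<and> t \<le> r + (R - r) / 2 ^ k \<and> t \<notin> critical_radii Q \<longrightarrow>
        circle_mean (\<lambda>z. log_plus (cmod ((deriv ^^ k) (\<lambda>z. g1 z / g0 z) z))) t \<le> C * B \<and>
        circle_mean (\<lambda>z. log_plus (cmod ((deriv ^^ k) (\<lambda>z. g1 z / g0 z) z / (g1 z / g0 z)))) t \<le> C + C * ln B"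
    using iterated_log_derivative[OF g, of k] by (elim exE conjE) (rule that)
  define C' where "C' = C * (1 + ln (2 * K + 1))"
  have C': "C' \<ge> C" using mult_left_mono[OF _ C, of 1 "1 + ln (2 * K + 1)"] K by (simp add: C'_def)
  have "outside_finite_measure (\<lambda>r. \<tau> (r + 1 / \<tau> r) \<le> 2 * \<tau> r \<and> r \<notin> critical_radii Q)"
    by (intro outside_finite_measure_conj outside_finite_measure_borel_growth outside_finite_measure_noncritical \<tau> Q)
  then have "outside_finite_measure (\<lambda>r. circle_mean (\<lambda>z. log_plus (cmod ((deriv ^^ k) (\<lambda>z. g1 z / g0 z) z / (g1 z / g0 z)))) r \<le> C' * (1 + ln (\<tau> r)))"
  proof (rule outside_finite_measure_mono)
    fix r :: real assume r: "r > 1" and h: "\<tau> (r + 1 / \<tau> r) \<le> 2 * \<tau> r \<and> r \<notin> critical_radii Q"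
    define R where "R = r + 1 / \<tau> r"
    define B where "B = (2 * K + 1) * \<tau> r"
    have t1: "\<tau> r \<ge> 1" using \<tau>(2) r by simp
    have le1: "1 / \<tau> r \<le> 1" using t1 by simp
    have R: "r < R" using t1 by (simp add: R_def)
    have R2: "R \<le> 2 * r" using le1 r unfolding R_def by linarith
    have B1: "\<tau> r \<le> B" unfolding B_def using mult_right_mono[of 1 "2 * K + 1" "\<tau> r"] K t1 by simp
    have b: "circle_mean (\<lambda>z. log_plus (cmod (g1 z / g0 z))) s + count_fun g0 s \<le> B"
      if s: "r \<le> s" "s \<le> R" "s \<notin> critical_radii Q" for s
    proof -
      have "circle_mean (\<lambda>z. log_plus (cmod (g1 z / g0 z))) s + count_fun g0 s \<le> K * \<tau> s"
        using bd[of s] s Q(2) r by auto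
      also have "\<dots> \<le> K * (2 * \<tau> r)" using \<tau>(1)[of s R] s r h K unfolding R_def by (intro mult_left_mono) auto
      also have "\<dots> \<le> B" using t1 by (simp add: B_def algebra_simps)
      finally show ?thesis .
    qed
    have "circle_mean (\<lambda>z. log_plus (cmod ((deriv ^^ k) (\<lambda>z. g1 z / g0 z) z / (g1 z / g0 z)))) r \<le> C + C * ln B"
      using H0[rule_format, of r R B r] r R R2 B1 t1 b h by (simp add: R_def)
    also have "ln B = ln (2 * K + 1) + ln (\<tau> r)" unfolding B_def by (rule ln_mult_pos) (use K t1 in auto)
    also have "C + C * (ln (2 * K + 1) + ln (\<tau> r)) = C' + C * ln (\<tau> r)" by (simp add: C'_def algebra_simps)
    also have "\<dots> \<le> C' * (1 + ln (\<tau> r))" using mult_right_mono[OF C', of "ln (\<tau> r)"] t1 by (simp add: algebra_simps)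
    finally show "circle_mean (\<lambda>z. log_plus (cmod ((deriv ^^ k) (\<lambda>z. g1 z / g0 z) z / (g1 z / g0 z)))) r \<le> C' * (1 + ln (\<tau> r))" .
  qed
  then show ?thesis using C C' by (intro exI[of _ C']) auto
qed

section \<open>Cartan's estimate\<close>

lemma wronskian_ln_bound:
  assumes g: "\<And>j. j \<le> s \<Longrightarrow> g j holomorphic_on UNIV" and sum0: "\<And>z. (\<Sum>j\<le>s. g j z) = 0"
    and j: "j \<le> s" and nz: "\<And>i. i \<le> s \<Longrightarrow> g i z \<noteq> 0" and W: "wronskian s g z \<noteq> 0"
  shows "ln (cmod (g j z)) - ln (cmod (g s z)) \<le> (\<Sum>i<s. ln (cmod (g i z))) - ln (cmod (wronskian s g z))
     + (ln (fact s) + (\<Sum>i<s. \<Sum>k\<le>s. log_plus (cmod ((deriv ^^ i) (\<lambda>z. g k z / g s z) z / (g k z / g s z)))))"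
proof -
  define f where "f = (\<lambda>i. if i = j then s else i)"
  have fs: "f i \<le> s" if "i < s" for i using that by (simp add: f_def)
  have inj: "inj_on f {..<s}" by (auto simp: inj_on_def f_def)
  have img: "f ` {..<s} = {..s} - {j}"
  proof
    show "f ` {..<s} \<subseteq> {..s} - {j}" using j by (auto simp: f_def)
    show "{..s} - {j} \<subseteq> f ` {..<s}"
    proof
      fix i assume i: "i \<in> {..s} - {j}"
      show "i \<in> f ` {..<s}"
      proof (cases "i = s")
        case True then show ?thesis using i j by (intro image_eqI[of _ _ j]) (auto simp: f_def)
      next
        case False then show ?thesis using i by (intro image_eqI[of _ _ i]) (auto simp: f_def)
      qed
    qed
  qed
  define \<phi> where "\<phi> = (\<lambda>k z. g k z / g s z)"
  define L where "L = (\<lambda>i k. log_plus (cmod ((deriv ^^ i) (\<phi> k) z / \<phi> k z)))"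
  have Wf: "cmod (wronskian s (\<lambda>i. g (f i)) z) = cmod (wronskian s g z)"
  proof (cases "j = s")
    case True
    then have "wronskian s (\<lambda>i. g (f i)) z = wronskian s g z"
      unfolding wronskian_def by (intro arg_cong[of _ _ Determinant.det] eq_matI) (auto simp: f_def)
    then show ?thesis by simp
  next
    case False
    then have "wronskian s (\<lambda>i. if i = j then g s else g i) z = - wronskian s g z"
      using j by (intro wronskian_exchange g sum0) auto
    moreover have "(\<lambda>i. if i = j then g s else g i) = (\<lambda>i. g (f i))" by (auto simp: f_def)
    ultimately show ?thesis by simp
  qed
  have op: "open {z. g s z \<noteq> 0}"
    by (intro open_Collect_neq holomorphic_on_imp_continuous_on[OF holomorphic_on_subset[OF g]] continuous_on_const) auto
  have hs: "(\<lambda>z. 1 / g s z) holomorphic_on {z. g s z \<noteq> 0}"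
    by (intro holomorphic_intros holomorphic_on_subset[OF g]) auto
  have "wronskian s (\<lambda>i z. (1 / g s z) * g (f i) z) z = (1 / g s z) ^ s * wronskian s (\<lambda>i. g (f i)) z"
    by (rule wronskian_scale[OF op hs]) (use nz fs in \<open>auto intro: holomorphic_on_subset[OF g]\<close>)
  moreover have "(\<lambda>i z. (1 / g s z) * g (f i) z) = (\<lambda>i. \<phi> (f i))" by (simp add: \<phi>_def)
  ultimately have sc: "cmod (wronskian s (\<lambda>i. \<phi> (f i)) z) * cmod (g s z) ^ s = cmod (wronskian s g z)"
    using nz[of s] by (simp add: norm_mult norm_divide norm_power Wf[symmetric] power_divide)
  have "cmod (wronskian s (\<lambda>i. \<phi> (f i)) z) \<le> (\<Prod>i<s. cmod (\<phi> (f i) z)) *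
      (fact s * (\<Prod>i<s. \<Prod>k<s. max 1 (cmod ((deriv ^^ i) (\<phi> (f k)) z / \<phi> (f k) z))))"
    by (rule wronskian_quotient_bound) (use nz fs in \<open>auto simp: \<phi>_def\<close>)
  from mult_right_mono[OF this, of "cmod (g s z) ^ s"]
  have "cmod (wronskian s g z) \<le> ((\<Prod>i<s. cmod (\<phi> (f i) z)) * cmod (g s z) ^ s) *
      (fact s * (\<Prod>i<s. \<Prod>k<s. max 1 (cmod ((deriv ^^ i) (\<phi> (f k)) z / \<phi> (f k) z))))"
    unfolding sc[symmetric] by (simp add: mult_ac)
  also have "(\<Prod>i<s. cmod (\<phi> (f i) z)) * cmod (g s z) ^ s = (\<Prod>i<s. cmod (g (f i) z))"
    using nz[of s] by (simp add: \<phi>_def norm_divide prod_dividef)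
  finally have "ln (cmod (wronskian s g z)) \<le> ln ((\<Prod>i<s. cmod (g (f i) z)) *
      (fact s * (\<Prod>i<s. \<Prod>k<s. max 1 (cmod ((deriv ^^ i) (\<phi> (f k)) z / \<phi> (f k) z)))))"
    using W by (intro ln_mono) auto
  also have "\<dots> = ln (\<Prod>i<s. cmod (g (f i) z)) + (ln (fact s) + ln (\<Prod>i<s. \<Prod>k<s. max 1 (cmod ((deriv ^^ i) (\<phi> (f k)) z / \<phi> (f k) z))))"
  proof -
    have p1: "(\<Prod>i<s. cmod (g (f i) z)) > 0" using nz fs by (intro prod_pos) auto
    have p2: "(\<Prod>i<s. \<Prod>k<s. max 1 (cmod ((deriv ^^ i) (\<phi> (f k)) z / \<phi> (f k) z))) > 0"
      by (intro prod_pos ballI) (auto intro: less_le_trans[of 0 1])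
    show ?thesis by (subst ln_mult_pos[OF p1], use p2 in simp, subst ln_mult_pos) (use p2 in auto)
  qed
  also have "ln (\<Prod>i<s. cmod (g (f i) z)) = (\<Sum>i<s. ln (cmod (g (f i) z)))"
    using nz fs by (intro ln_prod) auto
  also have "\<dots> = (\<Sum>i\<in>{..s} - {j}. ln (cmod (g i z)))"
    unfolding img[symmetric] by (subst sum.reindex[OF inj]) simp
  also have "\<dots> = (\<Sum>i\<le>s. ln (cmod (g i z))) - ln (cmod (g j z))" using j by (simp add: sum_diff1)
  also have "(\<Sum>i\<le>s. ln (cmod (g i z))) = (\<Sum>i<s. ln (cmod (g i z))) + ln (cmod (g s z))"
    by (simp add: lessThan_Suc_atMost[symmetric])
  also have "ln (\<Prod>i<s. \<Prod>k<s. max 1 (cmod ((deriv ^^ i) (\<phi> (f k)) z / \<phi> (f k) z))) = (\<Sum>i<s. \<Sum>k<s. L i (f k))"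
  proof -
    have mne: "max 1 x \<noteq> 0" for x :: real by (simp add: max_def)
    have "ln (\<Prod>i<s. \<Prod>k<s. max 1 (cmod ((deriv ^^ i) (\<phi> (f k)) z / \<phi> (f k) z))) = (\<Sum>i<s. ln (\<Prod>k<s. max 1 (cmod ((deriv ^^ i) (\<phi> (f k)) z / \<phi> (f k) z))))"
      by (rule ln_prod) (simp_all add: mne)
    also have "\<dots> = (\<Sum>i<s. \<Sum>k<s. L i (f k))" unfolding L_def log_plus_def
      by (intro sum.cong refl ln_prod) (simp_all add: mne)
    finally show ?thesis .
  qed
  also have "(\<Sum>i<s. \<Sum>k<s. L i (f k)) \<le> (\<Sum>i<s. \<Sum>k\<le>s. L i k)"
  proof (rule sum_mono)
    fix i
    have "(\<Sum>k<s. L i (f k)) = (\<Sum>k\<in>{..s} - {j}. L i k)" unfolding img[symmetric] by (subst sum.reindex[OF inj]) simp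
    also have "\<dots> \<le> (\<Sum>k\<le>s. L i k)" by (rule sum_mono2) (auto simp: L_def log_plus_nonneg)
    finally show "(\<Sum>k<s. L i (f k)) \<le> (\<Sum>k\<le>s. L i k)" .
  qed
  finally show ?thesis unfolding L_def \<phi>_def by simp
qed

lemma cartan_step:
  fixes \<tau> :: "real \<Rightarrow> real"
  assumes \<tau>: "\<And>r s. 1 \<le> r \<Longrightarrow> r \<le> s \<Longrightarrow> \<tau> r \<le> \<tau> s" "\<And>r. r \<ge> 1 \<Longrightarrow> \<tau> r \<ge> 1"
    and g: "\<And>j. j \<le> s \<Longrightarrow> nz_entire (g j)" and sum0: "\<And>z. (\<Sum>j\<le>s. g j z) = 0"
    and W: "nz_entire (wronskian s g)" and Q0: "nz_entire Q0" and K: "K \<ge> 0"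
    and bd: "\<And>j t. j \<le> s \<Longrightarrow> t \<ge> 1 \<Longrightarrow> t \<notin> critical_radii Q0 \<Longrightarrow>
       circle_mean (\<lambda>z. log_plus (cmod (g j z / g s z))) t + count_fun (g s) t \<le> K * \<tau> t"
  shows "\<exists>C\<ge>0. outside_finite_measure (\<lambda>r. \<forall>u. continuous_on (sphere 0 r) u \<longrightarrow>
     (\<forall>z. cmod z = r \<longrightarrow> (\<exists>j\<le>s. u z \<le> ln (cmod (g j z)) - ln (cmod (g s z)))) \<longrightarrow>
     circle_mean u r \<le> (\<Sum>j<s. count_fun (g j) r) - count_fun (wronskian s g) r + C * (1 + ln (\<tau> r)))"
proof -
  define I where "I = {..<s} \<times> {..s}"
  define D where "D = (\<lambda>i k z. log_plus (cmod ((deriv ^^ i) (\<lambda>z. g k z / g s z) z / (g k z / g s z))))"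
  have "\<exists>C. \<forall>p\<in>I. C p \<ge> 0 \<and> outside_finite_measure (\<lambda>r. circle_mean (D (fst p) (snd p)) r \<le> C p * (1 + ln (\<tau> r)))"
  proof (rule bchoice, rule ballI)
    fix p assume "p \<in> I"
    then have p: "snd p \<le> s" by (auto simp: I_def)
    show "\<exists>C. C \<ge> 0 \<and> outside_finite_measure (\<lambda>r. circle_mean (D (fst p) (snd p)) r \<le> C * (1 + ln (\<tau> r)))"
      unfolding D_def using higher_log_derivative_bound[OF \<tau> g[of s] g[OF p] Q0 K bd[OF p], of "fst p"] by auto
  qed
  then obtain C where C: "\<And>p. p \<in> I \<Longrightarrow> C p \<ge> 0"
    "\<And>p. p \<in> I \<Longrightarrow> outside_finite_measure (\<lambda>r. circle_mean (D (fst p) (snd p)) r \<le> C p * (1 + ln (\<tau> r)))" by blast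
  have fI: "finite I" by (simp add: I_def)
  have "\<exists>c. \<forall>j\<in>{..s}. \<forall>r. r \<ge> 1 \<longrightarrow> r \<notin> critical_radii (g j) \<longrightarrow> circle_mean (\<lambda>z. ln (cmod (g j z))) r = count_fun (g j) r + c j"
    by (rule bchoice) (use jensen[OF g] in \<open>metis atMost_iff\<close>)
  then obtain c where c: "\<And>j r. j \<le> s \<Longrightarrow> r \<ge> 1 \<Longrightarrow> r \<notin> critical_radii (g j) \<Longrightarrow> circle_mean (\<lambda>z. ln (cmod (g j z))) r = count_fun (g j) r + c j" by auto
  obtain cW where cW: "\<And>r. r \<ge> 1 \<Longrightarrow> r \<notin> critical_radii (wronskian s g) \<Longrightarrow> circle_mean (\<lambda>z. ln (cmod (wronskian s g z))) r = count_fun (wronskian s g) r + cW"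
    using jensen[OF W] by blast
  define C0 where "C0 = (\<Sum>j<s. \<bar>c j\<bar>) + \<bar>cW\<bar> + ln (fact s) + (\<Sum>p\<in>I. C p)"
  have f0: "ln (fact s) \<ge> (0::real)" by (simp add: fact_ge_1)
  have C0: "C0 \<ge> 0" unfolding C0_def using C(1) f0 by (intro add_nonneg_nonneg sum_nonneg) auto
  have "outside_finite_measure (\<lambda>r. (\<forall>p\<in>I. circle_mean (D (fst p) (snd p)) r \<le> C p * (1 + ln (\<tau> r))) \<and>
     ((\<forall>j\<in>{..s}. r \<notin> critical_radii (g j)) \<and> r \<notin> critical_radii (wronskian s g)))"
    by (intro outside_finite_measure_conj outside_finite_measure_ball outside_finite_measure_noncritical fI C W g) auto
  then have "outside_finite_measure (\<lambda>r. \<forall>u. continuous_on (sphere 0 r) u \<longrightarrow>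
     (\<forall>z. cmod z = r \<longrightarrow> (\<exists>j\<le>s. u z \<le> ln (cmod (g j z)) - ln (cmod (g s z)))) \<longrightarrow>
     circle_mean u r \<le> (\<Sum>j<s. count_fun (g j) r) - count_fun (wronskian s g) r + C0 * (1 + ln (\<tau> r)))"
  proof (rule outside_finite_measure_mono, intro allI impI)
    fix r :: real and u :: "complex \<Rightarrow> real"
    assume r: "r > 1" and h: "(\<forall>p\<in>I. circle_mean (D (fst p) (snd p)) r \<le> C p * (1 + ln (\<tau> r))) \<and>
     ((\<forall>j\<in>{..s}. r \<notin> critical_radii (g j)) \<and> r \<notin> critical_radii (wronskian s g))"
      and cu: "continuous_on (sphere 0 r) u" and u: "\<forall>z. cmod z = r \<longrightarrow> (\<exists>j\<le>s. u z \<le> ln (cmod (g j z)) - ln (cmod (g s z)))"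
    have nz: "g j z \<noteq> 0" if "j \<le> s" "cmod z = r" for j z using h that noncritical_nz by blast
    have Wnz: "wronskian s g z \<noteq> 0" if "cmod z = r" for z using h that noncritical_nz by blast
    define \<Psi> where "\<Psi> = (\<lambda>z. ln (fact s) + (\<Sum>i<s. \<Sum>k\<le>s. D i k z))"
    have cg: "continuous_on (sphere 0 r) (\<lambda>z. ln (cmod (g j z)))" if "j \<le> s" for j
      using nz[OF that] by (auto intro!: continuous_intros nz_entire_cont g[OF that])
    have cw: "continuous_on (sphere 0 r) (\<lambda>z. ln (cmod (wronskian s g z)))"
      using Wnz by (auto intro!: continuous_intros nz_entire_cont W)
    have cD: "continuous_on (sphere 0 r) (D i k)" if "k \<le> s" for i k
    proof -
      have op: "open {z. g s z \<noteq> 0}"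
        by (intro open_Collect_neq nz_entire_cont g continuous_on_const) auto
      have "(\<lambda>z. g k z / g s z) holomorphic_on {z. g s z \<noteq> 0}"
        by (rule holomorphic_on_divide) (use g that in \<open>auto intro: nz_entire_holo\<close>)
      from holomorphic_higher_deriv[OF this op, of i]
      have "continuous_on {z. g s z \<noteq> 0} ((deriv ^^ i) (\<lambda>z. g k z / g s z))" by (rule holomorphic_on_imp_continuous_on)
      then have "continuous_on (sphere 0 r) ((deriv ^^ i) (\<lambda>z. g k z / g s z))"
        by (rule continuous_on_subset) (use nz[of s] in auto)
      then show ?thesis unfolding D_def
        using nz[OF that] nz[of s] by (auto intro!: continuous_intros nz_entire_cont[OF g[OF that]] nz_entire_cont[OF g[OF order_refl]])
    qed
    have cPsi: "continuous_on (sphere 0 r) \<Psi>" unfolding \<Psi>_def by (intro continuous_intros cD) auto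
    have r1: "r \<ge> 1" "r \<ge> 0" using r by auto
    have cs: "continuous_on (sphere 0 r) (\<lambda>z. \<Sum>i<s. ln (cmod (g i z)))" by (intro continuous_on_sum cg) auto
    have "circle_mean u r \<le> circle_mean (\<lambda>z. (\<Sum>i<s. ln (cmod (g i z))) - ln (cmod (wronskian s g z)) + \<Psi> z) r"
    proof (rule circle_mean_mono)
      fix z assume z: "cmod z = r"
      then obtain j where j: "j \<le> s" "u z \<le> ln (cmod (g j z)) - ln (cmod (g s z))" using u by blast
      note j(2)
      also have "ln (cmod (g j z)) - ln (cmod (g s z)) \<le> (\<Sum>i<s. ln (cmod (g i z))) - ln (cmod (wronskian s g z)) + \<Psi> z"
        unfolding \<Psi>_def D_def
        by (rule wronskian_ln_bound) (use g nz_entire_holo sum0 j nz Wnz z in auto)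
      finally show "u z \<le> (\<Sum>i<s. ln (cmod (g i z))) - ln (cmod (wronskian s g z)) + \<Psi> z" .
    qed (use cu continuous_on_add[OF continuous_on_diff[OF cs cw] cPsi] r in auto)
    also have "\<dots> = (\<Sum>i<s. circle_mean (\<lambda>z. ln (cmod (g i z))) r) - circle_mean (\<lambda>z. ln (cmod (wronskian s g z))) r + circle_mean \<Psi> r"
    proof -
      show ?thesis
        by (subst circle_mean_add[OF continuous_on_diff[OF cs cw] cPsi r1(2)], subst circle_mean_diff[OF cs cw r1(2)],
            subst circle_mean_sum) (use cg r in auto)
    qed
    also have "(\<Sum>i<s. circle_mean (\<lambda>z. ln (cmod (g i z))) r) = (\<Sum>i<s. count_fun (g i) r) + (\<Sum>i<s. c i)"
      unfolding sum.distrib[symmetric] by (intro sum.cong refl c) (use r h in auto)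
    also have "circle_mean (\<lambda>z. ln (cmod (wronskian s g z))) r = count_fun (wronskian s g) r + cW"
      using cW r h by auto
    also have "circle_mean \<Psi> r = ln (fact s) + (\<Sum>i<s. \<Sum>k\<le>s. circle_mean (D i k) r)"
    proof -
      have c1: "continuous_on (sphere 0 r) (\<lambda>z. \<Sum>k\<le>s. D i k z)" for i by (intro continuous_on_sum cD) auto
      have "circle_mean (\<lambda>z. \<Sum>i<s. \<Sum>k\<le>s. D i k z) r = (\<Sum>i<s. circle_mean (\<lambda>z. \<Sum>k\<le>s. D i k z) r)"
        by (rule circle_mean_sum) (use c1 r in auto)
      also have "\<dots> = (\<Sum>i<s. \<Sum>k\<le>s. circle_mean (D i k) r)"
        by (intro sum.cong refl circle_mean_sum cD) (use r in auto)
      finally show ?thesis unfolding \<Psi>_def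
        by (subst circle_mean_add) (use c1 cD r in \<open>auto intro!: continuous_on_sum\<close>)
    qed
    also have "(\<Sum>i<s. \<Sum>k\<le>s. circle_mean (D i k) r) = (\<Sum>p\<in>I. circle_mean (D (fst p) (snd p)) r)"
      unfolding I_def by (simp add: sum.cartesian_product case_prod_unfold)
    also have "\<dots> \<le> (\<Sum>p\<in>I. C p * (1 + ln (\<tau> r)))" using h by (intro sum_mono) auto
    also have "\<dots> = (\<Sum>p\<in>I. C p) * (1 + ln (\<tau> r))" by (rule sum_distrib_right[symmetric])
    finally have fin: "circle_mean u r \<le> (\<Sum>i<s. count_fun (g i) r) + (\<Sum>i<s. c i) - (count_fun (wronskian s g) r + cW) + (ln (fact s) + (\<Sum>p\<in>I. C p) * (1 + ln (\<tau> r)))"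
      by simp
    have l: "1 \<le> 1 + ln (\<tau> r)" using \<tau>(2)[OF r1(1)] by simp
    define X where "X = (\<Sum>j<s. \<bar>c j\<bar>) + \<bar>cW\<bar> + ln (fact s)"
    have X0: "X \<ge> 0" unfolding X_def using f0 by (intro add_nonneg_nonneg sum_nonneg) auto
    have "(\<Sum>i<s. c i) \<le> (\<Sum>j<s. \<bar>c j\<bar>)" by (intro sum_mono) auto
    then have "(\<Sum>i<s. c i) - cW + ln (fact s) \<le> X" unfolding X_def
      using abs_ge_minus_self[of cW] by linarith
    also have "X \<le> X * (1 + ln (\<tau> r))" using mult_left_mono[OF l X0] by simp
    finally have "(\<Sum>i<s. c i) - cW + ln (fact s) + (\<Sum>p\<in>I. C p) * (1 + ln (\<tau> r)) \<le> C0 * (1 + ln (\<tau> r))"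
      unfolding C0_def X_def[symmetric] by (simp add: distrib_right)
    then show "circle_mean u r \<le> (\<Sum>j<s. count_fun (g j) r) - count_fun (wronskian s g) r + C0 * (1 + ln (\<tau> r))"
      using fin by linarith
  qed
  then show ?thesis using C0 by blast
qed

section \<open>Spans over a subfield\<close>

definition closed_subfield :: "'a::field set \<Rightarrow> bool" where
  "closed_subfield K \<longleftrightarrow> 0 \<in> K \<and> 1 \<in> K \<and> (\<forall>x\<in>K. \<forall>y\<in>K. x + y \<in> K \<and> x * y \<in> K) \<and>
     (\<forall>x\<in>K. - x \<in> K \<and> inverse x \<in> K)"

lemma closed_subfieldD:
  assumes "closed_subfield K"
  shows "0 \<in> K" "1 \<in> K" "x \<in> K \<Longrightarrow> y \<in> K \<Longrightarrow> x + y \<in> K" "x \<in> K \<Longrightarrow> y \<in> K \<Longrightarrow> x * y \<in> K"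
    "x \<in> K \<Longrightarrow> - x \<in> K" "x \<in> K \<Longrightarrow> inverse x \<in> K" "x \<in> K \<Longrightarrow> y \<in> K \<Longrightarrow> x - y \<in> K" "x \<in> K \<Longrightarrow> y \<in> K \<Longrightarrow> x / y \<in> K"
proof -
  show "0 \<in> K" "1 \<in> K" and a: "x \<in> K \<Longrightarrow> y \<in> K \<Longrightarrow> x + y \<in> K" and m: "x \<in> K \<Longrightarrow> y \<in> K \<Longrightarrow> x * y \<in> K"
    and u: "x \<in> K \<Longrightarrow> - x \<in> K" and i: "x \<in> K \<Longrightarrow> inverse x \<in> K" for x y
    using assms by (auto simp: closed_subfield_def)
  show "x \<in> K \<Longrightarrow> y \<in> K \<Longrightarrow> x - y \<in> K" using a[of x "- y"] u[of y] by simp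
  show "x \<in> K \<Longrightarrow> y \<in> K \<Longrightarrow> x / y \<in> K" using m[of x "inverse y"] i[of y] by (simp add: divide_inverse)
qed

lemma closed_subfield_sum:
  "closed_subfield K \<Longrightarrow> (\<And>i. i \<in> S \<Longrightarrow> f i \<in> K) \<Longrightarrow> (\<Sum>i\<in>S. f i) \<in> K"
  by (induction S rule: infinite_finite_induct) (auto simp: closed_subfieldD)

lemma closed_subfield_prod:
  "closed_subfield K \<Longrightarrow> (\<And>i. i \<in> S \<Longrightarrow> f i \<in> K) \<Longrightarrow> (\<Prod>i\<in>S. f i) \<in> K"
  by (induction S rule: infinite_finite_induct) (auto simp: closed_subfieldD)

definition kspan :: "'a::field set \<Rightarrow> ('i \<Rightarrow> 'a) \<Rightarrow> 'i set \<Rightarrow> 'a set" where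
  "kspan K v S = {x. \<exists>c. (\<forall>i\<in>S. c i \<in> K) \<and> x = (\<Sum>i\<in>S. c i * v i)}"

definition kindep :: "'a::field set \<Rightarrow> ('i \<Rightarrow> 'a) \<Rightarrow> 'i set \<Rightarrow> bool" where
  "kindep K v S \<longleftrightarrow> (\<forall>c. (\<forall>i\<in>S. c i \<in> K) \<longrightarrow> (\<Sum>i\<in>S. c i * v i) = 0 \<longrightarrow> (\<forall>i\<in>S. c i = 0))"

context
  fixes K :: "'a::field set"
  assumes K: "closed_subfield K"
begin

lemmas Kcl = closed_subfieldD[OF K]

lemma kspan_zero: "0 \<in> kspan K v S"
  unfolding kspan_def using Kcl(1) by (auto intro!: exI[of _ "\<lambda>_. 0"])

lemma kspan_add: "x \<in> kspan K v S \<Longrightarrow> y \<in> kspan K v S \<Longrightarrow> x + y \<in> kspan K v S"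
proof -
  assume "x \<in> kspan K v S" "y \<in> kspan K v S"
  then obtain c d where "\<forall>i\<in>S. c i \<in> K" "x = (\<Sum>i\<in>S. c i * v i)" "\<forall>i\<in>S. d i \<in> K" "y = (\<Sum>i\<in>S. d i * v i)"
    unfolding kspan_def by blast
  then show ?thesis unfolding kspan_def using Kcl(3)
    by (auto intro!: exI[of _ "\<lambda>i. c i + d i"] simp: distrib_right sum.distrib)
qed

lemma kspan_scale: "x \<in> kspan K v S \<Longrightarrow> a \<in> K \<Longrightarrow> a * x \<in> kspan K v S"
proof -
  assume "x \<in> kspan K v S" and a: "a \<in> K"
  then obtain c where "\<forall>i\<in>S. c i \<in> K" "x = (\<Sum>i\<in>S. c i * v i)" unfolding kspan_def by blast
  then show ?thesis unfolding kspan_def using Kcl(4) a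
    by (auto intro!: exI[of _ "\<lambda>i. a * c i"] simp: sum_distrib_left mult.assoc)
qed

lemma kspan_uminus: "x \<in> kspan K v S \<Longrightarrow> - x \<in> kspan K v S"
  using kspan_scale[of x v S "- 1"] Kcl by simp

lemma kspan_base: "finite S \<Longrightarrow> i \<in> S \<Longrightarrow> v i \<in> kspan K v S"
  unfolding kspan_def using Kcl
  by (auto intro!: exI[of _ "\<lambda>j. if j = i then 1 else 0"] simp: if_distrib[of "\<lambda>x. x * _"] cong: if_cong)

lemma kspan_sum: "(\<And>j. j \<in> T \<Longrightarrow> f j \<in> kspan K v S) \<Longrightarrow> (\<Sum>j\<in>T. f j) \<in> kspan K v S"
  by (induction T rule: infinite_finite_induct) (auto intro: kspan_zero kspan_add)

lemma kspan_subspan: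
  assumes "\<And>j. j \<in> T \<Longrightarrow> w j \<in> kspan K v S" "x \<in> kspan K w T" shows "x \<in> kspan K v S"
proof -
  obtain c where c: "\<forall>j\<in>T. c j \<in> K" "x = (\<Sum>j\<in>T. c j * w j)" using assms(2) unfolding kspan_def by blast
  show ?thesis unfolding c(2) by (intro kspan_sum kspan_scale assms(1)) (use c in auto)
qed

lemma kspan_mono: "finite S' \<Longrightarrow> S \<subseteq> S' \<Longrightarrow> x \<in> kspan K v S \<Longrightarrow> x \<in> kspan K v S'"
  by (rule kspan_subspan[of S v]) (auto intro: kspan_base)

lemma kindep_subset:
  assumes "kindep K v S" "S' \<subseteq> S" "finite S" shows "kindep K v S'"
  unfolding kindep_def
proof (intro allI impI)
  fix c assume c: "\<forall>i\<in>S'. c i \<in> K" "(\<Sum>i\<in>S'. c i * v i) = 0"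
  define d where "d = (\<lambda>i. if i \<in> S' then c i else 0)"
  have "(\<Sum>i\<in>S. d i * v i) = (\<Sum>i\<in>S'. c i * v i)"
    by (rule sum.mono_neutral_cong_right) (use assms in \<open>auto simp: d_def\<close>)
  then have "(\<Sum>i\<in>S. d i * v i) = 0" using c by simp
  moreover have "\<forall>i\<in>S. d i \<in> K" using c Kcl(1) by (auto simp: d_def)
  ultimately have "\<forall>i\<in>S. d i = 0" using assms(1) unfolding kindep_def by blast
  then have "\<forall>i\<in>S'. d i = 0" using assms(2) by blast
  then show "\<forall>i\<in>S'. c i = 0" by (simp add: d_def)
qed

lemma steinitz:
  assumes "finite T" "finite S" "kindep K v S" "\<And>i. i \<in> S \<Longrightarrow> v i \<in> kspan K w T"
  shows "card S \<le> card T"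
  using assms
proof (induction T arbitrary: S v rule: finite_induct)
  case empty
  have "S = {}"
  proof (rule ccontr)
    assume "S \<noteq> {}"
    then obtain i where i: "i \<in> S" by blast
    have "v j = 0" if "j \<in> S" for j using empty.prems(3)[OF that] by (simp add: kspan_def)
    then have "(\<Sum>j\<in>S. 1 * v j) = 0" by simp
    moreover have "\<forall>j\<in>S. 1 \<in> K" using Kcl(2) by simp
    ultimately have "\<forall>j\<in>S. (1::'a) = 0"
      using empty.prems(2)[unfolded kindep_def, rule_format, of "\<lambda>_. 1"] by blast
    then show False using i by auto
  qed
  then show ?case by simp
next
  case (insert t T)
  have "\<exists>a x. a \<in> K \<and> x \<in> kspan K w T \<and> v i = a * w t + x" if i: "i \<in> S" for i
  proof -
    obtain c where "\<forall>j\<in>insert t T. c j \<in> K" "v i = (\<Sum>j\<in>insert t T. c j * w j)"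
      using insert.prems(3)[OF i] unfolding kspan_def by blast
    then show ?thesis using insert.hyps
      by (intro exI[of _ "c t"] exI[of _ "\<Sum>j\<in>T. c j * w j"]) (auto simp: kspan_def)
  qed
  then obtain a x where ax: "\<And>i. i \<in> S \<Longrightarrow> a i \<in> K" "\<And>i. i \<in> S \<Longrightarrow> x i \<in> kspan K w T" "\<And>i. i \<in> S \<Longrightarrow> v i = a i * w t + x i"
    by metis
  show ?case
  proof (cases "\<forall>i\<in>S. a i = 0")
    case True
    then have "card S \<le> card T" using ax by (intro insert.IH[OF insert.prems(1,2)]) auto
    then show ?thesis using insert.hyps by simp
  next
    case False
    then obtain i0 where i0: "i0 \<in> S" "a i0 \<noteq> 0" by blast
    define b where "b = (\<lambda>i. a i / a i0)"
    have bK: "b i \<in> K" if "i \<in> S" for i using ax i0 that Kcl(8) by (auto simp: b_def)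
    define v' where "v' = (\<lambda>i. v i - b i * v i0)"
    have "card (S - {i0}) \<le> card T"
    proof (rule insert.IH)
      show "finite (S - {i0})" using insert.prems by simp
      show "kindep K v' (S - {i0})" unfolding kindep_def
      proof (intro allI impI)
        fix c assume c: "\<forall>i\<in>S - {i0}. c i \<in> K" "(\<Sum>i\<in>S - {i0}. c i * v' i) = 0"
        define d where "d = c(i0 := - (\<Sum>i\<in>S - {i0}. c i * b i))"
        have "d i \<in> K" if "i \<in> S" for i
          using c bK that by (auto simp: d_def intro!: Kcl closed_subfield_sum[OF K])
        moreover have "(\<Sum>i\<in>S. d i * v i) = 0"
        proof -
          have "(\<Sum>i\<in>S. d i * v i) = d i0 * v i0 + (\<Sum>i\<in>S - {i0}. d i * v i)"
            using i0 insert.prems(1) by (subst sum.remove[of S i0]) auto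
          also have "(\<Sum>i\<in>S - {i0}. d i * v i) = (\<Sum>i\<in>S - {i0}. c i * v i)" by (intro sum.cong) (auto simp: d_def)
          also have "d i0 * v i0 + (\<Sum>i\<in>S - {i0}. c i * v i) = (\<Sum>i\<in>S - {i0}. c i * v' i)"
            by (simp add: d_def v'_def right_diff_distrib sum_subtractf sum_distrib_right mult.assoc)
          finally show ?thesis using c by simp
        qed
        ultimately have "\<forall>i\<in>S. d i = 0" using insert.prems(2) unfolding kindep_def by blast
        then have "\<forall>i\<in>S - {i0}. d i = 0" by blast
        then show "\<forall>i\<in>S - {i0}. c i = 0" by (simp add: d_def)
      qed
      fix i assume i: "i \<in> S - {i0}"
      have "v' i = x i - b i * x i0"
        using ax(3)[of i] ax(3)[of i0] i i0 by (simp add: v'_def b_def field_simps)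
      also have "\<dots> = x i + - (b i * x i0)" by simp
      also have "\<dots> \<in> kspan K w T"
        by (intro kspan_add kspan_uminus kspan_scale ax bK) (use i i0 in auto)
      finally show "v' i \<in> kspan K w T" .
    qed
    then show ?thesis using insert.hyps i0 insert.prems(1) by (simp add: card_Diff_singleton)
  qed
qed

lemma kspan_basis_exists:
  assumes "finite S" obtains B where "B \<subseteq> S" "kindep K v B" "\<And>i. i \<in> S \<Longrightarrow> v i \<in> kspan K v B"
proof -
  define P where "P = (\<lambda>B. B \<subseteq> S \<and> (\<forall>i\<in>S. v i \<in> kspan K v B))"
  have "P S" unfolding P_def using kspan_base[OF assms] by auto
  then obtain B where B: "P B" "\<And>B'. P B' \<Longrightarrow> card B \<le> card B'"
    using ex_has_least_nat[of P S card] by blast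
  have fB: "finite B" using B(1) assms unfolding P_def by (auto intro: finite_subset)
  have "kindep K v B" unfolding kindep_def
  proof (intro allI impI ballI, rule ccontr)
    fix c i assume c: "\<forall>i\<in>B. c i \<in> K" "(\<Sum>i\<in>B. c i * v i) = 0" and i: "i \<in> B" "c i \<noteq> 0"
    have "c i * v i + (\<Sum>j\<in>B - {i}. c j * v j) = 0" using c(2) i fB by (subst (asm) sum.remove[of B i]) auto
    then have "c i * v i = - (\<Sum>j\<in>B - {i}. c j * v j)" by (rule eq_neg_iff_add_eq_0[THEN iffD2])
    then have "v i = inverse (c i) * (- (\<Sum>j\<in>B - {i}. c j * v j))" using i(2) by (metis mult.assoc left_inverse mult_1)
    also have "\<dots> \<in> kspan K v (B - {i})"
      by (intro kspan_scale kspan_uminus) (use c i Kcl in \<open>auto simp: kspan_def\<close>)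
    finally have vi: "v i \<in> kspan K v (B - {i})" .
    have "v j \<in> kspan K v (B - {i})" if "j \<in> B" for j using vi fB that by (cases "j = i") (auto intro: kspan_base)
    then have "P (B - {i})" using B(1) unfolding P_def by (auto intro: kspan_subspan[of B v v "B - {i}"])
    then show False using B(2)[of "B - {i}"] i fB by (metis card_Diff1_less not_less)
  qed
  then show ?thesis using B(1) that unfolding P_def by blast
qed

text \<open>
  The family \<open>v\<close> is in general position, that is, any \<open>n + 1\<close> members span, and it has
  at least \<open>2 * n + 3 - card B\<close> members. This is exactly what prevents it from splitting into two
  families with independent spans, so that a span can always be enlarged by a new relation that
  meets it in a nonzero vector.
\<close>

lemma spanning_chain:
  fixes v :: "'i \<Rightarrow> 'a" and w :: "'j \<Rightarrow> 'a"
  assumes J: "finite J" "i1 \<in> J" and v0: "\<And>i. i \<in> J \<Longrightarrow> v i \<noteq> 0"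
    and T: "finite T" "B \<subseteq> T" "kindep K w B" "\<And>l. l \<in> T \<Longrightarrow> w l \<in> kspan K w B" "card T = n + 1"
    and vw: "\<And>i. i \<in> J \<Longrightarrow> v i \<in> kspan K w T"
    and gp: "\<And>S l. S \<subseteq> J \<Longrightarrow> card S = n + 1 \<Longrightarrow> l \<in> T \<Longrightarrow> w l \<in> kspan K v S"
    and card: "2 * n + 3 \<le> card J + card B"
    and Q1: "Q {i1}"
    and step: "\<And>I I' c e. I \<subseteq> J \<Longrightarrow> I' \<subseteq> J \<Longrightarrow> I \<inter> I' = {} \<Longrightarrow> I \<noteq> {} \<Longrightarrow> I' \<noteq> {} \<Longrightarrow> Q I \<Longrightarrow>
       (\<And>i. i \<in> I' \<Longrightarrow> c i \<in> K \<and> c i \<noteq> 0) \<Longrightarrow> (\<And>i. i \<in> I \<Longrightarrow> e i \<in> K) \<Longrightarrow>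
       (\<Sum>i\<in>I'. c i * v i) = (\<Sum>i\<in>I. e i * v i) \<Longrightarrow> (\<Sum>i\<in>I. e i * v i) \<noteq> 0 \<Longrightarrow> kindep K v I' \<Longrightarrow> card I' \<le> card B \<Longrightarrow>
       Q (I \<union> I')"
  shows "\<exists>I\<subseteq>J. I \<noteq> {} \<and> Q I \<and> (\<forall>l\<in>T. w l \<in> kspan K v I)"
proof -
  define P where "P = (\<lambda>I. I \<subseteq> J \<and> i1 \<in> I \<and> Q I)"
  have "P {i1}" using J Q1 by (simp add: P_def)
  moreover have "\<forall>I. P I \<longrightarrow> card I < Suc (card J)" using J by (auto simp: P_def less_Suc_eq_le intro: card_mono)
  ultimately obtain I where I: "P I" "\<And>I'. P I' \<Longrightarrow> card I' \<le> card I"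
    using ex_has_greatest_nat[of P "{i1}" card "Suc (card J)"] by blast
  have IJ: "I \<subseteq> J" "i1 \<in> I" "Q I" using I(1) by (auto simp: P_def)
  have fI: "finite I" using IJ J finite_subset by blast
  have fB: "finite B" using T finite_subset by blast
  have Bn: "card B \<le> n + 1" using T card_mono by metis
  have vB: "v i \<in> kspan K w B" if "i \<in> J" for i using kspan_subspan[OF T(4) vw[OF that]] .
  show ?thesis
  proof (rule ccontr)
    assume "\<not> ?thesis"
    then obtain l where l: "l \<in> T" "w l \<notin> kspan K v I" using IJ by blast
    define W where "W = kspan K v I"
    define S where "S = {i\<in>J. v i \<in> W}"
    define R where "R = J - S"
    have IS: "I \<subseteq> S" using IJ kspan_base[OF fI] by (auto simp: S_def W_def)
    have fS: "finite S" and fR: "finite R" and SJ: "S \<subseteq> J" and RJ: "R \<subseteq> J" using J by (auto simp: S_def R_def)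
    have cJ: "card S + card R = card J" using fS fR J SJ unfolding R_def by (simp add: card_Diff_subset card_mono)
    have sub: "kspan K v S \<subseteq> W" unfolding W_def using kspan_subspan[of S v v I] by (auto simp: S_def W_def)
    have cS: "card S \<le> n"
    proof (rule ccontr)
      assume "\<not> ?thesis"
      then obtain S' where S': "S' \<subseteq> S" "card S' = n + 1" using obtain_subset_with_card_n[of "n + 1" S] by auto
      then have "w l \<in> kspan K v S'" using gp SJ l by blast
      then have "w l \<in> kspan K v S" using kspan_mono[OF fS S'(1)] by blast
      then show False using sub l W_def by blast
    qed
    have "\<exists>x. x \<noteq> 0 \<and> x \<in> W \<and> x \<in> kspan K v R"
    proof (rule ccontr)
      assume "\<not> ?thesis"
      then have triv: "\<And>x. x \<in> W \<Longrightarrow> x \<in> kspan K v R \<Longrightarrow> x = 0" by blast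
      have cR: "card R \<le> n"
      proof (rule ccontr)
        assume "\<not> ?thesis"
        then obtain R' where R': "R' \<subseteq> R" "card R' = n + 1" using obtain_subset_with_card_n[of "n + 1" R] by auto
        then have "w l \<in> kspan K v R" if "l \<in> T" for l using gp[of R' l] RJ that kspan_mono[OF fR R'(1)] by blast
        then have "v i1 \<in> kspan K v R" using kspan_subspan[of T w v R] vw J by blast
        moreover have "v i1 \<in> W" using IS IJ by (auto simp: S_def)
        ultimately show False using triv v0 J by blast
      qed
      obtain BS where BS: "BS \<subseteq> S" "kindep K v BS" "\<And>i. i \<in> S \<Longrightarrow> v i \<in> kspan K v BS" using kspan_basis_exists[OF fS] by blast
      obtain BR where BR: "BR \<subseteq> R" "kindep K v BR" "\<And>i. i \<in> R \<Longrightarrow> v i \<in> kspan K v BR" using kspan_basis_exists[OF fR] by blast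
      have fBS: "finite BS" "finite BR" using BS BR fS fR finite_subset by blast+
      have disj: "BS \<inter> BR = {}" using BS BR by (auto simp: R_def)
      have "kindep K v (BS \<union> BR)" unfolding kindep_def
      proof (intro allI impI)
        fix c assume c: "\<forall>i\<in>BS \<union> BR. c i \<in> K" "(\<Sum>i\<in>BS \<union> BR. c i * v i) = 0"
        have s0: "(\<Sum>i\<in>BS. c i * v i) + (\<Sum>i\<in>BR. c i * v i) = 0" using c(2) fBS disj by (simp add: sum.union_disjoint)
        have k1: "(\<Sum>i\<in>BS. c i * v i) \<in> kspan K v BS" and k2: "(\<Sum>i\<in>BR. c i * v i) \<in> kspan K v BR"
          unfolding kspan_def using c by blast+
        have "(\<Sum>i\<in>BS. c i * v i) \<in> W" using kspan_mono[OF fS BS(1) k1] sub by blast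
        moreover have "(\<Sum>i\<in>BS. c i * v i) = - (\<Sum>i\<in>BR. c i * v i)" using s0 by (rule eq_neg_iff_add_eq_0[THEN iffD2])
        moreover have "- (\<Sum>i\<in>BR. c i * v i) \<in> kspan K v R" using kspan_uminus[OF kspan_mono[OF fR BR(1) k2]] .
        ultimately have z: "(\<Sum>i\<in>BS. c i * v i) = 0" using triv by metis
        then have "(\<Sum>i\<in>BR. c i * v i) = 0" using s0 by simp
        then show "\<forall>i\<in>BS \<union> BR. c i = 0" using z BS(2) BR(2) c(1) unfolding kindep_def by blast
      qed
      then have le: "card BS + card BR \<le> card B"
        using steinitz[OF fB _ _ , of "BS \<union> BR" v w] vB BS BR SJ RJ fBS disj by (simp add: card_Un_disjoint) blast
      have ge: "card B \<le> card BX + (n + 1 - card X)" if X: "X \<subseteq> J" "card X \<le> n" "BX \<subseteq> X" "\<And>i. i \<in> X \<Longrightarrow> v i \<in> kspan K v BX" for X BX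
      proof -
        have fX: "finite X" "finite BX" using X J finite_subset by metis+
        have "n + 1 - card X \<le> card (J - X)" using card Bn X fX by (simp add: card_Diff_subset)
        then obtain X' where X': "X' \<subseteq> J - X" "card X' = n + 1 - card X" "finite X'"
          using obtain_subset_with_card_n by metis
        have cXX: "card (X \<union> X') = n + 1" using X' X fX by (subst card_Un_disjoint) auto
        have "w l \<in> kspan K v (BX \<union> X')" if "l \<in> B" for l
        proof (rule kspan_subspan[of "X \<union> X'" v])
          show "w l \<in> kspan K v (X \<union> X')" using gp[OF _ cXX, of l] X X' that T by blast
          show "v j \<in> kspan K v (BX \<union> X')" if "j \<in> X \<union> X'" for j
            using that X(4)[of j] kspan_mono[of "BX \<union> X'" BX "v j" v] kspan_base[of "BX \<union> X'" j v] fX X'(3) by auto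
        qed
        then have "card B \<le> card (BX \<union> X')" using steinitz[of "BX \<union> X'" B w v] fX X' fB T by auto
        also have "\<dots> \<le> card BX + card X'" by (rule card_Un_le)
        finally show ?thesis using X' by simp
      qed
      have "card B \<le> card BS + (n + 1 - card S)" using ge[OF SJ cS BS(1,3)] .
      moreover have "card B \<le> card BR + (n + 1 - card R)" using ge[OF RJ cR BR(1,3)] .
      ultimately show False using le cS cR cJ card by linarith
    qed
    then obtain x0 where x0: "x0 \<noteq> 0" "x0 \<in> W" "x0 \<in> kspan K v R" by blast
    define P' where "P' = (\<lambda>I'. I' \<subseteq> R \<and> (\<exists>x. x \<noteq> 0 \<and> x \<in> W \<and> x \<in> kspan K v I'))"
    have "P' R" using x0 by (auto simp: P'_def)
    then obtain I' where I': "P' I'" "\<And>I''. P' I'' \<Longrightarrow> card I' \<le> card I''"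
      using ex_has_least_nat[of P' R card] by blast
    have I'R: "I' \<subseteq> R" using I'(1) by (simp add: P'_def)
    have fI': "finite I'" using I'R fR finite_subset by blast
    obtain x where x: "x \<noteq> 0" "x \<in> W" "x \<in> kspan K v I'" using I'(1) by (auto simp: P'_def)
    obtain c where c: "\<forall>i\<in>I'. c i \<in> K" "x = (\<Sum>i\<in>I'. c i * v i)" using x(3) unfolding kspan_def by blast
    obtain e where e: "\<forall>i\<in>I. e i \<in> K" "x = (\<Sum>i\<in>I. e i * v i)" using x(2) unfolding kspan_def W_def by blast
    have smaller: "y = 0" if "y \<in> W" "y \<in> kspan K v (I' - {j})" "j \<in> I'" for y j
    proof (rule ccontr)
      assume "y \<noteq> 0"
      then have "P' (I' - {j})" using that I'R by (auto simp: P'_def)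
      then show False using I'(2)[of "I' - {j}"] that fI' by (metis card_Diff1_less not_less)
    qed
    have c0: "c i \<noteq> 0" if i: "i \<in> I'" for i
    proof
      assume "c i = 0"
      then have "x = (\<Sum>i\<in>I' - {i}. c i * v i)" unfolding c(2) using i fI' by (subst sum.remove[of I' i]) auto
      then have "x \<in> kspan K v (I' - {i})" unfolding kspan_def using c(1) by blast
      then show False using smaller[OF x(2) _ i] x(1) by blast
    qed
    have ind: "kindep K v I'" unfolding kindep_def
    proof (intro allI impI ballI, rule ccontr)
      fix b i assume b: "\<forall>i\<in>I'. b i \<in> K" "(\<Sum>i\<in>I'. b i * v i) = 0" and i: "i \<in> I'" "b i \<noteq> 0"
      define a where "a = (\<lambda>j. c j - c i / b i * b j)"
      have "x = (\<Sum>j\<in>I'. a j * v j)"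
        using b(2) by (simp add: a_def left_diff_distrib sum_subtractf c(2) mult.assoc sum_distrib_left[symmetric] sum_divide_distrib[symmetric])
      also have "\<dots> = (\<Sum>j\<in>I' - {i}. a j * v j)" using i fI' by (subst sum.remove[of I' i]) (auto simp: a_def)
      finally have "x \<in> kspan K v (I' - {i})"
        unfolding kspan_def using c(1) b(1) i Kcl by (auto intro!: exI[of _ a] simp: a_def)
      then show False using smaller[OF x(2) _ i(1)] x(1) by blast
    qed
    have I'0: "I' \<noteq> {}" using c x(1) by auto
    then obtain j where j: "j \<in> I'" by blast
    have i1n: "i1 \<notin> I'" using IJ IS I'R by (auto simp: R_def)
    have "card (insert i1 (I' - {j})) \<le> card B"
    proof (rule steinitz[OF fB])
      show "finite (insert i1 (I' - {j}))" using fI' by simp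
      show "v i \<in> kspan K w B" if "i \<in> insert i1 (I' - {j})" for i using that vB J I'R RJ by blast
      show "kindep K v (insert i1 (I' - {j}))" unfolding kindep_def
      proof (intro allI impI)
        fix b assume b: "\<forall>i\<in>insert i1 (I' - {j}). b i \<in> K" "(\<Sum>i\<in>insert i1 (I' - {j}). b i * v i) = 0"
        have s: "b i1 * v i1 + (\<Sum>i\<in>I' - {j}. b i * v i) = 0" using b(2) fI' i1n by simp
        have y1: "(\<Sum>i\<in>I' - {j}. b i * v i) \<in> kspan K v (I' - {j})" unfolding kspan_def using b(1) by blast
        have "(\<Sum>i\<in>I' - {j}. b i * v i) = - (b i1 * v i1)" using s by (simp add: eq_neg_iff_add_eq_0 add.commute)
        moreover have "- (b i1 * v i1) \<in> W" unfolding W_def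
          by (intro kspan_uminus kspan_scale kspan_base fI IJ) (use b in auto)
        ultimately have z: "(\<Sum>i\<in>I' - {j}. b i * v i) = 0" using smaller[OF _ y1 j] by simp
        have "kindep K v (I' - {j})" by (rule kindep_subset[OF ind _ fI']) auto
        then have "\<forall>i\<in>I' - {j}. b i = 0" using z b(1) unfolding kindep_def by blast
        moreover have "b i1 = 0" using s z v0 J by simp
        ultimately show "\<forall>i\<in>insert i1 (I' - {j}). b i = 0" by blast
      qed
    qed
    then have cI': "card I' \<le> card B" using i1n fI' j by (simp add: card_Diff_singleton)
    have dI: "I \<inter> I' = {}" using IS I'R by (auto simp: R_def)
    have "Q (I \<union> I')"
      by (rule step[of I I' c e]) (use IJ I'R RJ dI I'0 c c0 e x ind cI' in auto)
    then have "P (I \<union> I')" using IJ I'R RJ by (auto simp: P_def)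
    then have "card (I \<union> I') \<le> card I" by (rule I(2))
    moreover have "card (I \<union> I') = card I + card I'" by (rule card_Un_disjoint[OF fI fI' dI])
    moreover have "card I' > 0" using I'0 fI' by (simp add: card_gt_0_iff)
    ultimately show False by simp
  qed
qed

end

section \<open>Small functions\<close>

definition small_entire :: "(complex \<Rightarrow> real) \<Rightarrow> nat \<Rightarrow> (complex \<Rightarrow> complex) \<Rightarrow> bool" where
  "small_entire P m h \<longleftrightarrow> h holomorphic_on UNIV \<and> (\<exists>C. \<forall>z. cmod (h z) \<le> C * P z ^ m)"

definition small_field :: "(complex \<Rightarrow> real) \<Rightarrow> complex fls set" where
  "small_field P = {x. \<exists>m h g. small_entire P m h \<and> small_entire P m g \<and> nz_entire g \<and> x * entire_fls g = entire_fls h}"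

context
  fixes P :: "complex \<Rightarrow> real"
  assumes P: "\<And>z. P z > 0"
begin

lemma small_entire_holo: "small_entire P m h \<Longrightarrow> h holomorphic_on UNIV" by (simp add: small_entire_def)

lemma small_entire_bound:
  assumes "small_entire P m h" obtains C where "C > 0" "\<And>z. cmod (h z) \<le> C * P z ^ m"
proof -
  obtain C where C: "\<And>z. cmod (h z) \<le> C * P z ^ m" using assms by (auto simp: small_entire_def)
  have "cmod (h z) \<le> (\<bar>C\<bar> + 1) * P z ^ m" for z
  proof -
    have "C * P z ^ m \<le> (\<bar>C\<bar> + 1) * P z ^ m" by (rule mult_right_mono) (use P[of z] in \<open>auto simp: less_imp_le\<close>)
    then show ?thesis using C[of z] by linarith
  qed
  then show ?thesis by (intro that[of "\<bar>C\<bar> + 1"]) auto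
qed

lemma small_entire_const: "small_entire P 0 (\<lambda>_. c)"
  unfolding small_entire_def by auto

lemma small_entire_add:
  assumes "small_entire P m h" "small_entire P m g" shows "small_entire P m (\<lambda>z. h z + g z)"
proof -
  obtain C D where "\<And>z. cmod (h z) \<le> C * P z ^ m" "\<And>z. cmod (g z) \<le> D * P z ^ m" using assms by (auto simp: small_entire_def)
  then have "cmod (h z + g z) \<le> (C + D) * P z ^ m" for z
    using norm_triangle_ineq[of "h z" "g z"] by (smt (verit) distrib_right)
  then show ?thesis using assms unfolding small_entire_def by (auto intro!: holomorphic_intros)
qed

lemma small_entire_mult:
  assumes "small_entire P m h" "small_entire P m' g" shows "small_entire P (m + m') (\<lambda>z. h z * g z)"
proof -
  obtain C where C: "C > 0" "\<And>z. cmod (h z) \<le> C * P z ^ m" using small_entire_bound[OF assms(1)] by blast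
  obtain D where D: "D > 0" "\<And>z. cmod (g z) \<le> D * P z ^ m'" using small_entire_bound[OF assms(2)] by blast
  have "cmod (h z * g z) \<le> (C * P z ^ m) * (D * P z ^ m')" for z
    unfolding norm_mult using C D P[of z] by (intro mult_mono) (auto simp: less_imp_le)
  then have "cmod (h z * g z) \<le> (C * D) * P z ^ (m + m')" for z by (simp add: power_add mult_ac)
  then show ?thesis using assms unfolding small_entire_def by (auto intro!: holomorphic_intros)
qed

lemma small_fieldI:
  "small_entire P m h \<Longrightarrow> small_entire P m g \<Longrightarrow> nz_entire g \<Longrightarrow> x * entire_fls g = entire_fls h \<Longrightarrow> x \<in> small_field P"
  unfolding small_field_def by blast

lemma small_field_const: "fls_const c \<in> small_field P"
  by (rule small_fieldI[OF small_entire_const[of c] small_entire_const[of 1]])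
     (auto simp: entire_fls_const nz_entire_const)

lemma small_field_closed: "closed_subfield (small_field P)"
  unfolding closed_subfield_def
proof (intro conjI ballI)
  show "0 \<in> small_field P" "1 \<in> small_field P" using small_field_const[of 0] small_field_const[of 1] by auto
next
  fix x y assume "x \<in> small_field P" "y \<in> small_field P"
  then obtain m h g m' h' g' where x: "small_entire P m h" "small_entire P m g" "nz_entire g" "x * entire_fls g = entire_fls h"
    and y: "small_entire P m' h'" "small_entire P m' g'" "nz_entire g'" "y * entire_fls g' = entire_fls h'"
    unfolding small_field_def by blast
  note hol = x(1,2)[THEN small_entire_holo] y(1,2)[THEN small_entire_holo]
  have g: "small_entire P (m + m') (\<lambda>z. g z * g' z)" "nz_entire (\<lambda>z. g z * g' z)"
    using small_entire_mult[OF x(2) y(2)] vanish_order_mult(1)[OF x(3) y(3)] by auto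
  have a: "small_entire P (m + m') (\<lambda>z. h z * g' z + g z * h' z)"
    by (intro small_entire_add small_entire_mult x y)
  show "x + y \<in> small_field P"
  proof (rule small_fieldI[OF a g])
    have "entire_fls (\<lambda>z. h z * g' z + g z * h' z) = entire_fls h * entire_fls g' + entire_fls g * entire_fls h'"
      by (simp add: entire_fls_add entire_fls_mult hol holomorphic_on_mult)
    then show "(x + y) * entire_fls (\<lambda>z. g z * g' z) = entire_fls (\<lambda>z. h z * g' z + g z * h' z)"
      by (simp add: entire_fls_mult hol x(4)[symmetric] y(4)[symmetric] algebra_simps)
  qed
  show "x * y \<in> small_field P"
  proof (rule small_fieldI[OF small_entire_mult[OF x(1) y(1)] g])
    show "(x * y) * entire_fls (\<lambda>z. g z * g' z) = entire_fls (\<lambda>z. h z * h' z)"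
      by (simp add: entire_fls_mult hol x(4)[symmetric] y(4)[symmetric] algebra_simps)
  qed
next
  fix x assume "x \<in> small_field P"
  then obtain m h g where x: "small_entire P m h" "small_entire P m g" "nz_entire g" "x * entire_fls g = entire_fls h"
    unfolding small_field_def by blast
  note hol = x(1,2)[THEN small_entire_holo]
  show "- x \<in> small_field P"
  proof (rule small_fieldI[OF _ x(2,3)])
    show "small_entire P m (\<lambda>z. (-1) * h z)" using small_entire_mult[OF small_entire_const[of "-1"] x(1)] by simp
    have "entire_fls (\<lambda>z. (-1) * h z) = entire_fls (\<lambda>z. -1) * entire_fls h" by (rule entire_fls_mult) (use hol in auto)
    then show "- x * entire_fls g = entire_fls (\<lambda>z. (-1) * h z)" by (simp add: entire_fls_const x(4))
  qed
  show "inverse x \<in> small_field P"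
  proof (cases "x = 0")
    case True then show ?thesis using small_field_const[of 0] by simp
  next
    case False
    have "entire_fls g \<noteq> 0" by (rule entire_fls_nz[OF x(3)])
    then have hne: "entire_fls h \<noteq> 0" using False x(4) by (metis mult_eq_0_iff)
    have "nz_entire h"
    proof (rule ccontr)
      assume "\<not> nz_entire h"
      then have "h = (\<lambda>_. 0)" using hol by (auto simp: nz_entire_def)
      then show False using hne entire_fls_const[of 0] by simp
    qed
    then show ?thesis
      by (rule small_fieldI[OF x(2,1)]) (use x(4) False in \<open>simp add: x(4)[symmetric]\<close>)
  qed
qed

lemma small_field_common_denominator:
  assumes "finite I" "\<And>i. i \<in> I \<Longrightarrow> x i \<in> small_field P"
  obtains m g h where "small_entire P m g" "nz_entire g" "\<And>i. i \<in> I \<Longrightarrow> small_entire P m (h i)"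
    "\<And>i. i \<in> I \<Longrightarrow> x i * entire_fls g = entire_fls (h i)"
  using assms
proof (induction I arbitrary: thesis rule: finite_induct)
  case empty
  show ?case by (rule empty.prems(1)[OF small_entire_const[of 1] nz_entire_const]) auto
next
  case (insert i I)
  obtain m g h where g: "small_entire P m g" "nz_entire g" "\<And>i. i \<in> I \<Longrightarrow> small_entire P m (h i)"
    "\<And>i. i \<in> I \<Longrightarrow> x i * entire_fls g = entire_fls (h i)" using insert.IH insert.prems by blast
  obtain m' h' g' where g': "small_entire P m' h'" "small_entire P m' g'" "nz_entire g'" "x i * entire_fls g' = entire_fls h'"
    using insert.prems(2)[of i] unfolding small_field_def by blast
  note hol = g(1)[THEN small_entire_holo] g'(1,2)[THEN small_entire_holo]
  define H where "H = (\<lambda>j. if j = i then (\<lambda>z. g z * h' z) else (\<lambda>z. h j z * g' z))"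
  show ?case
  proof (rule insert.prems(1))
    show "small_entire P (m + m') (\<lambda>z. g z * g' z)" "nz_entire (\<lambda>z. g z * g' z)"
      using small_entire_mult[OF g(1) g'(2)] vanish_order_mult(1)[OF g(2) g'(3)] by auto
    fix j assume j: "j \<in> insert i I"
    show "small_entire P (m + m') (H j)"
      using j g g' by (auto simp: H_def intro: small_entire_mult)
    show "x j * entire_fls (\<lambda>z. g z * g' z) = entire_fls (H j)"
    proof (cases "j = i")
      case True then show ?thesis by (simp add: H_def entire_fls_mult hol g'(4)[symmetric] mult_ac)
    next
      case False
      then have "j \<in> I" using j by simp
      then show ?thesis using False g(3)[THEN small_entire_holo]
        by (simp add: H_def entire_fls_mult hol g(4)[symmetric] mult_ac)
    qed
  qed
qed

end

lemma closed_subfield_det: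
  assumes K: "closed_subfield K" and M: "M \<in> carrier_mat s s" "\<And>i j. i < s \<Longrightarrow> j < s \<Longrightarrow> M $$ (i, j) \<in> K"
  shows "Determinant.det M \<in> K"
proof -
  have pl: "p i < s" if "p permutes {0..<s}" "i < s" for p i using permutes_in_image[OF that(1), of i] that(2) by simp
  have "signof p \<in> K" for p :: "nat \<Rightarrow> nat"
    using signof_pm_one[of p, where 'a='a] closed_subfieldD[OF K] by auto
  then show ?thesis unfolding det_def'[OF M(1)]
    by (intro closed_subfield_sum[OF K] closed_subfieldD(4)[OF K] closed_subfield_prod[OF K] M(2)) (auto simp: pl)
qed

lemma kspan_of_invertible:
  fixes M :: "'a::field mat"
  assumes K: "closed_subfield K" and M: "M \<in> carrier_mat s s" "\<And>i j. i < s \<Longrightarrow> j < s \<Longrightarrow> M $$ (i, j) \<in> K"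
    and d: "Determinant.det M \<noteq> 0" and v: "\<And>i. i < s \<Longrightarrow> v i = (\<Sum>l<s. M $$ (i, l) * w l)" and l: "l < s"
  shows "w l \<in> kspan K v {..<s}"
proof -
  define wv where "wv = Matrix.vec s w"
  define vv where "vv = Matrix.vec s v"
  have wv: "wv \<in> carrier_vec s" by (simp add: wv_def)
  have "M *\<^sub>v wv = vv"
    by (rule eq_vecI) (use M v in \<open>auto simp: wv_def vv_def scalar_prod_def lessThan_atLeast0 intro!: sum.cong\<close>)
  then have "adj_mat M *\<^sub>v vv = (adj_mat M * M) *\<^sub>v wv"
    using adj_mat[OF M(1)] M wv by (metis assoc_mult_mat_vec)
  also have "\<dots> = Determinant.det M \<cdot>\<^sub>v wv" unfolding adj_mat(3)[OF M(1)]
    by (rule eq_vecI) (use wv in auto)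
  finally have "(adj_mat M *\<^sub>v vv) $ l = Determinant.det M * w l" using l by (simp add: wv_def)
  moreover have "(adj_mat M *\<^sub>v vv) $ l = (\<Sum>j<s. adj_mat M $$ (l, j) * v j)"
    using l adj_mat(1)[OF M(1)] by (auto simp: vv_def scalar_prod_def lessThan_atLeast0 intro!: sum.cong)
  ultimately have "Determinant.det M * w l = (\<Sum>j<s. adj_mat M $$ (l, j) * v j)" by simp
  then have eq: "w l = (\<Sum>j<s. (adj_mat M $$ (l, j) / Determinant.det M) * v j)"
    using d by (simp add: sum_divide_distrib[symmetric] nonzero_eq_divide_eq mult.commute)
  have dK: "Determinant.det M \<in> K" by (rule closed_subfield_det[OF K M])
  have "adj_mat M $$ (l, j) \<in> K" if j: "j < s" for j
  proof -
    have "adj_mat M $$ (l, j) = cofactor M j l" using M l j by (simp add: adj_mat_def)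
    also have "\<dots> = (-1) ^ (j + l) * Determinant.det (mat_delete M j l)" by (simp add: cofactor_def)
    also have "\<dots> \<in> K"
    proof (rule closed_subfieldD(4)[OF K])
      show "(-1) ^ (j + l) \<in> K" using closed_subfieldD[OF K] by (cases "even (j + l)") auto
      show "Determinant.det (mat_delete M j l) \<in> K"
        by (rule closed_subfield_det[OF K, of _ "s - 1"])
           (use M in \<open>auto simp: mat_delete_def intro!: M(2)\<close>)
    qed
    finally show ?thesis .
  qed
  then show ?thesis unfolding kspan_def using eq dK closed_subfieldD(8)[OF K]
    by (auto intro!: exI[of _ "\<lambda>j. adj_mat M $$ (l, j) / Determinant.det M"])
qed

lemma kspan_reindex:
  assumes "bij_betw \<sigma> T S" "x \<in> kspan K (\<lambda>j. v (\<sigma> j)) T" shows "x \<in> kspan K v S"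
proof -
  obtain c where c: "\<forall>j\<in>T. c j \<in> K" "x = (\<Sum>j\<in>T. c j * v (\<sigma> j))" using assms(2) unfolding kspan_def by blast
  define d where "d = (\<lambda>i. c (the_inv_into T \<sigma> i))"
  have inj: "inj_on \<sigma> T" and im: "\<sigma> ` T = S" using assms(1) by (auto simp: bij_betw_def)
  have ds: "d (\<sigma> j) = c j" if "j \<in> T" for j using the_inv_into_f_f[OF inj that] by (simp add: d_def)
  have "x = (\<Sum>i\<in>S. d i * v i)" unfolding im[symmetric] sum.reindex[OF inj] c(2) by (intro sum.cong refl) (simp add: ds)
  moreover have "\<forall>i\<in>S. d i \<in> K" using c(1) ds im by auto
  ultimately show ?thesis unfolding kspan_def by blast
qed

section \<open>Moving targets\<close>

lemma continuous_on_Max_image: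
  fixes f :: "'i \<Rightarrow> 'a::topological_space \<Rightarrow> real"
  assumes "finite I" "I \<noteq> {}" "\<And>i. i \<in> I \<Longrightarrow> continuous_on S (f i)"
  shows "continuous_on S (\<lambda>z. Max ((\<lambda>i. f i z) ` I))"
  using assms
proof (induction I rule: finite_ne_induct)
  case (singleton i) then show ?case by simp
next
  case (insert i I)
  have "continuous_on S (\<lambda>z. max (f i z) (Max ((\<lambda>i. f i z) ` I)))"
    by (rule continuous_on_max) (use insert.IH insert.prems in auto)
  moreover have "Max ((\<lambda>i. f i z) ` insert i I) = max (f i z) (Max ((\<lambda>i. f i z) ` I))" for z
    using insert.hyps by simp
  ultimately show ?case by presburger
qed

text \<open>
  The contribution of a point, at which the members of a family vanish to the orders \<open>\<nu>\<close>, to the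
  bound for the mean of the logarithm of their maximum. The common zeros have to be counted without
  truncation until the family is large enough to have none.
\<close>

definition family_mult :: "nat \<Rightarrow> 'i set \<Rightarrow> ('i \<Rightarrow> nat) \<Rightarrow> nat" where
  "family_mult k I \<nu> = Min (\<nu> ` I) + (\<Sum>i\<in>I. min (\<nu> i - Min (\<nu> ` I)) k)"

lemma family_mult_step:
  fixes \<nu> :: "'i \<Rightarrow> nat"
  assumes I: "finite I" "I \<noteq> {}" "finite I'" "I' \<noteq> {}" "I \<inter> I' = {}" and s: "s = card I'" "s \<le> k + 1"
    and H1: "\<And>\<mu>. \<mu> = Min (\<nu> ` I) \<Longrightarrow> (\<And>i. i \<in> I' \<Longrightarrow> \<mu> \<le> \<nu> i) \<Longrightarrow> s * \<mu> + (\<Sum>i\<in>I'. \<nu> i - \<mu> - (s - 1)) \<le> W"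
    and H2: "\<And>j \<mu>. j \<in> I' \<Longrightarrow> \<mu> = \<nu> j \<Longrightarrow> \<mu> < Min (\<nu> ` I) \<Longrightarrow> (\<And>i. i \<in> I' \<Longrightarrow> \<mu> \<le> \<nu> i) \<Longrightarrow>
        s * \<mu> + (\<Sum>i\<in>I' - {j}. \<nu> i - \<mu> - (s - 1)) + (Min (\<nu> ` I) - \<mu> - (s - 1)) \<le> W"
  shows "family_mult k I \<nu> + (\<Sum>i\<in>I'. \<nu> i) \<le> family_mult k (I \<union> I') \<nu> + W"
proof -
  define M where "M = Min (\<nu> ` I)"
  define m where "m = Min (\<nu> ` I')"
  have Mle: "M \<le> \<nu> i" if "i \<in> I" for i using that I by (simp add: M_def)
  have mL: "m \<le> \<nu> i" if "i \<in> I'" for i using that I by (simp add: m_def)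
  have U: "Min (\<nu> ` (I \<union> I')) = min M m" unfolding image_Un M_def m_def by (rule Min_Un) (use I in auto)
  have split: "x - \<mu> \<le> min (x - \<mu>) k + (x - \<mu> - (s - 1))" for x \<mu> :: nat using s by linarith
  show ?thesis
  proof (cases "M \<le> m")
    case True
    have le: "M \<le> \<nu> i" if "i \<in> I'" for i using mL[OF that] True by simp
    have "(\<Sum>i\<in>I'. \<nu> i) = s * M + (\<Sum>i\<in>I'. \<nu> i - M)"
    proof -
      have "(\<Sum>i\<in>I'. \<nu> i) = (\<Sum>i\<in>I'. M + (\<nu> i - M))" by (intro sum.cong refl) (use le in auto)
      then show ?thesis using s by (simp add: sum.distrib)
    qed
    also have "(\<Sum>i\<in>I'. \<nu> i - M) \<le> (\<Sum>i\<in>I'. min (\<nu> i - M) k) + (\<Sum>i\<in>I'. \<nu> i - M - (s - 1))"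
      unfolding sum.distrib[symmetric] by (intro sum_mono split)
    finally have "(\<Sum>i\<in>I'. \<nu> i) \<le> (\<Sum>i\<in>I'. min (\<nu> i - M) k) + W"
      using H1[OF M_def le] by linarith
    moreover have "family_mult k (I \<union> I') \<nu> = M + (\<Sum>i\<in>I. min (\<nu> i - M) k) + (\<Sum>i\<in>I'. min (\<nu> i - M) k)"
      unfolding family_mult_def U using True I by (simp add: sum.union_disjoint min_def)
    ultimately show ?thesis unfolding family_mult_def M_def[symmetric] by linarith
  next
    case False
    then have mM: "m < M" by simp
    have "m \<in> \<nu> ` I'" unfolding m_def by (rule Min_in) (use I in auto)
    then obtain j where j: "j \<in> I'" "\<nu> j = m" by force
    have "M \<in> \<nu> ` I" unfolding M_def by (rule Min_in) (use I in auto)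
    then obtain i0 where i0: "i0 \<in> I" "\<nu> i0 = M" by force
    have "(\<Sum>i\<in>I'. \<nu> i) = s * m + (\<Sum>i\<in>I'. \<nu> i - m)"
    proof -
      have "(\<Sum>i\<in>I'. \<nu> i) = (\<Sum>i\<in>I'. m + (\<nu> i - m))" by (intro sum.cong refl) (use mL in auto)
      then show ?thesis using s by (simp add: sum.distrib)
    qed
    also have "(\<Sum>i\<in>I'. \<nu> i - m) = (\<Sum>i\<in>I' - {j}. \<nu> i - m)" using j I by (subst sum.remove[of I' j]) auto
    also have "\<dots> \<le> (\<Sum>i\<in>I' - {j}. min (\<nu> i - m) k) + (\<Sum>i\<in>I' - {j}. \<nu> i - m - (s - 1))"
      unfolding sum.distrib[symmetric] by (intro sum_mono split)
    also have "(\<Sum>i\<in>I' - {j}. min (\<nu> i - m) k) \<le> (\<Sum>i\<in>I'. min (\<nu> i - m) k)" using I by (intro sum_mono2) auto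
    finally have 1: "(\<Sum>i\<in>I'. \<nu> i) + (M - m - (s - 1)) \<le> (\<Sum>i\<in>I'. min (\<nu> i - m) k) + W"
      using H2[OF j(1) j(2)[symmetric]] mM mL unfolding M_def by fastforce
    have "(\<Sum>i\<in>I. min (\<nu> i - M) k) = (\<Sum>i\<in>I - {i0}. min (\<nu> i - M) k)" using i0 I by (subst sum.remove[of I i0]) auto
    also have "\<dots> \<le> (\<Sum>i\<in>I - {i0}. min (\<nu> i - m) k)" using mM by (intro sum_mono) linarith
    finally have "min (M - m) k + (\<Sum>i\<in>I. min (\<nu> i - M) k) \<le> (\<Sum>i\<in>I. min (\<nu> i - m) k)"
      using i0 I by (subst (2) sum.remove[of I i0]) auto
    moreover have "M \<le> m + min (M - m) k + (M - m - (s - 1))" using split[of M m] mM by linarith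
    moreover have "family_mult k (I \<union> I') \<nu> = m + (\<Sum>i\<in>I. min (\<nu> i - m) k) + (\<Sum>i\<in>I'. min (\<nu> i - m) k)"
      unfolding family_mult_def U using mM I by (simp add: sum.union_disjoint min_def)
    ultimately show ?thesis using 1 unfolding family_mult_def M_def[symmetric] by linarith
  qed
qed

lemma family_mult_le:
  assumes "finite I" "I \<noteq> {}" "Min (\<nu> ` I) \<le> d"
  shows "family_mult k I \<nu> \<le> d + (\<Sum>i\<in>I. min (\<nu> i) k)"
  unfolding family_mult_def using assms by (intro add_mono sum_mono) auto

lemma locally_finite_family_mult:
  assumes "finite I" "I \<noteq> {}" "\<And>i. i \<in> I \<Longrightarrow> nz_entire (V i)"
  shows "locally_finite (\<lambda>a. real (family_mult k I (\<lambda>i. vanish_order (V i) a)))"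
proof (rule locally_finite_subset)
  show "locally_finite (\<lambda>a. \<Sum>i\<in>I. real (vanish_order (V i) a))"
    by (intro locally_finite_sum locally_finite_vanish_order assms)
  fix a assume "real (family_mult k I (\<lambda>i. vanish_order (V i) a)) \<noteq> 0"
  moreover have "family_mult k I (\<lambda>i. vanish_order (V i) a) = 0" if "\<forall>i\<in>I. vanish_order (V i) a = 0"
    using that assms by (auto simp: family_mult_def)
  ultimately obtain i where "i \<in> I" "vanish_order (V i) a \<noteq> 0" by auto
  then show "(\<Sum>i\<in>I. real (vanish_order (V i) a)) \<noteq> 0"
    using assms(1) by (subst sum_nonneg_eq_0_iff) auto
qed

locale moving_targets =
  fixes n q :: nat and F :: "nat \<Rightarrow> complex \<Rightarrow> complex" and A :: "nat \<Rightarrow> nat \<Rightarrow> complex \<Rightarrow> complex"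
    and e :: "nat \<Rightarrow> complex \<Rightarrow> complex"
  assumes F: "curve_rep n F" and A: "\<And>i. i \<in> {1..q} \<Longrightarrow> curve_rep n (A i)"
    and e: "\<And>i. i \<in> {1..q} \<Longrightarrow> nz_entire (e i)" "\<And>i z. i \<in> {1..q} \<Longrightarrow> cmod (e i z) \<le> rep_norm n (A i) z"
    and pairing_nz: "\<And>i. i \<in> {1..q} \<Longrightarrow> nz_entire (pairing n F (A i))"
begin

definition P :: "complex \<Rightarrow> real" where "P z = (\<Prod>i\<in>{1..q}. rep_norm n (A i) z)"

definition V :: "nat \<Rightarrow> complex \<Rightarrow> complex" where
  "V i z = pairing n F (A i) z * (\<Prod>j\<in>{1..q} - {i}. e j z)"

definition Asum :: "real \<Rightarrow> real" where "Asum r = (\<Sum>i\<in>{1..q}. characteristic n (A i) r)"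

definition \<tau> :: "real \<Rightarrow> real" where "\<tau> r = 1 + characteristic n F r + Asum r"

lemma P_pos: "P z > 0" unfolding P_def by (intro prod_pos rep_norm_pos A)

lemma ln_P_cont: "continuous_on S (\<lambda>z. ln (P z))"
  using P_pos unfolding P_def by (intro continuous_intros rep_norm_cont A) (auto simp: less_le)

lemma circle_mean_ln_P: "r \<ge> 0 \<Longrightarrow> circle_mean (\<lambda>z. ln (P z)) r = Asum r + circle_mean (\<lambda>z. ln (P z)) 1"
proof -
  have "circle_mean (\<lambda>z. ln (P z)) s = (\<Sum>i\<in>{1..q}. circle_mean (\<lambda>z. ln (rep_norm n (A i) z)) s)" if "s \<ge> 0" for s
  proof -
    have "circle_mean (\<lambda>z. ln (P z)) s = circle_mean (\<lambda>z. \<Sum>i\<in>{1..q}. ln (rep_norm n (A i) z)) s"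
      unfolding P_def by (intro circle_mean_cong ln_prod) (use rep_norm_pos[OF A] in \<open>auto simp: less_le\<close>)
    also have "\<dots> = (\<Sum>i\<in>{1..q}. circle_mean (\<lambda>z. ln (rep_norm n (A i) z)) s)"
      by (rule circle_mean_sum) (use that A ln_rep_norm_cont in auto)
    finally show ?thesis .
  qed
  then show "r \<ge> 0 \<Longrightarrow> ?thesis" unfolding Asum_def characteristic_eq by (simp add: sum_subtractf)
qed

lemma Asum_mono: "1 \<le> r \<Longrightarrow> r \<le> s \<Longrightarrow> Asum r \<le> Asum s"
  unfolding Asum_def by (intro sum_mono characteristic_mono A) auto

lemma Asum_nonneg: "1 \<le> r \<Longrightarrow> Asum r \<ge> 0"
  unfolding Asum_def by (intro sum_nonneg characteristic_mono(1)[OF A]) auto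

lemma \<tau>_mono: "1 \<le> r \<Longrightarrow> r \<le> s \<Longrightarrow> \<tau> r \<le> \<tau> s"
  unfolding \<tau>_def using characteristic_mono(2)[OF F] Asum_mono by (simp add: add_mono)

lemma \<tau>_ge1: "1 \<le> r \<Longrightarrow> \<tau> r \<ge> 1"
  unfolding \<tau>_def using characteristic_mono(1)[OF F, of r r] Asum_nonneg[of r] by simp

lemma V_nz:
  assumes "i \<in> {1..q}"
  shows "nz_entire (V i)" "vanish_order (V i) a = vanish_order (pairing n F (A i)) a + (\<Sum>j\<in>{1..q} - {i}. vanish_order (e j) a)"
proof -
  have p: "nz_entire (\<lambda>z. \<Prod>j\<in>{1..q} - {i}. e j z)" "vanish_order (\<lambda>z. \<Prod>j\<in>{1..q} - {i}. e j z) a = (\<Sum>j\<in>{1..q} - {i}. vanish_order (e j) a)"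
    using vanish_order_prod[of "{1..q} - {i}" e] e by auto
  have eq: "V i = (\<lambda>z. pairing n F (A i) z * (\<Prod>j\<in>{1..q} - {i}. e j z))" by (simp add: V_def fun_eq_iff)
  show "nz_entire (V i)" "vanish_order (V i) a = vanish_order (pairing n F (A i)) a + (\<Sum>j\<in>{1..q} - {i}. vanish_order (e j) a)"
    unfolding eq using vanish_order_mult[OF pairing_nz[OF assms] p(1)] p(2) by auto
qed

lemma V_le: assumes "i \<in> {1..q}" shows "cmod (V i z) \<le> rep_norm n F z * P z"
proof -
  have "cmod (V i z) \<le> (rep_norm n F z * rep_norm n (A i) z) * (\<Prod>j\<in>{1..q} - {i}. rep_norm n (A j) z)"
    unfolding V_def norm_mult prod_norm[symmetric]
    by (intro mult_mono prod_mono pairing_cauchy_schwarz prod_nonneg mult_nonneg_nonneg rep_norm_nonneg) (use e in auto)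
  moreover have "P z = rep_norm n (A i) z * (\<Prod>j\<in>{1..q} - {i}. rep_norm n (A j) z)"
    unfolding P_def by (rule prod.remove) (use assms in auto)
  ultimately show ?thesis by (simp add: mult.assoc)
qed

lemma small_count_fun:
  assumes "small_entire P m h" "nz_entire h"
  shows "\<exists>C\<ge>0. \<forall>r\<ge>1. r \<notin> critical_radii h \<longrightarrow> count_fun h r \<le> C * (1 + Asum r)"
proof -
  obtain C where C: "C > 0" "\<And>z. cmod (h z) \<le> C * P z ^ m" using small_entire_bound[OF P_pos assms(1)] by blast
  obtain c where c: "\<And>r. r \<ge> 1 \<Longrightarrow> r \<notin> critical_radii h \<Longrightarrow> circle_mean (\<lambda>z. ln (cmod (h z))) r = count_fun h r + c"
    using jensen[OF assms(2)] by blast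
  define c1 where "c1 = circle_mean (\<lambda>z. ln (P z)) 1"
  define C' where "C' = \<bar>ln C\<bar> + m * \<bar>c1\<bar> + \<bar>c\<bar> + m"
  have "count_fun h r \<le> C' * (1 + Asum r)" if r: "r \<ge> 1" "r \<notin> critical_radii h" for r
  proof -
    have nz: "h z \<noteq> 0" if "cmod z = r" for z using noncritical_nz[OF r(2) that] .
    have "circle_mean (\<lambda>z. ln (cmod (h z))) r \<le> circle_mean (\<lambda>z. ln C + real m * ln (P z)) r"
    proof (rule circle_mean_mono)
      show "continuous_on (sphere 0 r) (\<lambda>z. ln (cmod (h z)))"
        using nz by (auto intro!: continuous_intros nz_entire_cont[OF assms(2)])
      fix z assume "cmod z = r"
      then have "ln (cmod (h z)) \<le> ln (C * P z ^ m)" using nz C by (intro ln_mono) auto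
      then show "ln (cmod (h z)) \<le> ln C + real m * ln (P z)" using C P_pos[of z] by (simp add: ln_mult_pos ln_realpow)
    qed (use r ln_P_cont in \<open>auto intro!: continuous_on_add continuous_on_mult\<close>)
    also have "\<dots> = ln C + real m * (Asum r + c1)"
      using r ln_P_cont circle_mean_ln_P[of r]
      by (subst circle_mean_add) (auto simp: circle_mean_cmul c1_def intro!: continuous_on_mult)
    finally have "count_fun h r \<le> ln C + real m * Asum r + real m * c1 - c" using c[OF r] by (simp add: distrib_left)
    also have "\<dots> \<le> (\<bar>ln C\<bar> + m * \<bar>c1\<bar> + \<bar>c\<bar>) + real m * Asum r"
    proof -
      have "real m * c1 \<le> m * \<bar>c1\<bar>" by (intro mult_left_mono) auto
      then show ?thesis using abs_ge_self[of "ln C"] abs_ge_minus_self[of c] by linarith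
    qed
    also have "\<dots> \<le> C' * (1 + Asum r)"
    proof -
      have "0 \<le> (\<bar>ln C\<bar> + m * \<bar>c1\<bar> + \<bar>c\<bar>) * Asum r" using Asum_nonneg[OF r(1)] by simp
      then show ?thesis unfolding C'_def by (simp add: algebra_simps)
    qed
    finally show ?thesis .
  qed
  moreover have "C' \<ge> 0" by (simp add: C'_def)
  ultimately show ?thesis by blast
qed

definition controlled :: "nat \<Rightarrow> nat set \<Rightarrow> bool" where
  "controlled k I \<longleftrightarrow> (\<exists>C\<ge>0. outside_finite_measure (\<lambda>r. (\<forall>i\<in>I. r \<notin> critical_radii (V i)) \<and>
     circle_mean (\<lambda>z. Max ((\<lambda>i. ln (cmod (V i z))) ` I)) r
       \<le> divisor_sum (\<lambda>a. real (family_mult k I (\<lambda>i. vanish_order (V i) a))) r + C * (1 + Asum r + ln (\<tau> r))))"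

lemma controlled_singleton:
  assumes "i \<in> {1..q}" shows "controlled k {i}"
proof -
  obtain c where c: "\<And>r. r \<ge> 1 \<Longrightarrow> r \<notin> critical_radii (V i) \<Longrightarrow> circle_mean (\<lambda>z. ln (cmod (V i z))) r = count_fun (V i) r + c"
    using jensen[OF V_nz(1)[OF assms]] by blast
  have "outside_finite_measure (\<lambda>r. (\<forall>i\<in>{i}. r \<notin> critical_radii (V i)) \<and>
     circle_mean (\<lambda>z. Max ((\<lambda>i. ln (cmod (V i z))) ` {i})) r
       \<le> divisor_sum (\<lambda>a. real (family_mult k {i} (\<lambda>i. vanish_order (V i) a))) r + \<bar>c\<bar> * (1 + Asum r + ln (\<tau> r)))"
  proof (rule outside_finite_measure_mono[OF outside_finite_measure_noncritical[OF V_nz(1)[OF assms]]])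
    fix r :: real assume r: "r > 1" "r \<notin> critical_radii (V i)"
    have "\<bar>c\<bar> * 1 \<le> \<bar>c\<bar> * (1 + Asum r + ln (\<tau> r))"
      using Asum_nonneg[of r] \<tau>_ge1[of r] r by (intro mult_left_mono) (auto intro: add_nonneg_nonneg)
    moreover have "(\<lambda>a. real (family_mult k {i} (\<lambda>i. vanish_order (V i) a))) = (\<lambda>a. real (vanish_order (V i) a))"
      by (simp add: family_mult_def)
    ultimately show "(\<forall>i\<in>{i}. r \<notin> critical_radii (V i)) \<and>
     circle_mean (\<lambda>z. Max ((\<lambda>i. ln (cmod (V i z))) ` {i})) r
       \<le> divisor_sum (\<lambda>a. real (family_mult k {i} (\<lambda>i. vanish_order (V i) a))) r + \<bar>c\<bar> * (1 + Asum r + ln (\<tau> r))"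
      using c[of r] r abs_ge_self[of c] by (auto simp: count_fun_def)
  qed
  then show ?thesis unfolding controlled_def by (intro exI[of _ "\<bar>c\<bar>"]) auto
qed

lemma V_holo: "i \<in> {1..q} \<Longrightarrow> V i holomorphic_on UNIV" by (rule nz_entire_holo[OF V_nz(1)])

text \<open>
  One link of the chain. The functions \<open>h i * V i\<close> with \<open>i\<close> in the new family and their
  negative sum \<open>- u\<close> have sum zero, and \<open>u\<close> is bounded by the old family, hence Cartan's
  estimate bounds the quotient of the two maxima.
\<close>

lemma controlled_step_functions:
  assumes I: "I \<subseteq> {1..q}" "I' \<subseteq> {1..q}" "I \<inter> I' = {}" "I \<noteq> {}" "I' \<noteq> {}" "card I' \<le> k + 1"
    and h: "\<And>i. i \<in> I \<union> I' \<Longrightarrow> small_entire P m (h i)" "\<And>i. i \<in> I' \<Longrightarrow> nz_entire (h i)"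
    and u: "\<And>z. u z = (\<Sum>i\<in>I. h i z * V i z)" "\<And>z. u z = (\<Sum>i\<in>I'. h i z * V i z)" "nz_entire u"
    and ind: "\<And>b. (\<And>z. (\<Sum>i\<in>I'. b i * (h i z * V i z)) = 0) \<Longrightarrow> (\<And>i. i \<in> I' \<Longrightarrow> b i = 0)"
    and ctrl: "controlled k I"
  shows "controlled k (I \<union> I')"
proof -
  have fI: "finite I" "finite I'" using I finite_subset by blast+
  define s where "s = card I'"
  obtain \<beta> where "bij_betw \<beta> {0..<s} I'" using ex_bij_betw_nat_finite[OF fI(2)] s_def by blast
  then have \<beta>: "bij_betw \<beta> {..<s} I'" by (simp add: lessThan_atLeast0)
  have \<beta>I: "\<beta> j \<in> I'" if "j < s" for j using \<beta> that by (auto simp: bij_betw_def)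
  have V_I: "nz_entire (V i)" if "i \<in> I \<union> I'" for i using V_nz(1) that I by blast
  define g where "g = (\<lambda>j z. if j < s then h (\<beta> j) z * V (\<beta> j) z else - u z)"
  have reidx: "(\<Sum>j<s. f (\<beta> j)) = (\<Sum>i\<in>I'. f i)" for f :: "nat \<Rightarrow> 'c::comm_monoid_add"
    by (rule sum.reindex_bij_betw[OF \<beta>])
  have gs: "g s = (\<lambda>z. - u z)" by (simp add: g_def)
  have gj: "g j = (\<lambda>z. h (\<beta> j) z * V (\<beta> j) z)" if "j < s" for j using that by (simp add: g_def)
  have nu: "nz_entire (\<lambda>z. - f z)" "vanish_order (\<lambda>z. - f z) a = vanish_order f a" if "nz_entire f" for f a
    using vanish_order_mult[OF nz_entire_const[of "-1"] that] vanish_order_0_iff[OF nz_entire_const[of "-1"], of a] by auto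
  have g: "nz_entire (g j)" if "j \<le> s" for j
  proof (cases "j < s")
    case True
    then show ?thesis unfolding gj[OF True] using vanish_order_mult(1)[OF h(2)[OF \<beta>I] V_I] \<beta>I by blast
  next
    case False then show ?thesis using that nu u(3) by (simp add: gs)
  qed
  have sum0: "(\<Sum>j\<le>s. g j z) = 0" for z
  proof -
    have "(\<Sum>j\<le>s. g j z) = (\<Sum>j<s. h (\<beta> j) z * V (\<beta> j) z) + g s z"
      unfolding lessThan_Suc_atMost[symmetric] by (simp add: gj)
    also have "\<dots> = 0" using reidx[of "\<lambda>i. h i z * V i z"] u(2)[of z] by (simp add: gs)
    finally show ?thesis .
  qed
  have W: "nz_entire (wronskian s g)"
  proof (rule wronskian_nonzero)
    show "g j holomorphic_on UNIV" if "j < s" for j using g that by (auto intro: nz_entire_holo)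
    fix b j assume b: "\<And>z. (\<Sum>j<s. b j * g j z) = 0" and j: "j < s"
    define b' where "b' = (\<lambda>i. b (the_inv_into {..<s} \<beta> i))"
    have b': "b' (\<beta> j) = b j" if "j < s" for j
      using the_inv_into_f_f[of \<beta> "{..<s}" j] \<beta> that by (auto simp: b'_def bij_betw_def)
    have "(\<Sum>i\<in>I'. b' i * (h i z * V i z)) = 0" for z
    proof -
      have "(\<Sum>i\<in>I'. b' i * (h i z * V i z)) = (\<Sum>j<s. b' (\<beta> j) * (h (\<beta> j) z * V (\<beta> j) z))" by (rule reidx[symmetric])
      also have "\<dots> = (\<Sum>j<s. b j * g j z)" by (intro sum.cong refl) (auto simp: b' gj)
      finally show ?thesis using b by simp
    qed
    then show "b j = 0" using ind[of b' "\<beta> j"] b'[OF j] \<beta>I[OF j] by simp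
  qed
  have g_holo: "g j holomorphic_on UNIV" if "j \<le> s" for j using g[OF that] by (rule nz_entire_holo)
  have "\<exists>C. \<forall>i\<in>I \<union> I'. C i > 0 \<and> (\<forall>z. cmod (h i z) \<le> C i * P z ^ m)"
    by (rule bchoice) (use small_entire_bound[OF P_pos h(1)] in metis)
  then obtain Ch where Ch: "\<And>i. i \<in> I \<union> I' \<Longrightarrow> Ch i > 0" "\<And>i z. i \<in> I \<union> I' \<Longrightarrow> cmod (h i z) \<le> Ch i * P z ^ m" by blast
  define CC where "CC = (\<Sum>i\<in>I \<union> I'. Ch i)"
  have CCi: "Ch i \<le> CC" if "i \<in> I \<union> I'" for i
    unfolding CC_def by (rule member_le_sum) (use that Ch fI in \<open>auto simp: less_imp_le\<close>)
  have CC: "CC > 0" using I(4) CCi Ch(1) by (metis UnI1 ex_in_conv less_le_trans)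
  have h_le: "cmod (h i z) \<le> CC * P z ^ m" if "i \<in> I \<union> I'" for i z
    using order_trans[OF Ch(2)[OF that, of z] mult_right_mono[OF CCi[OF that], of "P z ^ m"]] P_pos[of z] by (simp add: less_imp_le)
  have u_le: "cmod (u z) \<le> (\<Sum>i\<in>I. cmod (V i z)) * (CC * P z ^ m)" for z
  proof -
    have "cmod (u z) \<le> (\<Sum>i\<in>I. cmod (V i z) * (CC * P z ^ m))"
      unfolding u(1) by (rule order_trans[OF norm_sum], rule sum_mono) (use h_le in \<open>auto simp: norm_mult mult.commute[of "cmod (V _ z)"] intro!: mult_right_mono\<close>)
    then show ?thesis by (simp add: sum_distrib_right)
  qed
  define N where "N = real (card I) + 1"
  have N1: "N \<ge> 1" by (simp add: N_def)
  have g_le: "cmod (g j z) \<le> (N * CC) * (P z ^ (m + 1) * rep_norm n F z)" if "j \<le> s" for j z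
  proof -
    have X0: "0 \<le> CC * (P z ^ (m + 1) * rep_norm n F z)" using CC P_pos[of z] rep_norm_nonneg[of n F z] by (simp add: less_imp_le)
    have "cmod (g j z) \<le> N * (CC * (P z ^ (m + 1) * rep_norm n F z))"
    proof (cases "j < s")
      case True
      have "cmod (g j z) \<le> (CC * P z ^ m) * (rep_norm n F z * P z)"
        unfolding gj[OF True] norm_mult using \<beta>I[OF True] I CC P_pos[of z]
        by (intro mult_mono h_le V_le) (auto simp: less_imp_le)
      then show ?thesis using mult_right_mono[OF N1 X0] by (simp add: mult_ac)
    next
      case False
      then have "cmod (g j z) = cmod (u z)" using that by (simp add: gs)
      also have "\<dots> \<le> (\<Sum>i\<in>I. rep_norm n F z * P z) * (CC * P z ^ m)"
        by (rule order_trans[OF u_le], rule mult_right_mono, rule sum_mono, rule V_le) (use I CC P_pos[of z] in \<open>auto simp: less_imp_le\<close>)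
      also have "\<dots> = real (card I) * (CC * (P z ^ (m + 1) * rep_norm n F z))" by simp
      also have "\<dots> \<le> N * (CC * (P z ^ (m + 1) * rep_norm n F z))" by (rule mult_right_mono[OF _ X0]) (simp add: N_def)
      finally show ?thesis .
    qed
    then show ?thesis by (simp add: mult.assoc)
  qed
  define c1 where "c1 = circle_mean (\<lambda>z. ln (P z)) 1"
  define cF where "cF = circle_mean (\<lambda>z. ln (rep_norm n F z)) 1"
  obtain cs where cs: "\<And>r. r \<ge> 1 \<Longrightarrow> r \<notin> critical_radii (g s) \<Longrightarrow> circle_mean (\<lambda>z. ln (cmod (g s z))) r = count_fun (g s) r + cs"
    using jensen[OF g[of s]] by blast
  define Q0 where "Q0 = (\<lambda>z. \<Prod>j\<in>{..s}. g j z)"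
  have Q0: "nz_entire Q0" "critical_radii Q0 = (\<Union>j\<le>s. critical_radii (g j))"
    unfolding Q0_def using vanish_order_prod(1)[of "{..s}" g] g by (auto simp: critical_radii_prod)
  define K where "K = \<bar>ln (N * CC)\<bar> + \<bar>real (m + 1) * c1\<bar> + \<bar>cF\<bar> + \<bar>cs\<bar> + real (m + 2)"
  have K0: "K \<ge> 0" by (simp add: K_def)
  have bd: "circle_mean (\<lambda>z. log_plus (cmod (g j z / g s z))) t + count_fun (g s) t \<le> K * \<tau> t"
    if j: "j \<le> s" and t: "t \<ge> 1" "t \<notin> critical_radii Q0" for j t
  proof -
    have nz: "g i z \<noteq> 0" if "i \<le> s" "cmod z = t" for i z using t(2) that Q0(2) noncritical_nz[of t "g i" z] by blast
    have cg: "continuous_on (sphere 0 t) (g i)" if "i \<le> s" for i using nz_entire_cont[OF g[OF that]] .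
    let ?G = "\<lambda>z. ln (N * CC) + (real (m + 1) * ln (P z) + ln (rep_norm n F z))"
    have lng: "ln (cmod (g i z)) \<le> ?G z" if "i \<le> s" "cmod z = t" for i z
    proof -
      have "ln (cmod (g i z)) \<le> ln ((N * CC) * (P z ^ (m + 1) * rep_norm n F z))"
        using nz[OF that] g_le[OF that(1), of z] by (intro ln_mono) auto
      also have "\<dots> = ln (N * CC) + (ln (P z ^ (m + 1)) + ln (rep_norm n F z))"
        using CC N1 P_pos[of z] rep_norm_pos[OF F, of z] by (subst ln_mult_pos, simp, simp, subst ln_mult_pos) auto
      finally show ?thesis by (subst (asm) ln_realpow) auto
    qed
    have cG: "continuous_on (sphere 0 t) ?G" by (intro continuous_intros ln_P_cont ln_rep_norm_cont F)
    have cl: "continuous_on (sphere 0 t) (\<lambda>z. ln (cmod (g s z)))"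
      using nz[of s] by (auto intro!: continuous_intros cg)
    have "circle_mean (\<lambda>z. log_plus (cmod (g j z / g s z))) t \<le> circle_mean (\<lambda>z. ?G z - ln (cmod (g s z))) t"
    proof (rule circle_mean_mono)
      fix z assume z: "cmod z = t"
      have "log_plus (cmod (g j z / g s z)) = max 0 (ln (cmod (g j z)) - ln (cmod (g s z)))"
        using nz[OF j z] nz[OF order_refl z] by (simp add: log_plus_def norm_divide ln_div max_def)
      then show "log_plus (cmod (g j z / g s z)) \<le> ?G z - ln (cmod (g s z))"
        using lng[OF j z] lng[OF order_refl z] by simp
    qed (use t continuous_on_diff[OF cG cl] nz[OF j] nz[OF order_refl] cg[OF j] cg[OF order_refl] in \<open>auto intro!: continuous_intros\<close>)
    also have "\<dots> = circle_mean ?G t - circle_mean (\<lambda>z. ln (cmod (g s z))) t"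
      by (rule circle_mean_diff[OF cG cl]) (use t in auto)
    also have "circle_mean ?G t = ln (N * CC) + (real (m + 1) * (Asum t + c1) + (characteristic n F t + cF))"
      using t circle_mean_ln_P[of t] ln_P_cont ln_rep_norm_cont[OF F] unfolding c1_def cF_def characteristic_eq
      by (subst circle_mean_add, simp, intro continuous_intros ln_P_cont ln_rep_norm_cont F, simp,
          subst circle_mean_add) (auto simp: circle_mean_cmul intro!: continuous_on_mult)
    also have "circle_mean (\<lambda>z. ln (cmod (g s z))) t = count_fun (g s) t + cs"
      by (rule cs) (use t Q0 in auto)
    finally have X: "circle_mean (\<lambda>z. log_plus (cmod (g j z / g s z))) t + count_fun (g s) t
       \<le> ln (N * CC) + (real (m + 1) * (Asum t + c1) + (characteristic n F t + cF)) - cs" by simp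
    have T0: "characteristic n F t \<ge> 0" using characteristic_mono(1)[OF F, of t t] t by simp
    have A0: "Asum t \<ge> 0" using Asum_nonneg t by simp
    define K1 where "K1 = \<bar>ln (N * CC)\<bar> + \<bar>real (m + 1) * c1\<bar> + \<bar>cF\<bar> + \<bar>cs\<bar>"
    have "real (m + 1) * (Asum t + c1) = real (m + 1) * Asum t + real (m + 1) * c1" by (simp add: distrib_left)
    then have "ln (N * CC) + (real (m + 1) * (Asum t + c1) + (characteristic n F t + cF)) - cs
       \<le> K1 + (real (m + 1) * Asum t + characteristic n F t)"
      unfolding K1_def by linarith
    also have "\<dots> \<le> (K1 + real (m + 2)) * \<tau> t"
    proof -
      have "0 \<le> K1" by (simp add: K1_def)
      then have "0 \<le> K1 * Asum t" "0 \<le> K1 * characteristic n F t" "0 \<le> real m * characteristic n F t" using T0 A0 by auto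
      then show ?thesis using T0 A0 unfolding \<tau>_def by (simp add: algebra_simps)
    qed
    finally show ?thesis using X unfolding K_def K1_def by linarith
  qed
  obtain C1 where C1: "C1 \<ge> 0" "outside_finite_measure (\<lambda>r. \<forall>u. continuous_on (sphere 0 r) u \<longrightarrow>
     (\<forall>z. cmod z = r \<longrightarrow> (\<exists>j\<le>s. u z \<le> ln (cmod (g j z)) - ln (cmod (g s z)))) \<longrightarrow>
     circle_mean u r \<le> (\<Sum>j<s. count_fun (g j) r) - count_fun (wronskian s g) r + C1 * (1 + ln (\<tau> r)))"
    using cartan_step[of \<tau> s g Q0 K, OF \<tau>_mono \<tau>_ge1 g sum0 W Q0(1) K0 bd] by blast
  obtain C2 where C2: "C2 \<ge> 0" "outside_finite_measure (\<lambda>r. (\<forall>i\<in>I. r \<notin> critical_radii (V i)) \<and>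
     circle_mean (\<lambda>z. Max ((\<lambda>i. ln (cmod (V i z))) ` I)) r
       \<le> divisor_sum (\<lambda>a. real (family_mult k I (\<lambda>i. vanish_order (V i) a))) r + C2 * (1 + Asum r + ln (\<tau> r)))"
    using ctrl unfolding controlled_def by blast
  have "\<exists>c. \<forall>i\<in>I'. \<forall>r\<ge>1. r \<notin> critical_radii (h i) \<longrightarrow> circle_mean (\<lambda>z. ln (cmod (h i z))) r = count_fun (h i) r + c i"
    by (rule bchoice) (use jensen[OF h(2)] in metis)
  then obtain ch where ch: "\<And>i r. i \<in> I' \<Longrightarrow> r \<ge> 1 \<Longrightarrow> r \<notin> critical_radii (h i) \<Longrightarrow> circle_mean (\<lambda>z. ln (cmod (h i z))) r = count_fun (h i) r + ch i" by blast
  have vgj: "vanish_order (g j) a = vanish_order (h (\<beta> j)) a + vanish_order (V (\<beta> j)) a" if "j < s" for j a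
    unfolding gj[OF that] by (rule vanish_order_mult(2)[OF h(2) V_I]) (use \<beta>I[OF that] in auto)
  have Wdiv: "family_mult k I (\<lambda>i. vanish_order (V i) a) + (\<Sum>i\<in>I'. vanish_order (V i) a)
     \<le> family_mult k (I \<union> I') (\<lambda>i. vanish_order (V i) a) + vanish_order (wronskian s g) a" for a
  proof (rule family_mult_step[where s=s])
    let ?\<nu> = "\<lambda>i. vanish_order (V i) a"
    show "s * \<mu> + (\<Sum>i\<in>I'. ?\<nu> i - \<mu> - (s - 1)) \<le> vanish_order (wronskian s g) a"
      if "\<And>i. i \<in> I' \<Longrightarrow> \<mu> \<le> ?\<nu> i" for \<mu>
    proof -
      have "s * \<mu> + (\<Sum>j<s. ?\<nu> (\<beta> j) - \<mu> - (s - 1)) \<le> vanish_order (wronskian s g) a"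
        by (rule vanish_order_wronskian_ge[OF _ W]) (use g_holo that \<beta>I vgj in auto)
      then show ?thesis by (subst (asm) reidx)
    qed
    fix i0 \<mu> assume i0: "i0 \<in> I'" "\<mu> = ?\<nu> i0" "\<mu> < Min (?\<nu> ` I)" and \<mu>: "\<And>i. i \<in> I' \<Longrightarrow> \<mu> \<le> ?\<nu> i"
    obtain j0 where j0: "j0 < s" "\<beta> j0 = i0" using \<beta> i0(1) by (auto simp: bij_betw_def image_iff)
    define M where "M = Min (?\<nu> ` I)"
    have Mle: "M \<le> ?\<nu> i" if "i \<in> I" for i using that fI by (simp add: M_def)
    have "\<exists>v. \<forall>i\<in>I. v i holomorphic_on UNIV \<and> (\<forall>z. V i z = (z - a) ^ M * v i z)"
    proof (rule bchoice, rule ballI)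
      fix i assume i: "i \<in> I"
      then have "V i holomorphic_on UNIV" using V_holo I by blast
      from vanish_order_dvdE[OF this, of M a] Mle[OF i]
      show "\<exists>v. v holomorphic_on UNIV \<and> (\<forall>z. V i z = (z - a) ^ M * v z)" by blast
    qed
    then obtain v where v: "\<And>i. i \<in> I \<Longrightarrow> v i holomorphic_on UNIV" "\<And>i z. i \<in> I \<Longrightarrow> V i z = (z - a) ^ M * v i z" by blast
    have Mu: "M \<le> vanish_order (g s) a"
    proof (rule vanish_order_ge[OF g[OF order_refl], of a M "\<lambda>z. - (\<Sum>i\<in>I. h i z * v i z)"])
      show "g s z = (z - a) ^ M * - (\<Sum>i\<in>I. h i z * v i z)" for z
        unfolding gs u(1) by (simp add: sum_distrib_left v(2) mult_ac)
      show "(\<lambda>z. - (\<Sum>i\<in>I. h i z * v i z)) holomorphic_on UNIV"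
        by (intro holomorphic_intros v) (use h(1) in \<open>auto simp: small_entire_def\<close>)
    qed
    define g' where "g' = (\<lambda>j. if j = j0 then g s else g j)"
    have W': "wronskian s g' = (\<lambda>z. - wronskian s g z)"
      unfolding g'_def using wronskian_exchange[of s g j0, OF g_holo sum0 j0(1)] by (rule ext)
    define w where "w = (\<lambda>j. if j = j0 then M else ?\<nu> (\<beta> j))"
    have "s * \<mu> + (\<Sum>j<s. w j - \<mu> - (s - 1)) \<le> vanish_order (wronskian s g') a"
    proof (rule vanish_order_wronskian_ge)
      show "nz_entire (wronskian s g')" unfolding W' by (rule nu(1)[OF W])
      fix j assume j: "j < s"
      show "g' j holomorphic_on UNIV" using g_holo j by (simp add: g'_def)
      show "w j \<le> vanish_order (g' j) a \<or> (\<forall>z. g' j z = 0)" using Mu vgj[OF j] by (simp add: g'_def w_def)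
      show "\<mu> \<le> w j" using \<mu>[OF \<beta>I[OF j]] i0(3) by (simp add: w_def M_def)
    qed
    also have "vanish_order (wronskian s g') a = vanish_order (wronskian s g) a" unfolding W' by (rule nu(2)[OF W])
    also have "(\<Sum>j<s. w j - \<mu> - (s - 1)) = (M - \<mu> - (s - 1)) + (\<Sum>j\<in>{..<s} - {j0}. ?\<nu> (\<beta> j) - \<mu> - (s - 1))"
      using j0 by (subst sum.remove[of "{..<s}" j0]) (auto simp: w_def)
    also have "(\<Sum>j\<in>{..<s} - {j0}. ?\<nu> (\<beta> j) - \<mu> - (s - 1)) = (\<Sum>i\<in>I' - {i0}. ?\<nu> i - \<mu> - (s - 1))"
    proof (rule sum.reindex_bij_betw)
      show "bij_betw \<beta> ({..<s} - {j0}) (I' - {i0})"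
        using \<beta> j0 by (auto simp: bij_betw_def inj_on_def image_iff)
    qed
    finally show "s * \<mu> + (\<Sum>i\<in>I' - {i0}. ?\<nu> i - \<mu> - (s - 1)) + (Min (?\<nu> ` I) - \<mu> - (s - 1)) \<le> vanish_order (wronskian s g) a"
      by (simp add: M_def)
  qed (use I fI s_def in auto)
  define L where "L = ln (real (card I))"
  have L0: "L \<ge> 0" unfolding L_def using fI I by (simp add: Suc_le_eq card_gt_0_iff)
  define C3 where "C3 = L + (\<Sum>i\<in>I'. \<bar>ln CC\<bar> + real m * \<bar>c1\<bar> + real m + \<bar>ch i\<bar>)"
  have C3: "C3 \<ge> 0" unfolding C3_def using L0 by (intro add_nonneg_nonneg sum_nonneg) auto
  define C where "C = C1 + C2 + C3"
  have "outside_finite_measure (\<lambda>r. (\<forall>u. continuous_on (sphere 0 r) u \<longrightarrow>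
     (\<forall>z. cmod z = r \<longrightarrow> (\<exists>j\<le>s. u z \<le> ln (cmod (g j z)) - ln (cmod (g s z)))) \<longrightarrow>
     circle_mean u r \<le> (\<Sum>j<s. count_fun (g j) r) - count_fun (wronskian s g) r + C1 * (1 + ln (\<tau> r))) \<and>
     ((\<forall>i\<in>I. r \<notin> critical_radii (V i)) \<and>
     circle_mean (\<lambda>z. Max ((\<lambda>i. ln (cmod (V i z))) ` I)) r
       \<le> divisor_sum (\<lambda>a. real (family_mult k I (\<lambda>i. vanish_order (V i) a))) r + C2 * (1 + Asum r + ln (\<tau> r))) \<and>
     (\<forall>i\<in>I'. r \<notin> critical_radii (V i)) \<and> (\<forall>i\<in>I'. r \<notin> critical_radii (h i)) \<and> r \<notin> critical_radii u)"
    by (intro outside_finite_measure_conj C1 C2 outside_finite_measure_ball fI outside_finite_measure_noncritical V_I h u) auto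
  then have "outside_finite_measure (\<lambda>r. (\<forall>i\<in>I \<union> I'. r \<notin> critical_radii (V i)) \<and>
     circle_mean (\<lambda>z. Max ((\<lambda>i. ln (cmod (V i z))) ` (I \<union> I'))) r
       \<le> divisor_sum (\<lambda>a. real (family_mult k (I \<union> I') (\<lambda>i. vanish_order (V i) a))) r + C * (1 + Asum r + ln (\<tau> r)))"
  proof (rule outside_finite_measure_mono, elim conjE, intro conjI)
    fix r :: real
    assume r: "r > 1" and H1: "\<forall>u. continuous_on (sphere 0 r) u \<longrightarrow>
     (\<forall>z. cmod z = r \<longrightarrow> (\<exists>j\<le>s. u z \<le> ln (cmod (g j z)) - ln (cmod (g s z)))) \<longrightarrow>
     circle_mean u r \<le> (\<Sum>j<s. count_fun (g j) r) - count_fun (wronskian s g) r + C1 * (1 + ln (\<tau> r))"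
    and crI: "\<forall>i\<in>I. r \<notin> critical_radii (V i)" and H2: "circle_mean (\<lambda>z. Max ((\<lambda>i. ln (cmod (V i z))) ` I)) r
       \<le> divisor_sum (\<lambda>a. real (family_mult k I (\<lambda>i. vanish_order (V i) a))) r + C2 * (1 + Asum r + ln (\<tau> r))"
    and crI': "\<forall>i\<in>I'. r \<notin> critical_radii (V i)" and crh: "\<forall>i\<in>I'. r \<notin> critical_radii (h i)" and cru: "r \<notin> critical_radii u"
    show "\<forall>i\<in>I \<union> I'. r \<notin> critical_radii (V i)" using crI crI' by blast
    have r1: "r \<ge> 1" "r \<ge> 0" using r by auto
    have Vz: "V i z \<noteq> 0" if "i \<in> I \<union> I'" "cmod z = r" for i z
      using crI crI' that noncritical_nz[of r "V i" z] by blast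
    have hz: "h i z \<noteq> 0" if "i \<in> I'" "cmod z = r" for i z using crh that noncritical_nz[of r "h i" z] by blast
    have uz: "u z \<noteq> 0" if "cmod z = r" for z using noncritical_nz[OF cru that] .
    define MI where "MI = (\<lambda>z. Max ((\<lambda>i. ln (cmod (V i z))) ` I))"
    define MU where "MU = (\<lambda>z. Max ((\<lambda>i. ln (cmod (V i z))) ` (I \<union> I')))"
    define B where "B = (\<lambda>i z. ln CC + real m * ln (P z) - ln (cmod (h i z)))"
    have cV: "continuous_on (sphere 0 r) (\<lambda>z. ln (cmod (V i z)))" if "i \<in> I \<union> I'" for i
      using Vz[OF that] by (auto intro!: continuous_intros nz_entire_cont[OF V_I[OF that]])
    have cMI: "continuous_on (sphere 0 r) MI" unfolding MI_def
      by (rule continuous_on_Max_image) (use fI I cV in auto)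
    have cMU: "continuous_on (sphere 0 r) MU" unfolding MU_def
      by (rule continuous_on_Max_image) (use fI I cV in auto)
    have chh: "continuous_on (sphere 0 r) (\<lambda>z. ln (cmod (h i z)))" if "i \<in> I'" for i
      using hz[OF that] by (auto intro!: continuous_intros nz_entire_cont[OF h(2)[OF that]])
    have cB: "continuous_on (sphere 0 r) (B i)" if "i \<in> I'" for i
      unfolding B_def by (intro continuous_intros ln_P_cont chh that)
    have cBs: "continuous_on (sphere 0 r) (\<lambda>z. \<Sum>i\<in>I'. B i z)" by (intro continuous_on_sum cB)
    have lnCP: "ln (CC * P z ^ m) = ln CC + real m * ln (P z)" for z
      using CC P_pos[of z] by (simp add: ln_mult_pos ln_realpow)
    have B0: "B i z \<ge> 0" if "i \<in> I'" "cmod z = r" for i z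
    proof -
      have "ln (cmod (h i z)) \<le> ln (CC * P z ^ m)" using h_le[of i z] hz[OF that] that by (intro ln_mono) auto
      then show ?thesis unfolding B_def lnCP by simp
    qed
    have lnu: "ln (cmod (u z)) \<le> ln (real (card I)) + MI z + (ln CC + real m * ln (P z))" if z: "cmod z = r" for z
    proof -
      have "cmod (V i z) \<le> exp (MI z)" if "i \<in> I" for i
      proof -
        have "ln (cmod (V i z)) \<le> MI z" unfolding MI_def using that fI by (intro Max_ge) auto
        then have "exp (ln (cmod (V i z))) \<le> exp (MI z)" by simp
        then show ?thesis using Vz[of i z] that z by simp
      qed
      then have "(\<Sum>i\<in>I. cmod (V i z)) \<le> real (card I) * exp (MI z)" using sum_bounded_above[of I "\<lambda>i. cmod (V i z)"] by blast
      then have "cmod (u z) \<le> (real (card I) * exp (MI z)) * (CC * P z ^ m)"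
        using u_le[of z] mult_right_mono[of _ _ "CC * P z ^ m"] CC P_pos[of z] by (smt (verit) mult_nonneg_nonneg zero_le_power)
      then have "ln (cmod (u z)) \<le> ln ((real (card I) * exp (MI z)) * (CC * P z ^ m))" using uz[OF z] by (intro ln_mono) auto
      also have "\<dots> = ln (real (card I)) + MI z + (ln CC + real m * ln (P z))"
        using fI I CC P_pos[of z] by (subst ln_mult_pos, simp add: card_gt_0_iff, simp, subst ln_mult_pos) (auto simp: card_gt_0_iff lnCP)
      finally show ?thesis .
    qed
    show "circle_mean (\<lambda>z. Max ((\<lambda>i. ln (cmod (V i z))) ` (I \<union> I'))) r
       \<le> divisor_sum (\<lambda>a. real (family_mult k (I \<union> I') (\<lambda>i. vanish_order (V i) a))) r + C * (1 + Asum r + ln (\<tau> r))"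
      unfolding MU_def[symmetric]
    proof -
      define U where "U = (\<lambda>z. MU z - MI z - L - (\<Sum>i\<in>I'. B i z))"
      have cU: "continuous_on (sphere 0 r) U" unfolding U_def by (intro continuous_intros cMU cMI cBs)
      have Uex: "\<exists>j\<le>s. U z \<le> ln (cmod (g j z)) - ln (cmod (g s z))" if z: "cmod z = r" for z
      proof -
        have SB: "(\<Sum>i\<in>I'. B i z) \<ge> 0" by (intro sum_nonneg B0 z)
        have "MU z \<in> (\<lambda>i. ln (cmod (V i z))) ` (I \<union> I')" unfolding MU_def by (rule Max_in) (use fI I in auto)
        then obtain i where i: "i \<in> I \<union> I'" "MU z = ln (cmod (V i z))" by blast
        show ?thesis
        proof (cases "i \<in> I")
          case True
          have "ln (cmod (V i z)) \<le> MI z" unfolding MI_def using True fI by (intro Max_ge) auto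
          then have "U z \<le> 0" unfolding U_def i(2) using SB L0 by linarith
          then show ?thesis by (intro exI[of _ s]) simp
        next
          case False
          then have i': "i \<in> I'" using i by blast
          obtain j where j: "j < s" "\<beta> j = i" using \<beta> i' by (auto simp: bij_betw_def image_iff)
          have "B i z \<le> (\<Sum>i\<in>I'. B i z)" by (rule member_le_sum) (use i' B0 z fI in auto)
          moreover have "ln (cmod (g j z)) = ln (cmod (h i z)) + ln (cmod (V i z))"
            using hz[OF i' z] Vz[OF i(1) z] by (simp add: gj[OF j(1)] j(2) norm_mult ln_mult_pos)
          moreover have "ln (cmod (g s z)) = ln (cmod (u z))" by (simp add: gs)
          ultimately have "U z \<le> ln (cmod (g j z)) - ln (cmod (g s z))"
            using lnu[OF z] unfolding U_def i(2) B_def L_def by linarith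
          then show ?thesis using j(1) by (intro exI[of _ j]) simp
        qed
      qed
      have E1: "circle_mean U r \<le> (\<Sum>j<s. count_fun (g j) r) - count_fun (wronskian s g) r + C1 * (1 + ln (\<tau> r))"
        using H1 cU Uex by blast
      have E2: "circle_mean U r = circle_mean MU r - circle_mean MI r - L - (\<Sum>i\<in>I'. circle_mean (B i) r)"
      proof -
        have c: "continuous_on (sphere 0 r) (\<lambda>z. MU z - MI z)" "continuous_on (sphere 0 r) (\<lambda>z. MU z - MI z - L)"
          by (intro continuous_intros cMU cMI)+
        show ?thesis unfolding U_def
          using circle_mean_diff[OF c(2) cBs r1(2)] circle_mean_diff[OF c(1) continuous_on_const r1(2), of L]
            circle_mean_diff[OF cMU cMI r1(2)] circle_mean_sum[OF fI(2) cB r1(2)] by simp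
      qed
      have E3: "circle_mean (B i) r = ln CC + real m * (Asum r + c1) - count_fun (h i) r - ch i" if "i \<in> I'" for i
      proof -
        have c: "continuous_on (sphere 0 r) (\<lambda>z. real m * ln (P z))" "continuous_on (sphere 0 r) (\<lambda>z. ln CC + real m * ln (P z))"
          by (intro continuous_intros ln_P_cont)+
        show ?thesis unfolding B_def
          using circle_mean_diff[OF c(2) chh[OF that] r1(2)] circle_mean_add[OF continuous_on_const c(1) r1(2), of "ln CC"]
            circle_mean_ln_P[OF r1(2)] ch[OF that r1(1)] crh that by (simp add: circle_mean_cmul c1_def)
      qed
      have E4: "(\<Sum>j<s. count_fun (g j) r) = (\<Sum>i\<in>I'. count_fun (h i) r) + (\<Sum>i\<in>I'. count_fun (V i) r)"
      proof -
        have "count_fun (g j) r = count_fun (h (\<beta> j)) r + count_fun (V (\<beta> j)) r" if "j < s" for j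
          unfolding count_fun_def vgj[OF that] of_nat_add
          by (rule divisor_sum_add) (use h(2) V_I \<beta>I[OF that] in \<open>auto intro: locally_finite_vanish_order\<close>)
        then have "(\<Sum>j<s. count_fun (g j) r) = (\<Sum>j<s. count_fun (h (\<beta> j)) r + count_fun (V (\<beta> j)) r)" by simp
        also have "\<dots> = (\<Sum>i\<in>I'. count_fun (h i) r + count_fun (V i) r)" by (rule reidx)
        finally show ?thesis by (simp add: sum.distrib)
      qed
      let ?D = "\<lambda>I a. real (family_mult k I (\<lambda>i. vanish_order (V i) a))"
      have E5: "divisor_sum (?D I) r + (\<Sum>i\<in>I'. count_fun (V i) r) \<le> divisor_sum (?D (I \<union> I')) r + count_fun (wronskian s g) r"
      proof -
        have lf: "locally_finite (?D I)" "locally_finite (?D (I \<union> I'))"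
          by (rule locally_finite_family_mult; use fI I V_I in auto)+
        have lv: "locally_finite (\<lambda>a. real (vanish_order (V i) a))" if "i \<in> I'" for i
          using that V_I by (auto intro: locally_finite_vanish_order)
        have lw: "locally_finite (\<lambda>a. real (vanish_order (wronskian s g) a))" using W by (rule locally_finite_vanish_order)
        have ls: "locally_finite (\<lambda>a. \<Sum>i\<in>I'. real (vanish_order (V i) a))" by (rule locally_finite_sum[OF fI(2) lv])
        have "divisor_sum (?D I) r + (\<Sum>i\<in>I'. count_fun (V i) r) = divisor_sum (\<lambda>a. ?D I a + (\<Sum>i\<in>I'. real (vanish_order (V i) a))) r"
          unfolding divisor_sum_add[OF lf(1) ls] count_fun_def using divisor_sum_sum[of I' "\<lambda>i a. real (vanish_order (V i) a)" r, OF fI(2) lv] by simp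
        also have "\<dots> \<le> divisor_sum (\<lambda>a. ?D (I \<union> I') a + real (vanish_order (wronskian s g) a)) r"
        proof (rule divisor_sum_mono[OF locally_finite_add[OF lf(1) ls] locally_finite_add[OF lf(2) lw] r1(1)])
          fix a show "?D I a + (\<Sum>i\<in>I'. real (vanish_order (V i) a)) \<le> ?D (I \<union> I') a + real (vanish_order (wronskian s g) a)"
            using Wdiv[of a] unfolding of_nat_sum[symmetric] of_nat_add[symmetric] of_nat_le_iff .
        qed
        also have "\<dots> = divisor_sum (?D (I \<union> I')) r + count_fun (wronskian s g) r"
          unfolding divisor_sum_add[OF lf(2) lw] count_fun_def by simp
        finally show ?thesis .
      qed
      have A0: "Asum r \<ge> 0" "ln (\<tau> r) \<ge> 0" using Asum_nonneg[OF r1(1)] \<tau>_ge1[OF r1(1)] by auto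
      have "(\<Sum>i\<in>I'. circle_mean (B i) r) = (\<Sum>i\<in>I'. (ln CC + real m * (Asum r + c1) - ch i) - count_fun (h i) r)"
        by (intro sum.cong refl) (use E3 in auto)
      then have E6: "(\<Sum>i\<in>I'. circle_mean (B i) r) + (\<Sum>i\<in>I'. count_fun (h i) r) = (\<Sum>i\<in>I'. ln CC + real m * (Asum r + c1) - ch i)"
        by (simp add: sum_subtractf)
      have E7: "L + (\<Sum>i\<in>I'. ln CC + real m * (Asum r + c1) - ch i) \<le> C3 * (1 + Asum r)"
      proof -
        have "ln CC + real m * (Asum r + c1) - ch i \<le> (\<bar>ln CC\<bar> + real m * \<bar>c1\<bar> + real m + \<bar>ch i\<bar>) * (1 + Asum r)" for i
        proof -
          have "real m * c1 \<le> real m * \<bar>c1\<bar>" by (intro mult_left_mono) auto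
          moreover have "0 \<le> (\<bar>ln CC\<bar> + real m * \<bar>c1\<bar> + \<bar>ch i\<bar>) * Asum r" using A0 by simp
          moreover have "ln CC \<le> \<bar>ln CC\<bar>" "- ch i \<le> \<bar>ch i\<bar>" by auto
          ultimately show ?thesis by (simp add: algebra_simps)
        qed
        then have "(\<Sum>i\<in>I'. ln CC + real m * (Asum r + c1) - ch i) \<le> (\<Sum>i\<in>I'. \<bar>ln CC\<bar> + real m * \<bar>c1\<bar> + real m + \<bar>ch i\<bar>) * (1 + Asum r)"
          unfolding sum_distrib_right by (intro sum_mono)
        moreover have "L \<le> L * (1 + Asum r)" using L0 A0 by (simp add: algebra_simps)
        ultimately show ?thesis unfolding C3_def by (simp add: distrib_right)
      qed
      have "circle_mean MU r = circle_mean U r + circle_mean MI r + L + (\<Sum>i\<in>I'. circle_mean (B i) r)" using E2 by simp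
      also have "\<dots> \<le> divisor_sum (?D (I \<union> I')) r + C1 * (1 + ln (\<tau> r)) + C2 * (1 + Asum r + ln (\<tau> r)) + C3 * (1 + Asum r)"
        using E1 H2[folded MI_def] E4 E5 E6 E7 by linarith
      also have "\<dots> \<le> divisor_sum (?D (I \<union> I')) r + C * (1 + Asum r + ln (\<tau> r))"
      proof -
        have "C1 * (1 + ln (\<tau> r)) \<le> C1 * (1 + Asum r + ln (\<tau> r))" using A0 C1(1) by (intro mult_left_mono) auto
        moreover have "C3 * (1 + Asum r) \<le> C3 * (1 + Asum r + ln (\<tau> r))" using A0 C3 by (intro mult_left_mono) auto
        ultimately show ?thesis unfolding C_def distrib_right by linarith
      qed
      finally show "circle_mean MU r \<le> divisor_sum (?D (I \<union> I')) r + C * (1 + Asum r + ln (\<tau> r))" .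
    qed
  qed
  then show ?thesis unfolding controlled_def using C1(1) C2(1) C3 by (intro exI[of _ C]) (auto simp: C_def)
qed

end

lemma nz_entire_of_fls:
  assumes "f holomorphic_on UNIV" "entire_fls f \<noteq> 0" shows "nz_entire f"
proof (rule ccontr)
  assume "\<not> nz_entire f"
  then have "f = (\<lambda>_. 0)" using assms(1) by (auto simp: nz_entire_def)
  then show False using assms(2) entire_fls_const[of 0] by simp
qed

lemma entire_fls_inj:
  assumes "f holomorphic_on UNIV" "g holomorphic_on UNIV" "entire_fls f = entire_fls g" shows "f z = g z"
proof -
  have hm: "(\<lambda>z. (-1) * g z) holomorphic_on UNIV" using assms(2) by (intro holomorphic_intros)
  have "entire_fls (\<lambda>z. f z + (-1) * g z) = entire_fls f + entire_fls (\<lambda>z. -1) * entire_fls g"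
    unfolding entire_fls_add[OF assms(1) hm] by (subst entire_fls_mult) (use assms(2) in auto)
  also have "\<dots> = 0" by (simp add: entire_fls_const assms(3))
  finally have "f z + (-1) * g z = 0" by (intro entire_fls_eq_0D[of "\<lambda>z. f z + (-1) * g z"] holomorphic_intros assms)
  then show ?thesis by simp
qed

context moving_targets
begin

lemma entire_fls_combination:
  assumes S: "finite S" "S \<subseteq> {1..q}" and h: "\<And>i. i \<in> S \<Longrightarrow> h i holomorphic_on UNIV" "\<And>i. i \<in> S \<Longrightarrow> y i * G = entire_fls (h i)"
  shows "entire_fls (\<lambda>z. \<Sum>i\<in>S. h i z * V i z) = G * (\<Sum>i\<in>S. y i * entire_fls (V i))"
proof -
  have V: "V i holomorphic_on UNIV" if "i \<in> S" for i using V_holo that S by blast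
  have "entire_fls (\<lambda>z. \<Sum>i\<in>S. h i z * V i z) = (\<Sum>i\<in>S. entire_fls (\<lambda>z. h i z * V i z))"
    by (rule entire_fls_sum[OF S(1)]) (intro holomorphic_intros h V)
  also have "\<dots> = (\<Sum>i\<in>S. (y i * G) * entire_fls (V i))"
    by (intro sum.cong refl) (simp add: entire_fls_mult h V)
  finally show ?thesis by (simp add: sum_distrib_left mult_ac)
qed

lemma controlled_step:
  assumes I: "I \<subseteq> {1..q}" "I' \<subseteq> {1..q}" "I \<inter> I' = {}" "I \<noteq> {}" "I' \<noteq> {}" "card I' \<le> k + 1" and ctrl: "controlled k I"
    and c: "\<And>i. i \<in> I' \<Longrightarrow> c i \<in> small_field P \<and> c i \<noteq> 0" and x: "\<And>i. i \<in> I \<Longrightarrow> x i \<in> small_field P"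
    and eq: "(\<Sum>i\<in>I'. c i * entire_fls (V i)) = (\<Sum>i\<in>I. x i * entire_fls (V i))" "(\<Sum>i\<in>I. x i * entire_fls (V i)) \<noteq> 0"
    and ind: "kindep (small_field P) (\<lambda>i. entire_fls (V i)) I'"
  shows "controlled k (I \<union> I')"
proof -
  have fI: "finite I" "finite I'" using I finite_subset by blast+
  define y where "y = (\<lambda>i. if i \<in> I' then c i else x i)"
  have y: "y i \<in> small_field P" if "i \<in> I \<union> I'" for i using that c x by (auto simp: y_def)
  obtain m g h where g: "small_entire P m g" "nz_entire g" and h: "\<And>i. i \<in> I \<union> I' \<Longrightarrow> small_entire P m (h i)"
    "\<And>i. i \<in> I \<union> I' \<Longrightarrow> y i * entire_fls g = entire_fls (h i)"
  proof (rule small_field_common_denominator[where I = "I \<union> I'" and x = y, OF P_pos])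
    show "finite (I \<union> I')" using fI by simp
    show "y i \<in> small_field P" if "i \<in> I \<union> I'" for i by (rule y[OF that])
  qed (rule that)
  have hh: "h i holomorphic_on UNIV" if "i \<in> I \<union> I'" for i using h(1)[OF that] by (simp add: small_entire_def)
  define u where "u = (\<lambda>z. \<Sum>i\<in>I. h i z * V i z)"
  have V: "V i holomorphic_on UNIV" if "i \<in> I \<union> I'" for i using V_holo that I by blast
  have uh: "u holomorphic_on UNIV" unfolding u_def by (intro holomorphic_intros hh V) auto
  have fu: "entire_fls u = entire_fls g * (\<Sum>i\<in>I. x i * entire_fls (V i))"
  proof -
    have "entire_fls u = entire_fls g * (\<Sum>i\<in>I. y i * entire_fls (V i))"
      unfolding u_def by (rule entire_fls_combination) (use I fI h hh in auto)
    also have "(\<Sum>i\<in>I. y i * entire_fls (V i)) = (\<Sum>i\<in>I. x i * entire_fls (V i))"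
      by (intro sum.cong refl) (use I(3) in \<open>auto simp: y_def\<close>)
    finally show ?thesis .
  qed
  have fu': "entire_fls (\<lambda>z. \<Sum>i\<in>I'. h i z * V i z) = entire_fls g * (\<Sum>i\<in>I'. c i * entire_fls (V i))"
  proof -
    have "entire_fls (\<lambda>z. \<Sum>i\<in>I'. h i z * V i z) = entire_fls g * (\<Sum>i\<in>I'. y i * entire_fls (V i))"
      by (rule entire_fls_combination) (use I fI h hh in auto)
    then show ?thesis by (simp add: y_def)
  qed
  have G: "entire_fls g \<noteq> 0" by (rule entire_fls_nz[OF g(2)])
  show ?thesis
  proof (rule controlled_step_functions[where m = m and h = h and u = u, OF I])
    show "small_entire P m (h i)" if "i \<in> I \<union> I'" for i using h(1)[OF that] .
    show "nz_entire (h i)" if "i \<in> I'" for i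
      by (rule nz_entire_of_fls[OF hh]) (use that h(2)[of i] c[of i] G in \<open>auto simp: y_def dest: sym\<close>)
    show "u z = (\<Sum>i\<in>I. h i z * V i z)" for z by (simp add: u_def)
    show "u z = (\<Sum>i\<in>I'. h i z * V i z)" for z
      by (rule entire_fls_inj[OF uh]) (auto simp: fu fu' eq(1) intro!: holomorphic_intros hh V)
    show "nz_entire u" by (rule nz_entire_of_fls[OF uh]) (use fu G eq(2) in auto)
    show "controlled k I" by (rule ctrl)
    fix b i assume b: "\<And>z. (\<Sum>i\<in>I'. b i * (h i z * V i z)) = 0" and i: "i \<in> I'"
    have "entire_fls g * (\<Sum>i\<in>I'. (fls_const (b i) * c i) * entire_fls (V i)) = entire_fls (\<lambda>z. \<Sum>i\<in>I'. (b i * h i z) * V i z)"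
    proof (rule entire_fls_combination[symmetric])
      fix i assume i: "i \<in> I'"
      show "(\<lambda>z. b i * h i z) holomorphic_on UNIV" using hh i by (intro holomorphic_intros) auto
      have "entire_fls (\<lambda>z. b i * h i z) = fls_const (b i) * entire_fls (h i)"
        by (subst entire_fls_mult) (use hh i in \<open>auto simp: entire_fls_const\<close>)
      then show "fls_const (b i) * c i * entire_fls g = entire_fls (\<lambda>z. b i * h i z)"
        using h(2)[of i] i by (simp add: y_def mult.assoc)
    qed (use fI I in auto)
    also have "\<dots> = 0" using b entire_fls_const[of 0] by (simp add: mult.assoc)
    finally have "(\<Sum>i\<in>I'. (fls_const (b i) * c i) * entire_fls (V i)) = 0" using G by simp
    moreover have "fls_const (b i) * c i \<in> small_field P" if "i \<in> I'" for i
      by (rule closed_subfieldD(4)[OF small_field_closed[OF P_pos]]) (use small_field_const[of P "b i", OF P_pos] c[OF that] in auto)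
    ultimately have "fls_const (b i) * c i = 0" using ind[unfolded kindep_def, THEN spec, of "\<lambda>i. fls_const (b i) * c i"] i by simp
    then show "b i = 0" using c[OF i] by simp
  qed
qed

definition coeff_fun :: "nat \<Rightarrow> nat \<Rightarrow> complex \<Rightarrow> complex" where
  "coeff_fun i l z = A i l z * (\<Prod>j\<in>{1..q} - {i}. e j z)"

lemma e_prod_holo: "S \<subseteq> {1..q} \<Longrightarrow> (\<lambda>z. \<Prod>j\<in>S. e j z) holomorphic_on UNIV"
  by (rule holomorphic_on_prod) (use nz_entire_holo[OF e(1)] in auto)

lemma coeff_fun_holo: assumes "i \<in> {1..q}" "l \<le> n" shows "coeff_fun i l holomorphic_on UNIV"
proof -
  have "(\<lambda>z. A i l z * (\<Prod>j\<in>{1..q} - {i}. e j z)) holomorphic_on UNIV"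
    using A[OF assms(1)] assms(2) by (intro holomorphic_on_mult e_prod_holo) (auto simp: curve_rep_def)
  then show ?thesis unfolding coeff_fun_def .
qed

lemma small_coeff_fun: assumes "i \<in> {1..q}" "l \<le> n" shows "small_entire P 1 (coeff_fun i l)"
proof -
  have "cmod (coeff_fun i l z) \<le> 1 * P z ^ 1" for z
  proof -
    have "cmod (coeff_fun i l z) \<le> rep_norm n (A i) z * (\<Prod>j\<in>{1..q} - {i}. rep_norm n (A j) z)"
      unfolding coeff_fun_def norm_mult prod_norm[symmetric]
      by (intro mult_mono prod_mono cmod_le_rep_norm assms(2) prod_nonneg rep_norm_nonneg) (use e in auto)
    moreover have "P z = rep_norm n (A i) z * (\<Prod>j\<in>{1..q} - {i}. rep_norm n (A j) z)"
      unfolding P_def by (rule prod.remove) (use assms in auto)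
    ultimately show ?thesis by simp
  qed
  then show ?thesis using coeff_fun_holo[OF assms] unfolding small_entire_def by blast
qed

definition E :: "complex \<Rightarrow> complex" where "E z = (\<Prod>j\<in>{1..q}. e j z)"

lemma E_nz: "nz_entire E" and vanish_order_E: "vanish_order E a = (\<Sum>j\<in>{1..q}. vanish_order (e j) a)"
proof -
  have "E = (\<lambda>z. \<Prod>j\<in>{1..q}. e j z)" by (simp add: E_def fun_eq_iff)
  then show "nz_entire E" "vanish_order E a = (\<Sum>j\<in>{1..q}. vanish_order (e j) a)"
    using vanish_order_prod[of "{1..q}" e] e by auto
qed

lemma small_E: "small_entire P 1 E"
proof -
  have "cmod (E z) \<le> 1 * P z ^ 1" for z
    unfolding E_def P_def prod_norm[symmetric] using e by (auto intro!: prod_mono)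
  then show ?thesis using nz_entire_holo[OF E_nz] unfolding small_entire_def by blast
qed

text \<open>
  A reduced representation of a moving hyperplane need not be small compared with \<open>P\<close>, only the
  quotients of its members are. This is why the numerators and the representation of the curve are
  both multiplied by \<open>E\<close>.
\<close>

definition coeff_fls :: "nat \<Rightarrow> nat \<Rightarrow> complex fls" where "coeff_fls i l = entire_fls (coeff_fun i l) / entire_fls E"

definition curve_fls :: "nat \<Rightarrow> complex fls" where "curve_fls l = entire_fls E * entire_fls (F l)"

lemma coeff_fls_in_field: "i \<in> {1..q} \<Longrightarrow> l \<le> n \<Longrightarrow> coeff_fls i l \<in> small_field P"
  by (rule small_fieldI[OF P_pos small_coeff_fun small_E E_nz]) (auto simp: coeff_fls_def entire_fls_nz[OF E_nz])

lemma entire_fls_V: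
  assumes i: "i \<in> {1..q}"
  shows "entire_fls (V i) = (\<Sum>l<n + 1. coeff_fls i l * curve_fls l)"
proof -
  have Fh: "F l holomorphic_on UNIV" if "l < n + 1" for l using F that by (auto simp: curve_rep_def)
  have ch: "coeff_fun i l holomorphic_on UNIV" if "l < n + 1" for l using coeff_fun_holo[OF i] that by simp
  have "V i = (\<lambda>z. \<Sum>l<n + 1. coeff_fun i l z * F l z)"
    by (auto simp: V_def coeff_fun_def pairing_def sum_distrib_right lessThan_Suc_atMost atLeast0AtMost mult_ac intro!: sum.cong ext)
  then have "entire_fls (V i) = entire_fls (\<lambda>z. \<Sum>l<n + 1. coeff_fun i l z * F l z)" by simp
  also have "\<dots> = (\<Sum>l<n + 1. entire_fls (\<lambda>z. coeff_fun i l z * F l z))"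
    by (rule entire_fls_sum) (auto intro!: holomorphic_on_mult Fh ch)
  also have "\<dots> = (\<Sum>l<n + 1. entire_fls (coeff_fun i l) * entire_fls (F l))"
    by (intro sum.cong refl entire_fls_mult ch Fh) auto
  also have "\<dots> = (\<Sum>l<n + 1. coeff_fls i l * curve_fls l)"
    using entire_fls_nz[OF E_nz] by (simp add: coeff_fls_def curve_fls_def)
  finally show ?thesis .
qed

lemma general_position_span:
  assumes gp: "general_position n q A" and S: "S \<subseteq> {1..q}" "card S = n + 1" and l: "l \<le> n"
  shows "curve_fls l \<in> kspan (small_field P) (\<lambda>i. entire_fls (V i)) S"
proof -
  have fS: "finite S" using S finite_subset by blast
  obtain \<sigma> where \<sigma>0: "bij_betw \<sigma> {..<card S} S" "strict_mono_on {..<card S} \<sigma>"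
    by (rule ex_bij_betw_strict_mono_card[OF fS]) (rule that)
  note \<sigma> = \<sigma>0[unfolded lessThan_atLeast0]
  have eq: "{0..<card S} = {0..n}" using S by auto
  have \<sigma>S: "\<sigma> j \<in> {1..q}" if "j \<le> n" for j using bij_betwE[OF \<sigma>(1)] S(1) that unfolding eq by (meson atLeastAtMost_iff le0 subsetD)
  define MA where "MA = (\<lambda>z. Matrix.mat (n + 1) (n + 1) (\<lambda>(j, l). A (\<sigma> j) l z))"
  define MC where "MC = (\<lambda>z. Matrix.mat (n + 1) (n + 1) (\<lambda>(j, l). coeff_fun (\<sigma> j) l z))"
  have "\<sigma> ` {0..n} \<subseteq> {1..q}" using \<sigma>S by auto
  then obtain z0 where z0: "Determinant.det (MA z0) \<noteq> 0"
    using gp \<sigma>(2) unfolding general_position_def eq MA_def by blast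
  have dA: "nz_entire (\<lambda>z. Determinant.det (MA z))"
    unfolding MA_def by (rule nz_entireI[OF entire_det_holo(1)])
      (use A \<sigma>S z0 in \<open>auto simp: curve_rep_def MA_def\<close>)
  have \<rho>: "nz_entire (\<lambda>z. \<Prod>i\<in>{1..q} - {\<sigma> j}. e i z)" for j
    by (rule vanish_order_prod(1)) (use e in auto)
  have \<rho>p: "nz_entire (\<lambda>z. \<Prod>j\<in>{0..<n + 1}. \<Prod>i\<in>{1..q} - {\<sigma> j}. e i z)"
    using vanish_order_prod(1)[of "{0..<n + 1}" "\<lambda>j z. \<Prod>i\<in>{1..q} - {\<sigma> j}. e i z"] \<rho> by simp
  have "Determinant.det (MC z) = Determinant.det (MA z) * (\<Prod>j\<in>{0..<n + 1}. \<Prod>i\<in>{1..q} - {\<sigma> j}. e i z)" for z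
  proof -
    have pl: "p i < n + 1" if "p permutes {0..<n + 1}" "i < n + 1" for p i using permutes_in_image[OF that(1), of i] that(2) by simp
    have "Determinant.det (MC z) = (\<Sum>p\<in>{p. p permutes {0..<n + 1}}. signof p * (\<Prod>j=0..<n + 1. A (\<sigma> j) (p j) z * (\<Prod>i\<in>{1..q} - {\<sigma> j}. e i z)))"
      unfolding MC_def coeff_fun_def
      by (subst det_def'[of _ "n + 1"]) (auto intro!: sum.cong prod.cong simp del: prod.op_ivl_Suc simp: pl less_Suc_eq_le[symmetric])
    also have "\<dots> = (\<Sum>p\<in>{p. p permutes {0..<n + 1}}. signof p * (\<Prod>j=0..<n + 1. A (\<sigma> j) (p j) z)) * (\<Prod>j\<in>{0..<n + 1}. \<Prod>i\<in>{1..q} - {\<sigma> j}. e i z)"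
      unfolding prod.distrib sum_distrib_right by (simp only: mult.assoc)
    also have "(\<Sum>p\<in>{p. p permutes {0..<n + 1}}. signof p * (\<Prod>j=0..<n + 1. A (\<sigma> j) (p j) z)) = Determinant.det (MA z)"
      unfolding MA_def
      by (subst det_def'[of _ "n + 1"]) (auto intro!: sum.cong prod.cong simp del: prod.op_ivl_Suc simp: pl less_Suc_eq_le[symmetric])
    finally show ?thesis .
  qed
  then have dC: "nz_entire (\<lambda>z. Determinant.det (MC z))" using vanish_order_mult(1)[OF dA \<rho>p] by simp
  define M0 where "M0 = Matrix.mat (n + 1) (n + 1) (\<lambda>(j, l). entire_fls (coeff_fun (\<sigma> j) l))"
  have "entire_fls (\<lambda>z. Determinant.det (MC z)) = Determinant.det M0"
    unfolding MC_def M0_def by (rule entire_det_holo(2)) (use coeff_fun_holo \<sigma>S in auto)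
  then have dM0: "Determinant.det M0 \<noteq> 0" using entire_fls_nz[OF dC] by simp
  define M where "M = Matrix.mat (n + 1) (n + 1) (\<lambda>(j, l). coeff_fls (\<sigma> j) l)"
  have "M = inverse (entire_fls E) \<cdot>\<^sub>m M0"
    by (rule eq_matI) (auto simp: M_def M0_def coeff_fls_def field_class.field_divide_inverse)
  then have dM: "Determinant.det M \<noteq> 0" using dM0 entire_fls_nz[OF E_nz] by simp
  have "curve_fls l \<in> kspan (small_field P) (\<lambda>j. entire_fls (V (\<sigma> j))) {..<n + 1}"
  proof (rule kspan_of_invertible[OF small_field_closed[OF P_pos] _ _ dM])
    show "M \<in> carrier_mat (n + 1) (n + 1)" by (simp add: M_def)
    show "M $$ (i, j) \<in> small_field P" if "i < n + 1" "j < n + 1" for i j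
      using that coeff_fls_in_field[OF \<sigma>S] by (simp add: M_def)
    show "entire_fls (V (\<sigma> i)) = (\<Sum>l<n + 1. M $$ (i, l) * curve_fls l)" if "i < n + 1" for i
      unfolding entire_fls_V[OF \<sigma>S[of i]] using that entire_fls_V[OF \<sigma>S[of i]] by (simp add: M_def)
    show "l < n + 1" using l by simp
  qed
  then show ?thesis by (rule kspan_reindex[rotated]) (use \<sigma>(1) S in \<open>simp add: lessThan_atLeast0\<close>)
qed

end

lemma ex_subset_small_average:
  fixes x :: "'i \<Rightarrow> real"
  assumes "finite S" "p \<le> card S"
  shows "\<exists>J\<subseteq>S. card J = p \<and> real (card S) * sum x J \<le> real p * sum x S"
  using assms
proof (induction "card S - p" arbitrary: S)
  case 0
  then have "card S = p" by simp
  then show ?case by (intro exI[of _ S]) auto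
next
  case (Suc k)
  have "S \<noteq> {}" using Suc.hyps(2) by auto
  then have "Max (x ` S) \<in> x ` S" using Suc.prems by (intro Max_in) auto
  then obtain m where m: "m \<in> S" "x m = Max (x ` S)" by auto
  have xm: "x i \<le> x m" if "i \<in> S" for i unfolding m(2) using that Suc.prems by (intro Max_ge) auto
  have cS: "card S = card (S - {m}) + 1" using m Suc.prems by (metis card.remove Suc_eq_plus1)
  obtain J where J: "J \<subseteq> S - {m}" "card J = p" "real (card (S - {m})) * sum x J \<le> real p * sum x (S - {m})"
  proof -
    have "k = card (S - {m}) - p" "finite (S - {m})" "p \<le> card (S - {m})" using Suc.hyps(2) Suc.prems cS by auto
    from Suc.hyps(1)[OF this] show ?thesis using that by blast
  qed
  have "sum x J \<le> real p * x m" using sum_bounded_above[of J x "x m"] J xm by auto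
  moreover have "sum x S = x m + sum x (S - {m})" by (rule sum.remove) (use m Suc.prems in auto)
  ultimately have "real (card S) * sum x J \<le> real p * sum x S" using J(3) unfolding cS by (simp add: algebra_simps)
  then show ?case using J by blast
qed

context moving_targets
begin

lemma characteristic_le_controlled:
  assumes I: "I \<subseteq> {1..q}" "I \<noteq> {}" "controlled k I"
    and sp: "\<And>l. l \<le> n \<Longrightarrow> curve_fls l \<in> kspan (small_field P) (\<lambda>i. entire_fls (V i)) I"
  shows "\<exists>C\<ge>0. outside_finite_measure (\<lambda>r. characteristic n F r
     \<le> (\<Sum>i\<in>I. divisor_sum (\<lambda>a. real (min (vanish_order (V i) a) k)) r) + C * (1 + Asum r + ln (\<tau> r)))"
proof -
  have fI: "finite I" using I finite_subset by blast
  have V_I: "nz_entire (V i)" if "i \<in> I" for i using V_nz(1) that I by blast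
  have Fh: "F l holomorphic_on UNIV" if "l \<le> n" for l using F that by (auto simp: curve_rep_def)
  have "\<exists>c. \<forall>l\<in>{0..n}. (\<forall>i\<in>I. c l i \<in> small_field P) \<and> curve_fls l = (\<Sum>i\<in>I. c l i * entire_fls (V i))"
    by (rule bchoice) (use sp in \<open>auto simp: kspan_def\<close>)
  then obtain c where c: "\<And>l i. l \<le> n \<Longrightarrow> i \<in> I \<Longrightarrow> c l i \<in> small_field P"
    "\<And>l. l \<le> n \<Longrightarrow> curve_fls l = (\<Sum>i\<in>I. c l i * entire_fls (V i))" by fastforce
  let ?X = "{0..n} \<times> I"
  have fX: "finite ?X" using fI by simp
  have cX: "c (fst x) (snd x) \<in> small_field P" if "x \<in> ?X" for x using c(1) that by auto
  obtain m g0 h where g0: "small_entire P m g0" "nz_entire g0" and h: "\<And>x. x \<in> ?X \<Longrightarrow> small_entire P m (h x)"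
    "\<And>x. x \<in> ?X \<Longrightarrow> c (fst x) (snd x) * entire_fls g0 = entire_fls (h x)"
  proof (rule small_field_common_denominator[where I = ?X and x = "\<lambda>x. c (fst x) (snd x)", OF P_pos fX])
    show "c (fst x) (snd x) \<in> small_field P" if "x \<in> ?X" for x by (rule cX[OF that])
  qed (rule that)
  define g where "g = (\<lambda>z. g0 z * E z)"
  have g: "nz_entire g" unfolding g_def by (rule vanish_order_mult(1)[OF g0(2) E_nz])
  have gh: "g holomorphic_on UNIV" by (rule nz_entire_holo[OF g])
  have fg: "entire_fls g = entire_fls g0 * entire_fls E"
    unfolding g_def by (rule entire_fls_mult[OF nz_entire_holo[OF g0(2)] nz_entire_holo[OF E_nz]])
  have hh: "h (l, i) holomorphic_on UNIV" if "l \<le> n" "i \<in> I" for l i using h(1)[of "(l, i)"] that by (simp add: small_entire_def)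
  have Vh: "V i holomorphic_on UNIV" if "i \<in> I" for i by (rule nz_entire_holo[OF V_I[OF that]])
  have gF: "g z * F l z = (\<Sum>i\<in>I. h (l, i) z * V i z)" if l: "l \<le> n" for l z
  proof (rule entire_fls_inj[of "\<lambda>z. g z * F l z"])
    show "(\<lambda>z. g z * F l z) holomorphic_on UNIV" by (intro holomorphic_intros gh Fh l)
    show "(\<lambda>z. \<Sum>i\<in>I. h (l, i) z * V i z) holomorphic_on UNIV" by (intro holomorphic_intros hh Vh l)
    have "entire_fls (\<lambda>z. \<Sum>i\<in>I. h (l, i) z * V i z) = entire_fls g0 * (\<Sum>i\<in>I. c l i * entire_fls (V i))"
      by (rule entire_fls_combination[OF fI I(1)]) (use l hh h(2)[of "(l, _)"] in auto)
    then show "entire_fls (\<lambda>z. g z * F l z) = entire_fls (\<lambda>z. \<Sum>i\<in>I. h (l, i) z * V i z)"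
      using entire_fls_mult[OF gh Fh[OF l]] c(2)[OF l] by (simp add: fg curve_fls_def mult.assoc)
  qed
  have "\<exists>C. \<forall>x\<in>?X. C x > 0 \<and> (\<forall>z. cmod (h x z) \<le> C x * P z ^ m)"
    by (rule bchoice) (use small_entire_bound[OF P_pos h(1)] in metis)
  then obtain Ch where Ch': "\<forall>x\<in>?X. Ch x > 0 \<and> (\<forall>z. cmod (h x z) \<le> Ch x * P z ^ m)" by (elim exE) (rule that)
  have Ch: "Ch x > 0" "cmod (h x z) \<le> Ch x * P z ^ m" if "x \<in> ?X" for x z using bspec[OF Ch' that] by auto
  define CC where "CC = (\<Sum>x\<in>?X. Ch x)"
  have CC: "CC > 0" unfolding CC_def by (rule sum_pos) (use fX Ch I(2) in auto)
  have h_le: "cmod (h x z) \<le> CC * P z ^ m" if "x \<in> ?X" for x z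
  proof -
    have "Ch x \<le> CC" unfolding CC_def by (rule member_le_sum) (use that Ch fX in \<open>auto simp: less_imp_le\<close>)
    then show ?thesis
      using order_trans[OF Ch(2)[OF that, of z] mult_right_mono[of _ CC "P z ^ m"]] P_pos[of z] by (simp add: less_imp_le)
  qed
  define N where "N = real (n + 1) * real (card I) * CC"
  have N: "N > 0" unfolding N_def using CC fI I(2) by (simp add: card_gt_0_iff)
  have gF_le: "cmod (g z) * rep_norm n F z \<le> N * P z ^ m * R" if R: "\<And>i. i \<in> I \<Longrightarrow> cmod (V i z) \<le> R" for z R
  proof -
    have "cmod (g z * F l z) \<le> real (card I) * (CC * P z ^ m * R)" if "l \<le> n" for l
      unfolding gF[OF that]
    proof (rule order_trans[OF norm_sum], rule sum_bounded_above)
      fix i assume i: "i \<in> I"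
      show "cmod (h (l, i) z * V i z) \<le> CC * P z ^ m * R" unfolding norm_mult
        by (intro mult_mono h_le R i) (use that i CC P_pos[of z] in \<open>auto simp: less_imp_le\<close>)
    qed
    then have "(\<Sum>l=0..n. cmod (g z * F l z)) \<le> real (card {0..n}) * (real (card I) * (CC * P z ^ m * R))"
      by (intro sum_bounded_above) auto
    moreover have "rep_norm n F z \<le> (\<Sum>l=0..n. cmod (F l z))"
      unfolding rep_norm_def L2_set_def[symmetric] by (rule L2_set_le_sum) auto
    then have "cmod (g z) * rep_norm n F z \<le> (\<Sum>l=0..n. cmod (g z * F l z))"
      unfolding norm_mult sum_distrib_left[symmetric] by (rule mult_left_mono) auto
    ultimately show ?thesis by (simp add: N_def mult_ac)
  qed
  have order: "Min ((\<lambda>i. vanish_order (V i) a) ` I) \<le> vanish_order g a" for a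
  proof -
    define M where "M = Min ((\<lambda>i. vanish_order (V i) a) ` I)"
    have Mle: "M \<le> vanish_order (V i) a" if "i \<in> I" for i using that fI by (simp add: M_def)
    have "\<exists>v. \<forall>i\<in>I. v i holomorphic_on UNIV \<and> (\<forall>z. V i z = (z - a) ^ M * v i z)"
    proof (rule bchoice, rule ballI)
      fix i assume i: "i \<in> I"
      from vanish_order_dvdE[OF Vh[OF i], of M a] Mle[OF i]
      show "\<exists>v. v holomorphic_on UNIV \<and> (\<forall>z. V i z = (z - a) ^ M * v z)" by blast
    qed
    then obtain v where v: "\<And>i. i \<in> I \<Longrightarrow> v i holomorphic_on UNIV" "\<And>i z. i \<in> I \<Longrightarrow> V i z = (z - a) ^ M * v i z" by blast
    obtain l where l: "l \<le> n" "F l a \<noteq> 0" using F by (auto simp: curve_rep_def)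
    have Fl: "nz_entire (F l)" by (rule nz_entireI[of _ a]) (use Fh l in auto)
    have "M \<le> vanish_order (\<lambda>z. g z * F l z) a"
    proof (rule vanish_order_ge[of _ a M "\<lambda>z. \<Sum>i\<in>I. h (l, i) z * v i z"])
      show "nz_entire (\<lambda>z. g z * F l z)" by (rule vanish_order_mult(1)[OF g Fl])
      show "g z * F l z = (z - a) ^ M * (\<Sum>i\<in>I. h (l, i) z * v i z)" for z
        unfolding gF[OF l(1)] by (simp add: sum_distrib_left v(2) mult_ac)
      show "(\<lambda>z. \<Sum>i\<in>I. h (l, i) z * v i z) holomorphic_on UNIV" by (intro holomorphic_intros v hh l)
    qed
    then show ?thesis using vanish_order_mult(2)[OF g Fl, of a] l(2) by (simp add: M_def vanish_order_def)
  qed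
  obtain cg where cg: "\<And>r. r \<ge> 1 \<Longrightarrow> r \<notin> critical_radii g \<Longrightarrow> circle_mean (\<lambda>z. ln (cmod (g z))) r = count_fun g r + cg"
    using jensen[OF g] by blast
  obtain C2 where C2: "C2 \<ge> 0" "outside_finite_measure (\<lambda>r. (\<forall>i\<in>I. r \<notin> critical_radii (V i)) \<and>
     circle_mean (\<lambda>z. Max ((\<lambda>i. ln (cmod (V i z))) ` I)) r
       \<le> divisor_sum (\<lambda>a. real (family_mult k I (\<lambda>i. vanish_order (V i) a))) r + C2 * (1 + Asum r + ln (\<tau> r)))"
    using I(3) unfolding controlled_def by blast
  define c1 where "c1 = circle_mean (\<lambda>z. ln (P z)) 1"
  define cF where "cF = circle_mean (\<lambda>z. ln (rep_norm n F z)) 1"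
  define C3 where "C3 = \<bar>ln N\<bar> + real m + real m * \<bar>c1\<bar> + \<bar>cg\<bar> + \<bar>cF\<bar>"
  have C3: "C3 \<ge> 0" by (simp add: C3_def)
  have "outside_finite_measure (\<lambda>r. characteristic n F r
     \<le> (\<Sum>i\<in>I. divisor_sum (\<lambda>a. real (min (vanish_order (V i) a) k)) r) + (C2 + C3) * (1 + Asum r + ln (\<tau> r)))"
  proof (rule outside_finite_measure_mono[OF outside_finite_measure_conj[OF C2(2) outside_finite_measure_noncritical[OF g]]], elim conjE)
    fix r :: real
    assume r: "r > 1" and crI: "\<forall>i\<in>I. r \<notin> critical_radii (V i)" and H: "circle_mean (\<lambda>z. Max ((\<lambda>i. ln (cmod (V i z))) ` I)) r
       \<le> divisor_sum (\<lambda>a. real (family_mult k I (\<lambda>i. vanish_order (V i) a))) r + C2 * (1 + Asum r + ln (\<tau> r))"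
    and crg: "r \<notin> critical_radii g"
    have r1: "r \<ge> 1" "r \<ge> 0" using r by auto
    have Vz: "V i z \<noteq> 0" if "i \<in> I" "cmod z = r" for i z using crI that noncritical_nz[of r "V i" z] by blast
    have gz: "g z \<noteq> 0" if "cmod z = r" for z using noncritical_nz[OF crg that] .
    define MI where "MI = (\<lambda>z. Max ((\<lambda>i. ln (cmod (V i z))) ` I))"
    have cMI: "continuous_on (sphere 0 r) MI" unfolding MI_def
    proof (rule continuous_on_Max_image[OF fI I(2)])
      fix i assume i: "i \<in> I"
      show "continuous_on (sphere 0 r) (\<lambda>z. ln (cmod (V i z)))"
        using Vz[OF i] by (auto intro!: continuous_intros nz_entire_cont[OF V_I[OF i]])
    qed
    have cG: "continuous_on (sphere 0 r) (\<lambda>z. ln (cmod (g z)))"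
      using gz by (auto intro!: continuous_intros nz_entire_cont[OF g])
    have cP: "continuous_on (sphere 0 r) (\<lambda>z. real m * ln (P z))" "continuous_on (sphere 0 r) (\<lambda>z. ln N + real m * ln (P z))"
      by (intro continuous_intros ln_P_cont)+
    have "circle_mean (\<lambda>z. ln (cmod (g z)) + ln (rep_norm n F z)) r \<le> circle_mean (\<lambda>z. (ln N + real m * ln (P z)) + MI z) r"
    proof (rule circle_mean_mono)
      show "continuous_on (sphere 0 r) (\<lambda>z. ln (cmod (g z)) + ln (rep_norm n F z))" by (intro continuous_on_add cG ln_rep_norm_cont F)
      show "continuous_on (sphere 0 r) (\<lambda>z. (ln N + real m * ln (P z)) + MI z)" by (intro continuous_on_add[OF cP(2)] cMI)
      fix z assume z: "cmod z = r"
      have "cmod (V i z) \<le> exp (MI z)" if "i \<in> I" for i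
      proof -
        have "ln (cmod (V i z)) \<le> MI z" unfolding MI_def using that fI by (intro Max_ge) auto
        then have "exp (ln (cmod (V i z))) \<le> exp (MI z)" by simp
        then show ?thesis using Vz[OF that z] by simp
      qed
      then have "ln (cmod (g z) * rep_norm n F z) \<le> ln (N * P z ^ m * exp (MI z))"
        using gF_le[of z "exp (MI z)"] gz[OF z] rep_norm_pos[OF F, of z] by (intro ln_mono) auto
      then show "ln (cmod (g z)) + ln (rep_norm n F z) \<le> (ln N + real m * ln (P z)) + MI z"
        using N P_pos[of z] gz[OF z] rep_norm_pos[OF F, of z] by (simp add: ln_mult_pos ln_realpow)
    qed (use r in auto)
    then have "count_fun g r + cg + (characteristic n F r + cF) \<le> ln N + real m * (Asum r + c1) + circle_mean MI r"
      using circle_mean_add[OF cG ln_rep_norm_cont[OF F] r1(2)] circle_mean_add[OF cP(2) cMI r1(2)]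
        circle_mean_add[OF continuous_on_const cP(1) r1(2), of "ln N"] cg[OF r1(1) crg] circle_mean_ln_P[OF r1(2)]
      by (simp add: circle_mean_cmul c1_def cF_def characteristic_eq)
    moreover have "divisor_sum (\<lambda>a. real (family_mult k I (\<lambda>i. vanish_order (V i) a))) r
       \<le> count_fun g r + (\<Sum>i\<in>I. divisor_sum (\<lambda>a. real (min (vanish_order (V i) a) k)) r)"
    proof -
      have lg: "locally_finite (\<lambda>a. real (vanish_order g a))" by (rule locally_finite_vanish_order[OF g])
      have lm: "locally_finite (\<lambda>a. real (min (vanish_order (V i) a) k))" if "i \<in> I" for i
        by (rule locally_finite_subset[OF locally_finite_vanish_order[OF V_I[OF that]]]) auto
      have ls: "locally_finite (\<lambda>a. \<Sum>i\<in>I. real (min (vanish_order (V i) a) k))" by (rule locally_finite_sum[OF fI lm])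
      have "divisor_sum (\<lambda>a. real (family_mult k I (\<lambda>i. vanish_order (V i) a))) r
         \<le> divisor_sum (\<lambda>a. real (vanish_order g a) + (\<Sum>i\<in>I. real (min (vanish_order (V i) a) k))) r"
      proof (rule divisor_sum_mono[OF locally_finite_family_mult[OF fI I(2) V_I] locally_finite_add[OF lg ls] r1(1)])
        fix a show "real (family_mult k I (\<lambda>i. vanish_order (V i) a)) \<le> real (vanish_order g a) + (\<Sum>i\<in>I. real (min (vanish_order (V i) a) k))"
          using family_mult_le[OF fI I(2) order[of a], of k] unfolding of_nat_sum[symmetric] of_nat_add[symmetric] of_nat_le_iff .
      qed
      then show ?thesis unfolding divisor_sum_add[OF lg ls] count_fun_def
        using divisor_sum_sum[of I "\<lambda>i a. real (min (vanish_order (V i) a) k)" r, OF fI lm] by simp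
    qed
    moreover have "ln N + real m * (Asum r + c1) - cg - cF \<le> C3 * (1 + Asum r + ln (\<tau> r))"
    proof -
      have A0: "Asum r \<ge> 0" "ln (\<tau> r) \<ge> 0" using Asum_nonneg[OF r1(1)] \<tau>_ge1[OF r1(1)] by auto
      have "real m * c1 \<le> real m * \<bar>c1\<bar>" by (intro mult_left_mono) auto
      then have "ln N + real m * (Asum r + c1) - cg - cF \<le> C3 + real m * Asum r"
        unfolding C3_def distrib_left by linarith
      also have "\<dots> \<le> C3 + C3 * Asum r" using A0 by (intro add_mono mult_right_mono) (auto simp: C3_def)
      also have "\<dots> \<le> C3 * (1 + Asum r + ln (\<tau> r))" using mult_nonneg_nonneg[OF C3 A0(2)] by (simp add: distrib_left)
      finally show ?thesis .
    qed
    ultimately show "characteristic n F r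
     \<le> (\<Sum>i\<in>I. divisor_sum (\<lambda>a. real (min (vanish_order (V i) a) k)) r) + (C2 + C3) * (1 + Asum r + ln (\<tau> r))"
      using H[folded MI_def] unfolding distrib_right[of C2 C3] by linarith
  qed
  then show ?thesis using C2(1) C3 by (intro exI[of _ "C2 + C3"]) auto
qed

lemma truncation_bound:
  "\<exists>C\<ge>0. outside_finite_measure (\<lambda>r. \<forall>i\<in>{1..q}. divisor_sum (\<lambda>a. real (min (vanish_order (V i) a) k)) r
     \<le> real k * trunc_counting 1 (pairing n F (A i)) r + C * (1 + Asum r))"
proof -
  obtain C where C: "C \<ge> 0" "\<And>r. r \<ge> 1 \<Longrightarrow> r \<notin> critical_radii E \<Longrightarrow> count_fun E r \<le> C * (1 + Asum r)"
    using small_count_fun[OF small_E E_nz] by blast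
  have "outside_finite_measure (\<lambda>r. \<forall>i\<in>{1..q}. divisor_sum (\<lambda>a. real (min (vanish_order (V i) a) k)) r
     \<le> real k * trunc_counting 1 (pairing n F (A i)) r + C * (1 + Asum r))"
  proof (rule outside_finite_measure_mono[OF outside_finite_measure_noncritical[OF E_nz]], rule ballI)
    fix r i assume r: "r > 1" "r \<notin> critical_radii E" and i: "i \<in> {1..q}"
    have r1: "r \<ge> 1" using r by simp
    let ?D = "\<lambda>a. real (min (vanish_order (pairing n F (A i)) a) 1)"
    have lE: "locally_finite (\<lambda>a. real (vanish_order E a))" by (rule locally_finite_vanish_order[OF E_nz])
    have lD: "locally_finite ?D"
      by (rule locally_finite_subset[OF locally_finite_vanish_order[OF pairing_nz[OF i]]]) auto
    have lV: "locally_finite (\<lambda>a. real (min (vanish_order (V i) a) k))"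
      by (rule locally_finite_subset[OF locally_finite_vanish_order[OF V_nz(1)[OF i]]]) auto
    have lk: "locally_finite (\<lambda>a. \<Sum>t\<in>{..<k}. ?D a)" by (intro locally_finite_sum lD) auto
    have "divisor_sum (\<lambda>a. real (min (vanish_order (V i) a) k)) r \<le> divisor_sum (\<lambda>a. (\<Sum>t\<in>{..<k}. ?D a) + real (vanish_order E a)) r"
    proof (rule divisor_sum_mono[OF lV locally_finite_add[OF lk lE] r1])
      fix a
      have "(\<Sum>j\<in>{1..q} - {i}. vanish_order (e j) a) \<le> vanish_order E a" unfolding vanish_order_E by (rule sum_mono2) auto
      then have "min (vanish_order (V i) a) k \<le> k * min (vanish_order (pairing n F (A i)) a) 1 + vanish_order E a"
        unfolding V_nz(2)[OF i] by (cases "vanish_order (pairing n F (A i)) a = 0") auto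
      then have "real (min (vanish_order (V i) a) k) \<le> real (k * min (vanish_order (pairing n F (A i)) a) 1 + vanish_order E a)"
        unfolding of_nat_le_iff .
      then show "real (min (vanish_order (V i) a) k) \<le> (\<Sum>t\<in>{..<k}. ?D a) + real (vanish_order E a)" by simp
    qed
    also have "\<dots> = real k * trunc_counting 1 (pairing n F (A i)) r + count_fun E r"
      unfolding divisor_sum_add[OF lk lE] count_fun_def trunc_counting_eq_divisor_sum[OF pairing_nz[OF i] r1]
      using divisor_sum_sum[of "{..<k}" "\<lambda>_. ?D" r] lD by simp
    finally show "divisor_sum (\<lambda>a. real (min (vanish_order (V i) a) k)) r
       \<le> real k * trunc_counting 1 (pairing n F (A i)) r + C * (1 + Asum r)" using C(2)[OF r1 r(2)] by linarith
  qed
  then show ?thesis using C(1) by blast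
qed

lemma trunc_counting_pairing_nonneg:
  assumes "i \<in> {1..q}" "r \<ge> 1" shows "trunc_counting 1 (pairing n F (A i)) r \<ge> 0"
proof -
  have "divisor_sum (\<lambda>_. 0) r \<le> divisor_sum (\<lambda>a. real (min (vanish_order (pairing n F (A i)) a) 1)) r"
  proof (rule divisor_sum_mono[OF _ _ assms(2)])
    show "locally_finite (\<lambda>a. real (min (vanish_order (pairing n F (A i)) a) 1))"
      by (rule locally_finite_subset[OF locally_finite_vanish_order[OF pairing_nz[OF assms(1)]]]) auto
  qed (auto simp: locally_finite_def)
  then show ?thesis unfolding trunc_counting_eq_divisor_sum[OF pairing_nz[OF assms(1)] assms(2)] by (simp add: divisor_sum_def)
qed

lemma weighted_bound:
  assumes gp: "general_position n q A" and B: "B \<subseteq> {0..n}" "kindep (small_field P) curve_fls B"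
    "\<And>l. l \<in> {0..n} \<Longrightarrow> curve_fls l \<in> kspan (small_field P) curve_fls B" "card B = k + 1"
    and J: "J \<subseteq> {1..q}" "J \<noteq> {}" "k \<noteq> 0 \<Longrightarrow> 2 * n + 2 \<le> card J + k"
  shows "\<exists>C\<ge>0. outside_finite_measure (\<lambda>r. characteristic n F r
     \<le> real k * (\<Sum>i\<in>J. trunc_counting 1 (pairing n F (A i)) r) + C * (1 + Asum r + ln (\<tau> r)))"
proof -
  let ?K = "small_field P" and ?v = "\<lambda>i. entire_fls (V i)" and ?w = curve_fls
  have K: "closed_subfield ?K" by (rule small_field_closed[OF P_pos])
  have fJ: "finite J" using J finite_subset by blast
  obtain i1 where i1: "i1 \<in> J" using J by blast
  have i1q: "i1 \<in> {1..q}" using i1 J by blast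
  have v0: "?v i \<noteq> 0" if "i \<in> J" for i using entire_fls_nz[OF V_nz(1)] that J by blast
  have vw: "?v i \<in> kspan ?K ?w {0..n}" if "i \<in> J" for i
    unfolding kspan_def using entire_fls_V[of i] coeff_fls_in_field[of i] that J
    by (auto simp: lessThan_Suc_atMost atLeast0AtMost intro!: exI[of _ "\<lambda>l. coeff_fls i l"])
  have "\<exists>I\<subseteq>J. I \<noteq> {} \<and> controlled k I \<and> (\<forall>l\<in>{0..n}. ?w l \<in> kspan ?K ?v I)"
  proof (cases "k = 0")
    case True
    then obtain b where b: "B = {b}" using B(4) by (auto simp: card_1_singleton_iff)
    have "?v i1 \<in> kspan ?K ?w {b}" using kspan_subspan[OF K B(3) vw[OF i1]] b by simp
    then obtain c where c: "c b \<in> ?K" "?v i1 = c b * ?w b" unfolding kspan_def by auto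
    have "c b \<noteq> 0" using c(2) v0[OF i1] by auto
    then have "?w b = (\<Sum>i\<in>{i1}. inverse (c b) * ?v i)" by (simp add: c(2))
    then have wb: "?w b \<in> kspan ?K ?v {i1}" unfolding kspan_def using closed_subfieldD(6)[OF K c(1)]
      by (intro CollectI exI[of _ "\<lambda>_. inverse (c b)"]) auto
    have "?w l \<in> kspan ?K ?v {i1}" if "l \<in> {0..n}" for l
      by (rule kspan_subspan[OF K _ B(3)[OF that]]) (use wb b in auto)
    then show ?thesis using controlled_singleton[OF i1q] i1 by (intro exI[of _ "{i1}"]) auto
  next
    case False
    show ?thesis
    proof (rule spanning_chain[where T = "{0..n}" and B = B and w = ?w and n = n, OF K fJ i1 v0])
      show "kindep ?K ?w B" by (rule B(2))
      show "?w l \<in> kspan ?K ?w B" if "l \<in> {0..n}" for l by (rule B(3)[OF that])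
      show "?v i \<in> kspan ?K ?w {0..n}" if "i \<in> J" for i by (rule vw[OF that])
      show "?w l \<in> kspan ?K ?v S" if "S \<subseteq> J" "card S = n + 1" "l \<in> {0..n}" for S l
        by (rule general_position_span[OF gp]) (use that J in auto)
      show "controlled k {i1}" by (rule controlled_singleton[OF i1q])
      fix I I' c x
      assume *: "I \<subseteq> J" "I' \<subseteq> J" "I \<inter> I' = {}" "I \<noteq> {}" "I' \<noteq> {}" "controlled k I"
       "\<And>i. i \<in> I' \<Longrightarrow> c i \<in> ?K \<and> c i \<noteq> 0" "\<And>i. i \<in> I \<Longrightarrow> x i \<in> ?K"
       "(\<Sum>i\<in>I'. c i * ?v i) = (\<Sum>i\<in>I. x i * ?v i)" "(\<Sum>i\<in>I. x i * ?v i) \<noteq> 0" "kindep ?K ?v I'" "card I' \<le> card B"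
      show "controlled k (I \<union> I')"
        by (rule controlled_step[OF _ _ *(3-5) _ *(6-11)]) (use * J B in auto)
    qed (use B J(3)[OF False] in auto)
  qed
  then obtain I where I: "I \<subseteq> J" "I \<noteq> {}" "controlled k I" "\<And>l. l \<le> n \<Longrightarrow> ?w l \<in> kspan ?K ?v I"
    by (elim exE conjE) (rule that, auto)
  have Iq: "I \<subseteq> {1..q}" using I J by blast
  obtain C1 where C1: "C1 \<ge> 0" "outside_finite_measure (\<lambda>r. characteristic n F r
     \<le> (\<Sum>i\<in>I. divisor_sum (\<lambda>a. real (min (vanish_order (V i) a) k)) r) + C1 * (1 + Asum r + ln (\<tau> r)))"
    using characteristic_le_controlled[OF Iq I(2,3,4)] by blast
  obtain C2 where C2: "C2 \<ge> 0" "outside_finite_measure (\<lambda>r. \<forall>i\<in>{1..q}. divisor_sum (\<lambda>a. real (min (vanish_order (V i) a) k)) r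
     \<le> real k * trunc_counting 1 (pairing n F (A i)) r + C2 * (1 + Asum r))"
    using truncation_bound by blast
  define C where "C = C1 + real (card I) * C2"
  have "outside_finite_measure (\<lambda>r. characteristic n F r
     \<le> real k * (\<Sum>i\<in>J. trunc_counting 1 (pairing n F (A i)) r) + C * (1 + Asum r + ln (\<tau> r)))"
  proof (rule outside_finite_measure_mono[OF outside_finite_measure_conj[OF C1(2) C2(2)]], elim conjE)
    fix r :: real
    assume r: "r > 1" and T: "characteristic n F r
     \<le> (\<Sum>i\<in>I. divisor_sum (\<lambda>a. real (min (vanish_order (V i) a) k)) r) + C1 * (1 + Asum r + ln (\<tau> r))"
     and D: "\<forall>i\<in>{1..q}. divisor_sum (\<lambda>a. real (min (vanish_order (V i) a) k)) r
     \<le> real k * trunc_counting 1 (pairing n F (A i)) r + C2 * (1 + Asum r)"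
    have "(\<Sum>i\<in>I. divisor_sum (\<lambda>a. real (min (vanish_order (V i) a) k)) r)
      \<le> (\<Sum>i\<in>I. real k * trunc_counting 1 (pairing n F (A i)) r + C2 * (1 + Asum r))"
      by (intro sum_mono) (use D Iq in blast)
    also have "\<dots> = real k * (\<Sum>i\<in>I. trunc_counting 1 (pairing n F (A i)) r) + real (card I) * C2 * (1 + Asum r)"
      by (simp add: sum.distrib sum_distrib_left)
    also have "(\<Sum>i\<in>I. trunc_counting 1 (pairing n F (A i)) r) \<le> (\<Sum>i\<in>J. trunc_counting 1 (pairing n F (A i)) r)"
      by (rule sum_mono2[OF fJ I(1)]) (use trunc_counting_pairing_nonneg J r in auto)
    also have "real (card I) * C2 * (1 + Asum r) \<le> real (card I) * C2 * (1 + Asum r + ln (\<tau> r))"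
      by (rule mult_left_mono) (use \<tau>_ge1[of r] r C2(1) in auto)
    finally show "characteristic n F r \<le> real k * (\<Sum>i\<in>J. trunc_counting 1 (pairing n F (A i)) r) + C * (1 + Asum r + ln (\<tau> r))"
      using T by (simp add: C_def mult_left_mono distrib_right)
  qed
  then show ?thesis using C1(1) C2(1) by (intro exI[of _ C]) (auto simp: C_def)
qed

lemma second_main_estimate:
  assumes gp: "general_position n q A" and n: "n \<ge> 1" "q \<ge> 2 * n + 1"
  shows "\<exists>C\<ge>0. outside_finite_measure (\<lambda>r. real q / (real n * (real n + 2)) * characteristic n F r
     \<le> (\<Sum>i=1..q. trunc_counting 1 (pairing n F (A i)) r) + C * (1 + Asum r + ln (\<tau> r)))"
proof -
  let ?N = "\<lambda>i r. trunc_counting 1 (pairing n F (A i)) r"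
  have K: "closed_subfield (small_field P)" by (rule small_field_closed[OF P_pos])
  obtain B where B: "B \<subseteq> {0..n}" "kindep (small_field P) curve_fls B"
    "\<And>l. l \<in> {0..n} \<Longrightarrow> curve_fls l \<in> kspan (small_field P) curve_fls B"
    using kspan_basis_exists[OF K, of "{0..n}" curve_fls] by blast
  have fB: "finite B" using B(1) finite_subset by blast
  obtain l0 where l0: "l0 \<le> n" "F l0 0 \<noteq> 0" using F by (auto simp: curve_rep_def)
  have "entire_fls (F l0) \<noteq> 0" by (rule entire_fls_nz[OF nz_entireI[of "F l0" 0]]) (use F l0 in \<open>auto simp: curve_rep_def\<close>)
  then have "curve_fls l0 \<noteq> 0" using entire_fls_nz[OF E_nz] by (simp add: curve_fls_def)
  then have "B \<noteq> {}" using B(3)[of l0] l0 by (auto simp: kspan_def)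
  define k where "k = card B - 1"
  have cB: "card B = k + 1" using fB \<open>B \<noteq> {}\<close> by (simp add: k_def card_gt_0_iff Suc_leI)
  have kn: "k \<le> n" using card_mono[OF _ B(1)] cB by simp
  define \<rho> where "\<rho> = real q / (real n * (real n + 2))"
  have \<rho>: "\<rho> \<ge> 0" by (simp add: \<rho>_def)
  show ?thesis
  proof (cases "k = 0")
    case True
    obtain C where C: "C \<ge> 0" "outside_finite_measure (\<lambda>r. characteristic n F r
       \<le> real k * (\<Sum>i\<in>{1..q}. ?N i r) + C * (1 + Asum r + ln (\<tau> r)))"
      using weighted_bound[OF gp B cB, of "{1..q}"] True n by auto
    have "outside_finite_measure (\<lambda>r. \<rho> * characteristic n F r \<le> (\<Sum>i=1..q. ?N i r) + \<rho> * C * (1 + Asum r + ln (\<tau> r)))"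
    proof (rule outside_finite_measure_mono[OF C(2)])
      fix r :: real assume r: "r > 1" and *: "characteristic n F r \<le> real k * (\<Sum>i\<in>{1..q}. ?N i r) + C * (1 + Asum r + ln (\<tau> r))"
      have "\<rho> * characteristic n F r \<le> \<rho> * (C * (1 + Asum r + ln (\<tau> r)))" using * True \<rho> by (intro mult_left_mono) auto
      moreover have "(\<Sum>i=1..q. ?N i r) \<ge> 0" by (intro sum_nonneg trunc_counting_pairing_nonneg) (use r in auto)
      ultimately show "\<rho> * characteristic n F r \<le> (\<Sum>i=1..q. ?N i r) + \<rho> * C * (1 + Asum r + ln (\<tau> r))" by (simp add: mult.assoc)
    qed
    then show ?thesis unfolding \<rho>_def[symmetric] using \<rho> C(1) by (intro exI[of _ "\<rho> * C"]) auto
  next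
    case False
    define p where "p = 2 * n + 2 - k"
    have p: "p \<le> q" "p \<ge> 1" "p + k = 2 * n + 2" using kn False n by (auto simp: p_def)
    define JJ where "JJ = {J. J \<subseteq> {1..q} \<and> card J = p}"
    have fJJ: "finite JJ" by (rule finite_subset[of _ "Pow {1..q}"]) (auto simp: JJ_def)
    have "\<exists>C. \<forall>J\<in>JJ. C J \<ge> 0 \<and> outside_finite_measure (\<lambda>r. characteristic n F r
       \<le> real k * (\<Sum>i\<in>J. ?N i r) + C J * (1 + Asum r + ln (\<tau> r)))"
    proof (rule bchoice, rule ballI)
      fix J assume "J \<in> JJ"
      then have J: "J \<subseteq> {1..q}" "J \<noteq> {}" "2 * n + 2 \<le> card J + k" using p by (auto simp: JJ_def)
      from weighted_bound[OF gp B cB J]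
      show "\<exists>C. C \<ge> 0 \<and> outside_finite_measure (\<lambda>r. characteristic n F r
       \<le> real k * (\<Sum>i\<in>J. ?N i r) + C * (1 + Asum r + ln (\<tau> r)))" by blast
    qed
    then obtain C where C: "\<And>J. J \<in> JJ \<Longrightarrow> C J \<ge> 0" "\<And>J. J \<in> JJ \<Longrightarrow> outside_finite_measure (\<lambda>r. characteristic n F r
       \<le> real k * (\<Sum>i\<in>J. ?N i r) + C J * (1 + Asum r + ln (\<tau> r)))" by blast
    define C' where "C' = (\<Sum>J\<in>JJ. C J)"
    have C': "C' \<ge> 0" unfolding C'_def using C by (intro sum_nonneg) auto
    have "outside_finite_measure (\<lambda>r. \<rho> * characteristic n F r \<le> (\<Sum>i=1..q. ?N i r) + \<rho> * C' * (1 + Asum r + ln (\<tau> r)))"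
    proof (rule outside_finite_measure_mono[OF outside_finite_measure_ball[OF fJJ C(2)]])
      fix r :: real assume r: "r > 1" and H: "\<forall>J\<in>JJ. characteristic n F r \<le> real k * (\<Sum>i\<in>J. ?N i r) + C J * (1 + Asum r + ln (\<tau> r))"
      obtain J where J: "J \<subseteq> {1..q}" "card J = p" "real q * (\<Sum>i\<in>J. ?N i r) \<le> real p * (\<Sum>i=1..q. ?N i r)"
        using ex_subset_small_average[of "{1..q}" p "\<lambda>i. ?N i r"] p by auto
      have JJ: "J \<in> JJ" using J by (simp add: JJ_def)
      have N0: "(\<Sum>i=1..q. ?N i r) \<ge> 0" by (intro sum_nonneg trunc_counting_pairing_nonneg) (use r in auto)
      have "C J \<le> C'" unfolding C'_def by (rule member_le_sum[OF JJ]) (use C fJJ in auto)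
      then have "C J * (1 + Asum r + ln (\<tau> r)) \<le> C' * (1 + Asum r + ln (\<tau> r))"
        using Asum_nonneg[of r] \<tau>_ge1[of r] r by (intro mult_right_mono) (auto intro: add_nonneg_nonneg)
      then have "\<rho> * characteristic n F r \<le> \<rho> * (real k * (\<Sum>i\<in>J. ?N i r) + C' * (1 + Asum r + ln (\<tau> r)))"
        using H JJ \<rho> by (intro mult_left_mono) force+
      moreover have "\<rho> * (real k * (\<Sum>i\<in>J. ?N i r)) \<le> (\<Sum>i=1..q. ?N i r)"
      proof -
        have nn: "real n * (real n + 2) > 0" using n by simp
        have "\<rho> * (real k * (\<Sum>i\<in>J. ?N i r)) = real k * (real q * (\<Sum>i\<in>J. ?N i r)) / (real n * (real n + 2))"
          by (simp add: \<rho>_def)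
        also have "\<dots> \<le> real k * (real p * (\<Sum>i=1..q. ?N i r)) / (real n * (real n + 2))"
          using J(3) nn by (intro divide_right_mono mult_left_mono) auto
        also have "\<dots> = (real k * real p) / (real n * (real n + 2)) * (\<Sum>i=1..q. ?N i r)" by simp
        also have "\<dots> \<le> 1 * (\<Sum>i=1..q. ?N i r)"
        proof (rule mult_right_mono[OF _ N0])
          have rp: "real p = 2 * real n + 2 - real k" using p(3) by linarith
          have "0 \<le> (real n - real k) * (real n + 2 - real k)" using kn by (intro mult_nonneg_nonneg) auto
          then have "real k * real p \<le> real n * (real n + 2)" unfolding rp by (simp add: algebra_simps)
          then show "(real k * real p) / (real n * (real n + 2)) \<le> 1" using nn by simp
        qed
        finally show ?thesis by simp
      qed
      ultimately show "\<rho> * characteristic n F r \<le> (\<Sum>i=1..q. ?N i r) + \<rho> * C' * (1 + Asum r + ln (\<tau> r))"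
        by (simp add: distrib_left mult.assoc)
    qed
    then show ?thesis unfolding \<rho>_def[symmetric] using \<rho> C' by (intro exI[of _ "\<rho> * C'"]) auto
  qed
qed

end

theorem corollary1p2:
  fixes n q :: nat
    and f :: "complex \<Rightarrow> complex Matrix.vec set"
    and a :: "nat \<Rightarrow> complex \<Rightarrow> complex Matrix.vec set"
    and F :: "nat \<Rightarrow> complex \<Rightarrow> complex"
    and A :: "nat \<Rightarrow> nat \<Rightarrow> complex \<Rightarrow> complex"
  assumes "n \<ge> 1"
    and "holomorphic_map n f"
    and "reduced_representation n F f"
    and "\<And>i. i \<in> {1..q} \<Longrightarrow> holomorphic_map n (a i)"
    and "\<And>i. i \<in> {1..q} \<Longrightarrow> reduced_representation n (A i) (a i)"
    and "general_position n q A"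
    and "\<And>i. i \<in> {1..q} \<Longrightarrow> \<exists>z. pairing n F (A i) z \<noteq> 0"
    and "q \<ge> 2 * n + 1"
  shows "\<exists>\<epsilon> \<eta> :: real \<Rightarrow> real.
     \<epsilon> \<in> o[at_top](characteristic n F) \<and>
     \<eta> \<in> O[at_top](\<lambda>r. MAX i\<in>{1..q}. characteristic n (A i) r) \<and>
     outside_finite_measure (\<lambda>r.
       real q / (real n * (real n + 2)) * characteristic n F r
         \<le> (\<Sum>i=1..q. trunc_counting 1 (pairing n F (A i)) r) + \<epsilon> r + \<eta> r)"
proof -
  have F: "curve_rep n F"
    using assms(3) by (auto simp: reduced_representation_def represents_on_def curve_rep_def)
  have A: "curve_rep n (A i)" if "i \<in> {1..q}" for i
    using assms(5)[OF that] by (auto simp: reduced_representation_def represents_on_def curve_rep_def)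
  have "\<exists>l. \<forall>i\<in>{1..q}. l i \<le> n \<and> A i (l i) 0 \<noteq> 0"
    by (rule bchoice) (use A in \<open>auto simp: curve_rep_def\<close>)
  then obtain l where l: "\<And>i. i \<in> {1..q} \<Longrightarrow> l i \<le> n" "\<And>i. i \<in> {1..q} \<Longrightarrow> A i (l i) 0 \<noteq> 0" by blast
  define e where "e = (\<lambda>i. A i (l i))"
  interpret moving_targets n q F A e
  proof
    show "nz_entire (e i)" if "i \<in> {1..q}" for i
      unfolding e_def by (rule nz_entireI[of "A i (l i)" 0]) (use A[OF that] l that in \<open>auto simp: curve_rep_def\<close>)
    show "cmod (e i z) \<le> rep_norm n (A i) z" if "i \<in> {1..q}" for i z
      unfolding e_def by (rule cmod_le_rep_norm[OF l(1)[OF that]])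
    show "nz_entire (pairing n F (A i))" if i: "i \<in> {1..q}" for i
    proof -
      have "(\<lambda>z. \<Sum>l=0..n. F l z * A i l z) holomorphic_on UNIV"
        by (intro holomorphic_intros) (use F A[OF i] in \<open>auto simp: curve_rep_def\<close>)
      then show ?thesis using assms(7)[OF i] unfolding nz_entire_def pairing_def by simp
    qed
  qed (use F A in auto)
  let ?T = "characteristic n F"
  show ?thesis
  proof (cases "\<forall>l\<le>n. \<forall>m\<le>n. \<forall>z. F l 0 * F m z = F m 0 * F l z")
    case True
    have "outside_finite_measure (\<lambda>r. real q / (real n * (real n + 2)) * ?T r
       \<le> (\<Sum>i=1..q. trunc_counting 1 (pairing n F (A i)) r) + 0 + 0)"
    proof (rule outside_finite_measure_True)
      fix r :: real assume "r > 1"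
      then show "real q / (real n * (real n + 2)) * ?T r \<le> (\<Sum>i=1..q. trunc_counting 1 (pairing n F (A i)) r) + 0 + 0"
        using characteristic_const[OF F, of r] True sum_nonneg[of "{1..q}" "\<lambda>i. trunc_counting 1 (pairing n F (A i)) r"]
          trunc_counting_pairing_nonneg by simp
    qed
    then show ?thesis by (intro exI[of _ "\<lambda>_. 0"]) simp
  next
    case False
    then obtain l m z0 where "l \<le> n" "m \<le> n" "F l 0 * F m z0 \<noteq> F m 0 * F l z0" by blast
    then obtain c where c: "\<And>r. r \<ge> 2 \<Longrightarrow> ln r \<le> ?T r + c" using characteristic_ge_ln[OF F] by blast
    have T_top: "filterlim ?T at_top at_top"
    proof (rule filterlim_at_top_mono)
      show "filterlim (\<lambda>r::real. ln r - c) at_top at_top" by real_asymp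
      show "eventually (\<lambda>r. ln r - c \<le> ?T r) at_top"
        using eventually_ge_at_top[of 2] by eventually_elim (use c in force)
    qed
    obtain C where C: "C \<ge> 0" "outside_finite_measure (\<lambda>r. real q / (real n * (real n + 2)) * ?T r
       \<le> (\<Sum>i=1..q. trunc_counting 1 (pairing n F (A i)) r) + C * (1 + Asum r + ln (\<tau> r)))"
      using second_main_estimate[OF assms(6,1,8)] by blast
    show ?thesis
    proof (intro exI conjI)
      have "(\<lambda>x::real. 1 + ln (1 + x)) \<in> o[at_top](\<lambda>x. x)" by real_asymp
      then have "(\<lambda>r. 1 + ln (1 + ?T r)) \<in> o[at_top](?T)" using T_top by (rule landau_o.small.compose)
      then show "(\<lambda>r. C * (1 + ln (1 + ?T r))) \<in> o[at_top](?T)" by simp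
      show "(\<lambda>r. 2 * C * Asum r) \<in> O[at_top](\<lambda>r. MAX i\<in>{1..q}. characteristic n (A i) r)"
      proof (rule bigoI)
        show "eventually (\<lambda>r. norm (2 * C * Asum r) \<le> (2 * C * real q) * norm (MAX i\<in>{1..q}. characteristic n (A i) r)) at_top"
          using eventually_ge_at_top[of 1]
        proof eventually_elim
          case (elim r)
          define M where "M = (MAX i\<in>{1..q}. characteristic n (A i) r)"
          have "characteristic n (A i) r \<le> M" if "i \<in> {1..q}" for i
            unfolding M_def using that by (intro Max_ge) auto
          then have "Asum r \<le> real (card {1..q}) * M" unfolding Asum_def by (intro sum_bounded_above) auto
          also have "\<dots> \<le> real q * \<bar>M\<bar>" by (simp add: mult_left_mono)
          finally have "2 * C * Asum r \<le> 2 * C * (real q * \<bar>M\<bar>)" using C(1) by (intro mult_left_mono) auto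
          then show ?case using C(1) Asum_nonneg[OF elim] by (simp add: M_def abs_mult mult.assoc)
        qed
      qed
      show "outside_finite_measure (\<lambda>r. real q / (real n * (real n + 2)) * ?T r
         \<le> (\<Sum>i=1..q. trunc_counting 1 (pairing n F (A i)) r) + C * (1 + ln (1 + ?T r)) + 2 * C * Asum r)"
      proof (rule outside_finite_measure_mono[OF C(2)])
        fix r :: real
        assume r: "r > 1" and *: "real q / (real n * (real n + 2)) * ?T r
          \<le> (\<Sum>i=1..q. trunc_counting 1 (pairing n F (A i)) r) + C * (1 + Asum r + ln (\<tau> r))"
        have nn: "?T r \<ge> 0" "Asum r \<ge> 0" using characteristic_mono(1)[OF F, of r r] Asum_nonneg[of r] r by auto
        have "\<tau> r \<le> (1 + ?T r) * (1 + Asum r)" using mult_nonneg_nonneg[OF nn] by (simp add: \<tau>_def algebra_simps)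
        then have "ln (\<tau> r) \<le> ln ((1 + ?T r) * (1 + Asum r))" using \<tau>_ge1[of r] r by (intro ln_mono) auto
        also have "\<dots> = ln (1 + ?T r) + ln (1 + Asum r)" using nn by (intro ln_mult_pos) auto
        also have "ln (1 + Asum r) \<le> Asum r" using nn by (intro ln_add_one_self_le_self) auto
        finally have "C * (1 + Asum r + ln (\<tau> r)) \<le> C * (1 + ln (1 + ?T r) + 2 * Asum r)" using C(1) by (intro mult_left_mono) auto
        then show "real q / (real n * (real n + 2)) * ?T r
         \<le> (\<Sum>i=1..q. trunc_counting 1 (pairing n F (A i)) r) + C * (1 + ln (1 + ?T r)) + 2 * C * Asum r"
          using * by (simp add: algebra_simps)
      qed
    qed
  qed
qed

end
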